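(* Let $R$ be a Noetherian domain containing $\mathbb{Q}$ with quotient field $K$, let $A$ be an $\mathbb{A}^n$-fibration over $R$, and let $D: A \longrightarrow A$ be an $R$-LND. If the residual rank of $D$ equals the rank of $D_K$ and $D_K$ is rigid, then $D$ is residually rigid. Consequently, if $n=3$ and the residual rank of $D$ equals the rank of $D_K$, then $D$ is residually rigid.
   Context: Rings are commutative with unity. For a ring $R$, $R^{[n]}$ denotes the polynomial ring in $n$ variables over $R$; for an $R$-algebra $A$, $A = R^{[n]}$ means that $A$ is isomorphic as an $R$-algebra to $R^{[n]}$. For $P \in \mathrm{Spec}(R)$, $k(P) = R_P/PR_P$. An $R$-algebra $A$ is an $\mathbb{A}^n$-fibration over $R$ if it is finitely generated and flat over $R$ and $A \otimes_R k(P) = k(P)^{[n]}$ for all $P \in \mathrm{Spec}(R)$. An $R$-derivation $D: A \to A$ is a locally nilpotent $R$-derivation ($R$-LND) if for each $x \in A$ there is $m \in \mathbb{N}$ with $D^m(x)=0$. $D_K$ denotes the extension of $D$ to $S^{-1}A = A\otimes_R K = K^{[n]}$, where $S = R \setminus\{0\}$. Rank and rigidity over polynomial rings: for a ring $C$, $E = C^{[n]}$ and a $C$-LND $\delta$ of $E$, the rank of $\delta$ is the least non-negative integer $r$ such that there is a coordinate system $(X_1,\dots,X_n)$ of $E$ (i.e. $E = C[X_1,\dots,X_n]$) with $X_1,\dots,X_{n-r}\in\mathrm{Ker}(\delta)$. A rank-$r$ $C$-LND $\delta$ is rigid if for any two coordinate systems $(X_1,\dots,X_n)$ and $(Y_1,\dots,Y_n)$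 of $E$ with $X_1,\dots,X_{n-r},Y_1,\dots,Y_{n-r}\in\mathrm{Ker}(\delta)$ one has $C[X_1,\dots,X_{n-r}] = C[Y_1,\dots,Y_{n-r}]$. For an $\mathbb{A}^n$-fibration $A$ over $R$ and an $R$-subalgebra $B$ of $A$, $(R,B,A)$ is an $(n,r)$-residual system if $B$ is an $\mathbb{A}^{n-r}$-fibration over $R$ and $A\otimes_R k(P) = (B \otimes_R k(P))^{[r]}$ for all $P \in \mathrm{Spec}(R)$. The residual rank of an $R$-LND $D$ of $A$ is the least non-negative integer $r$ for which there is an $(n,r)$-residual system $(R,B,A)$ with $B \subseteq \mathrm{Ker}(D)$. An $R$-LND $D$ of residual rank $r$ is residually rigid if for any two $(n,r)$-residual systems $(R,B_1,A)$ and $(R,B_2,A)$ with $B_1,B_2\subseteq \mathrm{Ker}(D)$ one has $B_1=B_2$. *)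

theory Defs
  imports "HOL-Algebra.Algebra"
begin

section \<open>Modules and algebras\<close>

text \<open>
  Modules and (commutative) algebras over a commutative ring are those of the locales
  \<^locale>\<open>module\<close> and \<^locale>\<open>algebra\<close>. The multiplication and unit fields of a record that is
  only used as a module are irrelevant.
\<close>

definition linear_maps ::
  "('r, 'x) ring_scheme \<Rightarrow> ('r, 'a, 'm) module_scheme \<Rightarrow> ('r, 'b, 'k) module_scheme \<Rightarrow> ('a \<Rightarrow> 'b) set"
  where "linear_maps R M N =
    {f \<in> carrier M \<rightarrow> carrier N.
      (\<forall>x\<in>carrier M. \<forall>y\<in>carrier M. f (x \<oplus>\<^bsub>M\<^esub> y) = f x \<oplus>\<^bsub>N\<^esub> f y) \<and>
      (\<forall>r\<in>carrier R. \<forall>x\<in>carrier M. f (r \<odot>\<^bsub>M\<^esub> x) = r \<odot>\<^bsub>N\<^esub> f x)}"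

definition algebra_of_hom :: "('c \<Rightarrow> 'e) \<Rightarrow> ('e, 'm) ring_scheme \<Rightarrow> ('c, 'e) module"
  where "algebra_of_hom h E =
    \<lparr>carrier = carrier E, monoid.mult = (\<otimes>\<^bsub>E\<^esub>), monoid.one = \<one>\<^bsub>E\<^esub>, ring.zero = \<zero>\<^bsub>E\<^esub>, ring.add = (\<oplus>\<^bsub>E\<^esub>),
     smult = (\<lambda>c x. h c \<otimes>\<^bsub>E\<^esub> x)\<rparr>"

definition is_subalgebra ::
  "('r, 'x) ring_scheme \<Rightarrow> 'a set \<Rightarrow> ('r, 'a, 'm) module_scheme \<Rightarrow> bool"
  where "is_subalgebra R B A \<longleftrightarrow>
    subring B A \<and> (\<forall>r\<in>carrier R. \<forall>b\<in>B. r \<odot>\<^bsub>A\<^esub> b \<in> B)"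

text \<open>\<open>adjoin R A S\<close> is the \<open>R\<close>-subalgebra \<open>R[S]\<close> of \<open>A\<close>.\<close>

definition adjoin ::
  "('r, 'x) ring_scheme \<Rightarrow> ('r, 'a, 'm) module_scheme \<Rightarrow> 'a set \<Rightarrow> 'a set"
  where "adjoin R A S = generate_ring A ((\<lambda>r. r \<odot>\<^bsub>A\<^esub> \<one>\<^bsub>A\<^esub>) ` carrier R \<union> S)"

definition fin_gen_algebra :: "('r, 'x) ring_scheme \<Rightarrow> ('r, 'a, 'm) module_scheme \<Rightarrow> bool"
  where "fin_gen_algebra R A \<longleftrightarrow>
    (\<exists>S. finite S \<and> S \<subseteq> carrier A \<and> adjoin R A S = carrier A)"


section \<open>Polynomial algebras\<close>

text \<open>
  The polynomial ring in the variables indexed by \<open>{..<n}\<close>, on the carrier of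
  \<^theory>\<open>HOL-Algebra.Indexed_Polynomials\<close>: a polynomial maps each monomial (a multiset of
  variables) to its coefficient. The product, which that theory does not provide, is convolution.
\<close>

definition mpoly_algebra ::
  "('c, 'x) ring_scheme \<Rightarrow> nat \<Rightarrow> ('c, nat multiset \<Rightarrow> 'c) module"
  where "mpoly_algebra C n =
    \<lparr>carrier = ring.indexed_pset C {..<n} (carrier C),
     monoid.mult = (\<lambda>p q m. \<Oplus>\<^bsub>C\<^esub>k\<in>{k. k \<subseteq># m}. p k \<otimes>\<^bsub>C\<^esub> q (m - k)),
     monoid.one = ring.indexed_const C \<one>\<^bsub>C\<^esub>,
     ring.zero = ring.indexed_const C \<zero>\<^bsub>C\<^esub>,
     ring.add = ring.indexed_padd C,
     smult = (\<lambda>c p m. c \<otimes>\<^bsub>C\<^esub> p m)\<rparr>"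

definition is_polynomial_algebra ::
  "('c, 'x) ring_scheme \<Rightarrow> ('c, 'e, 'm) module_scheme \<Rightarrow> nat \<Rightarrow> bool"
  where "is_polynomial_algebra C E n \<longleftrightarrow>
    (\<exists>h. h \<in> ring_iso (mpoly_algebra C n) E \<and> h \<in> linear_maps C (mpoly_algebra C n) E)"


section \<open>Tensor products\<close>

text \<open>
  The tensor product of two \<open>R\<close>-modules is the free abelian group on \<open>M \<times> N\<close> modulo the
  subgroup generated by the usual bilinearity relators. Its elements are cosets.
\<close>

definition tensor_relators ::
  "('r, 'x) ring_scheme \<Rightarrow> ('r, 'a, 'm) module_scheme \<Rightarrow> ('r, 'b, 'k) module_scheme
    \<Rightarrow> ('a \<times> 'b \<Rightarrow>\<^sub>0 int) set"
  where "tensor_relators R M N =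
    {frag_of (x \<oplus>\<^bsub>M\<^esub> x', y) - frag_of (x, y) - frag_of (x', y) | x x' y.
       x \<in> carrier M \<and> x' \<in> carrier M \<and> y \<in> carrier N} \<union>
    {frag_of (x, y \<oplus>\<^bsub>N\<^esub> y') - frag_of (x, y) - frag_of (x, y') | x y y'.
       x \<in> carrier M \<and> y \<in> carrier N \<and> y' \<in> carrier N} \<union>
    {frag_of (r \<odot>\<^bsub>M\<^esub> x, y) - frag_of (x, r \<odot>\<^bsub>N\<^esub> y) | r x y.
       r \<in> carrier R \<and> x \<in> carrier M \<and> y \<in> carrier N}"

definition tensor_free ::
  "('r, 'a, 'm) module_scheme \<Rightarrow> ('r, 'b, 'k) module_scheme \<Rightarrow> ('a \<times> 'b \<Rightarrow>\<^sub>0 int) monoid"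
  where "tensor_free M N = free_Abelian_group (carrier M \<times> carrier N)"

definition tensor_kernel ::
  "('r, 'x) ring_scheme \<Rightarrow> ('r, 'a, 'm) module_scheme \<Rightarrow> ('r, 'b, 'k) module_scheme
    \<Rightarrow> ('a \<times> 'b \<Rightarrow>\<^sub>0 int) set"
  where "tensor_kernel R M N = generate (tensor_free M N) (tensor_relators R M N)"

definition tensor_class ::
  "('r, 'x) ring_scheme \<Rightarrow> ('r, 'a, 'm) module_scheme \<Rightarrow> ('r, 'b, 'k) module_scheme
    \<Rightarrow> ('a \<times> 'b \<Rightarrow>\<^sub>0 int) \<Rightarrow> ('a \<times> 'b \<Rightarrow>\<^sub>0 int) set"
  where "tensor_class R M N x = tensor_kernel R M N #>\<^bsub>tensor_free M N\<^esub> x"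

definition tensor_group ::
  "('r, 'x) ring_scheme \<Rightarrow> ('r, 'a, 'm) module_scheme \<Rightarrow> ('r, 'b, 'k) module_scheme
    \<Rightarrow> ('a \<times> 'b \<Rightarrow>\<^sub>0 int) set monoid"
  where "tensor_group R M N = tensor_free M N Mod tensor_kernel R M N"

text \<open>
  \<open>tensor_map R M N f g\<close> is the map \<open>f \<otimes> g\<close> with values in \<open>M \<otimes>\<^sub>R N\<close>. For linear \<open>f\<close>, \<open>g\<close> all the
  cosets in the union coincide.
\<close>

definition tensor_map ::
  "('r, 'x) ring_scheme \<Rightarrow> ('r, 'a, 'm) module_scheme \<Rightarrow> ('r, 'b, 'k) module_scheme
    \<Rightarrow> ('c \<Rightarrow> 'a) \<Rightarrow> ('d \<Rightarrow> 'b) \<Rightarrow> ('c \<times> 'd \<Rightarrow>\<^sub>0 int) set \<Rightarrow> ('a \<times> 'b \<Rightarrow>\<^sub>0 int) set"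
  where "tensor_map R M N f g U =
    (\<Union>x\<in>U. tensor_class R M N (frag_extend (\<lambda>(c, d). frag_of (f c, g d)) x))"

text \<open>For \<open>R\<close>-algebras, multiplication is induced by \<open>(a, l) (a', l') = (a a', l l')\<close> on generators.\<close>

definition tensor_ring ::
  "('r, 'x) ring_scheme \<Rightarrow> ('r, 'a, 'm) module_scheme \<Rightarrow> ('r, 'l, 'k) module_scheme
    \<Rightarrow> ('a \<times> 'l \<Rightarrow>\<^sub>0 int) set ring"
  where "tensor_ring R A L =
    \<lparr>carrier = carrier (tensor_group R A L),
     monoid.mult = (\<lambda>U V. \<Union>x\<in>U. \<Union>y\<in>V. tensor_class R A L
       (frag_extend (\<lambda>(a, l). frag_extend (\<lambda>(a', l'). frag_of (a \<otimes>\<^bsub>A\<^esub> a', l \<otimes>\<^bsub>L\<^esub> l')) y) x)),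
     monoid.one = tensor_class R A L (frag_of (\<one>\<^bsub>A\<^esub>, \<one>\<^bsub>L\<^esub>)),
     ring.zero = \<one>\<^bsub>tensor_group R A L\<^esub>,
     ring.add = (\<otimes>\<^bsub>tensor_group R A L\<^esub>)\<rparr>"

definition base_change ::
  "('r, 'x) ring_scheme \<Rightarrow> ('r, 'a, 'm) module_scheme \<Rightarrow> ('r, 'l, 'k) module_scheme
    \<Rightarrow> ('l, ('a \<times> 'l \<Rightarrow>\<^sub>0 int) set) module"
  where "base_change R A L =
    algebra_of_hom (\<lambda>l. tensor_class R A L (frag_of (\<one>\<^bsub>A\<^esub>, l))) (tensor_ring R A L)"

text \<open>
  Flatness: tensoring preserves injectivity of linear maps. HOL cannot quantify over modules on
  all types, so the modules here live on the type of elements of \<open>R\<close>. Nothing is lost, since the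
  inclusions of ideals into \<open>R\<close>, which already suffice to test flatness, are among them.
\<close>

definition flat_module ::
  "('r, 'x) ring_scheme \<Rightarrow> ('r, 'a, 'm) module_scheme \<Rightarrow> bool"
  where "flat_module R A \<longleftrightarrow>
    (\<forall>(M :: ('r, 'r) module) (N :: ('r, 'r) module) f.
      module R M \<and> module R N \<and> f \<in> linear_maps R M N \<and> inj_on f (carrier M) \<longrightarrow>
      inj_on (tensor_map R N A f (\<lambda>a. a)) (carrier (tensor_group R M A)))"


section \<open>Localizations and residue fields\<close>

definition fraction_rel ::
  "('r, 'x) ring_scheme \<Rightarrow> 'r set \<Rightarrow> (('r \<times> 'r) \<times> ('r \<times> 'r)) set"
  where "fraction_rel R S =
    {((a, s), (b, t)). a \<in> carrier R \<and> s \<in> S \<and> b \<in> carrier R \<and> t \<in> S \<and>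
      (\<exists>u\<in>S. u \<otimes>\<^bsub>R\<^esub> (a \<otimes>\<^bsub>R\<^esub> t) = u \<otimes>\<^bsub>R\<^esub> (b \<otimes>\<^bsub>R\<^esub> s))}"

definition fraction :: "('r, 'x) ring_scheme \<Rightarrow> 'r set \<Rightarrow> 'r \<Rightarrow> 'r \<Rightarrow> ('r \<times> 'r) set"
  where "fraction R S a s = fraction_rel R S `` {(a, s)}"

definition localization_ring ::
  "('r, 'x) ring_scheme \<Rightarrow> 'r set \<Rightarrow> ('r \<times> 'r) set ring"
  where "localization_ring R S =
    \<lparr>carrier = (carrier R \<times> S) // fraction_rel R S,
     monoid.mult = (\<lambda>U V. \<Union>(a, s)\<in>U. \<Union>(b, t)\<in>V. fraction R S (a \<otimes>\<^bsub>R\<^esub> b) (s \<otimes>\<^bsub>R\<^esub> t)),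
     monoid.one = fraction R S \<one>\<^bsub>R\<^esub> \<one>\<^bsub>R\<^esub>,
     ring.zero = fraction R S \<zero>\<^bsub>R\<^esub> \<one>\<^bsub>R\<^esub>,
     ring.add = (\<lambda>U V. \<Union>(a, s)\<in>U. \<Union>(b, t)\<in>V.
       fraction R S ((a \<otimes>\<^bsub>R\<^esub> t) \<oplus>\<^bsub>R\<^esub> (b \<otimes>\<^bsub>R\<^esub> s)) (s \<otimes>\<^bsub>R\<^esub> t))\<rparr>"

definition localization ::
  "('r, 'x) ring_scheme \<Rightarrow> 'r set \<Rightarrow> ('r, ('r \<times> 'r) set) module"
  where "localization R S = algebra_of_hom (\<lambda>a. fraction R S a \<one>\<^bsub>R\<^esub>) (localization_ring R S)"

definition quotient_field :: "('r, 'x) ring_scheme \<Rightarrow> ('r, ('r \<times> 'r) set) module"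
  where "quotient_field R = localization R (carrier R - {\<zero>\<^bsub>R\<^esub>})"

text \<open>The residue field \<open>k(P) = R\<^sub>P / P R\<^sub>P\<close>; here \<open>I\<close> is the ideal \<open>P R\<^sub>P\<close>.\<close>

definition residue_field ::
  "('r, 'x) ring_scheme \<Rightarrow> 'r set \<Rightarrow> ('r, ('r \<times> 'r) set set) module"
  where "residue_field R P =
    (let S = carrier R - P;
         RP = localization_ring R S;
         I = Idl\<^bsub>RP\<^esub> ((\<lambda>a. fraction R S a \<one>\<^bsub>R\<^esub>) ` P)
     in algebra_of_hom (\<lambda>a. I +>\<^bsub>RP\<^esub> fraction R S a \<one>\<^bsub>R\<^esub>) (RP Quot I))"


section \<open>Affine fibrations and locally nilpotent derivations\<close>

definition affine_fibration ::
  "('r, 'x) ring_scheme \<Rightarrow> ('r, 'a, 'm) module_scheme \<Rightarrow> nat \<Rightarrow> bool"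
  where "affine_fibration R A n \<longleftrightarrow>
    algebra R A \<and> fin_gen_algebra R A \<and> flat_module R A \<and>
    (\<forall>P. primeideal P R \<longrightarrow>
      is_polynomial_algebra (residue_field R P) (base_change R A (residue_field R P)) n)"

definition derivations ::
  "('r, 'x) ring_scheme \<Rightarrow> ('r, 'a, 'm) module_scheme \<Rightarrow> ('a \<Rightarrow> 'a) set"
  where "derivations R A =
    {D \<in> linear_maps R A A. \<forall>x\<in>carrier A. \<forall>y\<in>carrier A.
      D (x \<otimes>\<^bsub>A\<^esub> y) = (D x \<otimes>\<^bsub>A\<^esub> y) \<oplus>\<^bsub>A\<^esub> (x \<otimes>\<^bsub>A\<^esub> D y)}"

definition LNDs ::
  "('r, 'x) ring_scheme \<Rightarrow> ('r, 'a, 'm) module_scheme \<Rightarrow> ('a \<Rightarrow> 'a) set"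
  where "LNDs R A = {D \<in> derivations R A. \<forall>x\<in>carrier A. \<exists>m. (D ^^ m) x = \<zero>\<^bsub>A\<^esub>}"

definition Ker :: "('a, 'm) ring_scheme \<Rightarrow> ('a \<Rightarrow> 'a) \<Rightarrow> 'a set"
  where "Ker A D = {x \<in> carrier A. D x = \<zero>\<^bsub>A\<^esub>}"


section \<open>Rank and rigidity over polynomial rings\<close>

text \<open>
  Below \<open>E\<close> is meant to be a polynomial ring in \<open>n\<close> variables over \<open>C\<close>.
  Coordinates are indexed from \<open>0\<close>, so the first \<open>k\<close> of them are \<open>U ` {..<k}\<close>.
\<close>

definition coordinate_system ::
  "('c, 'x) ring_scheme \<Rightarrow> ('c, 'e, 'm) module_scheme \<Rightarrow> nat \<Rightarrow> (nat \<Rightarrow> 'e) \<Rightarrow> bool"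
  where "coordinate_system C E n U \<longleftrightarrow>
    U ` {..<n} \<subseteq> carrier E \<and> adjoin C E (U ` {..<n}) = carrier E"

definition LND_rank ::
  "('c, 'x) ring_scheme \<Rightarrow> ('c, 'e, 'm) module_scheme \<Rightarrow> nat \<Rightarrow> ('e \<Rightarrow> 'e) \<Rightarrow> nat"
  where "LND_rank C E n \<delta> =
    (LEAST r. r \<le> n \<and> (\<exists>U. coordinate_system C E n U \<and> U ` {..<n - r} \<subseteq> Ker E \<delta>))"

definition rigid ::
  "('c, 'x) ring_scheme \<Rightarrow> ('c, 'e, 'm) module_scheme \<Rightarrow> nat \<Rightarrow> ('e \<Rightarrow> 'e) \<Rightarrow> bool"
  where "rigid C E n \<delta> \<longleftrightarrow>
    (let r = LND_rank C E n \<delta> in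
      \<forall>U V. coordinate_system C E n U \<and> coordinate_system C E n V \<and>
        U ` {..<n - r} \<subseteq> Ker E \<delta> \<and> V ` {..<n - r} \<subseteq> Ker E \<delta> \<longrightarrow>
        adjoin C E (U ` {..<n - r}) = adjoin C E (V ` {..<n - r}))"


section \<open>Residual rank and residual rigidity\<close>

text \<open>
  \<open>residual_system R B A n r\<close>: the triple \<open>(R, B, A)\<close> is an \<open>(n, r)\<close>-residual system.
  In the last clause \<open>A \<otimes>\<^sub>R k(P)\<close> is an algebra over \<open>B \<otimes>\<^sub>R k(P)\<close> through the map induced by
  the inclusion of \<open>B\<close> in \<open>A\<close>.
\<close>

definition residual_system ::
  "('r, 'x) ring_scheme \<Rightarrow> 'a set \<Rightarrow> ('r, 'a, 'm) module_scheme \<Rightarrow> nat \<Rightarrow> nat \<Rightarrow> bool"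
  where "residual_system R B A n r \<longleftrightarrow>
    affine_fibration R A n \<and> is_subalgebra R B A \<and>
    r \<le> n \<and> affine_fibration R (A\<lparr>carrier := B\<rparr>) (n - r) \<and>
    (\<forall>P. primeideal P R \<longrightarrow>
      (let k = residue_field R P in
        is_polynomial_algebra
          (base_change R (A\<lparr>carrier := B\<rparr>) k)
          (algebra_of_hom (tensor_map R A k (\<lambda>b. b) (\<lambda>c. c)) (base_change R A k))
          r))"

definition residual_rank ::
  "('r, 'x) ring_scheme \<Rightarrow> ('r, 'a, 'm) module_scheme \<Rightarrow> nat \<Rightarrow> ('a \<Rightarrow> 'a) \<Rightarrow> nat"
  where "residual_rank R A n D = (LEAST r. \<exists>B. residual_system R B A n r \<and> B \<subseteq> Ker A D)"

definition residually_rigid ::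
  "('r, 'x) ring_scheme \<Rightarrow> ('r, 'a, 'm) module_scheme \<Rightarrow> nat \<Rightarrow> ('a \<Rightarrow> 'a) \<Rightarrow> bool"
  where "residually_rigid R A n D \<longleftrightarrow>
    (let r = residual_rank R A n D in
      \<forall>B\<^sub>1 B\<^sub>2. residual_system R B\<^sub>1 A n r \<and> residual_system R B\<^sub>2 A n r \<and>
        B\<^sub>1 \<subseteq> Ker A D \<and> B\<^sub>2 \<subseteq> Ker A D \<longrightarrow> B\<^sub>1 = B\<^sub>2)"


section \<open>Extension to the quotient field\<close>

definition generic_fibre ::
  "('r, 'x) ring_scheme \<Rightarrow> ('r, 'a, 'm) module_scheme
    \<Rightarrow> (('r \<times> 'r) set, ('a \<times> ('r \<times> 'r) set \<Rightarrow>\<^sub>0 int) set) module"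
  where "generic_fibre R A = base_change R A (quotient_field R)"

definition generic_extension ::
  "('r, 'x) ring_scheme \<Rightarrow> ('r, 'a, 'm) module_scheme \<Rightarrow> ('a \<Rightarrow> 'a)
    \<Rightarrow> ('a \<times> ('r \<times> 'r) set \<Rightarrow>\<^sub>0 int) set \<Rightarrow> ('a \<times> ('r \<times> 'r) set \<Rightarrow>\<^sub>0 int) set"
  where "generic_extension R A D = tensor_map R A (quotient_field R) D (\<lambda>c. c)"

abbreviation rat_ring :: "rat ring"
  where "rat_ring \<equiv> \<lparr>carrier = UNIV, monoid.mult = (*), monoid.one = 1, ring.zero = 0, ring.add = (+)\<rparr>"

definition contains_rationals :: "('r, 'x) ring_scheme \<Rightarrow> bool"
  where "contains_rationals R \<longleftrightarrow> (\<exists>h. h \<in> ring_hom rat_ring R \<and> inj h)"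

end

theory Submission
 imports Defs
  "HOL-Computational_Algebra.Fundamental_Theorem_Algebra"
  "HOL-Computational_Algebra.Polynomial_Factorial"
  "HOL-Computational_Algebra.Field_as_Ring"
  "HOL-Analysis.Continuum_Not_Denumerable"
begin

text \<open>
The first half of the theorem compares two residual systems \<open>B\<^sub>1\<close>, \<open>B\<^sub>2\<close> inside the kernel of \<open>D\<close> on the
generic fibre \<open>A\<^sub>K\<close>. At the prime \<open>0\<close> a residual system says that \<open>B \<otimes> K\<close> is a polynomial ring over \<open>K\<close> and
that \<open>A\<^sub>K\<close> is one over \<open>B \<otimes> K\<close>. Stacking coordinates, \<open>B\<^sub>i \<otimes> K\<close> is generated by the first \<open>n - r\<close>
coordinates of a system of \<open>A\<^sub>K\<close>, and these lie in the kernel of \<open>D\<^sub>K\<close> (lemma \<open>residual_coordinates\<close>). If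
\<open>r\<close> is the rank of \<open>D\<^sub>K\<close> and \<open>D\<^sub>K\<close> is rigid, then \<open>B\<^sub>1 \<otimes> K = B\<^sub>2 \<otimes> K\<close>. It remains to see
that \<open>(B \<otimes> K) \<inter> A = B\<close>. This follows from \<open>sA \<inter> B = sB\<close> for \<open>s \<noteq> 0\<close>, and more generally
\<open>IA \<inter> B = IB\<close> holds for every ideal \<open>I\<close> of \<open>R\<close> (lemma \<open>purity\<close>): for a prime \<open>P\<close> because \<open>B \<otimes> k(P)\<close>
embeds in the polynomial ring \<open>A \<otimes> k(P)\<close> over it, and for all ideals by Noetherian induction. Flatness enters
through the colon ideals: \<open>am \<in> IM\<close> implies \<open>m \<in> (I : a)M\<close> (lemma \<open>flat_colon\<close>).

For \<open>n = 3\<close> one has to show that every locally nilpotent derivation \<open>D\<close> of \<open>C[X, Y, Z]\<close>, for a field \<open>C\<close> of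
characteristic zero, is rigid (theorem \<open>rigid_three_variables\<close>). Rank \<open>0\<close> and rank \<open>3\<close> are trivial, and in rank
one the kernel is generated by the two coordinates in it. In rank two let \<open>X\<close> and \<open>V\<close> be first coordinates of two
systems, both in the kernel; it must be shown that \<open>C[X] = C[V]\<close>. Finitely many elements of \<open>C\<close> describe the
situation and they lie in a subfield that embeds in the complex numbers (lemma \<open>embedding_into_complex\<close>), so \<open>C\<close> may
be taken to be a countable field \<open>k\<close> of complex numbers.

The ring \<open>k(X)[Y, Z]\<close> embeds in \<open>\<complex>[Y, Z]\<close> by sending \<open>X\<close> to a number that is transcendental over \<open>k\<close>.
There Rentschler's theorem applies: the kernel of a locally nilpotent derivation is \<open>\<complex>[P]\<close> and the ring is
\<open>\<complex>[P, s]\<close>. Both descend to \<open>k(X)\<close> (lemma \<open>generic_coordinates\<close>), so \<open>k[X, Y, Z]\<close> is generated over the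
kernel by \<open>s\<close> after inverting polynomials in \<open>X\<close>. In the same way it is generated by some \<open>t\<close> after inverting
polynomials in \<open>V\<close>. If neither of \<open>X\<close> and \<open>V\<close> is a polynomial in the other, then polynomials in \<open>X\<close> and in \<open>V\<close> are coprime, which makes
it possible to remove the denominators (lemma \<open>two_first_coordinates\<close>): \<open>k[X, Y, Z] = k[X, P, s]\<close> with \<open>P\<close> in the
kernel. But then the rank is at most one.
\<close>

hide_const (open) Polynomials.degree Polynomials.lead_coeff

abbreviation scalar :: "('c, 'e, 'm) module_scheme \<Rightarrow> 'c \<Rightarrow> 'e"
 where "scalar E c \<equiv> c \<odot>\<^bsub>E\<^esub> \<one>\<^bsub>E\<^esub>"

section \<open>Polynomials with coefficients in a subring\<close>

definition sub_ring :: "'a::comm_ring_1 set \<Rightarrow> bool"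
 where "sub_ring S \<longleftrightarrow> 1 \<in> S \<and> (\<forall>x\<in>S. \<forall>y\<in>S. x - y \<in> S \<and> x * y \<in> S)"

definition sub_field :: "'a::field set \<Rightarrow> bool"
 where "sub_field S \<longleftrightarrow> sub_ring S \<and> (\<forall>x\<in>S. inverse x \<in> S)"

definition polys_over :: "'a::zero set \<Rightarrow> 'a poly set"
 where "polys_over S = {p. \<forall>i. coeff p i \<in> S}"

lemma sub_ringD:
 assumes "sub_ring S"
 shows "0 \<in> S" "1 \<in> S" "x \<in> S ==> y \<in> S ==> x + y \<in> S" "x \<in> S ==> y \<in> S ==> x - y \<in> S"
  "x \<in> S ==> y \<in> S ==> x * y \<in> S" "x \<in> S ==> - x \<in> S" "x \<in> S ==> x ^ n \<in> S" "of_nat n \<in> S"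
proof -
 have one: "1 \<in> S" and diff: "\<And>x y. x \<in> S ==> y \<in> S ==> x - y \<in> S"
  and mult: "\<And>x y. x \<in> S ==> y \<in> S ==> x * y \<in> S"
  using assms unfolding sub_ring_def by auto
 have zero: "0 \<in> S" using diff[OF one one] by simp
 have neg: "\<And>x. x \<in> S ==> - x \<in> S" using diff[OF zero] by simp
 have add: "\<And>x y. x \<in> S ==> y \<in> S ==> x + y \<in> S" using diff neg by force
 show "0 \<in> S" "1 \<in> S" by fact+
 show "x \<in> S ==> y \<in> S ==> x + y \<in> S" "x \<in> S ==> y \<in> S ==> x - y \<in> S"
  "x \<in> S ==> y \<in> S ==> x * y \<in> S" "x \<in> S ==> - x \<in> S"
  using add diff mult neg by auto
 show "x \<in> S ==> x ^ n \<in> S" by (induction n) (auto intro: one mult)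
 show "of_nat n \<in> S" by (induction n) (auto intro: zero one add)
qed

lemma sub_ring_sum:
 assumes "sub_ring S" "\<And>i. i \<in> I ==> f i \<in> S"
 shows "sum f I \<in> S"
 using assms(2) by (induction I rule: infinite_finite_induct) (auto intro: sub_ringD[OF assms(1)])

lemma sub_fieldD:
 assumes "sub_field S"
 shows "sub_ring S" "x \<in> S ==> inverse x \<in> S" "x \<in> S ==> y \<in> S ==> x / y \<in> S"
 using assms sub_ringD(5)[of S x "inverse y"] unfolding sub_field_def divide_inverse by auto

lemma sub_ring_UNIV [simp]: "sub_ring UNIV"
 by (simp add: sub_ring_def)

lemma sub_field_UNIV [simp]: "sub_field UNIV"
 by (simp add: sub_field_def)

lemma polys_over_UNIV [simp]: "polys_over UNIV = UNIV"
 by (simp add: polys_over_def)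

lemma coeff_polys_over: "p \<in> polys_over S ==> coeff p i \<in> S"
 by (simp add: polys_over_def)

lemma polys_over_mono: "S \<subseteq> T ==> polys_over S \<subseteq> polys_over T"
 by (auto simp: polys_over_def)

lemma pCons_polys_over_iff [simp]: "pCons a p \<in> polys_over S \<longleftrightarrow> a \<in> S \<and> p \<in> polys_over S"
proof -
 have "(\<forall>i. coeff (pCons a p) i \<in> S) \<longleftrightarrow> a \<in> S \<and> (\<forall>i. coeff p i \<in> S)"
  unfolding coeff_pCons by (metis (no_types, lifting) nat.case(1) nat.case(2) not0_implies_Suc)
 thus ?thesis by (simp add: polys_over_def)
qed

lemma zero_polys_over: "0 \<in> S ==> 0 \<in> polys_over S"
 by (simp add: polys_over_def)

lemma polys_over_sub_ring:
 assumes S: "sub_ring S"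
 shows "sub_ring (polys_over S)"
proof -
 have "1 \<in> polys_over S"
  unfolding one_pCons by (simp add: zero_polys_over sub_ringD[OF S])
 thus ?thesis
  by (auto simp: sub_ring_def polys_over_def coeff_mult intro!: sub_ring_sum[OF S] sub_ringD[OF S])
qed

lemma poly_in_sub_ring:
 assumes S: "sub_ring S" and p: "p \<in> polys_over S" and x: "x \<in> S"
 shows "poly p x \<in> S"
 unfolding poly_altdef
 by (intro sub_ring_sum[OF S] sub_ringD[OF S] coeff_polys_over[OF p] x)

lemma smult_polys_over:
 assumes S: "sub_ring S" and "a \<in> S" "p \<in> polys_over S"
 shows "smult a p \<in> polys_over S"
 using assms(2,3) by (auto simp: polys_over_def intro: sub_ringD[OF S])

lemma const_polys_over: "sub_ring S ==> [:a:] \<in> polys_over S \<longleftrightarrow> a \<in> S"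
 by (simp add: zero_polys_over sub_ringD)

lemma pderiv_polys_over:
 assumes S: "sub_ring S" and p: "p \<in> polys_over S"
 shows "pderiv p \<in> polys_over S"
 unfolding polys_over_def
 by (auto simp: coeff_pderiv simp del: of_nat_Suc intro!: sub_ringD[OF S] coeff_polys_over[OF p])

lemma map_poly_polys_over:
 assumes "p \<in> polys_over S" "\<And>x. x \<in> S ==> f x \<in> T" "f 0 = 0"
 shows "map_poly f p \<in> polys_over T"
 using assms by (auto simp: polys_over_def coeff_map_poly)

lemma polys_over_induct [consumes 2, case_names const var add mult]:
 assumes S: "sub_ring S" and p: "p \<in> polys_over S"
  and const: "\<And>a. a \<in> S ==> P [:a:]" and var: "P [:0, 1:]"
  and add: "\<And>p q. p \<in> polys_over S ==> q \<in> polys_over S ==> P p ==> P q ==> P (p + q)"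
  and mult: "\<And>p q. p \<in> polys_over S ==> q \<in> polys_over S ==> P p ==> P q ==> P (p * q)"
 shows "P p"
 using p
proof (induction p)
 case 0
 thus ?case using const[of 0] sub_ringD(1)[OF S] by simp
next
 case (pCons a p)
 have a: "a \<in> S" and p: "p \<in> polys_over S" using pCons.prems by auto
 have X: "[:0, 1:] \<in> polys_over S" by (simp add: zero_polys_over sub_ringD[OF S])
 have "P ([:a:] + [:0, 1:] * p)"
  using a p X by (intro add mult const var pCons.IH sub_ringD(5)[OF polys_over_sub_ring[OF S]])
   (auto simp: const_polys_over[OF S])
 thus ?case by simp
qed

section \<open>Ring homomorphisms and derivations on polynomials\<close>

definition rhom :: "('a::comm_ring_1 \<Rightarrow> 'b::comm_ring_1) \<Rightarrow> bool"
 where "rhom h \<longleftrightarrow> h 1 = 1 \<and> (\<forall>x y. h (x + y) = h x + h y) \<and> (\<forall>x y. h (x * y) = h x * h y)"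

lemma rhomD:
 assumes "rhom h"
 shows "h 1 = 1" "h 0 = 0" "h (x + y) = h x + h y" "h (x * y) = h x * h y"
  "h (x - y) = h x - h y" "h (- x) = - h x" "h (x ^ n) = h x ^ n"
proof -
 have one: "h 1 = 1" and add: "\<And>x y. h (x + y) = h x + h y" and mult: "\<And>x y. h (x * y) = h x * h y"
  using assms by (auto simp: rhom_def)
 have zero: "h 0 = 0" using add[of 0 0] by simp
 have neg: "\<And>x. h (- x) = - h x"
  using add zero by (metis add.right_inverse add_eq_0_iff)
 show "h 1 = 1" "h 0 = 0" "h (x + y) = h x + h y" "h (x * y) = h x * h y" "h (- x) = - h x" by fact+
 show "h (x - y) = h x - h y" using add[of x "- y"] neg by simp
 show "h (x ^ n) = h x ^ n" by (induction n) (simp_all add: one mult)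
qed

lemma rhom_sum: "rhom h ==> h (sum f I) = (\<Sum>i\<in>I. h (f i))"
 by (induction I rule: infinite_finite_induct) (simp_all add: rhomD)

lemma map_poly_pCons_gen: "f 0 = 0 ==> map_poly f (pCons a p) = pCons (f a) (map_poly f p)"
 by (rule poly_eqI) (simp add: coeff_map_poly coeff_pCons split: nat.split)

lemma map_poly_add_gen:
 "f 0 = 0 ==> (\<And>x y. f (x + y) = f x + f y) ==> map_poly f (p + q) = map_poly f p + map_poly f q"
 by (rule poly_eqI) (simp add: coeff_map_poly)

lemma map_poly_const: "f 0 = 0 ==> map_poly f [:a:] = [:f a:]"
 by (simp add: map_poly_pCons_gen)

lemma rhom_map_poly:
 assumes "rhom h"
 shows "rhom (map_poly h)"
 unfolding rhom_def
proof (intro conjI allI)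
 show "map_poly h 1 = 1"
  by (simp add: one_pCons map_poly_const rhomD[OF assms])
 show "map_poly h (p + q) = map_poly h p + map_poly h q" for p q
  by (rule poly_eqI) (simp add: coeff_map_poly rhomD[OF assms])
 show "map_poly h (p * q) = map_poly h p * map_poly h q" for p q
  by (rule poly_eqI) (simp add: coeff_map_poly coeff_mult rhomD[OF assms] rhom_sum[OF assms])
qed

lemma rhom_poly: "rhom (\<lambda>p. poly p x)"
 by (simp add: rhom_def)

lemma rhom_const: "rhom (\<lambda>c. [:c:])"
 by (simp add: rhom_def one_pCons)

lemma rhom_comp: "rhom f ==> rhom g ==> rhom (\<lambda>x. f (g x))"
 by (simp add: rhom_def)

lemma rhom_eval: "rhom h ==> rhom (\<lambda>p. poly (map_poly h p) x)"
 by (intro rhom_comp[OF rhom_poly] rhom_map_poly)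

lemma rhom_map_poly_poly: "rhom h ==> h (poly p x) = poly (map_poly h p) (h x)"
 by (induction p) (simp_all add: rhomD map_poly_pCons_gen)

definition der :: "('a::comm_ring_1 \<Rightarrow> 'a) \<Rightarrow> bool"
 where "der d \<longleftrightarrow> (\<forall>x y. d (x + y) = d x + d y) \<and> (\<forall>x y. d (x * y) = d x * y + x * d y)"

lemma derD:
 assumes "der d"
 shows "d 0 = 0" "d 1 = 0" "d (x + y) = d x + d y" "d (x * y) = d x * y + x * d y"
  "d (- x) = - d x" "d (x - y) = d x - d y"
proof -
 have add: "\<And>x y. d (x + y) = d x + d y" and mult: "\<And>x y. d (x * y) = d x * y + x * d y"
  using assms by (auto simp: der_def)
 have zero: "d 0 = 0" using add[of 0 0] by simp
 have neg: "\<And>x. d (- x) = - d x"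
  using add zero by (metis add.right_inverse add_eq_0_iff)
 show "d 0 = 0" "d (x + y) = d x + d y" "d (x * y) = d x * y + x * d y" "d (- x) = - d x" by fact+
 show "d 1 = 0" using mult[of 1 1] by simp
 show "d (x - y) = d x - d y" using add[of x "- y"] neg by simp
qed

lemma der_funpow_add: "der d ==> (d ^^ n) (x + y) = (d ^^ n) x + (d ^^ n) y"
 by (induction n) (simp_all add: derD)

lemma der_funpow_zero: "der d ==> (d ^^ n) 0 = 0"
 by (induction n) (simp_all add: derD)

lemma der_mult_ker: "der d ==> d a = 0 ==> d (a * x) = a * d x"
 by (simp add: derD)

lemma ker_sub_ring: "der d ==> sub_ring {a. d a = 0}"
 by (auto simp: sub_ring_def derD)

text \<open>The chain rule for a polynomial whose coefficients are constants.\<close>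

lemma der_poly_ker:
 assumes "der d" "G \<in> polys_over {a. d a = 0}"
 shows "d (poly G s) = poly (pderiv G) s * d s"
 using assms(2)
 by (induction G) (simp_all add: derD[OF assms(1)] pderiv_pCons algebra_simps)

lemma der_map_poly:
 assumes "der d"
 shows "der (map_poly d)"
 unfolding der_def
proof (intro conjI allI)
 show "map_poly d (p + q) = map_poly d p + map_poly d q" for p q
  by (rule map_poly_add_gen) (simp_all add: derD[OF assms])
 have dsum: "d (sum f I) = (\<Sum>i\<in>I. d (f i))" for f and I :: "nat set"
  by (induction I rule: infinite_finite_induct) (simp_all add: derD[OF assms])
 show "map_poly d (p * q) = map_poly d p * q + p * map_poly d q" for p q
  by (rule poly_eqI) (simp add: coeff_map_poly coeff_mult derD[OF assms] dsum sum.distrib)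
qed

lemma der_pderiv: "der pderiv"
 by (simp add: der_def pderiv_add pderiv_mult algebra_simps)

lemma der_combination: "der d ==> der e ==> der (\<lambda>x. f * d x + g * e x)"
 by (simp add: der_def algebra_simps)

definition lnd :: "('a::comm_ring_1 \<Rightarrow> 'a) \<Rightarrow> bool"
 where "lnd d \<longleftrightarrow> der d \<and> (\<forall>x. \<exists>n. (d ^^ n) x = 0)"

text \<open>
 A relation of least degree for \<open>s\<close>, differentiated, gives \<open>p'(s) d s = 0\<close> with a relation \<open>p'\<close> of smaller degree.
\<close>

lemma ker_transcendental:
 fixes d :: "'a::{idom, ring_char_0} \<Rightarrow> 'a"
 assumes d: "der d" and s: "d s \<noteq> 0"
  and G: "G \<in> polys_over {a. d a = 0}" "poly G s = 0"
 shows "G = 0"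
 using G
proof (induction "degree G" arbitrary: G rule: less_induct)
 case less
 have "poly (pderiv G) s * d s = 0"
  using der_poly_ker[OF d less.prems(1), of s] less.prems(2) derD(1)[OF d] by simp
 hence 0: "poly (pderiv G) s = 0" using s by simp
 have "degree G = 0"
 proof (rule ccontr)
  assume "degree G \<noteq> 0"
  hence "pderiv G = 0"
   using less.hyps[OF _ pderiv_polys_over[OF ker_sub_ring[OF d] less.prems(1)] 0]
   by (simp add: degree_pderiv)
  thus False using \<open>degree G \<noteq> 0\<close> by (simp add: pderiv_eq_0_iff)
 qed
 then obtain c where "G = [:c:]" by (rule degree_eq_zeroE)
 thus ?case using less.prems(2) by simp
qed

lemma der_funpow_mult:
 assumes d: "der d"
 shows "(d ^^ n) (x * y) = (\<Sum>i\<le>n. of_nat (n choose i) * ((d ^^ i) x * (d ^^ (n - i)) y))"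
proof (induction n)
 case 0
 thus ?case by simp
next
 case (Suc n)
 have dsum: "d (sum f I) = (\<Sum>i\<in>I. d (f i))" for f and I :: "nat set"
  by (induction I rule: infinite_finite_induct) (simp_all add: derD[OF d])
 have dnat: "d (of_nat m) = 0" for m
  by (induction m) (simp_all add: derD[OF d])
 let ?t = "\<lambda>i j. (d ^^ i) x * (d ^^ j) y"
 have "(d ^^ Suc n) (x * y) = (\<Sum>i\<le>n. of_nat (n choose i) * (?t (Suc i) (n - i) + ?t i (Suc (n - i))))"
  by (simp add: Suc dsum dnat derD[OF d])
 also have "\<dots> = (\<Sum>i\<le>n. of_nat (n choose i) * ?t (Suc i) (n - i))
   + (\<Sum>i\<le>n. of_nat (n choose i) * ?t i (Suc n - i))"
  by (simp add: distrib_left sum.distrib Suc_diff_le)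
 also have "(\<Sum>i\<le>n. of_nat (n choose i) * ?t i (Suc n - i)) =
   (\<Sum>i\<le>Suc n. of_nat (n choose i) * ?t i (Suc n - i))"
  by (simp add: binomial_eq_0)
 also have "\<dots> = ?t 0 (Suc n) + (\<Sum>i\<le>n. of_nat (n choose Suc i) * ?t (Suc i) (n - i))"
  by (simp add: sum.atMost_Suc_shift del: sum.atMost_Suc)
 finally have "(d ^^ Suc n) (x * y) =
   ?t 0 (Suc n) + (\<Sum>i\<le>n. of_nat (Suc n choose Suc i) * ?t (Suc i) (n - i))"
  by (simp add: sum.distrib[symmetric] distrib_right)
 thus ?case
  by (simp only: sum.atMost_Suc_shift[of _ n]) simp
qed

text \<open>The top nonvanishing iterates multiply, so kernels are factorially closed.\<close>

lemma ker_factorially_closed: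
 fixes d :: "'a::{idom, ring_char_0} \<Rightarrow> 'a"
 assumes d: "lnd d" and xy: "d (x * y) = 0" "x * y \<noteq> 0"
 shows "d x = 0" "d y = 0"
proof -
 have der: "der d" using d by (simp add: lnd_def)
 have top: "\<exists>m. (d ^^ m) z \<noteq> 0 \<and> (\<forall>j>m. (d ^^ j) z = 0)" if "z \<noteq> 0" for z
 proof -
  obtain n where n: "(d ^^ n) z = 0" using d by (auto simp: lnd_def)
  define N where "N = (LEAST n. (d ^^ n) z = 0)"
  have N: "(d ^^ N) z = 0" unfolding N_def by (rule LeastI[of _ n]) (rule n)
  hence "N \<noteq> 0" using that by (metis funpow_0)
  then obtain m where m: "N = Suc m" by (cases N) auto
  have "(d ^^ m) z \<noteq> 0" using not_less_Least[of m "\<lambda>n. (d ^^ n) z = 0"] m N_def by auto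
  moreover have "(d ^^ j) z = 0" if "j > m" for j
  proof -
   have "(d ^^ (j - N + N)) z = 0"
    using N der_funpow_zero[OF der] by (simp add: funpow_add)
   thus ?thesis using that m by simp
  qed
  ultimately show ?thesis by blast
 qed
 have x0: "x \<noteq> 0" and y0: "y \<noteq> 0" using xy by auto
 obtain m where m: "(d ^^ m) x \<noteq> 0" "\<And>j. j > m ==> (d ^^ j) x = 0" using top[OF x0] by blast
 obtain n where n: "(d ^^ n) y \<noteq> 0" "\<And>j. j > n ==> (d ^^ j) y = 0" using top[OF y0] by blast
 have "(d ^^ (m + n)) (x * y) =
   (\<Sum>i\<le>m + n. of_nat ((m + n) choose i) * ((d ^^ i) x * (d ^^ (m + n - i)) y))"
  by (rule der_funpow_mult[OF der])
 also have "\<dots> = (\<Sum>i\<in>{m}. of_nat ((m + n) choose i) * ((d ^^ i) x * (d ^^ (m + n - i)) y))"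
 proof (rule sum.mono_neutral_right)
  show "\<forall>i\<in>{..m + n} - {m}. of_nat (m + n choose i) * ((d ^^ i) x * (d ^^ (m + n - i)) y) = 0"
  proof
   fix i assume i: "i \<in> {..m + n} - {m}"
   hence "i > m \<or> m + n - i > n" by auto
   thus "of_nat (m + n choose i) * ((d ^^ i) x * (d ^^ (m + n - i)) y) = 0"
    using m(2) n(2) by auto
  qed
 qed auto
 also have "\<dots> \<noteq> 0" using m(1) n(1) by simp
 finally have nz: "(d ^^ (m + n)) (x * y) \<noteq> 0" .
 have "m + n = 0"
 proof (rule ccontr)
  assume "m + n \<noteq> 0"
  then obtain j where "m + n = Suc j" by (cases "m + n") auto
  hence "(d ^^ (m + n)) (x * y) = (d ^^ j) (d (x * y))" by (simp add: funpow_swap1)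
  thus False using nz xy(1) der_funpow_zero[OF der] by simp
 qed
 thus "d x = 0" "d y = 0" using m(2)[of 1] n(2)[of 1] by auto
qed

section \<open>The plane over the complex numbers\<close>

text \<open>
 Elements of \<open>complex poly poly\<close> are polynomials in \<open>Y\<close> and \<open>Z\<close>, with \<open>Z\<close> as outer variable. Like the total degree, the
 degree of the lexicographically leading monomial is additive on products and vanishes on constants only.
\<close>

definition bideg :: "'a::zero poly poly \<Rightarrow> nat"
 where "bideg F = degree F + degree (lead_coeff F)"

definition cc :: "'a::comm_ring_1 \<Rightarrow> 'a poly poly"
 where "cc c = [:[:c:]:]"

lemma rhom_cc: "rhom cc"
 unfolding cc_def using rhom_comp[OF rhom_const rhom_const] .

lemma cc_eq_0_iff [simp]: "cc c = 0 \<longleftrightarrow> c = 0"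
 by (simp add: cc_def)

lemma bideg_mult:
 fixes F G :: "'a::idom poly poly"
 shows "F \<noteq> 0 ==> G \<noteq> 0 ==> bideg (F * G) = bideg F + bideg G"
 using degree_mult_eq[of F G] lead_coeff_mult[of F G] degree_mult_eq[of "lead_coeff F" "lead_coeff G"]
 unfolding bideg_def by (metis add.assoc add.left_commute leading_coeff_0_iff)

lemma bideg_eq_0_iff:
 fixes F :: "'a::comm_ring_1 poly poly"
 shows "bideg F = 0 \<longleftrightarrow> (\<exists>c. F = cc c)"
proof
 assume "bideg F = 0"
 hence 0: "degree F = 0" "degree (lead_coeff F) = 0" by (auto simp: bideg_def)
 obtain p where p: "F = [:p:]" using 0(1) by (rule degree_eq_zeroE)
 hence "degree p = 0" using 0(2) by simp
 then obtain c where "p = [:c:]" by (rule degree_eq_zeroE)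
 thus "\<exists>c. F = cc c" using p by (auto simp: cc_def)
qed (auto simp: cc_def bideg_def)

lemma bideg_cc [simp]: "bideg (cc c) = 0"
 using bideg_eq_0_iff by blast

lemma bideg_add_const:
 fixes F :: "'a::comm_ring_1 poly poly"
 assumes "bideg F > 0"
 shows "bideg (F + cc c) = bideg F"
proof (cases "degree F = 0")
 case True
 then obtain p where p: "F = [:p:]" by (rule degree_eq_zeroE)
 hence "degree p > 0" using assms by (simp add: bideg_def)
 hence "degree (p + [:c:]) = degree p" by (intro degree_add_eq_left) simp
 thus ?thesis using p by (simp add: bideg_def cc_def)
next
 case False
 hence "degree (F + cc c) = degree F" by (intro degree_add_eq_left) (simp add: cc_def)
 moreover from this have "lead_coeff (F + cc c) = lead_coeff F"
  using False by (simp add: cc_def coeff_pCons split: nat.split)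
 ultimately show ?thesis by (simp add: bideg_def)
qed

lemma bideg_diff_const:
 fixes F :: "'a::comm_ring_1 poly poly"
 shows "bideg F > 0 ==> bideg (F - cc c) = bideg F"
 using bideg_add_const[of F "- c"] rhomD(6)[OF rhom_cc, of c] by simp

text \<open>
 \<open>ins P \<gamma>\<close> is \<open>\<gamma>(P)\<close>, and \<open>ins2 P s G\<close> below is \<open>G(P, s)\<close>.
\<close>

definition ins :: "'a::comm_ring_1 poly poly \<Rightarrow> 'a poly \<Rightarrow> 'a poly poly"
 where "ins P \<gamma> = poly (map_poly cc \<gamma>) P"

definition ins2 :: "'a::comm_ring_1 poly poly \<Rightarrow> 'a poly poly \<Rightarrow> 'a poly poly \<Rightarrow> 'a poly poly"
 where "ins2 P s G = poly (map_poly (ins P) G) s"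

lemma rhom_ins: "rhom (ins P)"
 unfolding ins_def using rhom_eval[OF rhom_cc] .

lemma rhom_ins2: "rhom (ins2 P s)"
 unfolding ins2_def using rhom_eval[OF rhom_ins] .

lemma ins_const: "ins P [:c:] = cc c"
 by (simp add: ins_def map_poly_const rhomD[OF rhom_cc])

lemma ins_pCons: "ins P (pCons c \<gamma>) = cc c + P * ins P \<gamma>"
 by (simp add: ins_def map_poly_pCons_gen rhomD[OF rhom_cc])

lemma ins_linear: "ins P [:- \<theta>, 1:] = P - cc \<theta>"
 by (simp add: ins_pCons rhomD[OF rhom_ins] rhomD[OF rhom_cc] ins_const one_pCons[symmetric])

lemma ins2_const: "ins2 P s [:\<gamma>:] = ins P \<gamma>"
 by (simp add: ins2_def map_poly_const rhomD[OF rhom_ins])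

lemma bideg_ins:
 fixes P :: "'a::idom poly poly"
 assumes "bideg P > 0" "\<gamma> \<noteq> 0"
 shows "ins P \<gamma> \<noteq> 0 \<and> bideg (ins P \<gamma>) = degree \<gamma> * bideg P"
 using assms(2)
proof (induction \<gamma>)
 case 0
 thus ?case by simp
next
 case (pCons c \<gamma>)
 have P: "P \<noteq> 0" using assms(1) by (auto simp: bideg_def)
 show ?case
 proof (cases "\<gamma> = 0")
  case True
  thus ?thesis using pCons.prems by (simp add: ins_const)
 next
  case False
  hence IH: "ins P \<gamma> \<noteq> 0" "bideg (ins P \<gamma>) = degree \<gamma> * bideg P" using pCons.IH by auto
  have b: "bideg (P * ins P \<gamma>) = bideg P + degree \<gamma> * bideg P"
   using bideg_mult[OF P IH(1)] IH(2) by simp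
  hence b': "bideg (P * ins P \<gamma> + cc c) = bideg P + degree \<gamma> * bideg P"
   using assms(1) by (subst bideg_add_const) auto
  moreover have "bideg (0 :: 'a poly poly) = 0" by (simp add: bideg_def)
  ultimately have "P * ins P \<gamma> + cc c \<noteq> 0" using assms(1) by (metis add_gr_0 less_not_refl)
  thus ?thesis using b' False by (simp add: ins_pCons add.commute)
 qed
qed

lemma ins_eq_0_iff:
 fixes P :: "'a::idom poly poly"
 shows "bideg P > 0 ==> ins P \<gamma> = 0 \<longleftrightarrow> \<gamma> = 0"
 using bideg_ins[of P \<gamma>] rhomD(2)[OF rhom_ins] by auto

text \<open>
 The derivation \<open>f \<partial>\<^sub>Y + g \<partial>\<^sub>Z\<close>.
\<close>

definition plane_der :: "'a::idom poly poly \<Rightarrow> 'a poly poly \<Rightarrow> 'a poly poly \<Rightarrow> 'a poly poly"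
 where "plane_der f g F = f * map_poly pderiv F + g * pderiv F"

lemma der_plane_der: "der (plane_der f g)"
 unfolding plane_der_def by (intro der_combination der_map_poly der_pderiv)

lemma plane_der_cc: "plane_der f g (cc c) = 0"
 by (simp add: plane_der_def cc_def map_poly_const pderiv_pCons)

lemma plane_der_vars: "plane_der f g [:[:0, 1:]:] = f" "plane_der f g [:0, 1:] = g"
proof -
 have "[:[:1:]:] = (1 :: 'a poly poly)" "map_poly pderiv (1 :: 'a poly poly) = 0"
  by (simp_all add: one_pCons map_poly_pCons_gen pderiv_pCons)
 thus "plane_der f g [:[:0, 1:]:] = f" "plane_der f g [:0, 1:] = g"
  by (simp_all add: plane_der_def map_poly_pCons_gen pderiv_pCons)
qed

lemma plane_der_ins:
 "plane_der f g P = 0 ==> plane_der f g (ins P \<gamma>) = 0"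
 by (induction \<gamma>)
  (simp_all add: ins_pCons rhomD[OF rhom_ins] derD[OF der_plane_der] plane_der_cc)

lemma pderiv_map_poly:
 assumes "rhom h"
 shows "pderiv (map_poly h G) = map_poly h (pderiv G)"
proof (rule poly_eqI)
 have nat: "h (of_nat n) = of_nat n" for n by (induction n) (simp_all add: rhomD[OF assms])
 show "coeff (pderiv (map_poly h G)) n = coeff (map_poly h (pderiv G)) n" for n
  by (simp add: coeff_pderiv coeff_map_poly rhomD[OF assms] nat del: of_nat_Suc)
qed

lemma plane_der_ins2:
 assumes "plane_der f g P = 0"
 shows "plane_der f g (ins2 P s G) = ins2 P s (pderiv G) * plane_der f g s"
proof -
 have "map_poly (ins P) G \<in> polys_over {a. plane_der f g a = 0}"
  by (simp add: polys_over_def coeff_map_poly rhomD[OF rhom_ins] plane_der_ins[OF assms])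
 thus ?thesis
  unfolding ins2_def using der_poly_ker[OF der_plane_der] pderiv_map_poly[OF rhom_ins] by metis
qed

subsection \<open>Retractions onto a subring\<close>

text \<open>
 An \<open>S\<close>-linear projection onto \<open>S\<close>. Applied to the coefficients of polynomials it commutes with all operations that are
 defined over \<open>S\<close>, which is how statements over \<open>\<complex>\<close> descend to a subfield.
\<close>

definition retraction :: "'a::comm_ring_1 set \<Rightarrow> ('a \<Rightarrow> 'a) \<Rightarrow> bool"
 where "retraction S \<rho> \<longleftrightarrow> (\<forall>x y. \<rho> (x + y) = \<rho> x + \<rho> y) \<and>
  (\<forall>a\<in>S. \<forall>x. \<rho> (a * x) = a * \<rho> x) \<and> (\<forall>x. \<rho> x \<in> S) \<and> (\<forall>a\<in>S. \<rho> a = a)"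

lemma retractionD:
 assumes "retraction S \<rho>"
 shows "\<rho> (x + y) = \<rho> x + \<rho> y" "a \<in> S ==> \<rho> (a * x) = a * \<rho> x" "\<rho> x \<in> S"
  "a \<in> S ==> \<rho> a = a" "\<rho> 0 = 0"
proof -
 show add: "\<rho> (x + y) = \<rho> x + \<rho> y" for x y using assms by (simp add: retraction_def)
 show "\<rho> 0 = 0" using add[of 0 0] by simp
qed (use assms in \<open>auto simp: retraction_def\<close>)

lemma retraction_sum: "retraction S \<rho> ==> \<rho> (sum f I) = (\<Sum>i\<in>I. \<rho> (f i))"
 by (induction I rule: infinite_finite_induct) (simp_all add: retractionD)

lemma retraction_map_poly:
 assumes S: "sub_ring S" and r: "retraction S \<rho>"
 shows "retraction (polys_over S) (map_poly \<rho>)"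
 unfolding retraction_def
proof (intro conjI allI ballI)
 show "map_poly \<rho> (p + q) = map_poly \<rho> p + map_poly \<rho> q" for p q
  by (rule map_poly_add_gen) (simp_all add: retractionD[OF r])
 show "map_poly \<rho> (p * q) = p * map_poly \<rho> q" if "p \<in> polys_over S" for p q
  by (rule poly_eqI) (simp add: coeff_map_poly coeff_mult retractionD[OF r] retraction_sum[OF r]
    coeff_polys_over[OF that])
 show "map_poly \<rho> p \<in> polys_over S" for p
  by (simp add: polys_over_def coeff_map_poly retractionD[OF r])
 show "map_poly \<rho> p = p" if "p \<in> polys_over S" for p
  by (rule poly_eqI) (simp add: coeff_map_poly retractionD[OF r] coeff_polys_over[OF that])
qed

text \<open>
 A complement of a subfield \<open>L\<close>, as an \<open>L\<close>-vector space, is an \<open>L\<close>-subspace maximal among those that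
 do not contain \<open>1\<close>.
\<close>

lemma exists_retraction:
 fixes L :: "'a::field set"
 assumes L: "sub_field L"
 shows "\<exists>\<rho>. retraction L \<rho>"
proof -
 note Lr = sub_fieldD(1)[OF L]
 define lin where "lin W \<longleftrightarrow> 0 \<in> W \<and> (\<forall>x\<in>W. \<forall>y\<in>W. x + y \<in> W) \<and> (\<forall>a\<in>L. \<forall>x\<in>W. a * x \<in> W)" for W
 define Fam where "Fam = {W. lin W \<and> 1 \<notin> W}"
 have "\<exists>W\<in>Fam. \<forall>V\<in>Fam. W \<subseteq> V \<longrightarrow> V = W"
 proof (rule subset_Zorn_nonempty)
  have "{0} \<in> Fam" by (auto simp: Fam_def lin_def)
  thus "Fam \<noteq> {}" by blast
  fix C assume C: "C \<noteq> {}" "subset.chain Fam C"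
  have each: "lin W" "1 \<notin> W" if "W \<in> C" for W
   using C(2) that by (auto simp: subset.chain_def Fam_def)
  have "x + y \<in> \<Union>C" if "x \<in> \<Union>C" "y \<in> \<Union>C" for x y
  proof -
   obtain U V where UV: "U \<in> C" "V \<in> C" "x \<in> U" "y \<in> V" using \<open>x \<in> \<Union>C\<close> \<open>y \<in> \<Union>C\<close> by blast
   hence "U \<subseteq> V \<or> V \<subseteq> U" using C(2) by (meson subset.chain_def subset_chain_def)
   then obtain T where T: "T \<in> C" "x \<in> T" "y \<in> T" using UV by blast
   hence "x + y \<in> T" using each(1)[OF T(1)] by (simp add: lin_def)
   thus ?thesis using T(1) by blast
  qed
  moreover have "0 \<in> \<Union>C" using C(1) each by (auto simp: lin_def)
  moreover have "a * x \<in> \<Union>C" if a: "a \<in> L" and x: "x \<in> \<Union>C" for a x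
  proof -
   obtain T where T: "T \<in> C" "x \<in> T" using x by blast
   hence "a * x \<in> T" using each(1)[OF T(1)] a by (simp add: lin_def)
   thus ?thesis using T(1) by blast
  qed
  ultimately show "\<Union>C \<in> Fam" using each(2) by (auto simp: Fam_def lin_def)
 qed
 then obtain W where W: "lin W" "1 \<notin> W" and max: "\<And>V. lin V ==> 1 \<notin> V ==> W \<subseteq> V ==> V = W"
  by (auto simp: Fam_def)
 have Wneg: "- x \<in> W" if "x \<in> W" for x
 proof -
  have "(- 1) * x \<in> W" using W(1) that sub_ringD(6)[OF Lr sub_ringD(2)[OF Lr]] unfolding lin_def by blast
  thus ?thesis by simp
 qed
 have uniq: "a = b" if "a \<in> L" "b \<in> L" "x - a \<in> W" "x - b \<in> W" for a b x
 proof (rule ccontr)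
  assume "a \<noteq> b"
  have "(x - a) + (- (x - b)) \<in> W" using that W(1) Wneg unfolding lin_def by blast
  hence "b - a \<in> W" by simp
  moreover have "inverse (b - a) \<in> L" using that sub_fieldD(2)[OF L] sub_ringD(4)[OF Lr] by blast
  ultimately have "inverse (b - a) * (b - a) \<in> W" using W(1) unfolding lin_def by blast
  thus False using W(2) \<open>a \<noteq> b\<close> by simp
 qed
 have ex: "\<exists>a\<in>L. x - a \<in> W" for x
 proof (rule ccontr)
  assume no: "\<not> (\<exists>a\<in>L. x - a \<in> W)"
  define U where "U = {w + a * x | w a. w \<in> W \<and> a \<in> L}"
  have "lin U" unfolding lin_def
  proof (intro conjI ballI)
   have "0 = 0 + 0 * x" by simp
   thus "0 \<in> U" unfolding U_def using W(1) sub_ringD(1)[OF Lr] unfolding lin_def by blast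
  next
   fix u v assume "u \<in> U" "v \<in> U"
   then obtain w a w' a' where *: "u = w + a * x" "v = w' + a' * x" "w \<in> W" "w' \<in> W" "a \<in> L" "a' \<in> L"
    by (auto simp: U_def)
   have "u + v = (w + w') + (a + a') * x" using * by (simp add: algebra_simps)
   thus "u + v \<in> U" unfolding U_def using * W(1) sub_ringD(3)[OF Lr] unfolding lin_def by blast
  next
   fix b u assume "b \<in> L" "u \<in> U"
   then obtain w a where *: "u = w + a * x" "w \<in> W" "a \<in> L" by (auto simp: U_def)
   have "b * u = b * w + (b * a) * x" using * by (simp add: algebra_simps)
   thus "b * u \<in> U" unfolding U_def using * \<open>b \<in> L\<close> W(1) sub_ringD(5)[OF Lr] unfolding lin_def by blast
  qed
  moreover have "W \<subseteq> U"
  proof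
   fix w assume "w \<in> W"
   moreover have "w = w + 0 * x" by simp
   ultimately show "w \<in> U" unfolding U_def using sub_ringD(1)[OF Lr] by blast
  qed
  moreover have "1 \<notin> U"
  proof
   assume "1 \<in> U"
   then obtain w a where *: "1 = w + a * x" "w \<in> W" "a \<in> L" by (auto simp: U_def)
   have "a \<noteq> 0" using * W(2) by auto
   have "inverse a * (a * x) = inverse a * (1 - w)" using *(1) by (metis add_diff_cancel_left')
   moreover have "inverse a * (a * x) = x" using \<open>a \<noteq> 0\<close> by simp
   ultimately have "x - inverse a = inverse a * (- w)" by (simp add: right_diff_distrib)
   hence "x - inverse a \<in> W"
    using W(1) Wneg[OF *(2)] sub_fieldD(2)[OF L *(3)] unfolding lin_def by metis
   thus False using no sub_fieldD(2)[OF L *(3)] by blast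
  qed
  ultimately have "U = W" by (intro max)
  moreover have "x \<in> U"
  proof -
   have "x = 0 + 1 * x" by simp
   thus ?thesis unfolding U_def using W(1) sub_ringD(2)[OF Lr] unfolding lin_def by blast
  qed
  ultimately have "x - 0 \<in> W" by simp
  thus False using no sub_ringD(1)[OF Lr] by blast
 qed
 define \<rho> where "\<rho> x = (SOME a. a \<in> L \<and> x - a \<in> W)" for x
 have \<rho>: "\<rho> x \<in> L" "x - \<rho> x \<in> W" for x
  using someI_ex[of "\<lambda>a. a \<in> L \<and> x - a \<in> W"] ex[of x] unfolding \<rho>_def by blast+
 have eq: "\<rho> x = a" if "a \<in> L" "x - a \<in> W" for x a using uniq[OF \<rho>(1) that(1) \<rho>(2) that(2)] .
 have "retraction L \<rho>" unfolding retraction_def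
 proof (intro conjI allI ballI)
  fix x y
  have "(x - \<rho> x) + (y - \<rho> y) \<in> W" using W(1) \<rho>(2) unfolding lin_def by blast
  thus "\<rho> (x + y) = \<rho> x + \<rho> y"
   by (intro eq sub_ringD(3)[OF Lr] \<rho>(1)) (simp add: algebra_simps)
 next
  fix a x assume a: "a \<in> L"
  have "a * (x - \<rho> x) \<in> W" using W(1) \<rho>(2) a unfolding lin_def by blast
  thus "\<rho> (a * x) = a * \<rho> x"
   using a by (intro eq sub_ringD(5)[OF Lr] \<rho>(1)) (simp_all add: algebra_simps)
 next
  show "\<rho> x \<in> L" for x by (rule \<rho>)
  show "\<rho> a = a" if "a \<in> L" for a using that W(1) by (intro eq) (auto simp: lin_def)
 qed
 thus ?thesis by blast
qed

lemma retraction_pderiv: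
 assumes S: "sub_ring S" and r: "retraction S \<rho>"
 shows "pderiv (map_poly \<rho> p) = map_poly \<rho> (pderiv p)"
 by (rule poly_eqI) (simp add: coeff_pderiv coeff_map_poly retractionD[OF r] sub_ringD[OF S] del: of_nat_Suc)

lemma retraction_plane_der:
 assumes S: "sub_ring S" and r: "retraction S \<rho>"
  and fg: "f \<in> polys_over (polys_over S)" "g \<in> polys_over (polys_over S)"
 shows "map_poly (map_poly \<rho>) (plane_der f g F) = plane_der f g (map_poly (map_poly \<rho>) F)"
proof -
 note r1 = retraction_map_poly[OF S r]
 note S1 = polys_over_sub_ring[OF S]
 note r2 = retraction_map_poly[OF S1 r1]
 have "map_poly (map_poly \<rho>) (map_poly pderiv F) = map_poly pderiv (map_poly (map_poly \<rho>) F)"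
  by (rule poly_eqI) (simp add: coeff_map_poly retraction_pderiv[OF S r])
 thus ?thesis
  by (simp add: plane_der_def retractionD(1,2)[OF r2] fg retraction_pderiv[OF S1 r1])
qed

lemma retraction_ins:
 assumes S: "sub_ring S" and r: "retraction S \<rho>" and P: "P \<in> polys_over (polys_over S)"
 shows "map_poly (map_poly \<rho>) (ins P \<gamma>) = ins P (map_poly \<rho> \<gamma>)"
proof (induction \<gamma>)
 case 0
 thus ?case by (simp add: rhomD[OF rhom_ins])
next
 case (pCons a p)
 note r2 = retraction_map_poly[OF polys_over_sub_ring[OF S] retraction_map_poly[OF S r]]
 have "map_poly (map_poly \<rho>) (cc a) = cc (\<rho> a)" by (simp add: cc_def map_poly_const retractionD[OF r])
 thus ?case
  by (simp add: ins_pCons retractionD(1,2)[OF r2] P pCons.IH map_poly_pCons_gen retractionD[OF r])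
qed

lemma retraction_ins2:
 assumes S: "sub_ring S" and r: "retraction S \<rho>" and P: "P \<in> polys_over (polys_over S)"
  and s: "s \<in> polys_over (polys_over S)"
 shows "map_poly (map_poly \<rho>) (ins2 P s G) = ins2 P s (map_poly (map_poly \<rho>) G)"
proof (induction G)
 case 0
 thus ?case by (simp add: rhomD[OF rhom_ins2])
next
 case (pCons a p)
 note r2 = retraction_map_poly[OF polys_over_sub_ring[OF S] retraction_map_poly[OF S r]]
 have *: "ins2 P s (pCons a p) = ins P a + s * ins2 P s p" for a p
  by (simp add: ins2_def map_poly_pCons_gen rhomD[OF rhom_ins])
 show ?case
  by (simp add: * retractionD(1,2)[OF r2] s pCons.IH map_poly_pCons_gen retraction_ins[OF S r P])
qed

subsection \<open>Algebraic dependence by counting\<close>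

text \<open>
 More unknowns than equations: one equation is used to eliminate one unknown.
\<close>

lemma homogeneous_system:
 fixes a :: "'i \<Rightarrow> 'j \<Rightarrow> 'a::field"
 assumes "finite J" "finite I" "card J < card I"
 shows "\<exists>c. (\<exists>i\<in>I. c i \<noteq> 0) \<and> (\<forall>j\<in>J. (\<Sum>i\<in>I. c i * a i j) = 0)"
 using assms
proof (induction J arbitrary: I a rule: finite_induct)
 case empty
 hence "I \<noteq> {}" by auto
 thus ?case by (intro exI[of _ "\<lambda>_. 1"]) auto
next
 case (insert j J)
 show ?case
 proof (cases "\<forall>i\<in>I. a i j = 0")
  case True
  obtain c where "\<exists>i\<in>I. c i \<noteq> 0" "\<forall>j\<in>J. (\<Sum>i\<in>I. c i * a i j) = 0"
   using insert.IH[of I a] insert.prems insert.hyps by auto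
  thus ?thesis using True by (intro exI[of _ c]) auto
 next
  case False
  then obtain p where p: "p \<in> I" "a p j \<noteq> 0" by blast
  define a' where "a' i j' = a i j' - a i j / a p j * a p j'" for i j'
  have "card J < card (I - {p})" using insert.prems insert.hyps p by simp
  then obtain c where c: "\<exists>i\<in>I - {p}. c i \<noteq> 0" "\<forall>j'\<in>J. (\<Sum>i\<in>I - {p}. c i * a' i j') = 0"
   using insert.IH[of "I - {p}" a'] insert.prems by auto
  define e where "e i = (if i = p then - (\<Sum>i\<in>I - {p}. c i * a i j) / a p j else c i)" for i
  have split: "(\<Sum>i\<in>I. e i * a i j') = e p * a p j' + (\<Sum>i\<in>I - {p}. c i * a i j')" for j'
  proof -
   have "(\<Sum>i\<in>I - {p}. e i * a i j') = (\<Sum>i\<in>I - {p}. c i * a i j')"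
    by (intro sum.cong) (auto simp: e_def)
   thus ?thesis
    using sum.remove[OF insert.prems(1) p(1), of "\<lambda>i. e i * a i j'"] by simp
  qed
  have "(\<Sum>i\<in>I. e i * a i j) = 0"
   unfolding split using p by (simp add: e_def)
  moreover have "(\<Sum>i\<in>I. e i * a i j') = 0" if "j' \<in> J" for j'
  proof -
   have "0 = (\<Sum>i\<in>I - {p}. c i * a i j' - c i * a i j * (a p j' / a p j))"
    using c(2) that by (simp add: a'_def right_diff_distrib mult.assoc)
   also have "\<dots> = (\<Sum>i\<in>I - {p}. c i * a i j') - (\<Sum>i\<in>I - {p}. c i * a i j) * (a p j' / a p j)"
    by (simp only: sum_subtractf sum_distrib_right)
   finally show ?thesis unfolding split by (simp add: e_def)
  qed
  moreover have "\<exists>i\<in>I. e i \<noteq> 0" using c(1) by (auto simp: e_def)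
  ultimately show ?thesis by (intro exI[of _ e]) auto
 qed
qed

definition support_bound :: "nat \<Rightarrow> 'a::zero poly poly \<Rightarrow> bool"
 where "support_bound d F \<longleftrightarrow> (\<forall>i j. i > d \<or> j > d \<longrightarrow> coeff (coeff F i) j = 0)"

lemma support_bound_exists: "\<exists>d. support_bound d F"
proof -
 define d where "d = degree F + Max ((\<lambda>i. degree (coeff F i)) ` {..degree F})"
 have "coeff (coeff F i) j = 0" if "i > d \<or> j > d" for i j
 proof (cases "i > degree F")
  case True
  thus ?thesis by (simp add: coeff_eq_0)
 next
  case False
  hence "degree (coeff F i) \<le> Max ((\<lambda>i. degree (coeff F i)) ` {..degree F})"
   by (intro Max_ge) auto
  hence "degree (coeff F i) < j" using that False unfolding d_def by linarith
  thus ?thesis by (rule coeff_eq_0)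
 qed
 thus ?thesis by (auto simp: support_bound_def)
qed

lemma support_bound_mult:
 fixes F G :: "'a::comm_ring_1 poly poly"
 assumes "support_bound d F" "support_bound e G"
 shows "support_bound (d + e) (F * G)"
 unfolding support_bound_def
proof (intro allI impI)
 fix i j assume ij: "i > d + e \<or> j > d + e"
 show "coeff (coeff (F * G) i) j = 0"
  unfolding coeff_mult coeff_sum
 proof (intro sum.neutral ballI)
  fix k l assume k: "k \<in> {..i}" and l: "l \<in> {..j}"
  from ij have "k > d \<or> i - k > e \<or> l > d \<or> j - l > e" by auto
  thus "coeff (coeff F k) l * coeff (coeff G (i - k)) (j - l) = 0"
   using assms by (auto simp: support_bound_def)
 qed
qed

lemma support_bound_power:
 fixes F :: "'a::comm_ring_1 poly poly"
 assumes "support_bound d F"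
 shows "support_bound (n * d) (F ^ n)"
proof (induction n)
 case 0
 show ?case by (auto simp: support_bound_def coeff_eq_0)
next
 case (Suc n)
 thus ?case using support_bound_mult[OF assms Suc] by simp
qed

lemma support_bound_mono: "support_bound d F ==> d \<le> e ==> support_bound e F"
 by (auto simp: support_bound_def)

text \<open>
 Three polynomials in two variables are algebraically dependent: there are more monomials in them
 of bounded exponents than there are coefficients in such monomials.
\<close>

lemma three_in_plane_dependent:
 fixes a b w :: "'a::field poly poly"
 shows "\<exists>N c. (\<exists>i\<le>N. \<exists>j\<le>N. \<exists>l\<le>N. c i j l \<noteq> 0) \<and>
  (\<Sum>l\<le>N. \<Sum>i\<le>N. \<Sum>j\<le>N. cc (c i j l) * (a ^ i * b ^ j * w ^ l)) = 0"
proof -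
 obtain da db dw where bnd: "support_bound da a" "support_bound db b" "support_bound dw w"
  using support_bound_exists by meson
 define d where "d = da + db + dw"
 define N where "N = (d + 1)\<^sup>2"
 define I where "I = {..N} \<times> {..N} \<times> {..N}"
 define J where "J = {..d * N} \<times> {..d * N}"
 define m where "m = (\<lambda>(l, i, j). a ^ i * b ^ j * w ^ l)"
 have "card J = (d * N + 1)\<^sup>2" by (simp add: J_def power2_eq_square)
 also have "\<dots> \<le> ((d + 1) * (N + 1))\<^sup>2" by (intro power_mono) (simp_all add: algebra_simps)
 also have "\<dots> = N * (N + 1)\<^sup>2" unfolding power_mult_distrib N_def ..
 also have "\<dots> < (N + 1) * (N + 1)\<^sup>2" by (intro mult_strict_right_mono) simp_all
 also have "\<dots> = card I" by (simp add: I_def power2_eq_square)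
 finally have card: "card J < card I" .
 obtain c where c: "\<exists>t\<in>I. c t \<noteq> 0"
   "\<And>u v. (u, v) \<in> J ==> (\<Sum>t\<in>I. c t * coeff (coeff (m t) u) v) = 0"
  using homogeneous_system[OF _ _ card, of "\<lambda>t (u, v). coeff (coeff (m t) u) v"]
  by (auto simp: I_def J_def)
 have bm: "support_bound (d * N) (m t)" if "t \<in> I" for t
 proof -
  obtain l i j where t0: "t = (l, i, j)" by (rule prod_cases3)
  hence t: "t = (l, i, j)" "l \<le> N" "i \<le> N" "j \<le> N" using that by (auto simp: I_def)
  have "support_bound (i * da + j * db + l * dw) (m t)"
   unfolding t(1) m_def by (auto intro!: support_bound_mult support_bound_power bnd)
  moreover have "i * da + j * db + l * dw \<le> d * N"
  proof -
   have "i * da + j * db + l * dw \<le> N * da + N * db + N * dw"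
    using t by (intro add_mono mult_right_mono) auto
   thus ?thesis by (simp add: d_def algebra_simps)
  qed
  ultimately show ?thesis by (rule support_bound_mono)
 qed
 have "(\<Sum>t\<in>I. cc (c t) * m t) = 0"
 proof (intro poly_eqI)
  fix u v
  have "coeff (coeff (\<Sum>t\<in>I. cc (c t) * m t) u) v = (\<Sum>t\<in>I. c t * coeff (coeff (m t) u) v)"
   by (simp add: coeff_sum cc_def)
  also have "\<dots> = 0"
  proof (cases "(u, v) \<in> J")
   case False
   hence "coeff (coeff (m t) u) v = 0" if "t \<in> I" for t
    using bm[OF that] by (auto simp: J_def support_bound_def)
   thus ?thesis by simp
  qed (rule c(2))
  finally show "coeff (coeff (\<Sum>t\<in>I. cc (c t) * m t) u) v = coeff (coeff 0 u) v" by simp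
 qed
 moreover have "(\<Sum>t\<in>I. cc (c t) * m t) =
   (\<Sum>l\<le>N. \<Sum>i\<le>N. \<Sum>j\<le>N. cc (c (l, i, j)) * (a ^ i * b ^ j * w ^ l))"
  by (simp add: I_def m_def sum.cartesian_product case_prod_unfold)
 moreover have "\<exists>i\<le>N. \<exists>j\<le>N. \<exists>l\<le>N. c (l, i, j) \<noteq> 0" using c(1) by (auto simp: I_def)
 ultimately show ?thesis by (intro exI[of _ N] exI[of _ "\<lambda>i j l. c (l, i, j)"]) auto
qed

subsection \<open>Kernels and slices\<close>

lemma sum_to_poly:
 fixes a P :: "'a::comm_ring_1 poly poly"
 shows "poly (map_poly (ins P) (\<Sum>i\<le>N. Polynomial.monom (\<Sum>j\<le>M. Polynomial.monom (c i j) j) i)) a =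
  (\<Sum>i\<le>N. \<Sum>j\<le>M. cc (c i j) * (a ^ i * P ^ j))"
proof -
 have m1: "poly (map_poly h (Polynomial.monom x n)) y = h x * y ^ n" if "rhom h"
  for h :: "'x::comm_ring_1 \<Rightarrow> 'y::comm_ring_1" and x y n
  by (simp add: map_poly_monom poly_monom rhomD[OF that])
 have "ins P (\<Sum>j\<le>M. Polynomial.monom (c i j) j) = (\<Sum>j\<le>M. cc (c i j) * P ^ j)" for i
  unfolding rhom_sum[OF rhom_ins] by (simp add: ins_def m1[OF rhom_cc])
 moreover have "poly (map_poly (ins P) (\<Sum>i\<le>N. Polynomial.monom (x i) i)) a = (\<Sum>i\<le>N. ins P (x i) * a ^ i)" for x
 proof -
  have "poly (map_poly (ins P) (\<Sum>i\<le>N. Polynomial.monom (x i) i)) a =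
    (\<Sum>i\<le>N. ins2 P a (Polynomial.monom (x i) i))"
   using rhom_sum[OF rhom_ins2, of P a] by (simp only: ins2_def)
  thus ?thesis by (simp add: ins2_def m1[OF rhom_ins])
 qed
 ultimately show ?thesis by (simp add: sum_distrib_left sum_distrib_right mult_ac)
qed

text \<open>
 The kernel of a nonzero derivation of the plane has transcendence degree at most one. Two elements of it and a variable
 that is not killed are dependent, and that variable is transcendental over the kernel.
\<close>

lemma plane_kernel_dependent:
 fixes f g :: "'a::field_char_0 poly poly"
 assumes fg: "f \<noteq> 0 \<or> g \<noteq> 0"
  and a: "plane_der f g a = 0" and P: "plane_der f g P = 0"
 shows "\<exists>G. G \<noteq> 0 \<and> poly (map_poly (ins P) G) a = 0"
proof -
 obtain w where w: "plane_der f g w \<noteq> 0" using fg plane_der_vars[of f g] by metis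
 obtain N c where c: "\<exists>i\<le>N. \<exists>j\<le>N. \<exists>l\<le>N. c i j l \<noteq> 0"
  "(\<Sum>l\<le>N. \<Sum>i\<le>N. \<Sum>j\<le>N. cc (c i j l) * (a ^ i * P ^ j * w ^ l)) = 0"
  using three_in_plane_dependent[of a P w] by blast
 define \<beta> where "\<beta> l = (\<Sum>i\<le>N. \<Sum>j\<le>N. cc (c i j l) * (a ^ i * P ^ j))" for l
 let ?K = "{x. plane_der f g x = 0}"
 note K = ker_sub_ring[OF der_plane_der[of f g]]
 have \<beta>K: "\<beta> l \<in> ?K" for l
  unfolding \<beta>_def by (intro sub_ring_sum[OF K] sub_ringD[OF K]) (use a P in \<open>auto simp: plane_der_cc\<close>)
 define G where "G = (\<Sum>l\<le>N. Polynomial.monom (\<beta> l) l)"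
 have coeffG: "coeff G l = (if l \<le> N then \<beta> l else 0)" for l
  by (simp add: G_def coeff_sum)
 have "G \<in> polys_over ?K"
  using \<beta>K sub_ringD(1)[OF K] by (auto simp: polys_over_def coeffG)
 moreover have "poly G w = 0"
  using c(2) by (simp add: G_def poly_sum poly_monom \<beta>_def sum_distrib_right mult.assoc)
 ultimately have "G = 0" using ker_transcendental[OF der_plane_der w] by blast
 hence \<beta>0: "\<beta> l = 0" if "l \<le> N" for l using coeffG[of l] that by simp
 obtain i j l where ijl: "i \<le> N" "j \<le> N" "l \<le> N" "c i j l \<noteq> 0" using c(1) by blast
 define G' where "G' = (\<Sum>i\<le>N. Polynomial.monom (\<Sum>j\<le>N. Polynomial.monom (c i j l) j) i)"
 have "coeff (coeff G' i) j = c i j l"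
  using ijl by (simp add: G'_def coeff_sum)
 hence "G' \<noteq> 0" using ijl(4) by auto
 moreover have "poly (map_poly (ins P) G') a = 0"
  unfolding G'_def sum_to_poly using \<beta>0[OF ijl(3)] by (simp add: \<beta>_def)
 ultimately show ?thesis by blast
qed

text \<open>
 An element that is algebraic modulo a prime is constant modulo it, because the complex numbers are
 algebraically closed.
\<close>

lemma algebraic_mod_prime:
 fixes \<pi> s :: "complex poly poly"
 assumes \<pi>: "prime_elem \<pi>" and nc: "\<And>c. c \<noteq> 0 ==> \<not> \<pi> dvd cc c"
  and Q: "Q \<noteq> 0" "\<pi> dvd ins s Q"
 shows "\<exists>c. \<pi> dvd s - cc c"
 using Q
proof (induction "degree Q" arbitrary: Q rule: less_induct)
 case less
 show ?case
 proof (cases "degree Q = 0")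
  case True
  then obtain c where "Q = [:c:]" by (rule degree_eq_zeroE)
  thus ?thesis using less.prems nc[of c] by (simp add: ins_const)
 next
  case False
  then obtain z where "poly Q z = 0"
   using fundamental_theorem_of_algebra[of Q] by (auto simp: constant_degree)
  then obtain Q' where Q': "Q = [:- z, 1:] * Q'" by (auto simp: poly_eq_0_iff_dvd dvd_def)
  have "\<pi> dvd (s - cc z) * ins s Q'"
   using less.prems(2) unfolding Q' rhomD(4)[OF rhom_ins] ins_linear .
  then consider "\<pi> dvd s - cc z" | "\<pi> dvd ins s Q'" using \<pi> by (auto simp: prime_elem_dvd_mult_iff)
  thus ?thesis
  proof cases
   case 2
   have "Q' \<noteq> 0" using less.prems(1) Q' by auto
   moreover from this have "degree Q' < degree Q" unfolding Q' by (subst degree_mult_eq) auto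
   ultimately show ?thesis using less.hyps 2 by blast
  qed blast
 qed
qed

text \<open>
 A factor of \<open>P - \<theta>\<close> lies in the kernel, which is factorially closed. By minimality of the degree of \<open>P\<close> one of two
 factors has degree zero.
\<close>

lemma minimal_kernel_prime:
 fixes f g :: "complex poly poly"
 assumes lnd: "lnd (plane_der f g)" and P: "plane_der f g P = 0" "bideg P > 0"
  and min: "\<And>a. plane_der f g a = 0 ==> bideg a > 0 ==> bideg P \<le> bideg a"
 shows "prime_elem (P - cc \<theta>)" "c \<noteq> 0 ==> \<not> P - cc \<theta> dvd cc c"
proof -
 define P' where "P' = P - cc \<theta>"
 have b: "bideg P' = bideg P" using bideg_diff_const[OF P(2)] by (simp add: P'_def)
 hence nz: "P' \<noteq> 0" using P(2) by (auto simp: bideg_def)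
 have D: "plane_der f g P' = 0" using P(1) by (simp add: P'_def derD[OF der_plane_der] plane_der_cc)
 have unit: "bideg u = 0" if "u dvd 1" for u :: "complex poly poly"
 proof -
  obtain v where "1 = u * v" using \<open>u dvd 1\<close> by (auto simp: dvd_def)
  moreover from this have "u \<noteq> 0" "v \<noteq> 0" by auto
  moreover have "bideg (1 :: complex poly poly) = 0" by (simp add: bideg_def)
  ultimately show ?thesis using bideg_mult[of u v] by simp
 qed
 have "Factorial_Ring.irreducible P'"
 proof (rule Factorial_Ring.irreducibleI)
  show "P' \<noteq> 0" by fact
  show "\<not> P' dvd 1" using unit[of P'] b P(2) by auto
  fix u v assume uv: "P' = u * v"
  have "plane_der f g u = 0" "plane_der f g v = 0"
   using ker_factorially_closed[OF lnd, of u v] D nz uv by auto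
  moreover have "u \<noteq> 0" "v \<noteq> 0" "bideg u + bideg v = bideg P'" using nz uv bideg_mult[of u v] by auto
  ultimately have "bideg u = 0 \<or> bideg v = 0" using min[of u] min[of v] b P(2) by force
  then obtain c where c: "u = cc c \<or> v = cc c" using bideg_eq_0_iff by metis
  have "cc c dvd 1" if "c \<noteq> 0" for c :: complex
  proof (rule dvdI)
   show "1 = cc c * cc (inverse c)"
    using that by (simp add: rhomD(4)[OF rhom_cc, symmetric] rhomD(1)[OF rhom_cc])
  qed
  thus "u dvd 1 \<or> v dvd 1" using c \<open>u \<noteq> 0\<close> \<open>v \<noteq> 0\<close> by auto
 qed
 thus "prime_elem (P - cc \<theta>)" unfolding P'_def by (rule irreducible_imp_prime_elem)
 show "\<not> P - cc \<theta> dvd cc c" if "c \<noteq> 0"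
 proof
  assume "P - cc \<theta> dvd cc c"
  then obtain v where v: "cc c = P' * v" by (auto simp: P'_def dvd_def)
  hence "v \<noteq> 0" using that by auto
  thus False using v bideg_mult[OF nz \<open>v \<noteq> 0\<close>] b P(2) bideg_cc[of c] by simp
 qed
qed

lemma ins_mod: "P - cc \<theta> dvd ins P \<gamma> - cc (poly \<gamma> \<theta>)"
proof -
 have "[:- \<theta>, 1:] dvd \<gamma> - [:poly \<gamma> \<theta>:]" by (simp add: poly_eq_0_iff_dvd[symmetric])
 then obtain q where "\<gamma> - [:poly \<gamma> \<theta>:] = [:- \<theta>, 1:] * q" by (auto simp: dvd_def)
 hence "ins P \<gamma> - cc (poly \<gamma> \<theta>) = (P - cc \<theta>) * ins P q"
  by (metis rhomD(4,5)[OF rhom_ins] ins_const ins_linear)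
 thus ?thesis by simp
qed

lemma ins2_mod: "P - cc \<theta> dvd ins2 P a G - ins a (map_poly (\<lambda>\<gamma>. poly \<gamma> \<theta>) G)"
proof (induction G)
 case 0
 thus ?case by (simp add: rhomD[OF rhom_ins2] rhomD[OF rhom_ins])
next
 case (pCons \<gamma> G)
 have "ins2 P a (pCons \<gamma> G) - ins a (map_poly (\<lambda>\<gamma>. poly \<gamma> \<theta>) (pCons \<gamma> G)) =
   (ins P \<gamma> - cc (poly \<gamma> \<theta>)) + a * (ins2 P a G - ins a (map_poly (\<lambda>\<gamma>. poly \<gamma> \<theta>) G))"
  by (simp add: ins2_def map_poly_pCons_gen rhomD[OF rhom_ins] ins_pCons algebra_simps)
 thus ?case using pCons.IH ins_mod[of P \<theta> \<gamma>] by (metis dvd_add dvd_mult)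
qed

text \<open>
 The kernel consists of the polynomials in an element \<open>P\<close> of least positive degree: an algebraic
 relation between \<open>a\<close> and \<open>P\<close>, stripped of factors \<open>P\<close>, shows that \<open>a\<close> is constant modulo the
 prime \<open>P\<close>, and the quotient of \<open>a - c\<close> by \<open>P\<close> is again in the kernel and has smaller degree.
\<close>

lemma plane_kernel:
 fixes f g :: "complex poly poly"
 assumes lnd: "lnd (plane_der f g)" and fg: "f \<noteq> 0 \<or> g \<noteq> 0"
  and P: "plane_der f g P = 0" "bideg P > 0"
  and min: "\<And>a. plane_der f g a = 0 ==> bideg a > 0 ==> bideg P \<le> bideg a"
  and a: "plane_der f g a = 0"
 shows "\<exists>\<gamma>. a = ins P \<gamma>"
 using a
proof (induction "bideg a" arbitrary: a rule: less_induct)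
 case less
 show ?case
 proof (cases "bideg a = 0")
  case True
  thus ?thesis using bideg_eq_0_iff ins_const by metis
 next
  case False
  hence nza: "bideg a > 0" by simp
  have nzP: "P \<noteq> 0" using P(2) by (auto simp: bideg_def)
  let ?T = "[:0, 1:] :: complex poly"
  define rel where "rel G \<longleftrightarrow> G \<noteq> 0 \<and> ins2 P a G = 0" for G
  obtain G0 where "rel G0"
   using plane_kernel_dependent[OF fg less.prems P(1)] by (auto simp: rel_def ins2_def)
  then obtain G where G: "rel G" and Gmin: "\<And>G'. rel G' ==> degree (lead_coeff G) \<le> degree (lead_coeff G')"
   using ex_has_least_nat[of rel G0 "\<lambda>G. degree (lead_coeff G)"] by blast
  define Q where "Q = map_poly (\<lambda>\<gamma>. poly \<gamma> 0) G"
  have "Q \<noteq> 0"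
  proof
   assume "Q = 0"
   hence "coeff Q i = 0" for i by simp
   hence "?T dvd coeff G i" for i
    using poly_eq_0_iff_dvd[of "coeff G i" 0] by (simp add: Q_def coeff_map_poly)
   hence "[:?T:] dvd G" by (simp add: const_poly_dvd_iff)
   then obtain G' where G': "G = [:?T:] * G'" by (auto simp: dvd_def)
   have "ins2 P a [:?T:] = P"
    using ins_linear[of P 0] by (simp add: ins2_const rhomD[OF rhom_cc])
   hence "P * ins2 P a G' = 0"
    using G unfolding rel_def G' rhomD(4)[OF rhom_ins2] by simp
   hence "rel G'" using G nzP by (auto simp: rel_def G')
   moreover have "degree (lead_coeff G') < degree (lead_coeff G)"
    using \<open>rel G'\<close> by (simp add: G' rel_def degree_mult_eq)
   ultimately show False using Gmin by fastforce
  qed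
  moreover have "P dvd ins a Q"
   using ins2_mod[of P 0 a G] G by (simp add: rel_def Q_def rhomD[OF rhom_cc])
  ultimately obtain c where "P dvd a - cc c"
   using algebraic_mod_prime[of P Q a] minimal_kernel_prime[OF lnd P min, where \<theta> = 0]
   by (auto simp: rhomD[OF rhom_cc])
  then obtain a' where a': "a - cc c = P * a'" by (auto simp: dvd_def)
  show ?thesis
  proof (cases "a' = 0")
   case True
   thus ?thesis using a' ins_const[of P c] by (intro exI[of _ "[:c:]"]) simp
  next
   case False
   have "plane_der f g (P * a') = 0"
    using less.prems by (simp add: a'[symmetric] derD[OF der_plane_der] plane_der_cc)
   hence "plane_der f g a' = 0" using P(1) nzP by (simp add: derD(4)[OF der_plane_der])
   moreover have "bideg a = bideg P + bideg a'"
    using bideg_diff_const[OF nza, of c] bideg_mult[OF nzP False] a' by simp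
   ultimately obtain \<gamma> where "a' = ins P \<gamma>" using less.hyps[of a'] P(2) by auto
   hence "a = ins P (pCons c \<gamma>)" using a' by (simp add: ins_pCons algebra_simps)
   thus ?thesis by blast
  qed
 qed
qed

lemma exists_antiderivative:
 fixes G :: "'a::field_char_0 poly poly"
 shows "\<exists>G'. pderiv G' = G"
proof -
 have mon: "pderiv (Polynomial.monom (smult (inverse (of_nat (Suc i))) (coeff G i)) (Suc i)) = Polynomial.monom (coeff G i) i" for i
 proof -
  have "of_nat (Suc i) * smult (inverse (of_nat (Suc i))) (coeff G i) = coeff G i"
   by (simp only: of_nat_poly mult_pCons_left) (simp del: of_nat_Suc)
  thus ?thesis by (simp add: pderiv_monom del: of_nat_Suc)
 qed
 have "pderiv (\<Sum>i\<le>degree G. F i) = (\<Sum>i\<le>degree G. pderiv (F i))" for F :: "nat \<Rightarrow> 'a poly poly"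
  using higher_pderiv_sum[of 1] by simp
 hence "pderiv (\<Sum>i\<le>degree G. Polynomial.monom (smult (inverse (of_nat (Suc i))) (coeff G i)) (Suc i)) = G"
  by (simp only: mon poly_as_sum_of_monoms)
 thus ?thesis by blast
qed

text \<open>
 Rentschler's theorem on locally nilpotent derivations of the plane. For \<open>s\<close> with \<open>D s \<in> Ker D\<close>
 every \<open>b\<close> satisfies \<open>(D s)\<^sup>N b \<in> Ker D[s]\<close>. If \<open>D s\<close> is of least degree, each linear factor \<open>P - \<theta>\<close> of
 \<open>D s\<close> can be cancelled here: otherwise \<open>s\<close> would be algebraic, hence constant modulo \<open>P - \<theta>\<close>, and
 \<open>(s - c) / (P - \<theta>)\<close> would contradict the choice of \<open>s\<close>.
\<close>

lemma Rentschler: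
 fixes f g :: "complex poly poly"
 assumes lnd: "lnd (plane_der f g)" and fg: "f \<noteq> 0 \<or> g \<noteq> 0"
  and P: "plane_der f g P = 0" "bideg P > 0"
  and min: "\<And>a. plane_der f g a = 0 ==> bideg a > 0 ==> bideg P \<le> bideg a"
  and s: "plane_der f g s = ins P H" "H \<noteq> 0"
  and smin: "\<And>s' H'. plane_der f g s' = ins P H' ==> H' \<noteq> 0 ==> degree H \<le> degree H'"
 shows "\<exists>G. b = ins2 P s G"
proof -
 let ?D = "plane_der f g"
 have "P \<noteq> 0" using P(2) by (auto simp: bideg_def)
 have DP: "?D (ins P \<gamma>) = 0" for \<gamma> by (rule plane_der_ins[OF P(1)])
 have local_slice: "\<exists>N G. ins P (H ^ N) * b = ins2 P s G" if "(?D ^^ n) b = 0" for n b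
  using that
 proof (induction n arbitrary: b)
  case 0
  thus ?case by (intro exI[of _ 0]) (simp add: rhomD[OF rhom_ins2])
 next
  case (Suc n)
  hence "(?D ^^ n) (?D b) = 0" by (simp add: funpow_swap1)
  then obtain N G where G: "ins P (H ^ N) * ?D b = ins2 P s G" using Suc.IH by blast
  obtain G' where G': "pderiv G' = G" using exists_antiderivative by blast
  have "?D (ins P (H ^ Suc N) * b - ins2 P s G') = ins P H * (ins P (H ^ N) * ?D b) - ins2 P s G * ?D s"
   unfolding derD(6)[OF der_plane_der] plane_der_ins2[OF P(1)] G' der_mult_ker[OF der_plane_der DP]
   by (simp add: rhomD(4)[OF rhom_ins])
  also have "\<dots> = 0" unfolding G s(1) by simp
  finally obtain \<gamma> where "ins P (H ^ Suc N) * b - ins2 P s G' = ins P \<gamma>"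
   using plane_kernel[OF lnd fg P min] by blast
  hence "ins P (H ^ Suc N) * b = ins2 P s (G' + [:\<gamma>:])"
   unfolding rhomD(3)[OF rhom_ins2] ins2_const by (metis add.commute diff_eq_eq)
  thus ?case by blast
 qed
 have cancel: "\<exists>G. b = ins2 P s G"
  if \<theta>: "poly H \<theta> = 0" and b: "(P - cc \<theta>) * b = ins2 P s G" for b \<theta> G
 proof -
  let ?L = "[:- \<theta>, 1:]"
  note prime = minimal_kernel_prime[OF lnd P min, where \<theta> = \<theta>]
  have nz: "P - cc \<theta> \<noteq> 0" using prime(1) unfolding prime_elem_def by blast
  define Q where "Q = map_poly (\<lambda>\<gamma>. poly \<gamma> \<theta>) G"
  have Pdvd: "P - cc \<theta> dvd ins s Q"
  proof -
   have "P - cc \<theta> dvd (P - cc \<theta>) * b - ins s Q"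
    using ins2_mod[of P \<theta> s G] unfolding Q_def b .
   hence "P - cc \<theta> dvd (P - cc \<theta>) * b - ((P - cc \<theta>) * b - ins s Q)"
    by (rule dvd_diff[OF dvd_triv_left])
   thus ?thesis by simp
  qed
  have "Q = 0"
  proof (rule ccontr)
   assume "Q \<noteq> 0"
   then obtain c where "P - cc \<theta> dvd s - cc c"
    using algebraic_mod_prime[OF prime(1,2) _ Pdvd] by blast
   then obtain s' where s': "s - cc c = (P - cc \<theta>) * s'" by (auto simp: dvd_def)
   obtain H1 where H1: "H = ?L * H1" using \<theta> by (auto simp: poly_eq_0_iff_dvd dvd_def)
   have "?D (P - cc \<theta>) = 0" unfolding derD(6)[OF der_plane_der] P(1) plane_der_cc by simp
   hence "(P - cc \<theta>) * ?D s' = ?D ((P - cc \<theta>) * s')"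
    by (rule der_mult_ker[OF der_plane_der, symmetric])
   also have "\<dots> = ins P H"
    unfolding s'[symmetric] derD(6)[OF der_plane_der] plane_der_cc s(1) by simp
   also have "\<dots> = (P - cc \<theta>) * ins P H1"
    unfolding H1 rhomD(4)[OF rhom_ins] ins_linear ..
   finally have "?D s' = ins P H1" using nz by simp
   moreover have "H1 \<noteq> 0" using s(2) H1 by auto
   ultimately have "degree H \<le> degree H1" using smin by blast
   thus False using \<open>H1 \<noteq> 0\<close> unfolding H1 by (subst (asm) degree_mult_eq) auto
  qed
  hence "coeff Q i = 0" for i by simp
  hence "?L dvd coeff G i" for i
   by (simp add: Q_def coeff_map_poly poly_eq_0_iff_dvd[symmetric])
  hence "[:?L:] dvd G" by (simp add: const_poly_dvd_iff)
  then obtain G' where G': "G = [:?L:] * G'" by (auto simp: dvd_def)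
  have "(P - cc \<theta>) * b = (P - cc \<theta>) * ins2 P s G'"
   unfolding b G' by (simp only: rhomD(4)[OF rhom_ins2] ins2_const ins_linear)
  thus ?thesis using nz by auto
 qed
 have cancel_all: "\<exists>G. b = ins2 P s G"
  if "\<gamma> \<noteq> 0" "\<And>\<theta>. poly \<gamma> \<theta> = 0 ==> poly H \<theta> = 0" "ins P \<gamma> * b = ins2 P s G" for \<gamma> G b
  using that
 proof (induction "degree \<gamma>" arbitrary: \<gamma> G rule: less_induct)
  case less
  show ?case
  proof (cases "degree \<gamma> = 0")
   case True
   then obtain c where c: "\<gamma> = [:c:]" by (rule degree_eq_zeroE)
   hence "c \<noteq> 0" using less.prems by auto
   hence "b = ins P [:inverse c:] * (ins P \<gamma> * b)"
    by (simp add: c mult.assoc[symmetric] rhomD(4)[OF rhom_ins, symmetric] rhomD(1)[OF rhom_ins] one_pCons[symmetric])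
   also have "\<dots> = ins2 P s ([:[:inverse c:]:] * G)"
    unfolding less.prems(3) rhomD(4)[OF rhom_ins2] ins2_const ..
   finally show ?thesis by blast
  next
   case False
   then obtain \<theta> where \<theta>: "poly \<gamma> \<theta> = 0"
    using fundamental_theorem_of_algebra[of \<gamma>] by (auto simp: constant_degree)
   then obtain \<gamma>' where \<gamma>': "\<gamma> = [:- \<theta>, 1:] * \<gamma>'" by (auto simp: poly_eq_0_iff_dvd dvd_def)
   have "(P - cc \<theta>) * (ins P \<gamma>' * b) = ins2 P s G"
    using less.prems(3) unfolding \<gamma>' rhomD(4)[OF rhom_ins] ins_linear by (simp only: mult.assoc)
   then obtain G' where "ins P \<gamma>' * b = ins2 P s G'" using cancel less.prems(2)[OF \<theta>] by blast
   moreover have "\<gamma>' \<noteq> 0" using less.prems(1) \<gamma>' by auto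
   moreover from this have "degree \<gamma>' < degree \<gamma>" unfolding \<gamma>' by (subst degree_mult_eq) auto
   ultimately show ?thesis using less.hyps[of \<gamma>' G'] less.prems(2) by (auto simp: \<gamma>')
  qed
 qed
 obtain n where "(?D ^^ n) b = 0" using lnd by (auto simp: lnd_def)
 then obtain N G where "ins P (H ^ N) * b = ins2 P s G" using local_slice by blast
 thus ?thesis using cancel_all[of "H ^ N" b G] s(2) by (auto simp: power_eq_0_iff)
qed

section \<open>Three variables over a field of constants\<close>

lemma map_poly_image:
 assumes "h 0 = 0" "0 \<in> S"
 shows "map_poly h ` polys_over S = polys_over (h ` S)"
proof (intro equalityI subsetI)
 fix p assume "p \<in> map_poly h ` polys_over S"
 thus "p \<in> polys_over (h ` S)" by (auto simp: polys_over_def coeff_map_poly assms)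
next
 fix p assume p: "p \<in> polys_over (h ` S)"
 define j where "j a = (if a = 0 then 0 else SOME x. x \<in> S \<and> h x = a)" for a
 have j: "j a \<in> S \<and> h (j a) = a" if "a \<in> h ` S" for a
  using that someI_ex[of "\<lambda>x. x \<in> S \<and> h x = a"] assms by (auto simp: j_def)
 have j0: "j 0 = 0" by (simp add: j_def)
 have "map_poly h (map_poly j p) = p"
  by (rule poly_eqI) (use p j in \<open>simp add: coeff_map_poly assms j0 polys_over_def\<close>)
 moreover have "map_poly j p \<in> polys_over S"
  using p j by (auto simp: polys_over_def coeff_map_poly j0)
 ultimately show "p \<in> map_poly h ` polys_over S" by (metis imageI)
qed

abbreviation ev :: "'a::comm_ring_1 \<Rightarrow> 'a poly \<Rightarrow> 'a"
 where "ev \<xi> \<equiv> (\<lambda>p. poly p \<xi>)"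

text \<open>
 The polynomials in \<open>X\<close>, \<open>Y\<close>, \<open>Z\<close> have type \<open>complex poly poly poly\<close>, with \<open>X\<close> as innermost variable. \<open>spec \<xi>\<close>
 evaluates \<open>X\<close> at \<open>\<xi>\<close> and leads to the plane.
\<close>

definition spec :: "'a::comm_ring_1 \<Rightarrow> 'a poly poly poly \<Rightarrow> 'a poly poly"
 where "spec \<xi> = map_poly (map_poly (ev \<xi>))"

lemma rhom_ev: "rhom (ev \<xi>)"
 by (rule rhom_poly)

lemma rhom_spec: "rhom (spec \<xi>)"
 unfolding spec_def by (intro rhom_map_poly rhom_poly)

lemma spec_cc: "spec \<xi> (cc c) = cc (poly c \<xi>)"
 by (simp add: spec_def cc_def map_poly_const)

lemma coeff_spec: "coeff (coeff (spec \<xi> F) i) j = poly (coeff (coeff F i) j) \<xi>"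
 by (simp add: spec_def coeff_map_poly)

lemma spec_plane_der: "spec \<xi> (plane_der f g F) = plane_der (spec \<xi> f) (spec \<xi> g) (spec \<xi> F)"
proof -
 have "spec \<xi> (map_poly pderiv F) = map_poly pderiv (spec \<xi> F)"
  by (rule poly_eqI)
   (simp add: spec_def coeff_map_poly pderiv_map_poly[OF rhom_ev])
 thus ?thesis
  by (simp add: plane_der_def rhomD[OF rhom_spec])
   (simp add: spec_def pderiv_map_poly[OF rhom_map_poly[OF rhom_ev]])
qed

lemma spec_ins: "spec \<xi> (ins P \<gamma>) = ins (spec \<xi> P) (map_poly (ev \<xi>) \<gamma>)"
 by (induction \<gamma>)
  (simp_all add: ins_pCons rhomD[OF rhom_spec] rhomD[OF rhom_ins] spec_cc map_poly_pCons_gen)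

lemma ins2_pCons: "ins2 P s (pCons \<gamma> G) = ins P \<gamma> + s * ins2 P s G"
 by (simp add: ins2_def map_poly_pCons_gen rhomD[OF rhom_ins])

lemma spec_ins2: "spec \<xi> (ins2 P s G) = ins2 (spec \<xi> P) (spec \<xi> s) (map_poly (map_poly (ev \<xi>)) G)"
 by (induction G)
  (simp_all add: ins2_pCons rhomD[OF rhom_spec] rhomD[OF rhom_ins2] spec_ins map_poly_pCons_gen)

abbreviation space_over :: "'a::zero set \<Rightarrow> 'a poly poly poly set"
 where "space_over k \<equiv> polys_over (polys_over (polys_over k))"

lemma cc_polys_over: "sub_ring S ==> cc c \<in> polys_over (polys_over S) \<longleftrightarrow> c \<in> S"
 using sub_ringD(1)[of S] by (simp add: cc_def zero_polys_over)

lemma ins_polys_over: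
 assumes S: "sub_ring S" and P: "P \<in> polys_over (polys_over S)" and "\<gamma> \<in> polys_over S"
 shows "ins P \<gamma> \<in> polys_over (polys_over S)"
 unfolding ins_def
 by (intro poly_in_sub_ring polys_over_sub_ring S P map_poly_polys_over[OF assms(3)])
  (auto simp: cc_polys_over[OF S])

lemma ins2_polys_over:
 assumes S: "sub_ring S" and P: "P \<in> polys_over (polys_over S)" and s: "s \<in> polys_over (polys_over S)"
  and G: "G \<in> polys_over (polys_over S)"
 shows "ins2 P s G \<in> polys_over (polys_over S)"
 unfolding ins2_def
 by (intro poly_in_sub_ring polys_over_sub_ring S s map_poly_polys_over[OF G] ins_polys_over P)
  (auto simp: rhomD[OF rhom_ins])

lemma plane_der_polys_over:
 assumes S: "sub_ring S" and "f \<in> polys_over (polys_over S)" "g \<in> polys_over (polys_over S)"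
  "F \<in> polys_over (polys_over S)"
 shows "plane_der f g F \<in> polys_over (polys_over S)"
 unfolding plane_der_def
 by (intro sub_ringD(3,5)[OF polys_over_sub_ring[OF polys_over_sub_ring[OF S]]] assms
   map_poly_polys_over[OF assms(4)] pderiv_polys_over polys_over_sub_ring S) auto

lemma plane_der_funpow_polys_over:
 assumes S: "sub_ring S" and "f \<in> polys_over (polys_over S)" "g \<in> polys_over (polys_over S)"
  "F \<in> polys_over (polys_over S)"
 shows "(plane_der f g ^^ n) F \<in> polys_over (polys_over S)"
 using assms(4) by (induction n) (auto intro: plane_der_polys_over[OF assms(1-3)])

subsection \<open>Division and minimal polynomials over a subfield\<close>

lemma polys_over_division:
 fixes p q :: "'a::field poly"
 assumes k: "sub_field k" and q: "q \<in> polys_over k" "q \<noteq> 0" and p: "p \<in> polys_over k"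
 shows "\<exists>u\<in>polys_over k. \<exists>r\<in>polys_over k. p = q * u + r \<and> (r = 0 \<or> degree r < degree q)"
 using p
proof (induction "degree p" arbitrary: p rule: less_induct)
 case less
 note S = sub_fieldD(1)[OF k] and S1 = polys_over_sub_ring[OF sub_fieldD(1)[OF k]]
 show ?case
 proof (cases "p = 0 \<or> degree p < degree q")
  case True
  thus ?thesis using less.prems sub_ringD(1)[OF S1] by (intro bexI[of _ 0] bexI[of _ p]) auto
 next
  case False
  define c where "c = lead_coeff p / lead_coeff q"
  define m where "m = Polynomial.monom c (degree p - degree q)"
  have c: "c \<in> k" unfolding c_def using sub_fieldD(3)[OF k] coeff_polys_over less.prems q(1) by blast
  hence m: "m \<in> polys_over k" using sub_ringD(1)[OF S] by (auto simp: m_def polys_over_def)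
  have c0: "c \<noteq> 0" using False q(2) by (simp add: c_def)
  define p' where "p' = p - q * m"
  have p': "p' \<in> polys_over k" unfolding p'_def by (intro sub_ringD[OF S1] less.prems q m)
  have "p' = 0 \<or> degree p' < degree p"
  proof (cases "degree p = 0")
   case True
   hence "degree q = 0" using False by simp
   then obtain a b where "p = [:a:]" "q = [:b:]" using True by (metis degree_eq_zeroE)
   thus ?thesis using q(2) by (simp add: p'_def m_def c_def monom_0)
  next
   case d: False
   have dm: "degree (q * m) = degree p"
    using q(2) c0 False by (simp add: m_def degree_mult_eq degree_monom_eq)
   have "coeff p' (degree p) = 0"
    using q(2) False dm lead_coeff_mult[of q m] by (simp add: p'_def m_def c_def degree_monom_eq)
   moreover have "degree p' \<le> degree p" unfolding p'_def by (rule degree_diff_le) (simp_all add: dm)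
   ultimately show ?thesis using eq_zero_or_degree_less by blast
  qed
  then obtain u r where ur: "u \<in> polys_over k" "r \<in> polys_over k" "p' = q * u + r" "r = 0 \<or> degree r < degree q"
  proof
   assume "p' = 0"
   thus ?thesis using that[of 0 0] sub_ringD(1)[OF S1] by simp
  next
   assume "degree p' < degree p"
   thus ?thesis using less.hyps[OF _ p'] that by blast
  qed
  have "p = q * (u + m) + r" using ur(3) by (simp add: p'_def algebra_simps)
  thus ?thesis using ur m sub_ringD(3)[OF S1] by blast
 qed
qed

text \<open>\<open>minimal_over k \<zeta> \<pi>\<close>: the polynomial \<open>\<pi>\<close> generates the ideal of relations of \<open>\<zeta>\<close> over \<open>k\<close>.\<close>

definition minimal_over :: "'a::field set \<Rightarrow> 'a \<Rightarrow> 'a poly \<Rightarrow> bool"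
 where "minimal_over k \<zeta> \<pi> \<longleftrightarrow> \<pi> \<in> polys_over k \<and> degree \<pi> > 0 \<and> poly \<pi> \<zeta> = 0 \<and>
  (\<forall>p\<in>polys_over k. poly p \<zeta> = 0 \<longrightarrow> (\<exists>q\<in>polys_over k. p = \<pi> * q))"

lemma minimal_over_exists:
 assumes k: "sub_field k" and p: "p \<in> polys_over k" "p \<noteq> 0" "poly p \<zeta> = 0"
 shows "\<exists>\<pi>. minimal_over k \<zeta> \<pi>"
proof -
 define R where "R p \<longleftrightarrow> p \<in> polys_over k \<and> p \<noteq> 0 \<and> poly p \<zeta> = 0" for p
 obtain \<pi> where \<pi>: "R \<pi>" and min: "\<And>q. R q ==> degree \<pi> \<le> degree q"
  using ex_has_least_nat[of R p degree] p by (auto simp: R_def)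
 have "degree \<pi> > 0"
 proof (rule ccontr)
  assume "\<not> degree \<pi> > 0"
  then obtain c where "\<pi> = [:c:]" using degree_eq_zeroE by blast
  thus False using \<pi> by (simp add: R_def)
 qed
 moreover have "\<exists>u\<in>polys_over k. q = \<pi> * u" if q: "q \<in> polys_over k" "poly q \<zeta> = 0" for q
 proof -
  obtain u r where ur: "u \<in> polys_over k" "r \<in> polys_over k" "q = \<pi> * u + r" "r = 0 \<or> degree r < degree \<pi>"
   using polys_over_division[OF k _ _ q(1), of \<pi>] \<pi> by (auto simp: R_def)
  have "poly r \<zeta> = 0" using q(2) \<pi> ur(3) by (simp add: R_def)
  hence "r = 0" using min[of r] ur(2,4) unfolding R_def by fastforce
  thus ?thesis using ur by auto
 qed
 ultimately show ?thesis using \<pi> by (auto simp: minimal_over_def R_def)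
qed

lemma minimal_over_divides_space:
 assumes m: "minimal_over k \<zeta> \<pi>" and k: "0 \<in> k"
  and F: "F \<in> space_over k" and 0: "spec \<zeta> F = 0"
 shows "\<exists>F'\<in>space_over k. F = cc \<pi> * F'"
proof -
 have "\<exists>q\<in>polys_over k. coeff (coeff F i) j = \<pi> * q" for i j
  using m F coeff_spec[of \<zeta> F i j] 0 by (auto simp: minimal_over_def coeff_polys_over)
 hence "F \<in> polys_over (polys_over ((*) \<pi> ` polys_over k))"
  unfolding polys_over_def[of "polys_over ((*) \<pi> ` polys_over k)"]
  by (auto simp: polys_over_def[of "(*) \<pi> ` polys_over k"] image_iff)
 also have "\<dots> = map_poly (map_poly ((*) \<pi>)) ` space_over k"
  using k by (simp add: map_poly_image zero_polys_over)
 finally obtain F' where F': "F' \<in> space_over k" "F = map_poly (map_poly ((*) \<pi>)) F'" by blast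
 hence "F = cc \<pi> * F'"
  by (intro poly_eqI) (simp add: coeff_map_poly cc_def)
 thus ?thesis using F' by blast
qed

lemma minimal_over_divides_poly:
 assumes m: "minimal_over k \<zeta> \<pi>" and k: "0 \<in> k"
  and F: "F \<in> polys_over (polys_over k)" and 0: "map_poly (ev \<zeta>) F = 0"
 shows "\<exists>F'\<in>polys_over (polys_over k). F = [:\<pi>:] * F'"
proof -
 have "\<exists>q\<in>polys_over k. coeff F i = \<pi> * q" for i
  using m F arg_cong[OF 0, of "\<lambda>p. coeff p i"]
  by (auto simp: minimal_over_def coeff_polys_over coeff_map_poly)
 hence "F \<in> polys_over ((*) \<pi> ` polys_over k)"
  by (auto simp: polys_over_def[of "(*) \<pi> ` polys_over k"] image_iff)
 also have "\<dots> = map_poly ((*) \<pi>) ` polys_over (polys_over k)"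
  using k by (simp add: map_poly_image zero_polys_over)
 finally obtain F' where F': "F' \<in> polys_over (polys_over k)" "F = map_poly ((*) \<pi>) F'" by blast
 hence "F = [:\<pi>:] * F'"
  by (intro poly_eqI) (simp add: coeff_map_poly)
 thus ?thesis using F' by blast
qed

text \<open>
 The generator \<open>d\<close> of the ideal of \<open>\<pi>\<close> and \<open>c\<close> in \<open>k[T]\<close> is constant if \<open>c\<close> does not vanish at \<open>\<zeta>\<close>, since
 then the cofactor of \<open>d\<close> in \<open>\<pi>\<close> vanishes at \<open>\<zeta>\<close>.
\<close>

lemma minimal_over_sub_field:
 assumes k: "sub_field k" and m: "minimal_over k \<zeta> \<pi>"
 shows "sub_field (ev \<zeta> ` polys_over k)"
proof -
 note S = sub_fieldD(1)[OF k] and S1 = polys_over_sub_ring[OF sub_fieldD(1)[OF k]]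
 have \<pi>: "\<pi> \<in> polys_over k" "poly \<pi> \<zeta> = 0" "\<pi> \<noteq> 0" using m by (auto simp: minimal_over_def)
 have inv: "inverse (poly c \<zeta>) \<in> ev \<zeta> ` polys_over k" if c: "c \<in> polys_over k" "poly c \<zeta> \<noteq> 0" for c
 proof -
  define J where "J = {u * \<pi> + w * c | u w. u \<in> polys_over k \<and> w \<in> polys_over k}"
  have Jk: "J \<subseteq> polys_over k"
   unfolding J_def using \<pi>(1) c(1) by (auto intro!: sub_ringD(3,5)[OF S1])
  have "1 * \<pi> + 0 * c \<in> J" "0 * \<pi> + 1 * c \<in> J"
   unfolding J_def using sub_ringD(1,2)[OF S1] by blast+
  hence \<pi>cJ: "\<pi> \<in> J" "c \<in> J" by auto
  obtain d where d: "d \<in> J" "d \<noteq> 0" and dmin: "\<And>e. e \<in> J ==> e \<noteq> 0 ==> degree d \<le> degree e"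
   using ex_has_least_nat[of "\<lambda>e. e \<in> J \<and> e \<noteq> 0" \<pi> degree] \<pi>cJ \<pi>(3) by auto
  have ddvd: "\<exists>u\<in>polys_over k. p = d * u" if p: "p \<in> J" for p
  proof -
   obtain u r where ur: "u \<in> polys_over k" "p = d * u + r" "r = 0 \<or> degree r < degree d"
    using polys_over_division[OF k _ d(2), of p] Jk d(1) p by auto
   obtain a b a' b' where ab: "p = a * \<pi> + b * c" "d = a' * \<pi> + b' * c"
     "a \<in> polys_over k" "b \<in> polys_over k" "a' \<in> polys_over k" "b' \<in> polys_over k"
    using p d(1) unfolding J_def by blast
   have "r = (a - a' * u) * \<pi> + (b - b' * u) * c"
    using ur(2) ab(1,2) by (simp add: algebra_simps)
   hence "r \<in> J" unfolding J_def using ab ur(1) sub_ringD(4,5)[OF S1] by blast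
   hence "r = 0" using dmin ur(3) by fastforce
   thus ?thesis using ur by auto
  qed
  obtain e where e: "e \<in> polys_over k" "\<pi> = d * e" using ddvd[OF \<pi>cJ(1)] by blast
  obtain e' where e': "c = d * e'" using ddvd[OF \<pi>cJ(2)] by blast
  have "poly d \<zeta> \<noteq> 0" using c(2) e' by auto
  hence "poly e \<zeta> = 0" using \<pi>(2) e(2) by auto
  then obtain q where "e = \<pi> * q" using m e(1) by (auto simp: minimal_over_def)
  hence "\<pi> * 1 = \<pi> * (d * q)" using e(2) by (simp add: mult_ac)
  hence "1 = d * q" using \<pi>(3) by simp
  hence "degree d = 0" by (metis dvd_triv_left is_unit_iff_degree one_neq_zero mult_zero_left)
  then obtain a where a: "d = [:a:]" by (rule degree_eq_zeroE)
  hence a': "a \<noteq> 0" "a \<in> k" using d Jk by (auto simp: const_polys_over[OF S])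
  obtain u w where uw: "u \<in> polys_over k" "w \<in> polys_over k" "d = u * \<pi> + w * c"
   using d(1) unfolding J_def by blast
  have "a = poly w \<zeta> * poly c \<zeta>" using arg_cong[OF uw(3), of "ev \<zeta>"] a \<pi>(2) by simp
  hence "inverse (poly c \<zeta>) = poly (smult (inverse a) w) \<zeta>"
   using a' c(2) by (simp add: field_simps)
  moreover have "smult (inverse a) w \<in> polys_over k"
   using smult_polys_over[OF S sub_fieldD(2)[OF k a'(2)] uw(2)] .
  ultimately show ?thesis by blast
 qed
 have "sub_ring (ev \<zeta> ` polys_over k)"
  unfolding sub_ring_def
 proof (intro conjI ballI)
  show "1 \<in> ev \<zeta> ` polys_over k" using sub_ringD(2)[OF S1] by (intro image_eqI[of _ _ 1]) auto
  fix x y assume "x \<in> ev \<zeta> ` polys_over k" "y \<in> ev \<zeta> ` polys_over k"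
  then obtain p q where pq: "x = poly p \<zeta>" "y = poly q \<zeta>" "p \<in> polys_over k" "q \<in> polys_over k" by auto
  show "x - y \<in> ev \<zeta> ` polys_over k"
   using pq sub_ringD(4)[OF S1] by (intro image_eqI[of _ _ "p - q"]) auto
  show "x * y \<in> ev \<zeta> ` polys_over k"
   using pq sub_ringD(5)[OF S1] by (intro image_eqI[of _ _ "p * q"]) auto
 qed
 moreover have "inverse x \<in> ev \<zeta> ` polys_over k" if "x \<in> ev \<zeta> ` polys_over k" for x
 proof (cases "x = 0")
  case True
  thus ?thesis using that by simp
 qed (use inv that in auto)
 ultimately show ?thesis unfolding sub_field_def by blast
qed

section \<open>Locally nilpotent derivations that kill the first variable\<close>

definition transcendental_over :: "'a::comm_ring_1 set \<Rightarrow> 'a \<Rightarrow> bool"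
 where "transcendental_over k \<tau> \<longleftrightarrow> (\<forall>p\<in>polys_over k. poly p \<tau> = 0 \<longrightarrow> p = 0)"

text \<open>The field \<open>k(\<tau>)\<close>.\<close>

definition frac_field :: "'a::field set \<Rightarrow> 'a \<Rightarrow> 'a set"
 where "frac_field k \<tau> = {poly p \<tau> / poly q \<tau> | p q. p \<in> polys_over k \<and> q \<in> polys_over k \<and> poly q \<tau> \<noteq> 0}"

lemma frac_field_sub_field:
 assumes S: "sub_ring k"
 shows "sub_field (frac_field k \<tau>)"
proof -
 note S1 = polys_over_sub_ring[OF S]
 have I: "poly p \<tau> / poly q \<tau> \<in> frac_field k \<tau>"
  if "p \<in> polys_over k" "q \<in> polys_over k" "poly q \<tau> \<noteq> 0" for p q
  unfolding frac_field_def using that by blast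
 have "sub_ring (frac_field k \<tau>)"
  unfolding sub_ring_def
 proof (intro conjI ballI)
  show "1 \<in> frac_field k \<tau>" using I[of 1 1] sub_ringD(2)[OF S1] by simp
  fix x y assume "x \<in> frac_field k \<tau>" "y \<in> frac_field k \<tau>"
  then obtain p q p' q' where *: "x = poly p \<tau> / poly q \<tau>" "y = poly p' \<tau> / poly q' \<tau>"
    "p \<in> polys_over k" "q \<in> polys_over k" "poly q \<tau> \<noteq> 0"
    "p' \<in> polys_over k" "q' \<in> polys_over k" "poly q' \<tau> \<noteq> 0"
   unfolding frac_field_def by blast
  have "x - y = poly (p * q' - p' * q) \<tau> / poly (q * q') \<tau>" using * by (simp add: diff_frac_eq)
  thus "x - y \<in> frac_field k \<tau>"
   using I[of "p * q' - p' * q" "q * q'"] * sub_ringD(4,5)[OF S1] by simp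
  have "x * y = poly (p * p') \<tau> / poly (q * q') \<tau>" using * by simp
  thus "x * y \<in> frac_field k \<tau>" using I[of "p * p'" "q * q'"] * sub_ringD(5)[OF S1] by simp
 qed
 moreover have "inverse x \<in> frac_field k \<tau>" if x: "x \<in> frac_field k \<tau>" for x
 proof -
  obtain p q where *: "x = poly p \<tau> / poly q \<tau>" "p \<in> polys_over k" "q \<in> polys_over k" "poly q \<tau> \<noteq> 0"
   using x unfolding frac_field_def by blast
  show ?thesis
  proof (cases "x = 0")
   case False
   thus ?thesis using I[of q p] * by simp
  qed (use x in simp)
 qed
 ultimately show ?thesis unfolding sub_field_def by blast
qed

lemma ev_image_frac_field:
 assumes S: "sub_ring k" and p: "p \<in> polys_over k"
 shows "poly p \<tau> \<in> frac_field k \<tau>"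
 unfolding frac_field_def mem_Collect_eq
 using p sub_ringD(2)[OF polys_over_sub_ring[OF S]] by (intro exI[of _ p] exI[of _ 1]) simp

lemma common_denominator:
 assumes S: "sub_ring k" and E: "finite E" "E \<subseteq> frac_field k \<tau>"
 shows "\<exists>m\<in>polys_over k. poly m \<tau> \<noteq> 0 \<and> (\<forall>e\<in>E. poly m \<tau> * e \<in> ev \<tau> ` polys_over k)"
 using E
proof (induction E rule: finite_induct)
 case empty
 thus ?case using sub_ringD(2)[OF polys_over_sub_ring[OF S]] by (intro bexI[of _ 1]) auto
next
 case (insert e E)
 note S1 = polys_over_sub_ring[OF S]
 obtain m where m: "m \<in> polys_over k" "poly m \<tau> \<noteq> 0" "\<And>e. e \<in> E ==> poly m \<tau> * e \<in> ev \<tau> ` polys_over k"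
  using insert by auto
 obtain p q where pq: "e = poly p \<tau> / poly q \<tau>" "p \<in> polys_over k" "q \<in> polys_over k" "poly q \<tau> \<noteq> 0"
  using insert.prems unfolding frac_field_def by blast
 show ?case
 proof (intro bexI[of _ "m * q"] conjI ballI)
  show "m * q \<in> polys_over k" using m pq sub_ringD(5)[OF S1] by blast
  show "poly (m * q) \<tau> \<noteq> 0" using m pq by simp
  fix e' assume "e' \<in> insert e E"
  thus "poly (m * q) \<tau> * e' \<in> ev \<tau> ` polys_over k"
  proof
   assume "e' = e"
   hence "poly (m * q) \<tau> * e' = poly (m * p) \<tau>" using pq by simp
   thus ?thesis using m(1) pq(2) sub_ringD(5)[OF S1] by (metis imageI)
  next
   assume "e' \<in> E"
   then obtain r where "r \<in> polys_over k" "poly m \<tau> * e' = poly r \<tau>" using m(3) by blast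
   hence "poly (m * q) \<tau> * e' = poly (q * r) \<tau>" by (simp add: mult_ac)
   thus ?thesis using \<open>r \<in> polys_over k\<close> pq(3) sub_ringD(5)[OF S1] by (metis imageI)
  qed
 qed
qed

text \<open>
 A polynomial over \<open>k(\<tau>)\<close> is, up to a common denominator, the value at \<open>X = \<tau>\<close> of a polynomial over \<open>k[X]\<close>.
\<close>

lemma clear_denominators:
 assumes S: "sub_ring k" and F: "F \<in> polys_over (polys_over (frac_field k \<tau>))"
 shows "\<exists>m\<in>polys_over k. poly m \<tau> \<noteq> 0 \<and> (\<exists>F'\<in>space_over k. spec \<tau> F' = cc (poly m \<tau>) * F)"
proof -
 obtain d where d: "support_bound d F" using support_bound_exists by blast
 define E where "E = (\<lambda>(i, j). coeff (coeff F i) j) ` ({..d} \<times> {..d})"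
 have "finite E" "E \<subseteq> frac_field k \<tau>" using F by (auto simp: E_def polys_over_def)
 then obtain m where m: "m \<in> polys_over k" "poly m \<tau> \<noteq> 0"
   "\<And>e. e \<in> E ==> poly m \<tau> * e \<in> ev \<tau> ` polys_over k"
  using common_denominator[OF S] by metis
 note z = sub_ringD(1)[OF S] zero_polys_over[OF sub_ringD(1)[OF S]]
 have "poly m \<tau> * coeff (coeff F i) j \<in> ev \<tau> ` polys_over k" for i j
 proof (cases "i > d \<or> j > d")
  case True
  hence "poly m \<tau> * coeff (coeff F i) j = poly 0 \<tau>" using d by (auto simp: support_bound_def)
  thus ?thesis using z by (metis imageI)
 next
  case False
  thus ?thesis by (intro m(3)) (auto simp: E_def)
 qed
 hence "cc (poly m \<tau>) * F \<in> polys_over (polys_over (ev \<tau> ` polys_over k))"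
  by (simp add: polys_over_def cc_def)
 also have "\<dots> = spec \<tau> ` space_over k"
  unfolding spec_def using z by (simp add: map_poly_image zero_polys_over)
 finally obtain F' where "F' \<in> space_over k" "spec \<tau> F' = cc (poly m \<tau>) * F" by (metis imageE)
 thus ?thesis using m by blast
qed

lemma clear_denominators_poly:
 assumes S: "sub_ring k" and \<gamma>: "\<gamma> \<in> polys_over (frac_field k \<tau>)"
 shows "\<exists>m\<in>polys_over k. poly m \<tau> \<noteq> 0 \<and>
  (\<exists>\<gamma>'\<in>polys_over (polys_over k). map_poly (ev \<tau>) \<gamma>' = smult (poly m \<tau>) \<gamma>)"
proof -
 have "[:\<gamma>:] \<in> polys_over (polys_over (frac_field k \<tau>))"
  using \<gamma> by (subst const_polys_over[OF polys_over_sub_ring[OF sub_fieldD(1)[OF frac_field_sub_field[OF S]]]])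
 then obtain m F' where m: "m \<in> polys_over k" "poly m \<tau> \<noteq> 0" "F' \<in> space_over k"
   "spec \<tau> F' = cc (poly m \<tau>) * [:\<gamma>:]"
  using clear_denominators[OF S] by blast
 have "map_poly (ev \<tau>) (coeff F' 0) = coeff (spec \<tau> F') 0" by (simp add: spec_def coeff_map_poly)
 also have "\<dots> = smult (poly m \<tau>) \<gamma>" unfolding m(4) by (simp add: cc_def)
 finally show ?thesis using m by (auto intro: coeff_polys_over)
qed

text \<open>
 For a number \<open>\<tau>\<close> that is transcendental over \<open>k\<close>, nothing defined over \<open>k\<close> is lost at \<open>X = \<tau>\<close>.
\<close>

lemma spec_inj:
 assumes \<tau>: "transcendental_over k \<tau>" and F: "F \<in> space_over k" and "spec \<tau> F = 0"
 shows "F = 0"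
proof (intro poly_eqI)
 fix i j n
 have "coeff (coeff F i) j = 0"
  using \<tau> F coeff_spec[of \<tau> F i j] assms(3) by (simp add: transcendental_over_def coeff_polys_over)
 thus "coeff (coeff (coeff F i) j) n = coeff (coeff (coeff 0 i) j) n" by simp
qed

lemma spec_eq:
 assumes k: "sub_ring k" and \<tau>: "transcendental_over k \<tau>" and "F \<in> space_over k" "G \<in> space_over k"
  and "spec \<tau> F = spec \<tau> G"
 shows "F = G"
proof -
 have "F - G \<in> space_over k"
  using assms(3,4) by (intro sub_ringD(4)[OF polys_over_sub_ring[OF polys_over_sub_ring[OF polys_over_sub_ring[OF k]]]])
 thus ?thesis using spec_inj[OF \<tau>, of "F - G"] assms(5) by (simp add: rhomD[OF rhom_spec])
qed

lemma map_poly_degree_inj: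
 assumes "h 0 = 0" "\<And>x. x \<in> S ==> h x = 0 ==> x = 0" "p \<in> polys_over S"
 shows "degree (map_poly h p) = degree p"
proof (cases "p = 0")
 case False
 have "h (lead_coeff p) \<noteq> 0" using assms(2)[of "lead_coeff p"] assms(3) False by (auto simp: polys_over_def)
 hence "coeff (map_poly h p) (degree p) \<noteq> 0" by (simp add: coeff_map_poly assms(1))
 thus ?thesis by (meson le_antisym le_degree map_poly_degree_leq)
qed simp

lemma bideg_spec:
 assumes \<tau>: "transcendental_over k \<tau>" and F: "F \<in> space_over k"
 shows "bideg (spec \<tau> F) = bideg F"
proof -
 have inj1: "p = 0" if "p \<in> polys_over k" "poly p \<tau> = 0" for p
  using \<tau> that by (simp add: transcendental_over_def)
 have inj2: "q = 0" if "q \<in> polys_over (polys_over k)" "map_poly (ev \<tau>) q = 0" for q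
 proof (rule poly_eqI)
  fix i
  have "poly (coeff q i) \<tau> = 0" using arg_cong[OF that(2), of "\<lambda>p. coeff p i"] by (simp add: coeff_map_poly)
  thus "coeff q i = coeff 0 i" using inj1 that(1) by (simp add: coeff_polys_over)
 qed
 have d: "degree (spec \<tau> F) = degree F"
  unfolding spec_def by (rule map_poly_degree_inj[OF _ _ F]) (use inj2 in auto)
 have "lead_coeff (spec \<tau> F) = map_poly (ev \<tau>) (lead_coeff F)"
  unfolding d by (simp add: spec_def coeff_map_poly)
 moreover have "degree (map_poly (ev \<tau>) (lead_coeff F)) = degree (lead_coeff F)"
  by (rule map_poly_degree_inj[where S = "polys_over k"]) (use F inj1 in \<open>auto intro: coeff_polys_over\<close>)
 ultimately show ?thesis using d by (simp add: bideg_def)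
qed

text \<open>
 Scaling makes the leading coefficient \<open>1\<close>, which the retraction fixes.
\<close>

lemma retraction_bideg:
 fixes a :: "'a::field poly poly"
 assumes r: "retraction S \<rho>" and S: "sub_ring S" and a: "a \<noteq> 0"
  and c: "c = inverse (lead_coeff (lead_coeff a))"
 shows "bideg (map_poly (map_poly \<rho>) (cc c * a)) = bideg a"
proof -
 let ?b = "map_poly (map_poly \<rho>) (cc c * a)"
 have \<rho>: "\<rho> 0 = 0" "\<rho> 1 = 1" using retractionD[OF r] sub_ringD[OF S] by auto
 have lc: "lead_coeff (lead_coeff a) \<noteq> 0" using a by simp
 have co: "coeff (coeff ?b i) j = \<rho> (c * coeff (coeff a i) j)" for i j
  by (simp add: coeff_map_poly \<rho>(1) cc_def)
 have one: "coeff (coeff ?b (degree a)) (degree (lead_coeff a)) = 1"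
  using lc \<rho>(2) unfolding co unfolding c by simp
 have "degree ?b = degree a"
 proof (rule antisym)
  show "degree a \<le> degree ?b" using one by (intro le_degree) auto
  have "coeff ?b i = 0" if "degree a < i" for i
   using that by (intro poly_eqI) (simp only: co coeff_eq_0 coeff_0 mult_zero_right \<rho>(1))
  thus "degree ?b \<le> degree a" by (intro degree_le) blast
 qed
 moreover have "degree (coeff ?b (degree a)) = degree (lead_coeff a)"
 proof (rule antisym)
  show "degree (lead_coeff a) \<le> degree (coeff ?b (degree a))" using one by (intro le_degree) auto
  have "coeff (coeff ?b (degree a)) j = 0" if "degree (lead_coeff a) < j" for j
   using that by (simp only: co coeff_eq_0 coeff_0 mult_zero_right \<rho>(1))
  thus "degree (coeff ?b (degree a)) \<le> degree (lead_coeff a)" by (intro degree_le) blast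
 qed
 ultimately show ?thesis by (simp add: bideg_def)
qed

lemma spec_frac_field:
 assumes S: "sub_ring k" and F: "F \<in> space_over k"
 shows "spec \<tau> F \<in> polys_over (polys_over (frac_field k \<tau>))"
 unfolding spec_def
 by (intro map_poly_polys_over[OF F] map_poly_polys_over[where S = "polys_over k"] ev_image_frac_field[OF S]) auto

text \<open>
 Elements that are killed by a power of a derivation are closed under sums and products.
\<close>

lemma lnd_plane_der:
 fixes f g :: "'a::field_char_0 poly poly"
 assumes "(plane_der f g ^^ n) [:[:0, 1:]:] = 0" "(plane_der f g ^^ n') [:0, 1:] = 0"
 shows "lnd (plane_der f g)"
proof -
 note d = der_plane_der[of f g]
 let ?N = "{F. \<exists>n. (plane_der f g ^^ n) F = 0}"
 have more: "(plane_der f g ^^ m) F = 0" if "(plane_der f g ^^ n) F = 0" "n \<le> m" for n m F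
 proof -
  have "(plane_der f g ^^ (m - n + n)) F = 0" using that(1) der_funpow_zero[OF d] by (simp add: funpow_add)
  thus ?thesis using that(2) by simp
 qed
 have add: "F + G \<in> ?N" and mult: "F * G \<in> ?N" if FG: "F \<in> ?N" "G \<in> ?N" for F G
 proof -
  obtain n m where nm: "(plane_der f g ^^ n) F = 0" "(plane_der f g ^^ m) G = 0" using FG by blast
  have "(plane_der f g ^^ (n + m)) (F + G) = 0"
   using more[OF nm(1), of "n + m"] more[OF nm(2), of "n + m"] by (simp add: der_funpow_add[OF d])
  thus "F + G \<in> ?N" by blast
  have "(plane_der f g ^^ (n + m)) (F * G) = 0"
   unfolding der_funpow_mult[OF d]
  proof (intro sum.neutral ballI)
   fix i assume "i \<in> {..n + m}"
   hence "n \<le> i \<or> m \<le> n + m - i" by auto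
   thus "of_nat (n + m choose i) * ((plane_der f g ^^ i) F * (plane_der f g ^^ (n + m - i)) G) = 0"
    using more[OF nm(1), of i] more[OF nm(2), of "n + m - i"] by auto
  qed
  thus "F * G \<in> ?N" by blast
 qed
 have const: "[:[:c:]:] \<in> ?N" for c
  using plane_der_cc[of f g c] by (intro CollectI exI[of _ 1]) (simp add: cc_def)
 have Y: "[:[:0, 1:]:] \<in> ?N" and Z: "[:0, 1:] \<in> ?N" using assms by blast+
 have level1: "[:p:] \<in> ?N" for p :: "'a poly"
 proof (induction p)
  case 0
  thus ?case using const[of 0] by simp
 next
  case (pCons a p)
  have "[:pCons a p:] = [:[:a:]:] + [:[:0, 1:]:] * [:p:]" by simp
  thus ?case using add[OF const mult[OF Y pCons.IH(1)]] by metis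
 qed
 have "F \<in> ?N" for F
 proof (induction F)
  case 0
  thus ?case using const[of 0] by simp
 next
  case (pCons p F)
  have "pCons p F = [:p:] + [:0, 1:] * F" by simp
  thus ?case using add[OF level1 mult[OF Z pCons.IH(1)]] by metis
 qed
 thus ?thesis using d unfolding lnd_def by blast
qed

text \<open>
 At a root \<open>\<zeta>\<close> of \<open>m\<close> the polynomial \<open>\<gamma>(P)\<close> vanishes, but \<open>P\<close> does not become constant. So \<open>\<zeta>\<close> is a root of all
 coefficients of \<open>\<gamma>\<close>, and the minimal polynomial of \<open>\<zeta>\<close> over \<open>k\<close> can be cancelled on both sides.
\<close>

lemma cancel_constants:
 fixes k :: "complex set"
 assumes k: "sub_field k"
  and P: "P \<in> space_over k" "\<And>\<zeta>. bideg (spec \<zeta> P) > 0"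
  and m: "m \<in> polys_over k" "m \<noteq> 0" and b: "b \<in> space_over k"
  and \<gamma>: "\<gamma> \<in> polys_over (polys_over k)" "cc m * b = ins P \<gamma>"
 shows "\<exists>\<gamma>\<in>polys_over (polys_over k). b = ins P \<gamma>"
 using m \<gamma>
proof (induction "degree m" arbitrary: m \<gamma> rule: less_induct)
 case less
 note S = sub_fieldD(1)[OF k]
 note S1 = polys_over_sub_ring[OF S]
 show ?case
 proof (cases "degree m = 0")
  case True
  then obtain c where c: "m = [:c:]" by (rule degree_eq_zeroE)
  hence c0: "c \<noteq> 0" "c \<in> k" using less.prems(1,2) by (auto simp: const_polys_over[OF S])
  have "[:inverse c:] * m = 1" using c c0 by (simp add: one_pCons)
  hence "cc [:inverse c:] * (cc m * b) = b"
   by (simp add: mult.assoc[symmetric] rhomD(4)[OF rhom_cc, symmetric] rhomD(1)[OF rhom_cc])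
  hence "b = ins P [:[:inverse c:]:] * ins P \<gamma>" by (simp only: ins_const less.prems(4))
  also have "\<dots> = ins P ([:[:inverse c:]:] * \<gamma>)" by (simp only: rhomD(4)[OF rhom_ins])
  finally have "b = ins P ([:[:inverse c:]:] * \<gamma>)" .
  moreover have "[:[:inverse c:]:] * \<gamma> \<in> polys_over (polys_over k)"
   using less.prems(3) sub_fieldD(2)[OF k c0(2)]
   by (intro sub_ringD(5)[OF polys_over_sub_ring[OF S1]])
    (simp_all add: zero_polys_over sub_ringD(1)[OF S])
  ultimately show ?thesis by blast
 next
  case False
  then obtain \<zeta> where z: "poly m \<zeta> = 0"
   using fundamental_theorem_of_algebra[of m] by (auto simp: constant_degree)
  obtain \<pi> where \<pi>: "minimal_over k \<zeta> \<pi>" using minimal_over_exists[OF k less.prems(1,2) z] by blast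
  then obtain m' where m': "m' \<in> polys_over k" "m = \<pi> * m'"
   using less.prems(1) z by (auto simp: minimal_over_def)
  have \<pi>0: "\<pi> \<noteq> 0" "degree \<pi> > 0" using \<pi> by (auto simp: minimal_over_def)
  have m'0: "m' \<noteq> 0" using m' less.prems(2) by auto
  have "spec \<zeta> (ins P \<gamma>) = 0"
   by (simp add: less.prems(4)[symmetric] rhomD(4)[OF rhom_spec] spec_cc z)
  hence "map_poly (ev \<zeta>) \<gamma> = 0" using ins_eq_0_iff[OF P(2)] by (simp add: spec_ins)
  then obtain \<gamma>' where \<gamma>': "\<gamma>' \<in> polys_over (polys_over k)" "\<gamma> = [:\<pi>:] * \<gamma>'"
   using minimal_over_divides_poly[OF \<pi> sub_ringD(1)[OF S] less.prems(3)] by blast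
  have "cc \<pi> * (cc m' * b) = cc \<pi> * ins P \<gamma>'"
   using less.prems(4) unfolding m'(2) \<gamma>'(2) rhomD(4)[OF rhom_cc] rhomD(4)[OF rhom_ins] ins_const
   by (simp only: mult.assoc)
  hence "cc m' * b = ins P \<gamma>'" using \<pi>0(1) by simp
  moreover have "degree m' < degree m" using m'0 \<pi>0 by (simp add: m'(2) degree_mult_eq)
  ultimately show ?thesis using less.hyps m'(1) m'0 \<gamma>'(1) by blast
 qed
qed

text \<open>
 An equation \<open>\<alpha>\<^sub>1(P) s = - \<alpha>\<^sub>0(P)\<close> in the plane puts \<open>s\<close> into \<open>\<complex>[P]\<close>: after cancelling the greatest
 common divisor, Bezout's identity makes \<open>\<alpha>\<^sub>1(P)\<close> a unit.
\<close>

lemma quotient_in_ins: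
 fixes P s :: "complex poly poly"
 assumes P: "bideg P > 0" and \<alpha>: "\<alpha>1 \<noteq> 0" and eq: "ins P \<alpha>0 + ins P \<alpha>1 * s = 0"
 shows "\<exists>\<gamma>. s = ins P \<gamma>"
proof -
 define h where "h = gcd \<alpha>0 \<alpha>1"
 have h0: "h \<noteq> 0" using \<alpha> by (simp add: h_def)
 obtain \<beta>0 \<beta>1 where \<beta>: "\<alpha>0 = h * \<beta>0" "\<alpha>1 = h * \<beta>1"
  using gcd_dvd1[of \<alpha>0 \<alpha>1] gcd_dvd2[of \<alpha>0 \<alpha>1] unfolding h_def dvd_def by blast
 obtain u w where uw: "u * \<alpha>0 + w * \<alpha>1 = h"
  using bezout_coefficients_fst_snd[of \<alpha>0 \<alpha>1] h_def by metis
 hence "h * (u * \<beta>0 + w * \<beta>1) = h * 1" by (simp add: \<beta> algebra_simps)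
 hence one: "u * \<beta>0 + w * \<beta>1 = 1" using h0 by simp
 have "ins P h * (ins P \<beta>0 + ins P \<beta>1 * s) = 0"
  using eq by (simp add: \<beta> rhomD(4)[OF rhom_ins] algebra_simps)
 moreover have "ins P h \<noteq> 0" using h0 ins_eq_0_iff[OF P] by blast
 ultimately have eq': "ins P \<beta>0 = - (ins P \<beta>1 * s)" by (simp add: eq_neg_iff_add_eq_0)
 have "ins P \<beta>1 * (ins P w - ins P u * s) = ins P u * ins P \<beta>0 + ins P w * ins P \<beta>1"
  unfolding eq' by (simp add: algebra_simps)
 also have "\<dots> = ins P 1"
  unfolding one[symmetric] by (simp only: rhomD(3,4)[OF rhom_ins])
 finally have unit: "ins P \<beta>1 * (ins P w - ins P u * s) = 1" by (simp add: rhomD(1)[OF rhom_ins])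
 hence nz: "ins P \<beta>1 \<noteq> 0" "ins P w - ins P u * s \<noteq> 0" by auto
 have "bideg (1 :: complex poly poly) = 0" by (simp add: bideg_def)
 hence "bideg (ins P \<beta>1) = 0" using bideg_mult[OF nz] unit by simp
 moreover have "\<beta>1 \<noteq> 0" using nz(1) by (auto simp: rhomD(2)[OF rhom_ins])
 ultimately have "degree \<beta>1 = 0" using bideg_ins[OF P, of \<beta>1] P by simp
 then obtain c where c: "\<beta>1 = [:c:]" by (rule degree_eq_zeroE)
 hence "c \<noteq> 0" using \<open>\<beta>1 \<noteq> 0\<close> by auto
 have "cc c * s = ins P (- \<beta>0)" using eq' by (simp add: c ins_const rhomD(6)[OF rhom_ins])
 hence "cc (inverse c) * (cc c * s) = ins P [:inverse c:] * ins P (- \<beta>0)" by (simp only: ins_const)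
 moreover have "cc (inverse c) * (cc c * s) = s"
  using \<open>c \<noteq> 0\<close> by (simp add: mult.assoc[symmetric] rhomD(4)[OF rhom_cc, symmetric] rhomD(1)[OF rhom_cc])
 ultimately have "s = ins P ([:inverse c:] * (- \<beta>0))" by (simp only: rhomD(4)[OF rhom_ins])
 thus ?thesis by blast
qed

text \<open>
 At \<open>X = \<zeta>\<close> the preceding lemma makes \<open>s\<close> a polynomial in \<open>P\<close> with complex coefficients. A retraction onto \<open>k(\<zeta>)\<close>
 turns these into values at \<open>\<zeta>\<close> of polynomials over \<open>k\<close>, and two polynomials over \<open>k[X]\<close> that agree at \<open>\<zeta>\<close>
 differ by a multiple of the minimal polynomial \<open>\<pi>\<close>.
\<close>

lemma quotient_in_ins_over:
 fixes k :: "complex set"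
 assumes k: "sub_field k" and \<pi>: "minimal_over k \<zeta> \<pi>"
  and P: "P \<in> space_over k" "bideg (spec \<zeta> P) > 0" and s: "s \<in> space_over k"
  and nz: "map_poly (ev \<zeta>) \<alpha>1 \<noteq> 0" and eq: "spec \<zeta> (ins P \<alpha>0 + ins P \<alpha>1 * s) = 0"
 shows "\<exists>\<beta>\<in>polys_over (polys_over k). \<exists>s'\<in>space_over k. s = ins P \<beta> + cc \<pi> * s'"
proof -
 note S = sub_fieldD(1)[OF k]
 note S1 = polys_over_sub_ring[OF S]
 note z = sub_ringD(1)[OF S] zero_polys_over[OF sub_ringD(1)[OF S]]
 define L where "L = ev \<zeta> ` polys_over k"
 have L: "sub_field L" unfolding L_def by (rule minimal_over_sub_field[OF k \<pi>])
 note Lr = sub_fieldD(1)[OF L]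
 obtain \<rho> where \<rho>: "retraction L \<rho>" using exists_retraction[OF L] by blast
 have specL: "spec \<zeta> F \<in> polys_over (polys_over L)" if "F \<in> space_over k" for F
  unfolding spec_def L_def by (intro map_poly_polys_over[OF that] map_poly_polys_over[where S = "polys_over k"]) auto
 obtain \<gamma> where \<gamma>: "spec \<zeta> s = ins (spec \<zeta> P) \<gamma>"
  using quotient_in_ins[OF P(2) nz, of "map_poly (ev \<zeta>) \<alpha>0" "spec \<zeta> s"] eq
  by (auto simp: rhomD[OF rhom_spec] spec_ins)
 have "spec \<zeta> s = map_poly (map_poly \<rho>) (spec \<zeta> s)"
  using retractionD(4)[OF retraction_map_poly[OF polys_over_sub_ring[OF Lr] retraction_map_poly[OF Lr \<rho>]] specL[OF s]]
  by simp
 also have "\<dots> = ins (spec \<zeta> P) (map_poly \<rho> \<gamma>)"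
  unfolding \<gamma> by (rule retraction_ins[OF Lr \<rho> specL[OF P(1)]])
 finally have sr: "spec \<zeta> s = ins (spec \<zeta> P) (map_poly \<rho> \<gamma>)" .
 have "map_poly \<rho> \<gamma> \<in> polys_over (ev \<zeta> ` polys_over k)"
  using retractionD(3)[OF \<rho>] retractionD(5)[OF \<rho>] by (auto simp: polys_over_def coeff_map_poly L_def)
 also have "\<dots> = map_poly (ev \<zeta>) ` polys_over (polys_over k)" using z by (simp add: map_poly_image)
 finally obtain \<beta> where \<beta>: "\<beta> \<in> polys_over (polys_over k)" "map_poly \<rho> \<gamma> = map_poly (ev \<zeta>) \<beta>" by blast
 have "spec \<zeta> (s - ins P \<beta>) = 0"
  by (simp add: rhomD(5)[OF rhom_spec] spec_ins sr \<beta>(2))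
 moreover have "s - ins P \<beta> \<in> space_over k"
  by (intro sub_ringD(4)[OF polys_over_sub_ring[OF polys_over_sub_ring[OF S1]]] s ins_polys_over S1 P \<beta>)
 ultimately obtain s' where "s' \<in> space_over k" "s - ins P \<beta> = cc \<pi> * s'"
  using minimal_over_divides_space[OF \<pi> z(1)] by blast
 thus ?thesis using \<beta>(1) by (intro bexI[of _ \<beta>] bexI[of _ s']) (simp_all add: algebra_simps)
qed

text \<open>
 The generic structure of a locally nilpotent derivation \<open>D = f \<partial>\<^sub>Y + g \<partial>\<^sub>Z\<close> of \<open>k[X, Y, Z]\<close> whose kernel
 is larger than \<open>k[X]\<close>: the kernel is \<open>k[X, P]\<close>, and over \<open>k(X)\<close> the ring is generated by \<open>P\<close> and
 some \<open>s\<close>. Replacing \<open>X\<close> by a complex number \<open>\<tau>\<close> transcendental over \<open>k\<close> turns \<open>k(X)[Y, Z]\<close> into a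
 subring of the complex plane; retractions onto \<open>k(\<tau>)\<close> carry minimality of degrees over \<open>k(\<tau>)\<close> to
 minimality over the complex numbers, where Rentschler's theorem applies.
\<close>

lemma generic_coordinates:
 fixes k :: "complex set" and f g :: "complex poly poly poly"
 assumes k: "sub_field k" and \<tau>: "transcendental_over k \<tau>"
  and f: "f \<in> space_over k" and g: "g \<in> space_over k" and fg: "f \<noteq> 0 \<or> g \<noteq> 0"
  and nilY: "(plane_der f g ^^ n) [:[:0, 1:]:] = 0" and nilZ: "(plane_der f g ^^ n') [:0, 1:] = 0"
  and w: "w \<in> space_over k" "plane_der f g w = 0" "bideg w > 0"
 shows "\<exists>P\<in>space_over k. \<exists>s\<in>space_over k.
  plane_der f g P = 0 \<and> plane_der f g s \<noteq> 0 \<and> plane_der f g (plane_der f g s) = 0 \<and>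
  (\<forall>\<zeta>. bideg (spec \<zeta> P) > 0) \<and> bideg P > 0 \<and>
  (\<forall>b\<in>space_over k. plane_der f g b = 0 \<longrightarrow> (\<exists>\<gamma>\<in>polys_over (polys_over k). b = ins P \<gamma>)) \<and>
  (\<forall>b\<in>space_over k. \<exists>m\<in>polys_over k. m \<noteq> 0 \<and> (\<exists>G\<in>space_over k. cc m * b = ins2 P s G))"
proof -
 let ?D = "plane_der f g"
 let ?B = "space_over k"
 let ?C = "plane_der (spec \<tau> f) (spec \<tau> g)"
 note S = sub_fieldD(1)[OF k]
 note S1 = polys_over_sub_ring[OF S]
 note S2 = polys_over_sub_ring[OF S1]
 note S3 = polys_over_sub_ring[OF S2]
 note z = sub_ringD(1)[OF S] zero_polys_over[OF sub_ringD(1)[OF S]]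
 define L where "L = frac_field k \<tau>"
 have L: "sub_field L" unfolding L_def by (rule frac_field_sub_field[OF S])
 note Lr = sub_fieldD(1)[OF L]
 note Lr1 = polys_over_sub_ring[OF Lr]
 obtain \<rho> where \<rho>: "retraction L \<rho>" using exists_retraction[OF L] by blast
 note \<rho>1 = retraction_map_poly[OF Lr \<rho>]
 note \<rho>2 = retraction_map_poly[OF Lr1 \<rho>1]
 let ?\<rho> = "map_poly (map_poly \<rho>)"
 have specL: "spec \<tau> F \<in> polys_over (polys_over L)" if "F \<in> ?B" for F
  unfolding L_def by (rule spec_frac_field[OF S that])
 have ev0: "p = 0" if "p \<in> polys_over k" "poly p \<tau> = 0" for p
  using \<tau> that by (simp add: transcendental_over_def)
 have DB: "?D b \<in> ?B" if "b \<in> ?B" for b by (rule plane_der_polys_over[OF S1 f g that])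
 have C_spec: "?C (spec \<tau> F) = spec \<tau> (?D F)" for F by (simp add: spec_plane_der)
 have C_funpow: "(?C ^^ n) (spec \<tau> F) = spec \<tau> ((?D ^^ n) F)" for n F
  by (induction n) (simp_all add: C_spec)
 have lnd: "lnd ?C"
 proof (rule lnd_plane_der)
  have "[:[:0, 1:]:] = spec \<tau> [:[:0, 1:]:]" "[:0, 1:] = spec \<tau> [:0, 1:]"
   by (simp_all add: spec_def map_poly_pCons_gen one_pCons)
  thus "(?C ^^ n) [:[:0, 1:]:] = 0" "(?C ^^ n') [:0, 1:] = 0"
   using C_funpow nilY nilZ rhomD(2)[OF rhom_spec] by metis+
 qed
 have Cfg: "spec \<tau> f \<noteq> 0 \<or> spec \<tau> g \<noteq> 0" using fg spec_inj[OF \<tau>] f g by blast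
 have C\<rho>: "?\<rho> (?C F) = ?C (?\<rho> F)" for F
  by (rule retraction_plane_der[OF Lr \<rho> specL[OF f] specL[OF g]])
 have clear: "\<exists>m\<in>polys_over k. m \<noteq> 0 \<and> (\<exists>F'\<in>?B. spec \<tau> F' = cc (poly m \<tau>) * F)"
  if "F \<in> polys_over (polys_over L)" for F
  using clear_denominators[OF S that[unfolded L_def]] by (metis poly_0)
 have clear1: "\<exists>m\<in>polys_over k. m \<noteq> 0 \<and> (\<exists>\<gamma>'\<in>polys_over (polys_over k). map_poly (ev \<tau>) \<gamma>' = smult (poly m \<tau>) \<gamma>)"
  if "\<gamma> \<in> polys_over L" for \<gamma>
  using clear_denominators_poly[OF S that[unfolded L_def]] by (metis poly_0)
 have \<rho>L: "?\<rho> F \<in> polys_over (polys_over L)" for F by (rule retractionD(3)[OF \<rho>2])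
 have C_cc: "?C (cc c * F) = cc c * ?C F" for c F
  by (rule der_mult_ker[OF der_plane_der plane_der_cc])

 (* Among the elements of least positive degree in the kernel, P has no constant term and a leading coefficient
    of least degree in X. If P were constant at X = zeta, it would vanish there, and the minimal polynomial of
    zeta could be divided out, which would lower that degree. *)
 define inK where "inK b \<longleftrightarrow> b \<in> ?B \<and> ?D b = 0 \<and> bideg b > 0" for b
 obtain P0 where P0: "inK P0" and P0min: "\<And>b. inK b ==> bideg P0 \<le> bideg b"
  using ex_has_least_nat[of inK w bideg] w by (auto simp: inK_def)
 define M where "M b \<longleftrightarrow> inK b \<and> bideg b = bideg P0 \<and> coeff (coeff b 0) 0 = 0" for b
 define c0 where "c0 = coeff (coeff P0 0) 0"
 have c0: "cc c0 \<in> ?B" using P0 by (simp add: inK_def c0_def cc_polys_over[OF S1] coeff_polys_over)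
 have "M (P0 - cc c0)"
  unfolding M_def inK_def
 proof (intro conjI)
  show "P0 - cc c0 \<in> ?B" using P0 c0 sub_ringD(4)[OF S3] by (auto simp: inK_def)
  show "?D (P0 - cc c0) = 0" using P0 by (simp add: inK_def derD(6)[OF der_plane_der] plane_der_cc)
  show "0 < bideg (P0 - cc c0)" "bideg (P0 - cc c0) = bideg P0"
   using P0 bideg_diff_const[of P0 c0] by (auto simp: inK_def)
  show "coeff (coeff (P0 - cc c0) 0) 0 = 0" by (simp add: c0_def cc_def)
 qed
 then obtain P where P: "M P"
   and Pmin: "\<And>b. M b ==> degree (lead_coeff (lead_coeff P)) \<le> degree (lead_coeff (lead_coeff b))"
  using ex_has_least_nat[of M _ "\<lambda>b. degree (lead_coeff (lead_coeff b))"] by blast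
 have PB: "P \<in> ?B" and DP: "?D P = 0" and bP: "bideg P > 0" and P00: "coeff (coeff P 0) 0 = 0"
  and min: "\<And>b. inK b ==> bideg P \<le> bideg b"
  using P P0min by (auto simp: M_def inK_def)
 have P_nz: "P \<noteq> 0" using bP by (auto simp: bideg_def)
 have bspecP: "bideg (spec \<zeta> P) > 0" for \<zeta>
 proof (rule ccontr)
  assume "\<not> bideg (spec \<zeta> P) > 0"
  then obtain c where c: "spec \<zeta> P = cc c" using bideg_eq_0_iff by auto
  have "coeff (coeff (spec \<zeta> P) 0) 0 = 0" unfolding coeff_spec P00 by simp
  hence "c = 0" unfolding c by (simp add: cc_def)
  hence 0: "spec \<zeta> P = 0" using c by simp
  define p where "p = lead_coeff (lead_coeff P)"
  have p: "p \<in> polys_over k" "p \<noteq> 0" "poly p \<zeta> = 0"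
  proof -
   show "p \<in> polys_over k" unfolding p_def by (intro coeff_polys_over PB)
   show "p \<noteq> 0" using P_nz by (simp add: p_def)
   have "poly p \<zeta> = coeff (coeff (spec \<zeta> P) (degree P)) (degree (lead_coeff P))"
    by (simp add: coeff_spec p_def)
   thus "poly p \<zeta> = 0" using 0 by simp
  qed
  obtain \<pi> where \<pi>: "minimal_over k \<zeta> \<pi>" using minimal_over_exists[OF k p] by blast
  obtain P' where P': "P' \<in> ?B" "P = cc \<pi> * P'"
   using minimal_over_divides_space[OF \<pi> z(1) PB 0] by blast
  have \<pi>0: "\<pi> \<noteq> 0" "degree \<pi> > 0" using \<pi> by (auto simp: minimal_over_def)
  have nz: "cc \<pi> \<noteq> 0" "P' \<noteq> 0" using P' P_nz \<pi>0 by auto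
  have "M P'"
   unfolding M_def inK_def
  proof (intro conjI)
   show "P' \<in> ?B" by fact
   have "cc \<pi> * ?D P' = 0" using DP unfolding P'(2) by (simp add: derD(4)[OF der_plane_der] plane_der_cc)
   thus "?D P' = 0" using nz by simp
   have "bideg P = bideg P'" using bideg_mult[OF nz] P'(2) by simp
   thus "0 < bideg P'" "bideg P' = bideg P0" using bP P by (simp_all add: M_def)
   have "\<pi> * coeff (coeff P' 0) 0 = 0" using P00 unfolding P'(2) by (simp add: cc_def)
   thus "coeff (coeff P' 0) 0 = 0" using \<pi>0 by simp
  qed
  moreover have "lead_coeff (lead_coeff P) = \<pi> * lead_coeff (lead_coeff P')"
   unfolding P'(2) by (simp only: lead_coeff_mult) (simp add: cc_def)
  hence "degree (lead_coeff (lead_coeff P)) = degree \<pi> + degree (lead_coeff (lead_coeff P'))"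
   using \<pi>0 nz(2) by (simp add: degree_mult_eq)
  ultimately show False using Pmin[of P'] \<pi>0(2) by simp
 qed

 (* Over the complex numbers P still has least positive degree: a retraction carries a competitor to k(tau)[Y, Z]. *)
 let ?P = "spec \<tau> P"
 have CP: "?C ?P = 0" using DP by (simp add: C_spec rhomD(2)[OF rhom_spec])
 have minC: "bideg ?P \<le> bideg a" if a: "?C a = 0" "bideg a > 0" for a
 proof -
  have a0: "a \<noteq> 0" using a(2) by (auto simp: bideg_def)
  define a' where "a' = ?\<rho> (cc (inverse (lead_coeff (lead_coeff a))) * a)"
  have ba': "bideg a' = bideg a" unfolding a'_def using retraction_bideg[OF \<rho> Lr a0] by simp
  have Ca': "?C a' = 0" unfolding a'_def C\<rho>[symmetric] C_cc a(1) by (simp add: retractionD(5)[OF \<rho>])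
  obtain m F where m: "m \<in> polys_over k" "m \<noteq> 0" "F \<in> ?B" "spec \<tau> F = cc (poly m \<tau>) * a'"
   using clear[of a'] \<rho>L unfolding a'_def by blast
  have mt: "poly m \<tau> \<noteq> 0" using ev0 m by blast
  have "a' \<noteq> 0" using ba' a(2) by (auto simp: bideg_def)
  hence "bideg F = bideg a" using bideg_spec[OF \<tau> m(3)] m(4) mt ba' by (simp add: bideg_mult)
  moreover have "spec \<tau> (?D F) = 0" using Ca' by (simp add: C_spec[symmetric] m(4) C_cc)
  hence "?D F = 0" using spec_inj[OF \<tau> DB[OF m(3)]] by blast
  ultimately have "bideg P \<le> bideg a" using min[of F] m(3) a(2) by (simp add: inK_def)
  thus ?thesis by (simp add: bideg_spec[OF \<tau> PB])
 qed
 have bP': "bideg ?P > 0" by (rule bspecP)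
 have kernel: "\<exists>\<gamma>\<in>polys_over (polys_over k). b = ins P \<gamma>" if b: "b \<in> ?B" "?D b = 0" for b
 proof -
  have "?C (spec \<tau> b) = 0" using b by (simp add: C_spec rhomD(2)[OF rhom_spec])
  then obtain \<gamma> where \<gamma>: "spec \<tau> b = ins ?P \<gamma>" using plane_kernel[OF lnd Cfg CP bP' minC] by blast
  have "spec \<tau> b = ?\<rho> (spec \<tau> b)" using retractionD(4)[OF \<rho>2 specL[OF b(1)]] by simp
  also have "\<dots> = ins ?P (map_poly \<rho> \<gamma>)" unfolding \<gamma> by (rule retraction_ins[OF Lr \<rho> specL[OF PB]])
  finally have eq: "spec \<tau> b = ins ?P (map_poly \<rho> \<gamma>)" .
  have "map_poly \<rho> \<gamma> \<in> polys_over L" by (rule retractionD(3)[OF \<rho>1])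
  then obtain m \<gamma>' where m: "m \<in> polys_over k" "m \<noteq> 0" "\<gamma>' \<in> polys_over (polys_over k)"
    "map_poly (ev \<tau>) \<gamma>' = smult (poly m \<tau>) (map_poly \<rho> \<gamma>)"
   using clear1 by blast
  have sm: "ins ?P (smult c p) = cc c * ins ?P p" for c p
   using rhomD(4)[OF rhom_ins, of ?P "[:c:]" p] by (simp add: ins_const)
  have "spec \<tau> (cc m * b) = spec \<tau> (ins P \<gamma>')"
   by (simp add: rhomD(4)[OF rhom_spec] spec_cc eq spec_ins m(4) sm)
  hence "cc m * b = ins P \<gamma>'"
   by (rule spec_eq[OF S \<tau>, rotated 2])
    (use b m PB in \<open>auto intro!: sub_ringD(5)[OF S3] ins_polys_over S1 simp: cc_polys_over[OF S1]\<close>)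
  thus ?thesis using cancel_constants[OF k PB bspecP m(1,2) b(1) m(3)] by blast
 qed

 (* The last nonzero iterate of D on a variable lies in the kernel, so the one before it is a slice. Among the
    slices one with D s of least degree in P is chosen; it remains minimal over the complex numbers. *)
 define slice where "slice s H \<longleftrightarrow> s \<in> ?B \<and> H \<in> polys_over (polys_over k) \<and> H \<noteq> 0 \<and> ?D s = ins P H" for s H
 have "\<exists>s H. slice s H"
 proof -
  obtain v where v: "v \<in> ?B" "?D v \<noteq> 0" "\<exists>n. (?D ^^ n) v = 0"
  proof (cases "f = 0")
   case True
   hence "?D [:0, 1:] \<noteq> 0" using fg plane_der_vars(2)[of f g] by simp
   moreover have "[:0, 1:] \<in> ?B" using sub_ringD(1,2)[OF S2] sub_ringD(1)[OF S3] by simp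
   ultimately show ?thesis using that nilZ by blast
  next
   case False
   hence "?D [:[:0, 1:]:] \<noteq> 0" using plane_der_vars(1)[of f g] by simp
   moreover have "[:[:0, 1:]:] \<in> ?B" using sub_ringD(1,2)[OF S1] sub_ringD(1)[OF S2] sub_ringD(1)[OF S3] by simp
   ultimately show ?thesis using that nilY by blast
  qed
  define N where "N = (LEAST n. (?D ^^ n) v = 0)"
  have N: "(?D ^^ N) v = 0" unfolding N_def using v(3) by (rule LeastI_ex)
  have "N \<noteq> 0"
  proof
   assume "N = 0"
   hence "v = 0" using N by simp
   thus False using v(2) derD(1)[OF der_plane_der] by blast
  qed
  moreover have "N \<noteq> 1" using N v(2) by auto
  ultimately obtain j where j: "N = Suc (Suc j)" by (metis One_nat_def nat.exhaust)
  define s where "s = (?D ^^ j) v"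
  have s: "s \<in> ?B" unfolding s_def by (rule plane_der_funpow_polys_over[OF S1 f g v(1)])
  have "?D (?D s) = 0" using N by (simp add: j s_def)
  moreover have "?D s \<noteq> 0" using not_less_Least[of "Suc j" "\<lambda>n. (?D ^^ n) v = 0"] by (simp add: j s_def N_def[symmetric])
  ultimately obtain H where "H \<in> polys_over (polys_over k)" "?D s = ins P H" using kernel[OF DB[OF s]] by blast
  moreover from this have "H \<noteq> 0" using \<open>?D s \<noteq> 0\<close> by (auto simp: rhomD(2)[OF rhom_ins])
  ultimately show ?thesis using s unfolding slice_def by blast
 qed
 then obtain s H where sH: "slice s H" and smin: "\<And>s' H'. slice s' H' ==> degree H \<le> degree H'"
  using ex_has_least_nat[of "\<lambda>H. \<exists>s. slice s H" _ degree] by blast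
 have sB: "s \<in> ?B" and H: "H \<in> polys_over (polys_over k)" "H \<noteq> 0" and Ds: "?D s = ins P H"
  using sH by (auto simp: slice_def)
 let ?s = "spec \<tau> s" and ?H = "map_poly (ev \<tau>) H"
 have degH: "degree (map_poly (ev \<tau>) \<gamma>) = degree \<gamma>" if "\<gamma> \<in> polys_over (polys_over k)" for \<gamma>
  by (rule map_poly_degree_inj[OF _ _ that]) (use ev0 in auto)
 have H0: "map_poly (ev \<tau>) \<gamma> = 0 ==> \<gamma> = 0" if "\<gamma> \<in> polys_over (polys_over k)" for \<gamma>
 proof -
  assume 0: "map_poly (ev \<tau>) \<gamma> = 0"
  show "\<gamma> = 0"
  proof (rule poly_eqI)
   fix i
   have "poly (coeff \<gamma> i) \<tau> = 0" using arg_cong[OF 0, of "\<lambda>p. coeff p i"] by (simp add: coeff_map_poly)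
   thus "coeff \<gamma> i = coeff 0 i" using ev0 that by (simp add: coeff_polys_over)
  qed
 qed
 have Cs: "?C ?s = ins ?P ?H" by (simp add: C_spec Ds spec_ins)
 have sminC: "degree ?H \<le> degree H'" if s': "?C s' = ins ?P H'" "H' \<noteq> 0" for s' H'
 proof -
  define c where "c = inverse (lead_coeff H')"
  define H1 where "H1 = map_poly \<rho> (smult c H')"
  have sm: "ins ?P (smult c p) = cc c * ins ?P p" for c p
   using rhomD(4)[OF rhom_ins, of ?P "[:c:]" p] by (simp add: ins_const)
  have H1co: "coeff H1 i = \<rho> (c * coeff H' i)" for i by (simp add: H1_def coeff_map_poly retractionD(5)[OF \<rho>])
  have "coeff H1 (degree H') = 1"
   unfolding H1co c_def using s'(2) retractionD(4)[OF \<rho> sub_ringD(2)[OF Lr]] by simp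
  moreover have "degree H1 \<le> degree H'"
   unfolding H1_def using map_poly_degree_leq[of \<rho> "smult c H'"] degree_smult_le[of c H'] by linarith
  ultimately have dH1: "degree H1 = degree H'" "H1 \<noteq> 0" using le_degree[of H1 "degree H'"] by auto
  define s1 where "s1 = ?\<rho> (cc c * s')"
  have "?C s1 = ?\<rho> (ins ?P (smult c H'))" unfolding s1_def C\<rho>[symmetric] C_cc s'(1) sm ..
  also have "\<dots> = ins ?P H1" unfolding H1_def by (rule retraction_ins[OF Lr \<rho> specL[OF PB]])
  finally have Cs1: "?C s1 = ins ?P H1" .
  obtain m F where m: "m \<in> polys_over k" "m \<noteq> 0" "F \<in> ?B" "spec \<tau> F = cc (poly m \<tau>) * s1"
   using clear[of s1] \<rho>L unfolding s1_def by blast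
  have mt: "poly m \<tau> \<noteq> 0" using ev0 m by blast
  have CF: "spec \<tau> (?D F) = ins ?P (smult (poly m \<tau>) H1)"
   by (simp add: C_spec[symmetric] m(4) C_cc Cs1 sm)
  hence "spec \<tau> (?D (?D F)) = 0" by (simp add: C_spec[symmetric] plane_der_ins[OF CP])
  hence "?D (?D F) = 0" using spec_inj[OF \<tau> DB[OF DB[OF m(3)]]] by blast
  then obtain H2 where H2: "H2 \<in> polys_over (polys_over k)" "?D F = ins P H2"
   using kernel[OF DB[OF m(3)]] by blast
  have "ins ?P (map_poly (ev \<tau>) H2 - smult (poly m \<tau>) H1) = 0"
   using CF by (simp add: H2(2) spec_ins rhomD(5)[OF rhom_ins])
  hence eq: "map_poly (ev \<tau>) H2 = smult (poly m \<tau>) H1" using ins_eq_0_iff[OF bP'] by simp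
  have "H2 \<noteq> 0" using eq dH1(2) mt by auto
  hence "slice F H2" using m(3) H2 by (simp add: slice_def)
  hence "degree H \<le> degree H2" using smin by blast
  also have "degree H2 = degree H'" using arg_cong[OF eq, of degree] degH[OF H2(1)] dH1 mt by simp
  finally show ?thesis by (simp add: degH[OF H(1)])
 qed
 have H'0: "?H \<noteq> 0" using H0 H by blast
 have generic: "\<exists>m\<in>polys_over k. m \<noteq> 0 \<and> (\<exists>G\<in>space_over k. cc m * b = ins2 P s G)" if b: "b \<in> ?B" for b
 proof -
  obtain G where G: "spec \<tau> b = ins2 ?P ?s G"
   using Rentschler[OF lnd Cfg CP bP' _ Cs H'0, of "spec \<tau> b"] minC sminC by blast
  have "spec \<tau> b = ?\<rho> (spec \<tau> b)" using retractionD(4)[OF \<rho>2 specL[OF b]] by simp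
  also have "\<dots> = ins2 ?P ?s (?\<rho> G)"
   unfolding G by (rule retraction_ins2[OF Lr \<rho> specL[OF PB] specL[OF sB]])
  finally have eq: "spec \<tau> b = ins2 ?P ?s (?\<rho> G)" .
  obtain m F where m: "m \<in> polys_over k" "m \<noteq> 0" "F \<in> ?B" "spec \<tau> F = cc (poly m \<tau>) * ?\<rho> G"
   using clear[OF \<rho>L] by blast
  have cc2: "ins2 ?P ?s (cc c) = cc c" for c by (simp add: cc_def[of c] ins2_const) (simp add: ins_const cc_def)
  have "spec \<tau> (cc m * b) = spec \<tau> (ins2 P s F)"
   using m(4) by (simp add: rhomD(4)[OF rhom_spec] spec_cc eq spec_ins2 spec_def[symmetric] rhomD(4)[OF rhom_ins2] cc2)
  hence "cc m * b = ins2 P s F"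
   by (rule spec_eq[OF S \<tau>, rotated 2])
    (use b m PB sB in \<open>auto intro!: sub_ringD(5)[OF S3] ins2_polys_over S1 simp: cc_polys_over[OF S1]\<close>)
  thus ?thesis using m by blast
 qed
 show ?thesis
 proof (rule bexI[OF bexI[OF _ sB] PB], intro conjI allI ballI impI)
  show "?D s \<noteq> 0" unfolding Ds using ins_eq_0_iff[OF bP] H(2) by blast
  show "?D (?D s) = 0" unfolding Ds by (rule plane_der_ins[OF DP])
 qed (rule DP bspecP bP kernel generic; assumption)+
qed

section \<open>Two first variables in the kernel\<close>

abbreviation xvar :: "'a::comm_ring_1 poly poly poly" where "xvar \<equiv> cc [:0, 1:]"

abbreviation yvar :: "'a::comm_ring_1 poly poly poly" where "yvar \<equiv> [:[:0, 1:]:]"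

abbreviation zvar :: "'a::comm_ring_1 poly poly poly" where "zvar \<equiv> [:0, 1:]"

abbreviation const3 :: "'a::comm_ring_1 \<Rightarrow> 'a poly poly poly" where "const3 c \<equiv> cc [:c:]"

lemma rhom_const3: "rhom const3"
 using rhom_comp[OF rhom_cc rhom_const] .

lemma const3_at_xvar: "poly (map_poly const3 p) xvar = cc p"
proof (induction p)
 case 0
 thus ?case by (simp add: rhomD(2)[OF rhom_cc])
next
 case (pCons a p)
 have "cc (pCons a p) = cc [:a:] + cc [:0, 1:] * cc p"
  by (simp add: rhomD(3,4)[OF rhom_cc, symmetric])
 thus ?case using pCons.IH by (simp add: map_poly_pCons_gen rhomD(2)[OF rhom_cc])
qed

lemma bideg_const3_poly:
 fixes u :: "'a::idom poly poly poly"
 assumes "bideg u > 0" "p \<noteq> 0"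
 shows "bideg (poly (map_poly const3 p) u) = degree p * bideg u"
proof -
 have *: "map_poly const3 p = map_poly cc (map_poly (\<lambda>c. [:c:]) p)"
  by (rule poly_eqI) (simp add: coeff_map_poly rhomD(2)[OF rhom_cc])
 have d: "degree (map_poly (\<lambda>c. [:c:]) p) = degree p"
  by (rule map_poly_degree_inj[where S = UNIV]) auto
 have "map_poly (\<lambda>c. [:c:]) p \<noteq> 0"
 proof
  assume "map_poly (\<lambda>c. [:c:]) p = 0"
  hence "coeff (map_poly (\<lambda>c. [:c:]) p) i = 0" for i by simp
  hence "coeff p i = 0" for i by (simp add: coeff_map_poly)
  thus False using assms(2) by (simp add: poly_eqI)
 qed
 thus ?thesis using bideg_ins[OF assms(1), of "map_poly (\<lambda>c. [:c:]) p"] d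
  unfolding * ins_def by simp
qed

lemma ker_polys_inj:
 fixes d :: "'a::{idom, ring_char_0} \<Rightarrow> 'a"
 assumes d: "der d" and s: "d s \<noteq> 0"
  and FG: "F \<in> polys_over {a. d a = 0}" "G \<in> polys_over {a. d a = 0}" "poly F s = poly G s"
 shows "F = G"
 using ker_transcendental[OF d s, of "F - G"] FG sub_ringD(4)[OF polys_over_sub_ring[OF ker_sub_ring[OF d]]]
 by simp

text \<open>
 If the first coordinates \<open>X\<close> of two coordinate systems both lie in the kernel of \<open>D\<close>, then either one
 is a polynomial in the other, or \<open>D\<close> has rank one. Here \<open>\<phi>\<close> carries the first system to the second
 and \<open>D'\<close> is \<open>D\<close> in the second system. Both systems yield, generically, a slice: \<open>s\<close> generates the ring
 over the kernel after inverting polynomials in \<open>X\<close>, \<open>t\<close> does so after inverting polynomials in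
 \<open>V = \<phi> X\<close>. As polynomials in \<open>X\<close> and in \<open>V\<close> are coprime, \<open>s\<close> can be improved to generate the ring
 over the kernel without inverting anything.
\<close>

lemma two_first_coordinates:
 fixes k :: "complex set" and f g f' g' :: "complex poly poly poly"
 assumes k: "sub_field k" and \<tau>: "transcendental_over k \<tau>"
  and f: "f \<in> space_over k" and g: "g \<in> space_over k" and fg: "f \<noteq> 0 \<or> g \<noteq> 0"
  and nil: "(plane_der f g ^^ n) yvar = 0" "(plane_der f g ^^ n') zvar = 0"
  and f': "f' \<in> space_over k" and g': "g' \<in> space_over k" and fg': "f' \<noteq> 0 \<or> g' \<noteq> 0"
  and nil': "(plane_der f' g' ^^ m) yvar = 0" "(plane_der f' g' ^^ m') zvar = 0"
  and \<phi>: "rhom \<phi>" and \<phi>_inj: "\<And>F. \<phi> F = 0 ==> F = 0" and \<phi>_surj: "\<phi> ` space_over k = space_over k"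
  and \<phi>_const: "\<And>c. c \<in> k ==> \<phi> (const3 c) = const3 c"
  and \<phi>_der: "\<And>F. F \<in> space_over k ==> \<phi> (plane_der f' g' F) = plane_der f g (\<phi> F)"
 shows "(\<exists>p\<in>polys_over k. xvar = poly (map_poly const3 p) (\<phi> xvar)) \<or>
  (\<exists>P\<in>space_over k. \<exists>s\<in>space_over k. plane_der f g P = 0 \<and>
   (\<forall>b\<in>space_over k. \<exists>G\<in>space_over k. b = ins2 P s G))"
proof -
 let ?B = "space_over k"
 let ?D = "plane_der f g" and ?D' = "plane_der f' g'"
 note S = sub_fieldD(1)[OF k]
 note S1 = polys_over_sub_ring[OF S]
 note S2 = polys_over_sub_ring[OF S1]
 note S3 = polys_over_sub_ring[OF S2]
 note z = sub_ringD(1)[OF S] zero_polys_over[OF sub_ringD(1)[OF S]]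
 have \<phi>_eq: "F = G" if "\<phi> F = \<phi> G" for F G using \<phi>_inj[of "F - G"] that by (simp add: rhomD(5)[OF \<phi>])
 have \<phi>B: "\<phi> b \<in> ?B" if "b \<in> ?B" for b using \<phi>_surj that by blast
 have xB: "xvar \<in> ?B" using sub_ringD(2)[OF S] z by (simp add: cc_polys_over[OF S1])
 have ccB: "cc p \<in> ?B" if "p \<in> polys_over k" for p using that by (simp add: cc_polys_over[OF S1])
 have \<phi>_cp: "\<phi> (poly (map_poly const3 p) u) = poly (map_poly const3 p) (\<phi> u)" if "p \<in> polys_over k" for p u
 proof -
  have "map_poly \<phi> (map_poly const3 p) = map_poly const3 p"
   by (rule poly_eqI)
    (use that in \<open>simp add: coeff_map_poly rhomD(2)[OF \<phi>] rhomD(2)[OF rhom_cc] \<phi>_const coeff_polys_over\<close>)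
  thus ?thesis by (simp add: rhom_map_poly_poly[OF \<phi>])
 qed
 have Dcc: "?D (cc c) = 0" "?D' (cc c) = 0" for c by (rule plane_der_cc)+
 have \<phi>xB: "\<phi> xvar \<in> ?B" using \<phi>B xB by blast
 have D\<phi>x: "?D (\<phi> xvar) = 0" using \<phi>_der[OF xB] by (simp add: Dcc rhomD(2)[OF \<phi>])
 obtain u where u: "u \<in> ?B" "\<phi> u = xvar" using \<phi>_surj xB by (metis imageE)
 have D'u: "?D' u = 0" using \<phi>_der[OF u(1)] \<phi>_inj by (simp add: u(2) Dcc)
 show ?thesis
 proof (cases "bideg u > 0")
  case False
  then obtain p where p: "u = cc p" using bideg_eq_0_iff by auto
  hence pk: "p \<in> polys_over k" using u(1) by (simp add: cc_polys_over[OF S1])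
  have "xvar = \<phi> (poly (map_poly const3 p) xvar)" by (simp add: const3_at_xvar p[symmetric] u(2))
  thus ?thesis using \<phi>_cp[OF pk] pk by auto
 next
  case u_pos: True
  (* If V = q(X), then X = q(u) with u of positive degree in Y and Z, so q would be constant. *)
  have v_pos: "bideg (\<phi> xvar) > 0"
  proof (rule ccontr)
   assume "\<not> bideg (\<phi> xvar) > 0"
   then obtain q where q: "\<phi> xvar = cc q" using bideg_eq_0_iff by auto
   hence qk: "q \<in> polys_over k" using \<phi>xB by (simp add: cc_polys_over[OF S1])
   have "\<phi> xvar = \<phi> (poly (map_poly const3 q) u)"
    using \<phi>_cp[OF qk] by (simp add: u(2) const3_at_xvar q)
   hence eq: "xvar = poly (map_poly const3 q) u" by (rule \<phi>_eq)
   have "q \<noteq> 0" using eq by (auto simp: cc_def)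
   hence "degree q * bideg u = 0" using bideg_const3_poly[OF u_pos, of q] eq by (metis bideg_cc)
   hence "degree q = 0" using u_pos by simp
   then obtain c where "q = [:c:]" by (rule degree_eq_zeroE)
   hence "xvar = const3 c" using eq by (simp add: map_poly_const rhomD(2)[OF rhom_cc])
   thus False by (simp add: cc_def)
  qed
  obtain P s where PB: "P \<in> ?B" and sB: "s \<in> ?B" and DP: "?D P = 0" and Ds: "?D s \<noteq> 0" "?D (?D s) = 0"
   and bspecP: "\<And>\<zeta>. bideg (spec \<zeta> P) > 0" and bP: "bideg P > 0"
   and kernel: "\<And>b. b \<in> ?B ==> ?D b = 0 ==> \<exists>\<gamma>\<in>polys_over (polys_over k). b = ins P \<gamma>"
   and generic: "\<And>b. b \<in> ?B ==> \<exists>m\<in>polys_over k. m \<noteq> 0 \<and> (\<exists>G\<in>?B. cc m * b = ins2 P s G)"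
   using generic_coordinates[OF k \<tau> f g fg nil \<phi>xB D\<phi>x v_pos] by blast
  obtain P' s' where P'B: "P' \<in> ?B" and s'B: "s' \<in> ?B" and D'P': "?D' P' = 0"
   and D's': "?D' s' \<noteq> 0" "?D' (?D' s') = 0"
   and generic': "\<And>b. b \<in> ?B ==> \<exists>m\<in>polys_over k. m \<noteq> 0 \<and> (\<exists>G\<in>?B. cc m * b = ins2 P' s' G)"
   using generic_coordinates[OF k \<tau> f' g' fg' nil' u(1) D'u u_pos] by blast
  define A where "A = {a \<in> ?B. ?D a = 0}"
  note der = der_plane_der[of f g]
  have A: "sub_ring A"
   unfolding A_def sub_ring_def
   using sub_ringD(2,4,5)[OF S3] by (auto simp: derD[OF der])
  note A1 = polys_over_sub_ring[OF A]
  have A_ker: "polys_over A \<subseteq> polys_over {a. ?D a = 0}" by (rule polys_over_mono) (auto simp: A_def)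
  have ccA: "cc p \<in> A" if "p \<in> polys_over k" for p using ccB[OF that] by (simp add: A_def Dcc)
  have insA: "ins P \<gamma> \<in> A" if "\<gamma> \<in> polys_over (polys_over k)" for \<gamma>
   using that by (simp add: A_def ins_polys_over[OF S1 PB] plane_der_ins[OF DP])
  have A_ins: "\<exists>\<gamma>\<in>polys_over (polys_over k). a = ins P \<gamma>" if "a \<in> A" for a
   using kernel that by (simp add: A_def)
  (* Generation over A after inverting polynomials in X, and in V. *)
  define gen where "gen s \<longleftrightarrow> (\<forall>b\<in>?B. \<exists>m\<in>polys_over k. m \<noteq> 0 \<and> (\<exists>G\<in>polys_over A. cc m * b = poly G s))" for s
  have gen_s: "gen s"
   unfolding gen_def
  proof
   fix b assume "b \<in> ?B"
   then obtain m G where m: "m \<in> polys_over k" "m \<noteq> 0" "G \<in> ?B" "cc m * b = ins2 P s G"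
    using generic by blast
   have "map_poly (ins P) G \<in> polys_over A"
    by (rule map_poly_polys_over[OF m(3)]) (auto simp: insA rhomD(2)[OF rhom_ins])
   thus "\<exists>m\<in>polys_over k. m \<noteq> 0 \<and> (\<exists>G\<in>polys_over A. cc m * b = poly G s)"
    using m unfolding ins2_def by blast
  qed
  define t where "t = \<phi> s'"
  have tB: "t \<in> ?B" unfolding t_def by (rule \<phi>B[OF s'B])
  have Dt: "?D t \<in> A" "?D (?D t) = 0"
  proof -
   have e: "?D t = \<phi> (?D' s')" unfolding t_def by (rule \<phi>_der[OF s'B, symmetric])
   have "?D' s' \<in> ?B" by (rule plane_der_polys_over[OF S1 f' g' s'B])
   hence "?D (?D t) = \<phi> (?D' (?D' s'))" unfolding e by (simp add: \<phi>_der)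
   thus "?D (?D t) = 0" by (simp add: D's'(2) rhomD(2)[OF \<phi>])
   thus "?D t \<in> A" by (simp add: A_def plane_der_polys_over[OF S1 f g tB])
  qed
  have gen_t: "\<exists>m\<in>polys_over k. m \<noteq> 0 \<and> (\<exists>G\<in>polys_over A. \<phi> (cc m) * b = poly G t)" if b: "b \<in> ?B" for b
  proof -
   obtain b' where b': "b' \<in> ?B" "b = \<phi> b'" using \<phi>_surj b by blast
   obtain m G where m: "m \<in> polys_over k" "m \<noteq> 0" "G \<in> ?B" "cc m * b' = ins2 P' s' G"
    using generic'[OF b'(1)] by blast
   have "\<phi> (cc m) * b = \<phi> (cc m * b')" by (simp add: b'(2) rhomD(4)[OF \<phi>])
   also have "\<dots> = poly (map_poly \<phi> (map_poly (ins P') G)) t"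
    unfolding m(4) ins2_def t_def by (rule rhom_map_poly_poly[OF \<phi>])
   finally have "\<phi> (cc m) * b = poly (map_poly \<phi> (map_poly (ins P') G)) t" .
   moreover have "map_poly \<phi> (map_poly (ins P') G) \<in> polys_over A"
   proof (intro map_poly_polys_over[where S = "{a \<in> ?B. ?D' a = 0}"] map_poly_polys_over[OF m(3)])
    show "ins P' \<gamma> \<in> {a \<in> ?B. ?D' a = 0}" if "\<gamma> \<in> polys_over (polys_over k)" for \<gamma>
     using that by (simp add: ins_polys_over[OF S1 P'B] plane_der_ins[OF D'P'])
    show "\<phi> a \<in> A" if "a \<in> {a \<in> ?B. ?D' a = 0}" for a
     using that \<phi>_der[of a] by (simp add: A_def \<phi>B rhomD(2)[OF \<phi>])
   qed (auto simp: rhomD(2)[OF rhom_ins] rhomD(2)[OF \<phi>])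
   ultimately show ?thesis using m by blast
  qed
  (* Otherwise a polynomial in X would have a factor pi(u) of positive degree in Y and Z. *)
  have coprime: "spec \<zeta> (\<phi> (cc m)) \<noteq> 0" if m: "m \<in> polys_over k" "m \<noteq> 0" and \<pi>: "minimal_over k \<zeta> \<pi>" for m \<zeta> \<pi>
  proof
   assume "spec \<zeta> (\<phi> (cc m)) = 0"
   then obtain b where b: "b \<in> ?B" "\<phi> (cc m) = cc \<pi> * b"
    using minimal_over_divides_space[OF \<pi> z(1) \<phi>B[OF ccB[OF m(1)]]] by blast
   obtain b' where b': "b' \<in> ?B" "b = \<phi> b'" using \<phi>_surj b by blast
   have \<pi>k: "\<pi> \<in> polys_over k" "\<pi> \<noteq> 0" "degree \<pi> > 0" using \<pi> by (auto simp: minimal_over_def)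
   let ?q = "poly (map_poly const3 \<pi>) u"
   have "\<phi> (cc m) = \<phi> (?q * b')"
    using \<phi>_cp[OF \<pi>k(1)] by (simp add: rhomD(4)[OF \<phi>] u(2) const3_at_xvar b b'(2))
   hence eq: "cc m = ?q * b'" by (rule \<phi>_eq)
   hence nz: "?q \<noteq> 0" "b' \<noteq> 0" using m(2) by auto
   have "bideg ?q > 0" using bideg_const3_poly[OF u_pos \<pi>k(2)] \<pi>k(3) u_pos by simp
   thus False using bideg_mult[OF nz] eq bideg_cc[of m] by simp
  qed
  have root: "\<exists>\<zeta> \<pi> m'. minimal_over k \<zeta> \<pi> \<and> m' \<in> polys_over k \<and> m = \<pi> * m' \<and> m' \<noteq> 0 \<and> degree m' < degree m"
   if m: "m \<in> polys_over k" "m \<noteq> 0" "degree m \<noteq> 0" for m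
  proof -
   obtain \<zeta> where \<zeta>: "poly m \<zeta> = 0"
    using fundamental_theorem_of_algebra[of m] m(3) by (auto simp: constant_degree)
   obtain \<pi> where \<pi>: "minimal_over k \<zeta> \<pi>" using minimal_over_exists[OF k m(1,2) \<zeta>] by blast
   then obtain m' where m': "m' \<in> polys_over k" "m = \<pi> * m'" using m(1) \<zeta> by (auto simp: minimal_over_def)
   moreover have "m' \<noteq> 0" using m' m(2) by auto
   moreover have "degree m' < degree m" using \<pi> \<open>m' \<noteq> 0\<close> m(2) unfolding m'(2)
    by (subst degree_mult_eq) (auto simp: minimal_over_def)
   ultimately show ?thesis using \<pi> by blast
  qed
  have A_cancel: "a \<in> A" if "cc p * a \<in> A" "p \<noteq> 0" "a \<in> ?B" for p a
   using that by (auto simp: A_def der_mult_ker[OF der Dcc(1)])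
  have A_div: "\<exists>a'\<in>A. a = cc \<pi> * a'" if a: "a \<in> A" "spec \<zeta> a = 0" and \<pi>: "minimal_over k \<zeta> \<pi>" for a \<zeta> \<pi>
  proof -
   obtain a' where a': "a' \<in> ?B" "a = cc \<pi> * a'"
    using minimal_over_divides_space[OF \<pi> z(1) _ a(2)] a(1) by (auto simp: A_def)
   moreover have "\<pi> \<noteq> 0" using \<pi> by (auto simp: minimal_over_def)
   ultimately have "a' \<in> A" using A_cancel[of \<pi> a'] a(1) by simp
   thus ?thesis using a' by blast
  qed
  have cc_nz: "cc \<pi> \<noteq> 0" if "minimal_over k \<zeta> \<pi>" for \<zeta> \<pi> using that by (auto simp: minimal_over_def)
  (* As D s and D t lie in A, the element m(X) t is linear in s over A. The degree of m is made as small as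
     possible by changing s; at a root zeta of m it can be lowered. *)
  define rel where "rel s m a0 a1 \<longleftrightarrow> s \<in> ?B \<and> ?D s \<noteq> 0 \<and> gen s \<and> m \<in> polys_over k \<and> m \<noteq> 0 \<and>
   a0 \<in> A \<and> a1 \<in> A \<and> cc m * t = a0 + a1 * s" for s m a0 a1
  have "\<exists>m a0 a1. rel s m a0 a1"
  proof -
   obtain m G where m: "m \<in> polys_over k" "m \<noteq> 0" "G \<in> polys_over A" "cc m * t = poly G s"
    using gen_s tB unfolding gen_def by blast
   define h where "h = ?D s"
   have h: "h \<in> A" "h \<noteq> 0" using Ds plane_der_polys_over[OF S1 f g sB] by (auto simp: h_def A_def)
   define a0 where "a0 = h * t - ?D t * s"
   have "?D a0 = 0"
    using Ds(2) Dt(2) by (simp add: a0_def h_def derD(4,6)[OF der])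
   moreover have "a0 \<in> ?B"
    unfolding a0_def using h(1) Dt(1) tB sB by (auto simp: A_def intro!: sub_ringD(4,5)[OF S3])
   ultimately have a0: "a0 \<in> A" by (simp add: A_def)
   have eq: "[:h:] * G = [:cc m * a0, cc m * ?D t:]"
   proof (rule ker_polys_inj[OF der Ds(1)])
    have "[:h:] * G \<in> polys_over A"
     by (rule sub_ringD(5)[OF A1 _ m(3)]) (simp only: const_polys_over[OF A] h(1))
    moreover have "[:cc m * a0, cc m * ?D t:] \<in> polys_over A"
     using sub_ringD(5)[OF A] ccA[OF m(1)] a0 Dt(1) zero_polys_over[OF sub_ringD(1)[OF A]] by simp
    ultimately show "[:h:] * G \<in> polys_over {a. ?D a = 0}" "[:cc m * a0, cc m * ?D t:] \<in> polys_over {a. ?D a = 0}"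
     using A_ker by blast+
    have "poly ([:h:] * G) s = h * (cc m * t)" by (simp add: m(4))
    also have "\<dots> = poly [:cc m * a0, cc m * ?D t:] s" by (simp add: a0_def algebra_simps)
    finally show "poly ([:h:] * G) s = poly [:cc m * a0, cc m * ?D t:] s" .
   qed
   have "coeff G i = 0" if "i > 1" for i
   proof -
    have "h * coeff G i = coeff ([:h:] * G) i" by simp
    also have "\<dots> = 0" unfolding eq using that by (simp add: coeff_pCons split: nat.split)
    finally show ?thesis using h(2) by simp
   qed
   hence "G = [:coeff G 0, coeff G 1:]"
    by (intro poly_eqI) (auto simp: coeff_pCons split: nat.split)
   hence "poly G s = coeff G 0 + coeff G 1 * s" by (metis add.right_neutral mult.commute mult_zero_right poly_0 poly_pCons)
   hence "rel s m (coeff G 0) (coeff G 1)"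
    unfolding rel_def using sB Ds(1) gen_s m coeff_polys_over[OF m(3)] by auto
   thus ?thesis by blast
  qed
  then obtain s1 m a0 a1 where r: "rel s1 m a0 a1"
   and rmin: "\<And>s' m' a0' a1'. rel s' m' a0' a1' ==> degree m \<le> degree m'"
   using ex_has_least_nat[of "\<lambda>m. \<exists>s a0 a1. rel s m a0 a1" _ degree] by blast
  have s1: "s1 \<in> ?B" "?D s1 \<noteq> 0" "gen s1" and m: "m \<in> polys_over k" "m \<noteq> 0"
   and a: "a0 \<in> A" "a1 \<in> A" and t: "cc m * t = a0 + a1 * s1" using r by (auto simp: rel_def)
  have "degree m = 0"
  proof (rule ccontr)
   assume "degree m \<noteq> 0"
   then obtain \<zeta> \<pi> m' where \<pi>: "minimal_over k \<zeta> \<pi>" and m': "m' \<in> polys_over k" "m = \<pi> * m'" "m' \<noteq> 0" "degree m' < degree m"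
    using root[OF m] by blast
   have \<pi>\<zeta>: "poly \<pi> \<zeta> = 0" using \<pi> by (simp add: minimal_over_def)
   have spec0: "spec \<zeta> (a0 + a1 * s1) = 0"
    unfolding t[symmetric] m'(2) by (simp add: rhomD(4)[OF rhom_spec] spec_cc \<pi>\<zeta>)
   obtain \<alpha>0 \<alpha>1 where \<alpha>: "\<alpha>0 \<in> polys_over (polys_over k)" "a0 = ins P \<alpha>0"
     "\<alpha>1 \<in> polys_over (polys_over k)" "a1 = ins P \<alpha>1"
    using A_ins a by metis
   show False
   proof (cases "map_poly (ev \<zeta>) \<alpha>1 = 0")
    case True
    hence a1z: "spec \<zeta> a1 = 0" by (simp add: \<alpha> spec_ins rhomD(2)[OF rhom_ins])
    hence a0z: "spec \<zeta> a0 = 0" using spec0 by (simp add: rhomD(3,4)[OF rhom_spec])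
    obtain b0 b1 where b: "b0 \<in> A" "a0 = cc \<pi> * b0" "b1 \<in> A" "a1 = cc \<pi> * b1"
     using A_div[OF a(1) a0z \<pi>] A_div[OF a(2) a1z \<pi>] by blast
    have "cc \<pi> * (cc m' * t) = cc \<pi> * (b0 + b1 * s1)"
     using t unfolding m'(2) b rhomD(4)[OF rhom_cc] by (simp add: algebra_simps)
    hence "cc m' * t = b0 + b1 * s1" using cc_nz[OF \<pi>] by simp
    hence "rel s1 m' b0 b1" using s1 m' b by (simp add: rel_def)
    thus False using rmin m'(4) by fastforce
   next
    case False
    have "spec \<zeta> (ins P \<alpha>0 + ins P \<alpha>1 * s1) = 0" using spec0 by (simp add: \<alpha>)
    then obtain \<beta> s' where \<beta>: "\<beta> \<in> polys_over (polys_over k)" "s' \<in> ?B" "s1 = ins P \<beta> + cc \<pi> * s'"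
     using quotient_in_ins_over[OF k \<pi> PB bspecP s1(1) False] by blast
    let ?b = "ins P \<beta>"
    have "?D s1 = cc \<pi> * ?D s'"
     unfolding \<beta>(3) derD(3)[OF der] plane_der_ins[OF DP] der_mult_ker[OF der Dcc(1)] by simp
    hence Ds': "?D s' \<noteq> 0" using s1(2) by auto
    have "gen s'"
     unfolding gen_def
    proof
     fix b assume "b \<in> ?B"
     then obtain q G where q: "q \<in> polys_over k" "q \<noteq> 0" "G \<in> polys_over A" "cc q * b = poly G s1"
      using s1(3) unfolding gen_def by blast
     have \<pi>A: "cc \<pi> \<in> A" using ccA \<pi> by (simp add: minimal_over_def)
     have "pcompose G [:?b, cc \<pi>:] \<in> polys_over A"
      unfolding pcompose_altdef
      using insA[OF \<beta>(1)] \<pi>A zero_polys_over[OF sub_ringD(1)[OF A]]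
      by (intro poly_in_sub_ring[OF A1] map_poly_polys_over[OF q(3)]) auto
     moreover have "poly (pcompose G [:?b, cc \<pi>:]) s' = poly G s1"
      by (simp add: poly_pcompose \<beta>(3) mult.commute)
     ultimately show "\<exists>m\<in>polys_over k. m \<noteq> 0 \<and> (\<exists>G\<in>polys_over A. cc m * b = poly G s')"
      using q by metis
    qed
    define b0 where "b0 = cc m' * t - a1 * s'"
    have b0: "cc \<pi> * b0 = a0 + a1 * ?b"
     using t unfolding m'(2) \<beta>(3) b0_def rhomD(4)[OF rhom_cc] by (simp add: algebra_simps)
    have "b0 \<in> ?B" unfolding b0_def
     using ccB[OF m'(1)] tB a(2) \<beta>(2) by (auto simp: A_def intro!: sub_ringD(4,5)[OF S3])
    moreover have "cc \<pi> * b0 \<in> A" unfolding b0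
     using sub_ringD(3,5)[OF A] a insA[OF \<beta>(1)] by blast
    ultimately have "b0 \<in> A" using A_cancel[of \<pi> b0] cc_nz[OF \<pi>] by simp
    moreover have "cc m' * t = b0 + a1 * s'" by (simp add: b0_def)
    ultimately have "rel s' m' b0 a1"
     using \<beta>(2) Ds' \<open>gen s'\<close> m'(1,3) a(2) by (simp add: rel_def)
    thus False using rmin m'(4) by fastforce
   qed
  qed
  then obtain c where c: "m = [:c:]" by (rule degree_eq_zeroE)
  have c0: "c \<noteq> 0" "c \<in> k" using m by (auto simp: c const_polys_over[OF S])
  define e where "e = const3 (inverse c)"
  have eA: "e \<in> A" unfolding e_def using sub_fieldD(2)[OF k c0(2)] by (intro ccA) (simp only: const_polys_over[OF S])
  have "e * cc m = 1" using c0 by (simp add: e_def c rhomD(4)[OF rhom_cc, symmetric] one_pCons[symmetric] rhomD(1)[OF rhom_cc])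
  hence t': "t = e * a0 + e * a1 * s1"
   using arg_cong[OF t, of "\<lambda>y. e * y"] by (simp add: mult.assoc[symmetric] distrib_left)
  (* A multiple of b by a polynomial in X and one by a polynomial in V lie in A[s1], and these are coprime. *)
  have final: "\<exists>F\<in>polys_over A. b = poly F s1" if b: "b \<in> ?B" for b
  proof -
   obtain q G where q: "q \<in> polys_over k" "q \<noteq> 0" "G \<in> polys_over A" "\<phi> (cc q) * b = poly G t"
    using gen_t[OF b] by blast
   define G' where "G' = pcompose G [:e * a0, e * a1:]"
   have G': "G' \<in> polys_over A" unfolding G'_def pcompose_altdef
    using sub_ringD(5)[OF A eA a(1)] sub_ringD(5)[OF A eA a(2)] zero_polys_over[OF sub_ringD(1)[OF A]]
    by (intro poly_in_sub_ring[OF A1] map_poly_polys_over[OF q(3)]) auto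
   have qb: "\<phi> (cc q) * b = poly G' s1"
    unfolding q(4) G'_def by (simp add: poly_pcompose t' mult_ac)
   have qA: "\<phi> (cc q) \<in> A"
    using \<phi>_der[OF ccB[OF q(1)]] \<phi>B[OF ccB[OF q(1)]] by (simp add: A_def Dcc rhomD(2)[OF \<phi>])
   have "\<exists>F\<in>polys_over A. b = poly F s1"
    if "m \<in> polys_over k" "m \<noteq> 0" "F \<in> polys_over A" "cc m * b = poly F s1" for m F
    using that
   proof (induction "degree m" arbitrary: m F rule: less_induct)
    case less
    show ?case
    proof (cases "degree m = 0")
     case True
     then obtain c where c: "m = [:c:]" by (rule degree_eq_zeroE)
     hence c0: "c \<noteq> 0" "c \<in> k" using less.prems by (auto simp: const_polys_over[OF S])
     let ?e = "const3 (inverse c)"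
     have "?e \<in> A" using sub_fieldD(2)[OF k c0(2)] by (intro ccA) (simp only: const_polys_over[OF S])
     hence "smult ?e F \<in> polys_over A" by (rule smult_polys_over[OF A _ less.prems(3)])
     moreover have "?e * cc m = 1"
      using c0 by (simp add: c rhomD(4)[OF rhom_cc, symmetric] one_pCons[symmetric] rhomD(1)[OF rhom_cc])
     hence "b = ?e * (cc m * b)" by (simp add: mult.assoc[symmetric])
     hence "b = poly (smult ?e F) s1" unfolding less.prems(4) by simp
     ultimately show ?thesis by blast
    next
     case False
     then obtain \<zeta> \<pi> m' where \<pi>: "minimal_over k \<zeta> \<pi>"
      and m': "m' \<in> polys_over k" "m = \<pi> * m'" "m' \<noteq> 0" "degree m' < degree m"
      using root[OF less.prems(1,2)] by blast
     have \<pi>\<zeta>: "poly \<pi> \<zeta> = 0" using \<pi> by (simp add: minimal_over_def)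
     have eq: "[:\<phi> (cc q):] * F = [:cc m:] * G'"
     proof (rule ker_polys_inj[OF der s1(2)])
      have "[:\<phi> (cc q):] * F \<in> polys_over A"
       by (rule sub_ringD(5)[OF A1 _ less.prems(3)]) (simp only: const_polys_over[OF A] qA)
      moreover have "[:cc m:] * G' \<in> polys_over A"
       by (rule sub_ringD(5)[OF A1 _ G']) (simp only: const_polys_over[OF A] ccA[OF less.prems(1)])
      ultimately show "[:\<phi> (cc q):] * F \<in> polys_over {a. ?D a = 0}" "[:cc m:] * G' \<in> polys_over {a. ?D a = 0}"
       using A_ker by blast+
      show "poly ([:\<phi> (cc q):] * F) s1 = poly ([:cc m:] * G') s1"
       by (simp add: mult_ac flip: qb less.prems(4))
     qed
     have "\<exists>a\<in>A. coeff F i = cc \<pi> * a" for i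
     proof (rule A_div[OF coeff_polys_over[OF less.prems(3)] _ \<pi>])
      have "\<phi> (cc q) * coeff F i = cc m * coeff G' i"
       using arg_cong[OF eq, of "\<lambda>p. coeff p i"] by simp
      hence "spec \<zeta> (\<phi> (cc q)) * spec \<zeta> (coeff F i) = spec \<zeta> (cc m) * spec \<zeta> (coeff G' i)"
       by (simp add: rhomD(4)[OF rhom_spec, symmetric])
      also have "spec \<zeta> (cc m) = 0" by (simp add: spec_cc m'(2) \<pi>\<zeta>)
      finally show "spec \<zeta> (coeff F i) = 0" using coprime[OF q(1,2) \<pi>] by simp
     qed
     hence "F \<in> polys_over ((*) (cc \<pi>) ` A)" by (auto simp: polys_over_def image_iff)
     also have "\<dots> = map_poly ((*) (cc \<pi>)) ` polys_over A"
      using sub_ringD(1)[OF A] by (simp add: map_poly_image)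
     finally obtain F' where F': "F' \<in> polys_over A" "F = map_poly ((*) (cc \<pi>)) F'" by blast
     have "F = smult (cc \<pi>) F'" unfolding F'(2) by (rule poly_eqI) (simp add: coeff_map_poly)
     hence "cc \<pi> * (cc m' * b) = cc \<pi> * poly F' s1"
      using less.prems(4) unfolding m'(2) rhomD(4)[OF rhom_cc] by (simp add: mult.assoc)
     hence "cc m' * b = poly F' s1" using cc_nz[OF \<pi>] by simp
     thus ?thesis using less.hyps[OF m'(4) m'(1,3) F'(1)] by blast
    qed
   qed
   thus ?thesis using s1(3) b unfolding gen_def by blast
  qed
  have "\<exists>G\<in>?B. b = ins2 P s1 G" if bB: "b \<in> ?B" for b
  proof -
   obtain F where F: "F \<in> polys_over A" "b = poly F s1" using final[OF bB] by blast
   have "F \<in> polys_over (ins P ` polys_over (polys_over k))"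
    using F(1) A_ins by (auto simp: polys_over_def image_iff)
   also have "\<dots> = map_poly (ins P) ` ?B"
    using z by (simp add: map_poly_image rhomD(2)[OF rhom_ins] zero_polys_over)
   finally show ?thesis using F(2) by (auto simp: ins2_def)
  qed
  thus ?thesis using PB s1(1) DP by blast
 qed
qed

section \<open>Surjective substitutions are injective\<close>

definition subst3 :: "'a::comm_ring_1 poly poly poly \<Rightarrow> 'a poly poly poly \<Rightarrow> 'a poly poly poly
  \<Rightarrow> 'a poly poly poly \<Rightarrow> 'a poly poly poly"
 where "subst3 u0 u1 u2 F =
  poly (map_poly (\<lambda>G. poly (map_poly (\<lambda>c. poly (map_poly const3 c) u0) G) u1) F) u2"

lemma rhom_subst3: "rhom (subst3 u0 u1 u2)"
 unfolding subst3_def[abs_def] by (intro rhom_eval rhom_const3)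

lemma subst3_const: "subst3 u0 u1 u2 (const3 c) = const3 c"
 by (simp add: subst3_def cc_def map_poly_const)

lemma subst3_vars: "subst3 u0 u1 u2 xvar = u0" "subst3 u0 u1 u2 yvar = u1" "subst3 u0 u1 u2 zvar = u2"
 by (simp_all add: subst3_def cc_def map_poly_pCons_gen flip: one_pCons)

lemma space_induct [consumes 2, case_names const x y z add mult]:
 assumes S: "sub_ring k" and F: "F \<in> space_over k"
  and const: "\<And>c. c \<in> k ==> Q (const3 c)" and vars: "Q xvar" "Q yvar" "Q zvar"
  and add: "\<And>F G. F \<in> space_over k ==> G \<in> space_over k ==> Q F ==> Q G ==> Q (F + G)"
  and mult: "\<And>F G. F \<in> space_over k ==> G \<in> space_over k ==> Q F ==> Q G ==> Q (F * G)"
 shows "Q F"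
proof -
 note S1 = polys_over_sub_ring[OF S]
 note S2 = polys_over_sub_ring[OF S1]
 note z = sub_ringD(1)[OF S1] sub_ringD(1)[OF S2] sub_ringD(1)[OF polys_over_sub_ring[OF S2]]
 have 1: "Q [:[:p:]:]" if "p \<in> polys_over k" for p
  using S that
 proof (induction p rule: polys_over_induct)
  case (const a)
  thus ?case using assms(3)[of a] by (simp only: cc_def)
 next
  case var
  show ?case using vars(1) by (simp only: cc_def)
 next
  case (add p q)
  have "Q ([:[:p:]:] + [:[:q:]:])" by (rule assms(7)) (use add z in auto)
  thus ?case by simp
 next
  case (mult p q)
  have "Q ([:[:p:]:] * [:[:q:]:])" by (rule assms(8)) (use mult z in auto)
  thus ?case by (simp add: mult.commute)
 qed
 have 2: "Q [:p:]" if "p \<in> polys_over (polys_over k)" for p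
  using S1 that
 proof (induction p rule: polys_over_induct)
  case (const a)
  thus ?case by (rule 1)
 next
  case var
  show ?case by (rule vars(2))
 next
  case (add p q)
  have "Q ([:p:] + [:q:])" by (rule assms(7)) (use add z in auto)
  thus ?case by simp
 next
  case (mult p q)
  have "Q ([:p:] * [:q:])" by (rule assms(8)) (use mult z in auto)
  thus ?case by (simp add: mult.commute)
 qed
 show ?thesis
  using S2 F
 proof (induction F rule: polys_over_induct)
  case (const a)
  thus ?case by (rule 2)
 next
  case var
  show ?case by (rule vars(3))
 qed (fact add mult)+
qed

lemma subst3_eqI:
 assumes S: "sub_ring k" and F: "F \<in> space_over k" and h: "rhom h" and h': "rhom h'"
  and "\<And>c. c \<in> k ==> h (const3 c) = h' (const3 c)" "h xvar = h' xvar" "h yvar = h' yvar" "h zvar = h' zvar"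
 shows "h F = h' F"
 using S F by (induction F rule: space_induct) (simp_all add: assms rhomD[OF h] rhomD[OF h'])

lemma partial_derivatives:
 fixes c :: "'a::idom"
 shows "map_poly (map_poly pderiv) (const3 c) = 0" "map_poly pderiv (const3 c) = 0" "pderiv (const3 c) = 0"
  "map_poly (map_poly pderiv) xvar = (1 :: 'a poly poly poly)" "map_poly pderiv xvar = (0 :: 'a poly poly poly)"
  "pderiv xvar = (0 :: 'a poly poly poly)"
  "map_poly (map_poly pderiv) yvar = (0 :: 'a poly poly poly)" "map_poly pderiv yvar = (1 :: 'a poly poly poly)"
  "pderiv yvar = (0 :: 'a poly poly poly)"
  "map_poly (map_poly pderiv) zvar = (0 :: 'a poly poly poly)" "map_poly pderiv zvar = (0 :: 'a poly poly poly)"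
  "pderiv zvar = (1 :: 'a poly poly poly)"
 by (simp_all add: cc_def map_poly_pCons_gen pderiv_pCons one_pCons)

lemma chain_rule:
 fixes d :: "'a::idom poly poly poly \<Rightarrow> 'a poly poly poly"
 assumes d: "der d" and const: "\<And>c. d (const3 c) = 0"
 shows "d (subst3 u0 u1 u2 F) = subst3 u0 u1 u2 (map_poly (map_poly pderiv) F) * d u0 +
  subst3 u0 u1 u2 (map_poly pderiv F) * d u1 + subst3 u0 u1 u2 (pderiv F) * d u2"
proof -
 let ?\<phi> = "subst3 u0 u1 u2"
 note \<phi> = rhomD[OF rhom_subst3, of u0 u1 u2]
 note d0 = derD[OF der_map_poly[OF der_map_poly[OF der_pderiv]]]
 note d1 = derD[OF der_map_poly[OF der_pderiv]]
 note d2 = derD[OF der_pderiv]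
 have "F \<in> space_over UNIV" by simp
 with sub_ring_UNIV show ?thesis
 proof (induction F rule: space_induct)
  case (const c)
  thus ?case
   unfolding subst3_const partial_derivatives assms(2) \<phi>(2) by simp
 next
  case x
  thus ?case
   unfolding subst3_vars partial_derivatives \<phi>(1,2) by simp
 next
  case y
  thus ?case
   unfolding subst3_vars partial_derivatives \<phi>(1,2) by simp
 next
  case z
  thus ?case
   unfolding subst3_vars partial_derivatives \<phi>(1,2) by simp
 next
  case (add F G)
  show ?case unfolding \<phi>(3) derD(3)[OF d] d0(3) d1(3) d2(3) add(3,4) by (simp add: algebra_simps)
 next
  case (mult F G)
  show ?case unfolding \<phi>(3,4) derD(4)[OF d] d0(4) d1(4) d2(4) mult(3,4) by (simp add: algebra_simps)
 qed
qed

text \<open>The determinant of a square matrix with a right inverse is a nonzero divisor.\<close>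

lemma three_by_three:
 fixes a11 :: "'a::idom"
 assumes "a11*b11 + a12*b21 + a13*b31 = 1" "a11*b12 + a12*b22 + a13*b32 = 0" "a11*b13 + a12*b23 + a13*b33 = 0"
  and "a21*b11 + a22*b21 + a23*b31 = 0" "a21*b12 + a22*b22 + a23*b32 = 1" "a21*b13 + a22*b23 + a23*b33 = 0"
  and "a31*b11 + a32*b21 + a33*b31 = 0" "a31*b12 + a32*b22 + a33*b32 = 0" "a31*b13 + a32*b23 + a33*b33 = 1"
  and g: "g1*b11 + g2*b21 + g3*b31 = 0" "g1*b12 + g2*b22 + g3*b32 = 0" "g1*b13 + g2*b23 + g3*b33 = 0"
 shows "g1 = 0 \<and> g2 = 0 \<and> g3 = 0"
proof -
 define da where "da = a11*(a22*a33 - a23*a32) - a12*(a21*a33 - a23*a31) + a13*(a21*a32 - a22*a31)"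
 define db where "db = b11*(b22*b33 - b23*b32) - b12*(b21*b33 - b23*b31) + b13*(b21*b32 - b22*b31)"
 have "da * db =
  (a11*b11 + a12*b21 + a13*b31) * ((a21*b12 + a22*b22 + a23*b32) * (a31*b13 + a32*b23 + a33*b33)
   - (a21*b13 + a22*b23 + a23*b33) * (a31*b12 + a32*b22 + a33*b32))
  - (a11*b12 + a12*b22 + a13*b32) * ((a21*b11 + a22*b21 + a23*b31) * (a31*b13 + a32*b23 + a33*b33)
   - (a21*b13 + a22*b23 + a23*b33) * (a31*b11 + a32*b21 + a33*b31))
  + (a11*b13 + a12*b23 + a13*b33) * ((a21*b11 + a22*b21 + a23*b31) * (a31*b12 + a32*b22 + a33*b32)
   - (a21*b12 + a22*b22 + a23*b32) * (a31*b11 + a32*b21 + a33*b31))"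
  unfolding da_def db_def by (simp add: algebra_simps)
 also have "\<dots> = 1" unfolding assms(1-9) by simp
 finally have "db \<noteq> 0" by auto
 moreover have "g1 * db = (g1*b11 + g2*b21 + g3*b31) * (b22*b33 - b23*b32)
   - (g1*b12 + g2*b22 + g3*b32) * (b21*b33 - b23*b31) + (g1*b13 + g2*b23 + g3*b33) * (b21*b32 - b22*b31)"
  unfolding db_def by (simp add: algebra_simps)
 moreover have "g2 * db = - (g1*b11 + g2*b21 + g3*b31) * (b12*b33 - b13*b32)
   + (g1*b12 + g2*b22 + g3*b32) * (b11*b33 - b13*b31) - (g1*b13 + g2*b23 + g3*b33) * (b11*b32 - b12*b31)"
  unfolding db_def by (simp add: algebra_simps)
 moreover have "g3 * db = (g1*b11 + g2*b21 + g3*b31) * (b12*b23 - b13*b22)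
   - (g1*b12 + g2*b22 + g3*b32) * (b11*b23 - b13*b21) + (g1*b13 + g2*b23 + g3*b33) * (b11*b22 - b12*b21)"
  unfolding db_def by (simp add: algebra_simps)
 ultimately show ?thesis unfolding g by simp
qed

lemma pderiv_stable_constant:
 fixes J :: "'a::{idom, ring_char_0} poly set"
 assumes J: "\<And>p. p \<in> J ==> pderiv p \<in> J" and p: "p \<in> J" "p \<noteq> 0"
 shows "\<exists>c. c \<noteq> 0 \<and> [:c:] \<in> J"
 using p
proof (induction "degree p" arbitrary: p rule: less_induct)
 case less
 show ?case
 proof (cases "degree p = 0")
  case True
  thus ?thesis using less.prems by (metis degree_eq_zeroE pCons_eq_0_iff)
 next
  case False
  hence "pderiv p \<noteq> 0" "degree (pderiv p) < degree p" by (simp_all add: pderiv_eq_0_iff degree_pderiv)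
  thus ?thesis using less.hyps J less.prems(1) by blast
 qed
qed

text \<open>
 The kernel of a substitution that hits all variables is stable under the partial derivatives, by the
 chain rule and because the Jacobian matrix is invertible. A nonzero ideal with that property contains
 a nonzero constant.
\<close>

lemma subst3_inj:
 fixes u0 u1 u2 :: "'a::field_char_0 poly poly poly"
 assumes vars: "xvar = subst3 u0 u1 u2 F0" "yvar = subst3 u0 u1 u2 F1" "zvar = subst3 u0 u1 u2 F2"
  and G: "subst3 u0 u1 u2 G = 0"
 shows "G = 0"
proof (rule ccontr)
 assume "G \<noteq> 0"
 let ?\<phi> = "subst3 u0 u1 u2"
 let ?d0 = "map_poly (map_poly pderiv) :: 'a poly poly poly \<Rightarrow> 'a poly poly poly"
 let ?d1 = "map_poly pderiv :: 'a poly poly poly \<Rightarrow> 'a poly poly poly"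
 let ?d2 = "pderiv :: 'a poly poly poly \<Rightarrow> 'a poly poly poly"
 have der: "der ?d0" "der ?d1" "der ?d2" by (intro der_map_poly der_pderiv)+
 note const = partial_derivatives(1-3)
 note dvars = partial_derivatives(4-12)
 note ch = chain_rule[OF der(1) const(1), of u0 u1 u2] chain_rule[OF der(2) const(2), of u0 u1 u2]
  chain_rule[OF der(3) const(3), of u0 u1 u2]
 have stable: "?\<phi> (?d0 G) = 0 \<and> ?\<phi> (?d1 G) = 0 \<and> ?\<phi> (?d2 G) = 0" if "?\<phi> G = 0" for G
 proof (rule three_by_three)
  show "?\<phi> (?d0 F0) * ?d0 u0 + ?\<phi> (?d1 F0) * ?d0 u1 + ?\<phi> (?d2 F0) * ?d0 u2 = 1"
   "?\<phi> (?d0 F0) * ?d1 u0 + ?\<phi> (?d1 F0) * ?d1 u1 + ?\<phi> (?d2 F0) * ?d1 u2 = 0"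
   "?\<phi> (?d0 F0) * ?d2 u0 + ?\<phi> (?d1 F0) * ?d2 u1 + ?\<phi> (?d2 F0) * ?d2 u2 = 0"
   "?\<phi> (?d0 F1) * ?d0 u0 + ?\<phi> (?d1 F1) * ?d0 u1 + ?\<phi> (?d2 F1) * ?d0 u2 = 0"
   "?\<phi> (?d0 F1) * ?d1 u0 + ?\<phi> (?d1 F1) * ?d1 u1 + ?\<phi> (?d2 F1) * ?d1 u2 = 1"
   "?\<phi> (?d0 F1) * ?d2 u0 + ?\<phi> (?d1 F1) * ?d2 u1 + ?\<phi> (?d2 F1) * ?d2 u2 = 0"
   "?\<phi> (?d0 F2) * ?d0 u0 + ?\<phi> (?d1 F2) * ?d0 u1 + ?\<phi> (?d2 F2) * ?d0 u2 = 0"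
   "?\<phi> (?d0 F2) * ?d1 u0 + ?\<phi> (?d1 F2) * ?d1 u1 + ?\<phi> (?d2 F2) * ?d1 u2 = 0"
   "?\<phi> (?d0 F2) * ?d2 u0 + ?\<phi> (?d1 F2) * ?d2 u1 + ?\<phi> (?d2 F2) * ?d2 u2 = 1"
   unfolding ch[symmetric] vars[symmetric] dvars by (rule refl)+
  show "?\<phi> (?d0 G) * ?d0 u0 + ?\<phi> (?d1 G) * ?d0 u1 + ?\<phi> (?d2 G) * ?d0 u2 = 0"
   "?\<phi> (?d0 G) * ?d1 u0 + ?\<phi> (?d1 G) * ?d1 u1 + ?\<phi> (?d2 G) * ?d1 u2 = 0"
   "?\<phi> (?d0 G) * ?d2 u0 + ?\<phi> (?d1 G) * ?d2 u1 + ?\<phi> (?d2 G) * ?d2 u2 = 0"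
   unfolding ch[symmetric] that using derD(1)[OF der(1)] derD(1)[OF der(2)] derD(1)[OF der(3)] by blast+
 qed
 obtain p where p: "p \<noteq> 0" "?\<phi> [:p:] = 0"
  using pderiv_stable_constant[of "{G. ?\<phi> G = 0}" G] stable \<open>G \<noteq> 0\<close> G by auto
 have "\<exists>q. q \<noteq> 0 \<and> [:q:] \<in> {p. ?\<phi> [:p:] = 0}"
 proof (rule pderiv_stable_constant[of _ p])
  show "pderiv q \<in> {p. ?\<phi> [:p:] = 0}" if "q \<in> {p. ?\<phi> [:p:] = 0}" for q
   using stable[of "[:q:]"] that by (simp add: map_poly_const)
 qed (use p in auto)
 then obtain q where q: "q \<noteq> 0" "?\<phi> [:[:q:]:] = 0" by auto
 have "\<exists>c. c \<noteq> 0 \<and> [:c:] \<in> {q. ?\<phi> [:[:q:]:] = 0}"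
 proof (rule pderiv_stable_constant[of _ q])
  show "pderiv r \<in> {q. ?\<phi> [:[:q:]:] = 0}" if "r \<in> {q. ?\<phi> [:[:q:]:] = 0}" for r
   using stable[of "[:[:r:]:]"] that by (simp add: map_poly_const)
 qed (use q in auto)
 then obtain c where "c \<noteq> 0" "?\<phi> (const3 c) = 0" by (auto simp: cc_def)
 thus False by (simp add: subst3_const)
qed

section \<open>Embedding finitely many elements of a field into the complex numbers\<close>

text \<open>
 Subrings and subfields of the complex numbers are sets in a type, other rings have an explicit carrier. This is the notion
 of a homomorphism from the former to the latter.
\<close>

definition hom_on :: "'a::comm_ring_1 set \<Rightarrow> ('a \<Rightarrow> 'e) \<Rightarrow> ('e, 'm) ring_scheme \<Rightarrow> bool"
 where "hom_on S \<sigma> E \<longleftrightarrow> (\<forall>x\<in>S. \<sigma> x \<in> carrier E) \<and> \<sigma> 1 = \<one>\<^bsub>E\<^esub> \<and>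
  (\<forall>x\<in>S. \<forall>y\<in>S. \<sigma> (x + y) = \<sigma> x \<oplus>\<^bsub>E\<^esub> \<sigma> y \<and> \<sigma> (x * y) = \<sigma> x \<otimes>\<^bsub>E\<^esub> \<sigma> y)"

lemma hom_onD:
 assumes "hom_on S \<sigma> E"
 shows "x \<in> S ==> \<sigma> x \<in> carrier E" "\<sigma> 1 = \<one>\<^bsub>E\<^esub>"
  "x \<in> S ==> y \<in> S ==> \<sigma> (x + y) = \<sigma> x \<oplus>\<^bsub>E\<^esub> \<sigma> y"
  "x \<in> S ==> y \<in> S ==> \<sigma> (x * y) = \<sigma> x \<otimes>\<^bsub>E\<^esub> \<sigma> y"
 using assms by (auto simp: hom_on_def)

lemma hom_on_zero:
 assumes "hom_on S \<sigma> E" "sub_ring S" "ring E"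
 shows "\<sigma> 0 = \<zero>\<^bsub>E\<^esub>"
proof -
 interpret ring E by fact
 have 0: "0 \<in> S" using sub_ringD(1)[OF assms(2)] .
 have "\<sigma> 0 \<oplus>\<^bsub>E\<^esub> \<sigma> 0 = \<sigma> 0" using hom_onD(3)[OF assms(1) 0 0] by simp
 thus ?thesis using hom_onD(1)[OF assms(1) 0] by (metis l_zero r_zero add.l_cancel zero_closed)
qed

lemma hom_on_diff:
 fixes E (structure)
 assumes h: "hom_on S \<sigma> E" and S: "sub_ring S" and E: "ring E" and xy: "x \<in> S" "y \<in> S"
 shows "\<sigma> (x - y) = \<sigma> x \<ominus> \<sigma> y" "\<sigma> (- y) = \<ominus> \<sigma> y"
proof -
 interpret ring E by fact
 have "\<sigma> (- y) \<oplus> \<sigma> y = \<zero>"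
  using hom_onD(3)[OF h sub_ringD(6)[OF S xy(2)] xy(2)] hom_on_zero[OF h S E] by simp
 thus neg: "\<sigma> (- y) = \<ominus> \<sigma> y"
  using hom_onD(1)[OF h xy(2)] hom_onD(1)[OF h sub_ringD(6)[OF S xy(2)]] minus_equality by metis
 show "\<sigma> (x - y) = \<sigma> x \<ominus> \<sigma> y"
  using hom_onD(3)[OF h xy(1) sub_ringD(6)[OF S xy(2)]] neg by (simp add: a_minus_def)
qed

text \<open>The extension of \<open>\<sigma>\<close> to polynomials that sends the variable to \<open>e\<close>.\<close>

definition heval :: "('e, 'm) ring_scheme \<Rightarrow> ('a::comm_ring_1 \<Rightarrow> 'e) \<Rightarrow> 'e \<Rightarrow> 'a poly \<Rightarrow> 'e"
 where "heval E \<sigma> e p = fold_coeffs (\<lambda>a v. \<sigma> a \<oplus>\<^bsub>E\<^esub> e \<otimes>\<^bsub>E\<^esub> v) p \<zero>\<^bsub>E\<^esub>"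

locale polynomial_evaluation = E: cring E for E :: "('e, 'm) ring_scheme" (structure) +
 fixes S :: "'a::comm_ring_1 set" and \<sigma> :: "'a \<Rightarrow> 'e" and e :: 'e
 assumes S: "sub_ring S" and \<sigma>: "hom_on S \<sigma> E" and e: "e \<in> carrier E"
begin

lemma S1: "sub_ring (polys_over S)"
 by (rule polys_over_sub_ring[OF S])

lemma \<sigma>0: "\<sigma> 0 = \<zero>"
 by (rule hom_on_zero[OF \<sigma> S E.ring_axioms])

lemma heval_0 [simp]: "heval E \<sigma> e 0 = \<zero>"
 by (simp add: heval_def)

lemma heval_pCons: "heval E \<sigma> e (pCons a p) = \<sigma> a \<oplus> e \<otimes> heval E \<sigma> e p"
proof (cases "a = 0 \<and> p = 0")
 case True
 thus ?thesis using e by (simp add: \<sigma>0)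
next
 case False
 thus ?thesis by (auto simp: heval_def)
qed

lemma heval_closed: "p \<in> polys_over S ==> heval E \<sigma> e p \<in> carrier E"
 by (induction p) (auto simp: heval_pCons e hom_onD(1)[OF \<sigma>])

lemma heval_const: "a \<in> S ==> heval E \<sigma> e [:a:] = \<sigma> a"
 using e hom_onD(1)[OF \<sigma>] by (simp add: heval_pCons)

lemma heval_var: "heval E \<sigma> e [:0, 1:] = e"
 using e by (simp add: heval_pCons \<sigma>0 hom_onD(2)[OF \<sigma>])

lemma heval_add:
 assumes "p \<in> polys_over S" "q \<in> polys_over S"
 shows "heval E \<sigma> e (p + q) = heval E \<sigma> e p \<oplus> heval E \<sigma> e q"
 using assms
proof (induction p arbitrary: q)
 case 0
 thus ?case by (simp add: heval_closed)
next
 case (pCons a p)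
 obtain b r where q: "q = pCons b r" by (cases q)
 have *: "a \<in> S" "b \<in> S" "p \<in> polys_over S" "r \<in> polys_over S" using pCons.prems q by auto
 have c: "\<sigma> a \<in> carrier E" "\<sigma> b \<in> carrier E" "heval E \<sigma> e p \<in> carrier E" "heval E \<sigma> e r \<in> carrier E"
  using * heval_closed hom_onD(1)[OF \<sigma>] by auto
 show ?case
  using * c e by (simp add: q heval_pCons pCons.IH hom_onD(3)[OF \<sigma>] E.r_distr E.a_ac)
qed

lemma heval_smult:
 assumes "a \<in> S" "p \<in> polys_over S"
 shows "heval E \<sigma> e (smult a p) = \<sigma> a \<otimes> heval E \<sigma> e p"
 using assms(2)
proof (induction p)
 case 0
 thus ?case using hom_onD(1)[OF \<sigma> assms(1)] by simp
next
 case (pCons b p)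
 hence *: "b \<in> S" "p \<in> polys_over S" by auto
 have c: "\<sigma> a \<in> carrier E" "\<sigma> b \<in> carrier E" "heval E \<sigma> e p \<in> carrier E"
  using * heval_closed hom_onD(1)[OF \<sigma>] assms(1) by auto
 show ?case
  using * c e by (simp add: heval_pCons pCons.IH hom_onD(4)[OF \<sigma> assms(1)] E.r_distr E.m_lcomm)
qed

lemma heval_mult:
 assumes "p \<in> polys_over S" "q \<in> polys_over S"
 shows "heval E \<sigma> e (p * q) = heval E \<sigma> e p \<otimes> heval E \<sigma> e q"
 using assms(1)
proof (induction p)
 case 0
 thus ?case using heval_closed[OF assms(2)] by simp
next
 case (pCons a p)
 hence *: "a \<in> S" "p \<in> polys_over S" by auto
 have c: "\<sigma> a \<in> carrier E" "heval E \<sigma> e p \<in> carrier E" "heval E \<sigma> e q \<in> carrier E"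
  using * heval_closed hom_onD(1)[OF \<sigma>] assms by auto
 have pq: "p * q \<in> polys_over S" using sub_ringD(5)[OF S1 *(2) assms(2)] .
 have "heval E \<sigma> e (pCons a p * q) = heval E \<sigma> e (smult a q) \<oplus> heval E \<sigma> e (pCons 0 (p * q))"
  using smult_polys_over[OF S *(1) assms(2)] pq sub_ringD(1)[OF S] by (simp add: heval_add)
 also have "\<dots> = \<sigma> a \<otimes> heval E \<sigma> e q \<oplus> e \<otimes> (heval E \<sigma> e p \<otimes> heval E \<sigma> e q)"
  using * c e by (simp add: heval_smult assms heval_pCons pCons.IH \<sigma>0)
 also have "\<dots> = heval E \<sigma> e (pCons a p) \<otimes> heval E \<sigma> e q"
  using * c e by (simp add: heval_pCons E.l_distr E.m_assoc)
 finally show ?case .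
qed

lemma heval_hom_on: "hom_on (polys_over S) (heval E \<sigma> e) E"
 unfolding hom_on_def
 using heval_closed heval_add heval_mult heval_const[OF sub_ringD(2)[OF S]] hom_onD(2)[OF \<sigma>]
 by (auto simp: one_pCons)

end

lemma countable_polys_over:
 assumes "countable S"
 shows "countable (polys_over S)"
proof -
 have "polys_over S \<subseteq> Poly ` lists S"
 proof
  fix p assume p: "p \<in> polys_over S"
  hence "set (coeffs p) \<subseteq> S" by (auto simp: coeffs_def polys_over_def)
  hence "coeffs p \<in> lists S" by auto
  moreover have "p = Poly (coeffs p)" by simp
  ultimately show "p \<in> Poly ` lists S" by (rule rev_image_eqI)
 qed
 thus ?thesis by (rule countable_subset) (intro countable_image countable_lists assms)
qed

lemma exists_transcendental:
 fixes k :: "complex set"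
 assumes "countable k"
 shows "\<exists>\<tau>. transcendental_over k \<tau>"
proof -
 define Alg where "Alg = (\<Union>p\<in>polys_over k - {0}. {z. poly p z = 0})"
 have "countable Alg"
  unfolding Alg_def using countable_polys_over[OF assms]
  by (intro countable_UN) (auto intro: countable_finite poly_roots_finite)
 moreover have "uncountable (UNIV :: complex set)"
 proof
  assume "countable (UNIV :: complex set)"
  hence "countable (Re ` UNIV)" by blast
  moreover have "Re ` UNIV = UNIV" by (metis Re_complex_of_real surjI)
  ultimately show False using uncountable_UNIV_real by simp
 qed
 ultimately obtain \<tau> where "\<tau> \<notin> Alg" by (metis UNIV_eq_I)
 thus ?thesis by (auto simp: Alg_def transcendental_over_def)
qed

text \<open>
 One more element \<open>e\<close> can be reached: it is matched with a transcendental number or with a root of its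
 minimal polynomial.
\<close>

lemma embedding_step:
 fixes F :: "('e, 'm) ring_scheme" (structure) and k :: "complex set"
 assumes F: "field F" and k: "sub_field k" "countable k" and \<sigma>: "hom_on k \<sigma> F" and e: "e \<in> carrier F"
 shows "\<exists>(k' :: complex set) \<sigma>'. sub_field k' \<and> countable k' \<and> hom_on k' \<sigma>' F \<and> insert e (\<sigma> ` k) \<subseteq> \<sigma>' ` k'"
proof -
 interpret F: field F by fact
 note S = sub_fieldD(1)[OF k(1)]
 interpret P: polynomial_evaluation F k \<sigma> e
  by unfold_locales (fact S \<sigma> e)+
 let ?ev = "heval F \<sigma> e"
 note S1 = P.S1
 have \<sigma>_inj: "c = 0" if "c \<in> k" "\<sigma> c = \<zero>" for c
 proof (rule ccontr)
  assume "c \<noteq> 0"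
  hence "\<sigma> c \<otimes> \<sigma> (inverse c) = \<one>"
   using that hom_onD(2,4)[OF \<sigma>] sub_fieldD(2)[OF k(1)] by (metis right_inverse)
  thus False using that(2) hom_onD(1)[OF \<sigma> sub_fieldD(2)[OF k(1) that(1)]] by simp
 qed
 have "\<exists>\<theta>. \<forall>p\<in>polys_over k. ?ev p = \<zero> \<longleftrightarrow> poly p \<theta> = 0"
 proof (cases "\<exists>p\<in>polys_over k. p \<noteq> 0 \<and> ?ev p = \<zero>")
  case False
  obtain \<theta> where "transcendental_over k \<theta>" using exists_transcendental[OF k(2)] by blast
  thus ?thesis using False unfolding transcendental_over_def by (metis P.heval_0 poly_0)
 next
  case True
  then obtain p where p: "p \<in> polys_over k" "p \<noteq> 0" "?ev p = \<zero>"
   and min: "\<And>q. q \<in> polys_over k ==> q \<noteq> 0 ==> ?ev q = \<zero> ==> degree p \<le> degree q"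
   using ex_has_least_nat[of "\<lambda>p. p \<in> polys_over k \<and> p \<noteq> 0 \<and> ?ev p = \<zero>" _ degree] by blast
  have "degree p \<noteq> 0"
  proof
   assume "degree p = 0"
   then obtain c where "p = [:c:]" by (rule degree_eq_zeroE)
   thus False using p \<sigma>_inj[of c] P.heval_const[of c] by simp
  qed
  then obtain \<theta> where \<theta>: "poly p \<theta> = 0"
   using fundamental_theorem_of_algebra[of p] by (auto simp: constant_degree)
  obtain \<pi> where \<pi>: "minimal_over k \<theta> \<pi>" using minimal_over_exists[OF k(1) p(1,2) \<theta>] by blast
  have \<pi>': "\<pi> \<in> polys_over k" "degree \<pi> > 0" using \<pi> by (auto simp: minimal_over_def)
  obtain p' where p': "p' \<in> polys_over k" "p = \<pi> * p'" using \<pi> p(1) \<theta> by (auto simp: minimal_over_def)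
  have "p' \<noteq> 0" using p' p(2) by auto
  hence "degree p' < degree p" using \<pi>' unfolding p'(2) by (subst degree_mult_eq) auto
  hence "?ev p' \<noteq> \<zero>" using min[OF p'(1) \<open>p' \<noteq> 0\<close>] by auto
  moreover have "?ev \<pi> \<otimes> ?ev p' = \<zero>"
   using p(3) P.heval_mult[OF \<pi>'(1) p'(1)] p'(2) by simp
  ultimately have ev\<pi>: "?ev \<pi> = \<zero>"
   using F.integral P.heval_closed[OF \<pi>'(1)] P.heval_closed[OF p'(1)] by blast
  have "?ev q = \<zero> \<longleftrightarrow> poly q \<theta> = 0" if q: "q \<in> polys_over k" for q
  proof
   assume 0: "?ev q = \<zero>"
   obtain u r where ur: "u \<in> polys_over k" "r \<in> polys_over k" "q = p * u + r" "r = 0 \<or> degree r < degree p"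
    using polys_over_division[OF k(1) p(1,2) q] by blast
   have "?ev q = ?ev p \<otimes> ?ev u \<oplus> ?ev r"
    unfolding ur(3) using ur p(1) sub_ringD(5)[OF S1] by (simp add: P.heval_add P.heval_mult)
   hence "?ev r = \<zero>" using 0 p(3) P.heval_closed ur(1,2) by simp
   hence "r = 0" using min[OF ur(2)] ur(4) by fastforce
   thus "poly q \<theta> = 0" using ur(3) \<theta> by simp
  next
   assume "poly q \<theta> = 0"
   then obtain u where "u \<in> polys_over k" "q = \<pi> * u" using \<pi> q by (auto simp: minimal_over_def)
   thus "?ev q = \<zero>" using P.heval_mult[OF \<pi>'(1)] ev\<pi> P.heval_closed by simp
  qed
  thus ?thesis by blast
 qed
 then obtain \<theta> where \<theta>: "\<And>p. p \<in> polys_over k ==> ?ev p = \<zero> \<longleftrightarrow> poly p \<theta> = 0" by blast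
 define k' where "k' = frac_field k \<theta>"
 have k': "sub_field k'" unfolding k'_def by (rule frac_field_sub_field[OF S])
 have "k' \<subseteq> (\<lambda>(p, q). poly p \<theta> / poly q \<theta>) ` (polys_over k \<times> polys_over k)"
  unfolding k'_def frac_field_def by auto
 hence countable: "countable k'"
  using countable_polys_over[OF k(2)] by (meson countable_SIGMA countable_image countable_subset)
 define rep where "rep x y \<longleftrightarrow> (\<exists>p\<in>polys_over k. \<exists>q\<in>polys_over k. poly q \<theta> \<noteq> 0 \<and>
   x = poly p \<theta> / poly q \<theta> \<and> y \<in> carrier F \<and> y \<otimes> ?ev q = ?ev p)" for x y
 have rep_ex: "\<exists>y. rep x y" if x: "x \<in> k'" for x
 proof -
  obtain p q where pq: "p \<in> polys_over k" "q \<in> polys_over k" "poly q \<theta> \<noteq> 0" "x = poly p \<theta> / poly q \<theta>"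
   using x unfolding k'_def frac_field_def by blast
  have c: "?ev p \<in> carrier F" "?ev q \<in> carrier F" "?ev q \<noteq> \<zero>"
   using pq \<theta> P.heval_closed by auto
  hence "inv (?ev q) \<in> carrier F" "inv (?ev q) \<otimes> ?ev q = \<one>"
   using F.field_Units by auto
  hence "(?ev p \<otimes> inv (?ev q)) \<otimes> ?ev q = ?ev p" "?ev p \<otimes> inv (?ev q) \<in> carrier F"
   using c by (simp_all add: F.m_assoc)
  thus ?thesis unfolding rep_def using pq by blast
 qed
 have rep_uniq: "y = y'" if y: "rep x y" "rep x y'" for x y y'
 proof -
  obtain p q where pq: "p \<in> polys_over k" "q \<in> polys_over k" "poly q \<theta> \<noteq> 0" "x = poly p \<theta> / poly q \<theta>"
   "y \<in> carrier F" "y \<otimes> ?ev q = ?ev p" using y(1) unfolding rep_def by blast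
  obtain p' q' where pq': "p' \<in> polys_over k" "q' \<in> polys_over k" "poly q' \<theta> \<noteq> 0" "x = poly p' \<theta> / poly q' \<theta>"
   "y' \<in> carrier F" "y' \<otimes> ?ev q' = ?ev p'" using y(2) unfolding rep_def by blast
  have cl: "?ev p \<in> carrier F" "?ev q \<in> carrier F" "?ev p' \<in> carrier F" "?ev q' \<in> carrier F"
   using pq pq' P.heval_closed by auto
  have in_k: "p * q' \<in> polys_over k" "p' * q \<in> polys_over k" "q * q' \<in> polys_over k"
   using pq pq' sub_ringD(5)[OF S1] by auto
  have "poly (p * q' - p' * q) \<theta> = 0" using pq pq' by (simp add: field_simps)
  hence "?ev (p * q' - p' * q) = \<zero>" using \<theta> sub_ringD(4)[OF S1 in_k(1,2)] by blast
  hence "?ev (p * q') \<ominus> ?ev (p' * q) = \<zero>"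
   using hom_on_diff(1)[OF P.heval_hom_on S1 F.ring_axioms in_k(1,2)] by simp
  hence "?ev p \<otimes> ?ev q' = ?ev p' \<otimes> ?ev q"
   using pq pq' cl by (simp add: P.heval_mult)
  hence "(y \<otimes> ?ev q) \<otimes> ?ev q' = (y' \<otimes> ?ev q') \<otimes> ?ev q" using pq(6) pq'(6) by simp
  hence "(?ev q \<otimes> ?ev q') \<otimes> y = (?ev q \<otimes> ?ev q') \<otimes> y'"
   using cl pq(5) pq'(5) by (simp add: F.m_ac)
  moreover have "?ev q \<otimes> ?ev q' \<noteq> \<zero>"
   using \<theta>[OF pq(2)] \<theta>[OF pq'(2)] pq(3) pq'(3) cl F.integral by blast
  ultimately show "y = y'" using F.m_lcancel cl pq(5) pq'(5) by (metis F.m_closed)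
 qed
 define \<sigma>' where "\<sigma>' x = (SOME y. rep x y)" for x
 have \<sigma>': "rep x (\<sigma>' x)" if "x \<in> k'" for x unfolding \<sigma>'_def using rep_ex[OF that] by (rule someI_ex)
 have \<sigma>'_eq: "\<sigma>' x = y" if "x \<in> k'" "rep x y" for x y using rep_uniq[OF \<sigma>'[OF that(1)] that(2)] .
 have \<sigma>'_poly: "\<sigma>' (poly p \<theta>) = ?ev p" if p: "p \<in> polys_over k" for p
 proof (rule \<sigma>'_eq)
  show "poly p \<theta> \<in> k'" unfolding k'_def by (rule ev_image_frac_field[OF S p])
  have "?ev 1 = \<one>" by (rule hom_onD(2)[OF P.heval_hom_on])
  thus "rep (poly p \<theta>) (?ev p)"
   unfolding rep_def using p P.heval_closed[OF p] sub_ringD(2)[OF S1]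
   by (intro bexI[of _ p] bexI[of _ 1]) auto
 qed
 have "hom_on k' \<sigma>' F"
  unfolding hom_on_def
 proof (intro conjI ballI)
  show "\<sigma>' x \<in> carrier F" if "x \<in> k'" for x using \<sigma>'[OF that] by (auto simp: rep_def)
  show "\<sigma>' 1 = \<one>" using \<sigma>'_poly[OF sub_ringD(2)[OF S1]] hom_onD(2)[OF P.heval_hom_on] by simp
  fix x y assume x: "x \<in> k'" and y: "y \<in> k'"
  obtain p q where pq: "p \<in> polys_over k" "q \<in> polys_over k" "poly q \<theta> \<noteq> 0" "x = poly p \<theta> / poly q \<theta>"
   "\<sigma>' x \<in> carrier F" "\<sigma>' x \<otimes> ?ev q = ?ev p" using \<sigma>'[OF x] unfolding rep_def by blast
  obtain p' q' where pq': "p' \<in> polys_over k" "q' \<in> polys_over k" "poly q' \<theta> \<noteq> 0" "y = poly p' \<theta> / poly q' \<theta>"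
   "\<sigma>' y \<in> carrier F" "\<sigma>' y \<otimes> ?ev q' = ?ev p'" using \<sigma>'[OF y] unfolding rep_def by blast
  have cl: "?ev p \<in> carrier F" "?ev q \<in> carrier F" "?ev p' \<in> carrier F" "?ev q' \<in> carrier F"
   using pq pq' P.heval_closed by auto
  have in_k: "p * q' \<in> polys_over k" "p' * q \<in> polys_over k" "q * q' \<in> polys_over k" "p * p' \<in> polys_over k"
   using pq pq' sub_ringD(5)[OF S1] by auto
  show "\<sigma>' (x + y) = \<sigma>' x \<oplus> \<sigma>' y"
  proof (rule \<sigma>'_eq)
   show "x + y \<in> k'" using sub_ringD(3)[OF sub_fieldD(1)[OF k']] x y .
   have "(\<sigma>' x \<oplus> \<sigma>' y) \<otimes> ?ev (q * q') =
     (\<sigma>' x \<otimes> ?ev q) \<otimes> ?ev q' \<oplus> (\<sigma>' y \<otimes> ?ev q') \<otimes> ?ev q"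
   proof -
    have y: "y \<otimes> (v \<otimes> w) = (y \<otimes> w) \<otimes> v"
     if "y \<in> carrier F" "v \<in> carrier F" "w \<in> carrier F" for y v w
     using that by (simp add: F.m_ac)
    show ?thesis
     unfolding P.heval_mult[OF pq(2) pq'(2)]
     using pq(5) pq'(5) cl y[of "\<sigma>' y" "?ev q" "?ev q'"] by (simp add: F.l_distr F.m_assoc)
   qed
   also have "\<dots> = ?ev (p * q' + p' * q)"
    unfolding pq(6) pq'(6) using pq(1-3,5) pq'(1-3,5) cl in_k by (simp add: P.heval_mult P.heval_add)
   finally have "(\<sigma>' x \<oplus> \<sigma>' y) \<otimes> ?ev (q * q') = ?ev (p * q' + p' * q)" .
   moreover have "x + y = poly (p * q' + p' * q) \<theta> / poly (q * q') \<theta>"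
    using pq(3,4) pq'(3,4) by (simp add: add_frac_eq)
   ultimately show "rep (x + y) (\<sigma>' x \<oplus> \<sigma>' y)"
    unfolding rep_def using pq(3,5) pq'(3,5) in_k sub_ringD(3)[OF S1]
    by (intro bexI[of _ "p * q' + p' * q"] bexI[of _ "q * q'"]) auto
  qed
  show "\<sigma>' (x * y) = \<sigma>' x \<otimes> \<sigma>' y"
  proof (rule \<sigma>'_eq)
   show "x * y \<in> k'" using sub_ringD(5)[OF sub_fieldD(1)[OF k']] x y .
   have "(\<sigma>' x \<otimes> \<sigma>' y) \<otimes> ?ev (q * q') = (\<sigma>' x \<otimes> ?ev q) \<otimes> (\<sigma>' y \<otimes> ?ev q')"
    using pq(1-3,5) pq'(1-3,5) cl by (simp add: P.heval_mult F.m_ac)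
   also have "\<dots> = ?ev (p * p')"
    unfolding pq(6) pq'(6) using pq(1-3,5) pq'(1-3,5) by (simp add: P.heval_mult)
   finally have "(\<sigma>' x \<otimes> \<sigma>' y) \<otimes> ?ev (q * q') = ?ev (p * p')" .
   moreover have "x * y = poly (p * p') \<theta> / poly (q * q') \<theta>" using pq(4) pq'(4) by simp
   ultimately show "rep (x * y) (\<sigma>' x \<otimes> \<sigma>' y)"
    unfolding rep_def using pq(3,5) pq'(3,5) in_k
    by (intro bexI[of _ "p * p'"] bexI[of _ "q * q'"]) auto
  qed
 qed
 moreover have "insert e (\<sigma> ` k) \<subseteq> \<sigma>' ` k'"
 proof
  fix y assume "y \<in> insert e (\<sigma> ` k)"
  then consider "y = e" | c where "c \<in> k" "y = \<sigma> c" by blast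
  then obtain p where "p \<in> polys_over k" "y = ?ev p"
  proof cases
   case 1
   thus ?thesis using that[of "[:0, 1:]"] P.heval_var sub_ringD(1,2)[OF S] by (simp add: zero_polys_over)
  next
   case 2
   thus ?thesis using that[of "[:c:]"] P.heval_const[of c] by (simp add: zero_polys_over sub_ringD(1)[OF S])
  qed
  hence "y = \<sigma>' (poly p \<theta>)" "poly p \<theta> \<in> k'"
   using \<sigma>'_poly ev_image_frac_field[OF S] by (auto simp: k'_def)
  thus "y \<in> \<sigma>' ` k'" by blast
 qed
 ultimately show ?thesis using k' countable by (intro exI[of _ k'] exI[of _ \<sigma>'] conjI)
qed

text \<open>
 The Lefschetz principle in the form that is needed: finitely many elements of a field of
 characteristic zero lie in a subfield that is isomorphic to a subfield of the complex numbers.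
\<close>

lemma embedding_into_complex:
 assumes F: "field F" and h: "h \<in> ring_hom rat_ring F" and H: "finite H" "H \<subseteq> carrier F"
 shows "\<exists>(k :: complex set) \<sigma>. sub_field k \<and> countable k \<and> hom_on k \<sigma> F \<and> H \<subseteq> \<sigma> ` k"
 using H
proof (induction H rule: finite_induct)
 case empty
 define r where "r = (inv_into UNIV of_rat :: complex \<Rightarrow> rat)"
 have r: "r (of_rat q) = q" for q unfolding r_def by (rule inv_f_f) (simp add: inj_def)
 let ?k = "range of_rat :: complex set"
 have "sub_field ?k"
  unfolding sub_field_def sub_ring_def
 proof (intro conjI ballI)
  show "1 \<in> ?k" by (metis of_rat_1 rangeI)
  fix x y :: complex assume "x \<in> ?k" "y \<in> ?k"
  then obtain p q where "x = of_rat p" "y = of_rat q" by auto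
  thus "x - y \<in> ?k" "x * y \<in> ?k" by (metis of_rat_diff of_rat_mult rangeI)+
 next
  fix x :: complex assume "x \<in> ?k"
  thus "inverse x \<in> ?k" by (metis of_rat_inverse rangeI imageE)
 qed
 moreover have "countable ?k" by simp
 moreover have "hom_on ?k (h \<circ> r) F"
  using ring_hom_memE[OF h] unfolding hom_on_def
  by (auto simp: r of_rat_add[symmetric] of_rat_mult[symmetric] simp del: of_rat_add of_rat_mult)
   (metis of_rat_1 r)
 ultimately show ?case by blast
next
 case (insert e H)
 then obtain k \<sigma> where k: "sub_field (k :: complex set)" "countable k" "hom_on k \<sigma> F" "H \<subseteq> \<sigma> ` k" by auto
 then obtain k' \<sigma>' where "sub_field (k' :: complex set)" "countable k'" "hom_on k' \<sigma>' F" "insert e (\<sigma> ` k) \<subseteq> \<sigma>' ` k'"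
  using embedding_step[OF F k(1-3), of e] insert.prems by blast
 moreover from this have "insert e H \<subseteq> \<sigma>' ` k'" using k(4) by (meson insert_mono subset_trans)
 ultimately show ?case by blast
qed

section \<open>Polynomial algebras and coordinate systems\<close>

lemma finite_submultisets: "finite {k. k \<subseteq># m}"
proof (induction m)
 case empty
 thus ?case by simp
next
 case (add x m)
 have "{k. k \<subseteq># add_mset x m} \<subseteq> {k. k \<subseteq># m} \<union> add_mset x ` {k. k \<subseteq># m}"
 proof
  fix k assume "k \<in> {k. k \<subseteq># add_mset x m}"
  hence k: "k \<subseteq># add_mset x m" by simp
  show "k \<in> {k. k \<subseteq># m} \<union> add_mset x ` {k. k \<subseteq># m}"
  proof (cases "x \<in># k")
   case True
   hence "k = add_mset x (k - {#x#})" by simp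
   moreover from this have "k - {#x#} \<subseteq># m" using k by (metis mset_subset_eq_add_mset_cancel)
   ultimately show ?thesis by blast
  next
   case False
   hence "k \<subseteq># m" using k by (metis diff_single_trivial subset_eq_diff_conv add_mset_add_single)
   thus ?thesis by blast
  qed
 qed
 thus ?case using add.IH by (meson finite_UnI finite_imageI finite_subset)
qed

lemma mpoly_algebra_simps:
 "carrier (mpoly_algebra C n) = ring.indexed_pset C {..<n} (carrier C)"
 "\<one>\<^bsub>mpoly_algebra C n\<^esub> = ring.indexed_const C \<one>\<^bsub>C\<^esub>"
 "\<zero>\<^bsub>mpoly_algebra C n\<^esub> = ring.indexed_const C \<zero>\<^bsub>C\<^esub>"
 "p \<oplus>\<^bsub>mpoly_algebra C n\<^esub> q = ring.indexed_padd C p q"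
 "c \<odot>\<^bsub>mpoly_algebra C n\<^esub> p = (\<lambda>m. c \<otimes>\<^bsub>C\<^esub> p m)"
 by (simp_all add: mpoly_algebra_def)

lemma mpoly_algebra_mult:
 "(p \<otimes>\<^bsub>mpoly_algebra C n\<^esub> q) m = (\<Oplus>\<^bsub>C\<^esub>k\<in>{k. k \<subseteq># m}. p k \<otimes>\<^bsub>C\<^esub> q (m - k))"
 by (simp add: mpoly_algebra_def)

context cring
begin

lemma indexed_var_eq: "indexed_var i = (\<lambda>m. if m = {#i#} then \<one> else \<zero>)"
proof
 fix m
 have "i \<in># m \<and> m - {#i#} = {#} \<longleftrightarrow> m = {#i#}"
  by (metis add_mset_diff_bothsides diff_empty insert_DiffM union_single_eq_member add.left_neutral add_mset_add_single)
 thus "indexed_var i m = (if m = {#i#} then \<one> else \<zero>)"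
  by (auto simp: indexed_var_def indexed_pmult_def indexed_const_def)
qed

lemma mpoly_mult_var:
 assumes p: "carrier_coeff p"
 shows "p \<otimes>\<^bsub>mpoly_algebra R n\<^esub> indexed_var i = indexed_pmult p i"
proof
 fix m
 have cl: "p k \<in> carrier R" for k using p by (simp add: carrier_coeff_def)
 have "(p \<otimes>\<^bsub>mpoly_algebra R n\<^esub> indexed_var i) m =
   (\<Oplus>k\<in>{k. k \<subseteq># m}. p k \<otimes> (if m - k = {#i#} then \<one> else \<zero>))"
  by (simp add: mpoly_algebra_mult indexed_var_eq)
 also have "\<dots> = indexed_pmult p i m"
 proof (cases "i \<in># m")
  case True
  have "(\<Oplus>k\<in>{k. k \<subseteq># m}. p k \<otimes> (if m - k = {#i#} then \<one> else \<zero>)) =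
    (\<Oplus>k\<in>{k. k \<subseteq># m}. if k = m - {#i#} then p k else \<zero>)"
  proof (rule add.finprod_cong')
   fix k assume "k \<in> {k. k \<subseteq># m}"
   hence "m - k = {#i#} \<longleftrightarrow> k = m - {#i#}"
    using True by (metis mem_Collect_eq diff_subset_eq_self multiset_diff_union_assoc subset_mset.diff_add add_diff_cancel_left' single_subset_iff add_diff_cancel_right' diff_union_swap2 add.commute)
   thus "p k \<otimes> (if m - k = {#i#} then \<one> else \<zero>) = (if k = m - {#i#} then p k else \<zero>)"
    using cl by auto
  qed (use cl in auto)
  also have "\<dots> = p (m - {#i#})"
   by (rule add.finprod_singleton_swap) (use cl finite_submultisets in auto)
  finally show ?thesis using True by (simp add: indexed_pmult_def)
 next
  case False
  have "m - k \<noteq> {#i#}" for k using False by (metis in_diffD union_single_eq_member add_mset_add_single empty_neutral(1))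
  hence "(\<Oplus>k\<in>{k. k \<subseteq># m}. p k \<otimes> (if m - k = {#i#} then \<one> else \<zero>)) = (\<Oplus>k\<in>{k. k \<subseteq># m}. \<zero>)"
   using cl by simp
  thus ?thesis using False by (simp add: indexed_pmult_def)
 qed
 finally show "(p \<otimes>\<^bsub>mpoly_algebra R n\<^esub> indexed_var i) m = indexed_pmult p i m" .
qed

lemma var_in_mpoly: "i < n ==> indexed_var i \<in> carrier (mpoly_algebra R n)"
 unfolding mpoly_algebra_simps indexed_var_def
 by (intro indexed_pset.indexed_pmult indexed_pset.indexed_const) auto

lemma const_in_mpoly: "c \<in> carrier R ==> indexed_const c \<in> carrier (mpoly_algebra R n)"
 unfolding mpoly_algebra_simps by (rule indexed_pset.indexed_const)

lemma mpoly_coeff: "p \<in> carrier (mpoly_algebra R n) ==> carrier_coeff p"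
 unfolding mpoly_algebra_simps by (rule indexed_pset_in_carrier) auto

end

definition mpoly_iso :: "('c, 'x) ring_scheme \<Rightarrow> ('c, 'e, 'm) module_scheme \<Rightarrow> nat \<Rightarrow> ((nat multiset \<Rightarrow> 'c) \<Rightarrow> 'e) \<Rightarrow> bool"
 where "mpoly_iso C E n h \<longleftrightarrow> h \<in> ring_iso (mpoly_algebra C n) E \<and> h \<in> linear_maps C (mpoly_algebra C n) E"

lemma is_polynomial_algebra_iff: "is_polynomial_algebra C E n \<longleftrightarrow> (\<exists>h. mpoly_iso C E n h)"
 by (simp add: is_polynomial_algebra_def mpoly_iso_def)

lemma mpoly_isoD:
 fixes E (structure)
 assumes C: "cring C" and h: "mpoly_iso C E n h"
 shows "p \<in> carrier (mpoly_algebra C n) ==> h p \<in> carrier E"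
  "h ` carrier (mpoly_algebra C n) = carrier E" "inj_on h (carrier (mpoly_algebra C n))"
  "p \<in> carrier (mpoly_algebra C n) ==> q \<in> carrier (mpoly_algebra C n) ==>
   h (ring.indexed_padd C p q) = h p \<oplus> h q"
  "p \<in> carrier (mpoly_algebra C n) ==> i < n ==>
   h (ring.indexed_pmult C p i) = h p \<otimes> h (ring.indexed_var C i)"
  "c \<in> carrier C ==> h (ring.indexed_const C c) = scalar E c"
proof -
 interpret C: cring C by fact
 have iso: "h \<in> ring_iso (mpoly_algebra C n) E" and lin: "h \<in> linear_maps C (mpoly_algebra C n) E"
  using h by (auto simp: mpoly_iso_def)
 note iso = ring_iso_memE[OF iso]
 show cl: "p \<in> carrier (mpoly_algebra C n) ==> h p \<in> carrier E" for p by (rule iso(1))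
 show "h ` carrier (mpoly_algebra C n) = carrier E" "inj_on h (carrier (mpoly_algebra C n))"
  using iso(5) by (auto simp: bij_betw_def)
 show "h (ring.indexed_padd C p q) = h p \<oplus> h q"
  if "p \<in> carrier (mpoly_algebra C n)" "q \<in> carrier (mpoly_algebra C n)"
  using iso(3)[OF that] by (simp add: mpoly_algebra_simps)
 show "h (ring.indexed_pmult C p i) = h p \<otimes> h (ring.indexed_var C i)"
  if "p \<in> carrier (mpoly_algebra C n)" "i < n"
  using iso(2)[OF that(1) C.var_in_mpoly[OF that(2)]] C.mpoly_mult_var[OF C.mpoly_coeff[OF that(1)]] by simp
 show "h (ring.indexed_const C c) = scalar E c" if c: "c \<in> carrier C"
 proof -
  have "ring.indexed_const C c = c \<odot>\<^bsub>mpoly_algebra C n\<^esub> \<one>\<^bsub>mpoly_algebra C n\<^esub>"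
   using c by (auto simp: mpoly_algebra_simps C.indexed_const_def)
  moreover have "\<one>\<^bsub>mpoly_algebra C n\<^esub> \<in> carrier (mpoly_algebra C n)"
   using C.const_in_mpoly[OF C.one_closed] by (simp add: mpoly_algebra_simps(2))
  ultimately show ?thesis using lin c iso(4) by (simp add: linear_maps_def)
 qed
qed

lemma adjoin_gens_in_carrier:
 assumes "algebra C E" "S \<subseteq> carrier E"
 shows "(\<lambda>r. scalar E r) ` carrier C \<union> S \<subseteq> carrier E"
proof -
 interpret algebra C E by fact
 show ?thesis using assms(2) by auto
qed

lemma adjoin_subring:
 assumes "algebra C E" "S \<subseteq> carrier E"
 shows "subring (adjoin C E S) E"
proof -
 interpret algebra C E by fact
 show ?thesis
  unfolding adjoin_def using adjoin_gens_in_carrier[OF assms] by (rule generate_ring_is_subring)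
qed

lemma adjoin_incl: "S \<subseteq> adjoin C E S" "c \<in> carrier C ==> scalar E c \<in> adjoin C E S"
 by (auto simp: adjoin_def intro: generate_ring.incl)

lemma adjoin_least:
 assumes "algebra C E" "subring T E" "S \<subseteq> T" "\<And>c. c \<in> carrier C ==> scalar E c \<in> T"
 shows "adjoin C E S \<subseteq> T"
proof -
 interpret algebra C E by fact
 have "T \<subseteq> carrier E" using subringE(1)[OF assms(2)] .
 thus ?thesis unfolding adjoin_def using assms(2-4)
  by (intro generate_ring_min_subring1) auto
qed

lemma coordinate_systemI:
 assumes "algebra C E" "U ` {..<n} \<subseteq> carrier E" "carrier E \<subseteq> adjoin C E (U ` {..<n})"
 shows "coordinate_system C E n U"
 using assms subringE(1)[OF adjoin_subring[OF assms(1,2)]] by (auto simp: coordinate_system_def)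

lemma polynomial_algebra_generated:
 assumes E: "algebra C E" and h: "mpoly_iso C E n h"
 shows "coordinate_system C E n (\<lambda>i. h (ring.indexed_var C i))"
proof -
 interpret algebra C E by fact
 note C = R_cring
 note hD = mpoly_isoD[OF C h]
 let ?U = "\<lambda>i. h (ring.indexed_var C i)"
 let ?G = "adjoin C E (?U ` {..<n})"
 have in_G: "h p \<in> ?G" if "p \<in> ring.indexed_pset C {..<n} (carrier C)" for p
  using that
 proof (induction p rule: R.indexed_pset.induct)
  case (indexed_const c)
  thus ?case unfolding hD(6)[OF indexed_const] by (rule adjoin_incl)
 next
  case (indexed_padd p q)
  thus ?case using hD(4)[of p q]
   by (simp add: mpoly_algebra_simps adjoin_def generate_ring.eng_add)
 next
  case (indexed_pmult p i)
  have "?U i \<in> ?G" unfolding adjoin_def using indexed_pmult(2) by (intro generate_ring.incl) auto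
  thus ?case using hD(5)[of p i] indexed_pmult
   by (simp add: mpoly_algebra_simps adjoin_def generate_ring.eng_mult)
 qed
 show ?thesis
 proof (rule coordinate_systemI[OF E])
  show "?U ` {..<n} \<subseteq> carrier E" using hD(1) R.var_in_mpoly by auto
  show "carrier E \<subseteq> ?G" unfolding hD(2)[symmetric] using in_G by (auto simp: mpoly_algebra_simps(1))
 qed
qed

lemma generate_ring_finite:
 assumes "e \<in> generate_ring E (A \<union> S)"
 shows "\<exists>H. finite H \<and> H \<subseteq> A \<and> e \<in> generate_ring E (H \<union> S)"
 using assms
proof (induction e rule: generate_ring.induct)
 case one
 show ?case by (intro exI[of _ "{}"]) (auto intro: generate_ring.one)
next
 case (incl e)
 show ?case
 proof (cases "e \<in> A")
  case True
  thus ?thesis by (intro exI[of _ "{e}"]) (auto intro: generate_ring.incl)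
 next
  case False
  thus ?thesis using incl by (intro exI[of _ "{}"]) (auto intro: generate_ring.incl)
 qed
next
 case (a_inv e)
 thus ?case by (blast intro: generate_ring.a_inv)
next
 case (eng_add e e')
 then obtain H H' where H: "finite H" "H \<subseteq> A" "e \<in> generate_ring E (H \<union> S)"
   "finite H'" "H' \<subseteq> A" "e' \<in> generate_ring E (H' \<union> S)" by blast
 have mono: "generate_ring E X' \<subseteq> generate_ring E Y'" if "X' \<subseteq> Y'" for X' Y'
 proof
  show "a \<in> generate_ring E Y'" if "a \<in> generate_ring E X'" for a
   using that \<open>X' \<subseteq> Y'\<close> by (induction a rule: generate_ring.induct) (auto intro: generate_ring.intros)
 qed
 have "e \<in> generate_ring E ((H \<union> H') \<union> S)" "e' \<in> generate_ring E ((H \<union> H') \<union> S)"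
  using H mono[of "H \<union> S" "(H \<union> H') \<union> S"] mono[of "H' \<union> S" "(H \<union> H') \<union> S"] by blast+
 thus ?case using H by (intro exI[of _ "H \<union> H'"]) (auto intro: generate_ring.eng_add)
next
 case (eng_mult e e')
 then obtain H H' where H: "finite H" "H \<subseteq> A" "e \<in> generate_ring E (H \<union> S)"
   "finite H'" "H' \<subseteq> A" "e' \<in> generate_ring E (H' \<union> S)" by blast
 have mono: "generate_ring E X' \<subseteq> generate_ring E Y'" if "X' \<subseteq> Y'" for X' Y'
 proof
  show "a \<in> generate_ring E Y'" if "a \<in> generate_ring E X'" for a
   using that \<open>X' \<subseteq> Y'\<close> by (induction a rule: generate_ring.induct) (auto intro: generate_ring.intros)
 qed
 have "e \<in> generate_ring E ((H \<union> H') \<union> S)" "e' \<in> generate_ring E ((H \<union> H') \<union> S)"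
  using H mono[of "H \<union> S" "(H \<union> H') \<union> S"] mono[of "H' \<union> S" "(H \<union> H') \<union> S"] by blast+
 thus ?case using H by (intro exI[of _ "H \<union> H'"]) (auto intro: generate_ring.eng_mult)
qed

lemma adjoin_finite:
 assumes W: "finite W" "W \<subseteq> adjoin C E S"
 shows "\<exists>H. finite H \<and> H \<subseteq> carrier C \<and>
  (\<forall>T. subring T E \<longrightarrow> (\<forall>c\<in>H. scalar E c \<in> T) \<longrightarrow> S \<subseteq> T \<longrightarrow> W \<subseteq> T)"
 using W
proof (induction W rule: finite_induct)
 case empty
 thus ?case by (intro exI[of _ "{}"]) auto
next
 case (insert w W)
 then obtain H where H: "finite H" "H \<subseteq> carrier C"
  "\<And>T. subring T E ==> \<forall>c\<in>H. scalar E c \<in> T ==> S \<subseteq> T ==> W \<subseteq> T" by auto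
 obtain H1 where H1: "finite H1" "H1 \<subseteq> (\<lambda>r. scalar E r) ` carrier C" "w \<in> generate_ring E (H1 \<union> S)"
  using generate_ring_finite[of w E _ S] insert.prems unfolding adjoin_def by blast
 obtain H2 where H2: "finite H2" "H2 \<subseteq> carrier C" "H1 = (\<lambda>r. scalar E r) ` H2"
  using finite_subset_image[OF H1(1,2)] by blast
 show ?case
 proof (intro exI[of _ "H \<union> H2"] conjI allI impI)
  fix T assume T: "subring T E" "\<forall>c\<in>H \<union> H2. scalar E c \<in> T" "S \<subseteq> T"
  have "a \<in> T" if "a \<in> generate_ring E (H1 \<union> S)" for a
   using that by (induction a rule: generate_ring.induct) (use T H2 in \<open>auto simp: subringE\<close>)
  thus "insert w W \<subseteq> T" using H(3)[OF T(1) _ T(3)] T(2) H1(3) by auto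
 qed (use H H2 in auto)
qed

section \<open>Complex polynomials as models of polynomial algebras\<close>

text \<open>Elements of the polynomial algebra that do not involve the variables from the \<open>i\<close>-th one on.\<close>

definition initial_part ::
 "('c, 'x) ring_scheme \<Rightarrow> ((nat multiset \<Rightarrow> 'c) \<Rightarrow> 'e) \<Rightarrow> nat \<Rightarrow> nat \<Rightarrow> 'e set"
 where "initial_part C h n i = h ` {q \<in> carrier (mpoly_algebra C n). \<forall>j\<ge>i. ring.index_free C q j}"

lemma heval_initial_part:
 fixes C (structure)
 assumes E: "algebra C E" and h: "mpoly_iso C E n h" and i: "i < n"
  and S: "sub_ring S" and \<sigma>: "hom_on S \<sigma> E" and \<sigma>_init: "\<sigma> ` S \<subseteq> initial_part C h n i"
  and \<sigma>_inj: "\<forall>a\<in>S. \<sigma> a = \<zero>\<^bsub>E\<^esub> \<longrightarrow> a = 0"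
 shows "heval E \<sigma> (h (ring.indexed_var C i)) ` polys_over S \<subseteq> initial_part C h n (Suc i)"
  "\<forall>p\<in>polys_over S. heval E \<sigma> (h (ring.indexed_var C i)) p = \<zero>\<^bsub>E\<^esub> \<longrightarrow> p = 0"
proof -
 interpret algebra C E by fact
 note C = R_cring
 note hD = mpoly_isoD[OF C h]
 let ?M = "mpoly_algebra C n"
 let ?e = "h (ring.indexed_var C i)"
 have e: "?e \<in> carrier E" using hD(1) R.var_in_mpoly[OF i] by blast
 interpret P: polynomial_evaluation E S \<sigma> ?e by unfold_locales (fact S \<sigma> e)+
 have z: "ring.indexed_const C \<zero> \<in> carrier ?M" by (rule R.const_in_mpoly) simp
 have hz: "h (ring.indexed_const C \<zero>) = \<zero>\<^bsub>E\<^esub>" using hD(6)[OF R.zero_closed] by simp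
 have "\<exists>q. q \<in> carrier ?M \<and> heval E \<sigma> ?e p = h q \<and> (\<forall>j\<ge>Suc i. ring.index_free C q j) \<and>
   (\<forall>l q'. q' \<in> carrier ?M \<longrightarrow> (\<forall>j\<ge>i. ring.index_free C q' j) \<longrightarrow> \<sigma> (poly.coeff p l) = h q' \<longrightarrow>
    (\<forall>m. i \<notin># m \<longrightarrow> q (m + replicate_mset l i) = q' m))"
  if "p \<in> polys_over S" for p
  using that
 proof (induction p)
  case 0
  show ?case
  proof (intro exI[of _ "ring.indexed_const C \<zero>"] conjI allI impI)
   fix l q' m assume "q' \<in> carrier ?M" "\<sigma> (poly.coeff 0 l) = h q'"
   hence "q' = ring.indexed_const C \<zero>"
    using hD(3) hz z P.\<sigma>0 by (auto simp: inj_on_def)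
   thus "ring.indexed_const C \<zero> (m + replicate_mset l i) = q' m" by (simp add: R.indexed_zero_def)
  qed (use z hz in \<open>auto simp: R.indexed_const_index_free\<close>)
 next
  case (pCons a p)
  hence a: "a \<in> S" and p: "p \<in> polys_over S" by auto
  obtain qa where qa: "qa \<in> carrier ?M" "\<sigma> a = h qa" "\<And>j. j \<ge> i ==> ring.index_free C qa j"
   using \<sigma>_init a unfolding initial_part_def by blast
  obtain q where q: "q \<in> carrier ?M" "heval E \<sigma> ?e p = h q" "\<And>j. j \<ge> Suc i ==> ring.index_free C q j"
   "\<And>l q' m. q' \<in> carrier ?M ==> \<forall>j\<ge>i. ring.index_free C q' j ==> \<sigma> (poly.coeff p l) = h q' ==>
    i \<notin># m ==> q (m + replicate_mset l i) = q' m"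
   using pCons.IH[OF p] by blast
  have cl: "qa m \<in> carrier C" "q m \<in> carrier C" for m
   using R.mpoly_coeff[OF qa(1)] R.mpoly_coeff[OF q(1)] by (auto simp: R.carrier_coeff_def)
  have qi: "ring.indexed_pmult C q i \<in> carrier ?M"
   using q(1) i by (auto simp: mpoly_algebra_simps intro: R.indexed_pset.indexed_pmult)
  define q1 where "q1 = ring.indexed_padd C qa (ring.indexed_pmult C q i)"
  have q1: "q1 m = qa m \<oplus> (if i \<in># m then q (m - {#i#}) else \<zero>)" for m
   by (simp add: q1_def R.indexed_padd_def R.indexed_pmult_def)
  show ?case
  proof (intro exI[of _ q1] conjI allI impI)
   show "q1 \<in> carrier ?M"
    using qa(1) qi unfolding q1_def mpoly_algebra_simps by (rule R.indexed_pset.indexed_padd)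
   show "heval E \<sigma> ?e (pCons a p) = h q1"
    unfolding P.heval_pCons q1_def hD(4)[OF qa(1) qi] hD(5)[OF q(1) i] qa(2) q(2)
    using e hD(1)[OF q(1)] by (simp add: m_comm)
   show "ring.index_free C q1 j" if "Suc i \<le> j" for j
    unfolding q1_def
    using that qa(3)[of j] q(3)[of j]
    by (intro R.indexed_padd_index_free R.indexed_pmult_index_free) auto
   fix l q' m assume q': "q' \<in> carrier ?M" "\<forall>j\<ge>i. ring.index_free C q' j" "\<sigma> (poly.coeff (pCons a p) l) = h q'"
    and m: "i \<notin># m"
   show "q1 (m + replicate_mset l i) = q' m"
   proof (cases l)
    case 0
    hence "h qa = h q'" using q'(3) qa(2) by simp
    hence "qa = q'" using hD(3) qa(1) q'(1) by (auto dest: inj_onD)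
    thus ?thesis using 0 m cl by (simp add: q1)
   next
    case (Suc l')
    have "qa (m + replicate_mset l i) = \<zero>"
     using qa(3)[of i] Suc by (simp add: R.index_free_def)
    moreover have "q (m + replicate_mset l' i) = q' m"
     using q(4)[OF q'(1,2) _ m, of l'] q'(3) Suc by simp
    moreover have "q' m \<in> carrier C" using R.mpoly_coeff[OF q'(1)] by (simp add: R.carrier_coeff_def)
    ultimately show ?thesis using Suc by (simp add: q1)
   qed
  qed
 qed
 note key = this
 show "heval E \<sigma> ?e ` polys_over S \<subseteq> initial_part C h n (Suc i)"
  using key unfolding initial_part_def by blast
 show "\<forall>p\<in>polys_over S. heval E \<sigma> ?e p = \<zero>\<^bsub>E\<^esub> \<longrightarrow> p = 0"
 proof (intro ballI impI poly_eqI)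
  fix p l assume p: "p \<in> polys_over S" "heval E \<sigma> ?e p = \<zero>\<^bsub>E\<^esub>"
  obtain q where q: "q \<in> carrier ?M" "heval E \<sigma> ?e p = h q"
   "\<And>l q' m. q' \<in> carrier ?M ==> \<forall>j\<ge>i. ring.index_free C q' j ==> \<sigma> (poly.coeff p l) = h q' ==>
    i \<notin># m ==> q (m + replicate_mset l i) = q' m"
   using key[OF p(1)] by blast
  have q0: "q = (\<lambda>_. \<zero>)"
   using hD(3) q(1,2) p(2) hz z by (auto simp: R.indexed_zero_def dest: inj_onD)
  have cS: "poly.coeff p l \<in> S" using p(1) by (rule coeff_polys_over)
  obtain q' where q': "q' \<in> carrier ?M" "\<sigma> (poly.coeff p l) = h q'" "\<forall>j\<ge>i. ring.index_free C q' j"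
   using \<sigma>_init cS unfolding initial_part_def by blast
  have "q' m = \<zero>" for m
  proof (cases "i \<in># m")
   case True
   thus ?thesis using q'(3) by (auto simp: R.index_free_def)
  next
   case False
   thus ?thesis using q(3)[OF q'(1,3,2), of m] q0 by simp
  qed
  hence "q' = ring.indexed_const C \<zero>" by (auto simp: R.indexed_zero_def)
  hence "\<sigma> (poly.coeff p l) = \<zero>\<^bsub>E\<^esub>" using q'(2) hz by simp
  thus "poly.coeff p l = poly.coeff 0 l" using \<sigma>_inj cS by simp
 qed
qed

lemma hom_on_image_subring:
 fixes E (structure)
 assumes S: "sub_ring S" and \<sigma>: "hom_on S \<sigma> E" and E: "ring E"
 shows "subring (\<sigma> ` S) E"
proof -
 interpret ring E by fact
 show ?thesis
 proof (rule subringI)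
  show "\<sigma> ` S \<subseteq> carrier E" using hom_onD(1)[OF \<sigma>] by auto
  show "\<one> \<in> \<sigma> ` S" using hom_onD(2)[OF \<sigma>] sub_ringD(2)[OF S] by (metis imageI)
  fix a assume "a \<in> \<sigma> ` S"
  then obtain x where x: "x \<in> S" "a = \<sigma> x" by auto
  show "\<ominus> a \<in> \<sigma> ` S"
   using hom_on_diff(2)[OF \<sigma> S E x(1) x(1)] x sub_ringD(6)[OF S x(1)] by (metis imageI)
  fix b assume "b \<in> \<sigma> ` S"
  then obtain y where y: "y \<in> S" "b = \<sigma> y" by auto
  show "a \<otimes> b \<in> \<sigma> ` S" "a \<oplus> b \<in> \<sigma> ` S"
   using hom_onD(3,4)[OF \<sigma> x(1) y(1)] x y sub_ringD(3,5)[OF S x(1) y(1)] by (metis imageI)+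
 qed
qed

lemma vars_in_space:
 assumes k: "sub_ring k"
 shows "xvar \<in> space_over k" "yvar \<in> space_over k" "zvar \<in> space_over k" "c \<in> k ==> const3 c \<in> space_over k"
 using sub_ringD(1,2)[OF k] by (auto simp: cc_polys_over[OF polys_over_sub_ring[OF k]] zero_polys_over one_pCons)

lemma subst3_space:
 assumes k: "sub_ring k" and u: "u0 \<in> space_over k" "u1 \<in> space_over k" "u2 \<in> space_over k"
  and F: "F \<in> space_over k"
 shows "subst3 u0 u1 u2 F \<in> space_over k"
proof -
 note S3 = polys_over_sub_ring[OF polys_over_sub_ring[OF polys_over_sub_ring[OF k]]]
 show ?thesis
  using k F
 proof (induction F rule: space_induct)
  case (const c)
  thus ?case unfolding subst3_const by (rule vars_in_space(4)[OF k])
 qed (simp_all add: subst3_vars u rhomD(3,4)[OF rhom_subst3] sub_ringD(3,5)[OF S3])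
qed

text \<open>
 \<open>model C E k \<sigma> \<Theta> U\<close>: the polynomials over the subfield \<open>k\<close> of the complex numbers are identified by
 \<open>\<Theta>\<close> with the subring of \<open>E\<close> generated by the subfield \<open>\<sigma> ` k\<close> of \<open>C\<close> and the coordinates \<open>U\<close>.
\<close>

definition model ::
 "('c, 'x) ring_scheme \<Rightarrow> ('c, 'e, 'm) module_scheme \<Rightarrow> complex set \<Rightarrow> (complex \<Rightarrow> 'c)
  \<Rightarrow> (complex poly poly poly \<Rightarrow> 'e) \<Rightarrow> (nat \<Rightarrow> 'e) \<Rightarrow> bool"
 where "model C E k \<sigma> \<Theta> U \<longleftrightarrow>
  sub_field k \<and> hom_on k \<sigma> C \<and> hom_on (space_over k) \<Theta> E \<and>
  (\<forall>b\<in>space_over k. \<Theta> b = \<zero>\<^bsub>E\<^esub> \<longrightarrow> b = 0) \<and>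
  (\<forall>c\<in>k. \<Theta> (const3 c) = scalar E (\<sigma> c)) \<and>
  \<Theta> xvar = U 0 \<and> \<Theta> yvar = U 1 \<and> \<Theta> zvar = U 2"

lemma modelD:
 assumes "model C E k \<sigma> \<Theta> U"
 shows "sub_field k" "hom_on k \<sigma> C" "hom_on (space_over k) \<Theta> E"
  "b \<in> space_over k ==> \<Theta> b = \<zero>\<^bsub>E\<^esub> ==> b = 0"
  "c \<in> k ==> \<Theta> (const3 c) = scalar E (\<sigma> c)"
  "\<Theta> xvar = U 0" "\<Theta> yvar = U 1" "\<Theta> zvar = U 2"
 using assms by (auto simp: model_def)

lemma model_eqI:
 assumes E: "ring E" and \<Theta>: "model C E k \<sigma> \<Theta> U"
  and ab: "a \<in> space_over k" "b \<in> space_over k" "\<Theta> a = \<Theta> b"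
 shows "a = b"
proof -
 interpret ring E by fact
 note D = modelD[OF \<Theta>]
 note S3 = polys_over_sub_ring[OF polys_over_sub_ring[OF polys_over_sub_ring[OF sub_fieldD(1)[OF D(1)]]]]
 have "\<Theta> (a - b) = \<zero>\<^bsub>E\<^esub>"
  using hom_on_diff(1)[OF D(3) S3 E ab(1,2)] ab(3) hom_onD(1)[OF D(3) ab(2)] by (simp add: r_right_minus_eq)
 thus ?thesis using D(4)[OF sub_ringD(4)[OF S3 ab(1,2)]] by simp
qed

lemma model_subst_in_subring:
 assumes E: "ring E" and \<Theta>: "model C E k \<sigma> \<Theta> U" and T: "subring T E"
  and u: "u0 \<in> space_over k" "u1 \<in> space_over k" "u2 \<in> space_over k"
  and uT: "\<Theta> u0 \<in> T" "\<Theta> u1 \<in> T" "\<Theta> u2 \<in> T" and cT: "\<And>c. c \<in> k ==> scalar E (\<sigma> c) \<in> T"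
  and F: "F \<in> space_over k"
 shows "\<Theta> (subst3 u0 u1 u2 F) \<in> T"
proof -
 note D = modelD[OF \<Theta>]
 note k = sub_fieldD(1)[OF D(1)]
 note sp = subst3_space[OF k u]
 show ?thesis
  using k F
 proof (induction F rule: space_induct)
  case (const c)
  thus ?case using cT by (simp add: subst3_const D(5))
 next
  case (add F G)
  thus ?case using hom_onD(3)[OF D(3) sp sp] subringE(7)[OF T] by (simp add: rhomD(3)[OF rhom_subst3])
 next
  case (mult F G)
  thus ?case using hom_onD(4)[OF D(3) sp sp] subringE(6)[OF T] by (simp add: rhomD(4)[OF rhom_subst3])
 qed (simp_all add: subst3_vars uT)
qed

lemma model_image_subring:
 assumes E: "ring E" and \<Theta>: "model C E k \<sigma> \<Theta> U"
 shows "subring (\<Theta> ` space_over k) E"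
 by (intro hom_on_image_subring[OF _ modelD(3)[OF \<Theta>] E] polys_over_sub_ring
   sub_fieldD(1)[OF modelD(1)[OF \<Theta>]])

text \<open>
 The change of variables between two systems that are defined over \<open>k\<close> is surjective, hence injective by lemma \<open>subst3_inj\<close>.
\<close>

lemma model_change:
 assumes E: "ring E" and \<Theta>: "model C E k \<sigma> \<Theta> U"
  and v: "v0 \<in> space_over k" "v1 \<in> space_over k" "v2 \<in> space_over k"
  and V: "\<Theta> v0 = V 0" "\<Theta> v1 = V 1" "\<Theta> v2 = V 2"
  and gen: "\<And>T. subring T E ==> (\<And>c. c \<in> k ==> scalar E (\<sigma> c) \<in> T) ==>
   {V 0, V 1, V 2} \<subseteq> T ==> {U 0, U 1, U 2} \<subseteq> T"
 shows "model C E k \<sigma> (\<lambda>F. \<Theta> (subst3 v0 v1 v2 F)) V"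
  "\<And>G. subst3 v0 v1 v2 G = 0 ==> G = 0" "subst3 v0 v1 v2 ` space_over k = space_over k"
proof -
 let ?B = "space_over k"
 let ?\<phi> = "subst3 v0 v1 v2"
 note D = modelD[OF \<Theta>]
 note k = sub_fieldD(1)[OF D(1)]
 note S3 = polys_over_sub_ring[OF polys_over_sub_ring[OF polys_over_sub_ring[OF k]]]
 note sp = subst3_space[OF k v]
 note vars = vars_in_space[OF k]
 have hom: "hom_on ?B (\<lambda>F. \<Theta> (?\<phi> F)) E"
  unfolding hom_on_def using hom_onD[OF D(3)] sp by (auto simp: rhomD(1,3,4)[OF rhom_subst3])
 have T: "subring ((\<lambda>F. \<Theta> (?\<phi> F)) ` ?B) E" by (rule hom_on_image_subring[OF S3 hom E])
 have "scalar E (\<sigma> c) \<in> (\<lambda>F. \<Theta> (?\<phi> F)) ` ?B" if "c \<in> k" for c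
  using that vars(4) D(5) subst3_const by (metis (no_types, lifting) imageI)
 moreover have "V 0 = \<Theta> (?\<phi> xvar)" "V 1 = \<Theta> (?\<phi> yvar)" "V 2 = \<Theta> (?\<phi> zvar)"
  by (simp_all add: subst3_vars V)
 hence "{V 0, V 1, V 2} \<subseteq> (\<lambda>F. \<Theta> (?\<phi> F)) ` ?B" using vars(1-3) by blast
 ultimately have "{U 0, U 1, U 2} \<subseteq> (\<lambda>F. \<Theta> (?\<phi> F)) ` ?B" by (rule gen[OF T])
 hence U_img: "U 0 \<in> (\<lambda>F. \<Theta> (?\<phi> F)) ` ?B" "U 1 \<in> (\<lambda>F. \<Theta> (?\<phi> F)) ` ?B" "U 2 \<in> (\<lambda>F. \<Theta> (?\<phi> F)) ` ?B"
  by simp_all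
 obtain F0 where F0: "F0 \<in> ?B" "U 0 = \<Theta> (?\<phi> F0)" using U_img(1) by (rule imageE)
 obtain F1 where F1: "F1 \<in> ?B" "U 1 = \<Theta> (?\<phi> F1)" using U_img(2) by (rule imageE)
 obtain F2 where F2: "F2 \<in> ?B" "U 2 = \<Theta> (?\<phi> F2)" using U_img(3) by (rule imageE)
 note F = F0(1) F1(1) F2(1)
 have eqs: "xvar = ?\<phi> F0" "yvar = ?\<phi> F1" "zvar = ?\<phi> F2"
  using model_eqI[OF E \<Theta> vars(1) sp[OF F(1)]] model_eqI[OF E \<Theta> vars(2) sp[OF F(2)]]
   model_eqI[OF E \<Theta> vars(3) sp[OF F(3)]] D(6-8) F0(2) F1(2) F2(2) by metis+
 show inj: "G = 0" if "?\<phi> G = 0" for G by (rule subst3_inj[OF eqs that])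
 show "model C E k \<sigma> (\<lambda>F. \<Theta> (?\<phi> F)) V"
  unfolding model_def
 proof (intro conjI ballI impI)
  show "F = 0" if "F \<in> ?B" "\<Theta> (?\<phi> F) = \<zero>\<^bsub>E\<^esub>" for F
   using D(4)[OF sp[OF that(1)] that(2)] by (rule inj)
 qed (simp_all add: D(1,2,5) hom subst3_vars V subst3_const)
 have "b \<in> ?\<phi> ` ?B" if b: "b \<in> ?B" for b
 proof -
  have "b = ?\<phi> (subst3 F0 F1 F2 b)"
  proof (rule subst3_eqI[OF k b])
   show "rhom (\<lambda>b :: complex poly poly poly. b)" by (simp add: rhom_def)
   show "rhom (\<lambda>b. ?\<phi> (subst3 F0 F1 F2 b))" by (rule rhom_comp[OF rhom_subst3 rhom_subst3])
  qed (simp_all only: subst3_const subst3_vars eqs[symmetric])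
  thus ?thesis using subst3_space[OF k F b] by blast
 qed
 thus "?\<phi> ` ?B = ?B" using sp by blast
qed

text \<open>
 Only finitely many elements of \<open>C\<close> occur in the data, and the coordinates of \<open>U\<close> and the images of the variables are
 expressed by each other with finitely many further ones. All of them lie in a subfield that embeds in the complex numbers.
\<close>

lemma model_exists:
 fixes E (structure)
 assumes C: "field C" and h0: "h0 \<in> ring_hom rat_ring C" and E: "algebra C E"
  and poly: "is_polynomial_algebra C E 3" and U: "coordinate_system C E 3 U"
  and H: "finite H" "H \<subseteq> carrier C" and W: "finite W" "W \<subseteq> carrier E"
 shows "\<exists>k \<sigma> \<Theta>. model C E k \<sigma> \<Theta> U \<and> countable k \<and> H \<subseteq> \<sigma> ` k \<and> W \<subseteq> \<Theta> ` space_over k"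
proof -
 interpret C: field C by fact
 interpret E: algebra C E by fact
 note Er = E.ring_axioms
 obtain h where h: "mpoly_iso C E 3 h" using poly by (auto simp: is_polynomial_algebra_iff)
 note hD = mpoly_isoD[OF C.is_cring h]
 define e where "e i = h (ring.indexed_var C i)" for i
 have coord: "coordinate_system C E 3 e" unfolding e_def by (rule polynomial_algebra_generated[OF E h])
 have three: "f ` {..<3::nat} = {f 0, f 1, f 2}" for f :: "nat \<Rightarrow> 'e"
  by (auto simp: eval_nat_numeral lessThan_Suc)
 have e_cl: "e 0 \<in> carrier E" "e 1 \<in> carrier E" "e 2 \<in> carrier E"
  using coord by (auto simp: coordinate_system_def three)
 have gen_e: "carrier E = adjoin C E {e 0, e 1, e 2}" and gen_U: "carrier E = adjoin C E {U 0, U 1, U 2}"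
  using coord U by (auto simp: coordinate_system_def three)
 have U_cl: "{U 0, U 1, U 2} \<subseteq> carrier E" using U by (auto simp: coordinate_system_def three)
 obtain H1 where H1: "finite H1" "H1 \<subseteq> carrier C"
  "\<And>T. subring T E ==> \<forall>c\<in>H1. scalar E c \<in> T ==> {e 0, e 1, e 2} \<subseteq> T ==> W \<union> {U 0, U 1, U 2} \<subseteq> T"
  using adjoin_finite[of "W \<union> {U 0, U 1, U 2}" C E "{e 0, e 1, e 2}"] W U_cl gen_e by auto
 obtain H2 where H2: "finite H2" "H2 \<subseteq> carrier C"
  "\<And>T. subring T E ==> \<forall>c\<in>H2. scalar E c \<in> T ==> {U 0, U 1, U 2} \<subseteq> T ==> {e 0, e 1, e 2} \<subseteq> T"
  using adjoin_finite[of "{e 0, e 1, e 2}" C E "{U 0, U 1, U 2}"] e_cl gen_U by auto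
 obtain k :: "complex set" and \<sigma> where k: "sub_field k" "countable k" "hom_on k \<sigma> C" "H \<union> H1 \<union> H2 \<subseteq> \<sigma> ` k"
  using embedding_into_complex[OF C h0, of "H \<union> H1 \<union> H2"] H H1 H2 by auto
 note S = sub_fieldD(1)[OF k(1)]
 note S1 = polys_over_sub_ring[OF S]
 note S2 = polys_over_sub_ring[OF S1]
 define \<theta> where "\<theta> c = scalar E (\<sigma> c)" for c
 have \<theta>: "hom_on k \<theta> E"
  unfolding hom_on_def \<theta>_def using hom_onD[OF k(3)]
  by (auto simp: E.smult_l_distr E.smult_assoc1 E.smult_assoc2)
 have \<sigma>0: "\<sigma> 0 = \<zero>\<^bsub>C\<^esub>" by (rule hom_on_zero[OF k(3) S C.ring_axioms])
 have \<theta>_init: "\<theta> ` k \<subseteq> initial_part C h 3 0"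
 proof
  fix y assume "y \<in> \<theta> ` k"
  then obtain c where c: "c \<in> k" "y = \<theta> c" by blast
  hence y: "y = h (ring.indexed_const C (\<sigma> c))" using hD(6) hom_onD(1)[OF k(3)] by (simp add: \<theta>_def)
  show "y \<in> initial_part C h 3 0"
   unfolding initial_part_def y
   by (intro imageI CollectI conjI allI impI C.const_in_mpoly hom_onD(1)[OF k(3) c(1)] C.indexed_const_index_free)
 qed
 have \<theta>_inj: "c = 0" if c: "c \<in> k" "\<theta> c = \<zero>" for c
 proof (rule ccontr)
  assume "c \<noteq> 0"
  have "h (ring.indexed_const C (\<sigma> c)) = h (ring.indexed_const C \<zero>\<^bsub>C\<^esub>)"
   using c hD(6) hom_onD(1)[OF k(3)] by (simp add: \<theta>_def)
  hence "ring.indexed_const C (\<sigma> c) = (ring.indexed_const C \<zero>\<^bsub>C\<^esub> :: nat multiset \<Rightarrow> _)"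
   by (rule inj_onD[OF hD(3) _ C.const_in_mpoly[OF hom_onD(1)[OF k(3) c(1)]] C.const_in_mpoly[OF C.zero_closed]])
  from fun_cong[OF this, of "{#}"] have "\<sigma> c = \<zero>\<^bsub>C\<^esub>" by (simp add: C.indexed_const_def)
  moreover have "\<sigma> c \<otimes>\<^bsub>C\<^esub> \<sigma> (inverse c) = \<one>\<^bsub>C\<^esub>"
   using hom_onD(2,4)[OF k(3)] c(1) sub_fieldD(2)[OF k(1)] \<open>c \<noteq> 0\<close> by (metis right_inverse)
  ultimately show False using hom_onD(1)[OF k(3) sub_fieldD(2)[OF k(1) c(1)]] by simp
 qed
 have lt: "0 < (3::nat)" "1 < (3::nat)" "2 < (3::nat)" by auto
 define \<theta>1 where "\<theta>1 = heval E \<theta> (e 0)"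
 define \<theta>2 where "\<theta>2 = heval E \<theta>1 (e 1)"
 define \<theta>3 where "\<theta>3 = heval E \<theta>2 (e 2)"
 interpret P1: polynomial_evaluation E k \<theta> "e 0" by unfold_locales (fact S \<theta> e_cl)+
 have h1: "hom_on (polys_over k) \<theta>1 E" unfolding \<theta>1_def by (rule P1.heval_hom_on)
 interpret P2: polynomial_evaluation E "polys_over k" \<theta>1 "e 1" by unfold_locales (fact S1 h1 e_cl)+
 have h2: "hom_on (polys_over (polys_over k)) \<theta>2 E" unfolding \<theta>2_def by (rule P2.heval_hom_on)
 interpret P3: polynomial_evaluation E "polys_over (polys_over k)" \<theta>2 "e 2" by unfold_locales (fact S2 h2 e_cl)+
 have h3: "hom_on (space_over k) \<theta>3 E" unfolding \<theta>3_def by (rule P3.heval_hom_on)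
 have \<theta>_inj': "\<forall>c\<in>k. \<theta> c = \<zero> \<longrightarrow> c = 0" using \<theta>_inj by blast
 have i1: "\<theta>1 ` polys_over k \<subseteq> initial_part C h 3 1"
  using heval_initial_part(1)[OF E h lt(1) S \<theta> \<theta>_init \<theta>_inj'] unfolding \<theta>1_def e_def One_nat_def .
 have j1: "\<forall>p\<in>polys_over k. \<theta>1 p = \<zero> \<longrightarrow> p = 0"
  using heval_initial_part(2)[OF E h lt(1) S \<theta> \<theta>_init \<theta>_inj'] unfolding \<theta>1_def e_def .
 have i2: "\<theta>2 ` polys_over (polys_over k) \<subseteq> initial_part C h 3 2"
  using heval_initial_part(1)[OF E h lt(2) S1 h1 i1 j1] unfolding \<theta>2_def e_def Suc_1 .
 have j2: "\<forall>p\<in>polys_over (polys_over k). \<theta>2 p = \<zero> \<longrightarrow> p = 0"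
  using heval_initial_part(2)[OF E h lt(2) S1 h1 i1 j1] unfolding \<theta>2_def e_def .
 have inj3: "\<forall>b\<in>space_over k. \<theta>3 b = \<zero> \<longrightarrow> b = 0"
  using heval_initial_part(2)[OF E h lt(3) S2 h2 i2 j2] unfolding \<theta>3_def e_def .
 have in_k: "c \<in> k ==> [:c:] \<in> polys_over k" "c \<in> k ==> [:[:c:]:] \<in> polys_over (polys_over k)" for c
  using sub_ringD(1)[OF S] by (simp_all add: zero_polys_over)
 have x_in: "[:0, 1:] \<in> polys_over k" "[:[:0, 1:]:] \<in> polys_over (polys_over k)" "[:0, 1:] \<in> polys_over (polys_over k)"
  using sub_ringD(1,2)[OF S] sub_ringD(1,2)[OF S1] by (simp_all add: zero_polys_over)
 have model0: "model C E k \<sigma> \<theta>3 e"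
  unfolding model_def
 proof (intro conjI ballI impI)
  show "\<theta>3 (const3 c) = scalar E (\<sigma> c)" if "c \<in> k" for c
   using in_k[OF that] that
   by (simp only: cc_def \<theta>3_def P3.heval_const) (simp only: \<theta>2_def P2.heval_const, simp only: \<theta>1_def P1.heval_const \<theta>_def)
  show "\<theta>3 xvar = e 0"
   using x_in by (simp only: cc_def \<theta>3_def P3.heval_const) (simp only: \<theta>2_def P2.heval_const, simp only: \<theta>1_def P1.heval_var)
  show "\<theta>3 yvar = e 1"
   using x_in by (simp only: \<theta>3_def P3.heval_const) (simp only: \<theta>2_def P2.heval_var)
  show "\<theta>3 zvar = e 2" by (simp only: \<theta>3_def P3.heval_var)
 qed (use k h3 inj3 in blast)+
 have img: "subring (\<theta>3 ` space_over k) E" by (rule model_image_subring[OF Er model0])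
 note vars = vars_in_space[OF S]
 have c_img: "scalar E (\<sigma> c) \<in> \<theta>3 ` space_over k" if "c \<in> k" for c
  using modelD(5)[OF model0 that] vars(4)[OF that] by (metis imageI)
 have e_img: "{e 0, e 1, e 2} \<subseteq> \<theta>3 ` space_over k"
  using modelD(6-8)[OF model0] vars(1-3) by (metis bot_least imageI insert_subset)
 have "\<forall>c\<in>H1. scalar E c \<in> \<theta>3 ` space_over k" using k(4) c_img by blast
 hence WU: "W \<union> {U 0, U 1, U 2} \<subseteq> \<theta>3 ` space_over k" using H1(3)[OF img _ e_img] by blast
 then obtain u0 u1 u2 where u: "u0 \<in> space_over k" "u1 \<in> space_over k" "u2 \<in> space_over k"
  and Uu: "\<theta>3 u0 = U 0" "\<theta>3 u1 = U 1" "\<theta>3 u2 = U 2" by auto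
 have gen: "{e 0, e 1, e 2} \<subseteq> T"
  if "subring T E" "\<And>c. c \<in> k ==> \<sigma> c \<odot> \<one> \<in> T" "{U 0, U 1, U 2} \<subseteq> T" for T
  using H2(3)[OF that(1) _ that(3)] that(2) k(4) by blast
 note change = model_change[OF Er model0 u Uu gen]
 define \<Theta> where "\<Theta> F = \<theta>3 (subst3 u0 u1 u2 F)" for F
 have "model C E k \<sigma> \<Theta> U" unfolding \<Theta>_def using change(1) by blast
 moreover have "\<Theta> ` space_over k = \<theta>3 ` space_over k"
  unfolding \<Theta>_def using change(3) by (metis (no_types, lifting) image_cong image_image)
 hence "W \<subseteq> \<Theta> ` space_over k" using WU by blast
 ultimately show ?thesis using k(2,4) by blast
qed

text \<open>A derivation that kills the first coordinate is \<open>f \<partial>\<^sub>Y + g \<partial>\<^sub>Z\<close> in the model.\<close>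

lemma model_derivation:
 fixes E (structure)
 assumes E: "algebra C E" and \<delta>: "\<delta> \<in> derivations C E" and \<Theta>: "model C E k \<sigma> \<Theta> U"
  and U0: "\<delta> (U 0) = \<zero>" and f: "f \<in> space_over k" "\<Theta> f = \<delta> (U 1)" and g: "g \<in> space_over k" "\<Theta> g = \<delta> (U 2)"
  and b: "b \<in> space_over k"
 shows "\<delta> (\<Theta> b) = \<Theta> (plane_der f g b)"
proof -
 interpret E: algebra C E by fact
 note D = modelD[OF \<Theta>]
 note k = sub_fieldD(1)[OF D(1)]
 note S3 = polys_over_sub_ring[OF polys_over_sub_ring[OF polys_over_sub_ring[OF k]]]
 note DB = plane_der_polys_over[OF polys_over_sub_ring[OF k] f(1) g(1)]
 have lin: "\<delta> x \<in> carrier E" "\<delta> (x \<oplus> y) = \<delta> x \<oplus> \<delta> y" "\<delta> (c \<odot> x) = c \<odot> \<delta> x"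
  "\<delta> (x \<otimes> y) = \<delta> x \<otimes> y \<oplus> x \<otimes> \<delta> y"
  if "x \<in> carrier E" "y \<in> carrier E" "c \<in> carrier C" for x y c
  using \<delta> that by (auto simp: derivations_def linear_maps_def)
 have one: "\<delta> \<one> = \<zero>"
 proof -
  have c1: "\<one> \<in> carrier E" by simp
  hence "\<delta> \<one> = \<delta> \<one> \<oplus> \<delta> \<one>"
   using lin(4)[OF c1 c1 E.R.zero_closed] lin(1)[OF c1 c1 E.R.zero_closed] by simp
  thus ?thesis using lin(1)[OF c1 c1 E.R.zero_closed] by (metis E.add.r_cancel_one')
 qed
 have \<Theta>0: "\<Theta> 0 = \<zero>" by (rule hom_on_zero[OF D(3) S3 E.ring_axioms])
 note H = hom_onD[OF D(3)]
 show ?thesis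
  using k b
 proof (induction b rule: space_induct)
  case (const c)
  thus ?case
   using lin(3)[OF E.one_closed E.one_closed hom_onD(1)[OF D(2) const]] one hom_onD(1)[OF D(2) const]
   by (simp add: D(5) plane_der_cc \<Theta>0)
 next
  case x
  show ?case by (simp add: D(6) U0 plane_der_cc \<Theta>0)
 next
  case y
  show ?case by (simp add: D(7) plane_der_vars f)
 next
  case z
  show ?case by (simp add: D(8) plane_der_vars g)
 next
  case (add F G)
  thus ?case
   using lin(2)[OF H(1) H(1) E.R.zero_closed] by (simp add: H(3) DB derD(3)[OF der_plane_der])
 next
  case (mult F G)
  have m: "plane_der f g F * G \<in> space_over k" "F * plane_der f g G \<in> space_over k"
   using mult(1,2) DB sub_ringD(5)[OF S3] by blast+
  have "\<delta> (\<Theta> (F * G)) = \<delta> (\<Theta> F) \<otimes> \<Theta> G \<oplus> \<Theta> F \<otimes> \<delta> (\<Theta> G)"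
   using lin(4)[OF H(1) H(1) E.R.zero_closed] mult(1,2) by (simp add: H(4))
  also have "\<dots> = \<Theta> (plane_der f g F * G) \<oplus> \<Theta> (F * plane_der f g G)"
   using mult DB by (simp add: H(4))
  also have "\<dots> = \<Theta> (plane_der f g (F * G))"
   unfolding derD(4)[OF der_plane_der] using H(3)[OF m] by simp
  finally show ?case .
 qed
qed

section \<open>Rigidity in three variables\<close>

lemma image_lessThan_3: "f ` {..<3::nat} = {f 0, f 1, f 2}"
 by (auto simp: eval_nat_numeral lessThan_Suc)

lemma image_lessThan_2: "f ` {..<2::nat} = {f 0, f 1}"
 by (auto simp: eval_nat_numeral lessThan_Suc)

lemma image_lessThan_1: "f ` {..<1::nat} = {f 0}"
 by (auto simp: lessThan_Suc)

lemma derivation_zeroD: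
 fixes E (structure)
 assumes E: "algebra C E" and \<delta>: "\<delta> \<in> derivations C E"
 shows "x \<in> carrier E ==> \<delta> x \<in> carrier E" "\<delta> \<zero> = \<zero>"
proof -
 interpret E: algebra C E by fact
 show cl: "\<delta> x \<in> carrier E" if "x \<in> carrier E" for x
  using \<delta> that by (auto simp: derivations_def linear_maps_def)
 have "\<delta> (\<zero>\<^bsub>C\<^esub> \<odot> \<zero>) = \<zero>\<^bsub>C\<^esub> \<odot> \<delta> \<zero>"
  using \<delta> unfolding derivations_def linear_maps_def by blast
 thus "\<delta> \<zero> = \<zero>" using cl[of "\<zero>"] by simp
qed

text \<open>
 In a model the derivation is \<open>g \<partial>\<^sub>Z\<close> with \<open>g \<noteq> 0\<close>, and its kernel is \<open>k[X, Y]\<close>.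
\<close>

lemma kernel_two_coordinates:
 fixes E (structure)
 assumes C: "field C" and h0: "h0 \<in> ring_hom rat_ring C" and E: "algebra C E"
  and poly: "is_polynomial_algebra C E 3" and \<delta>: "\<delta> \<in> derivations C E"
  and U: "coordinate_system C E 3 U" "\<delta> (U 0) = \<zero>" "\<delta> (U 1) = \<zero>" "\<delta> (U 2) \<noteq> \<zero>"
  and v: "v \<in> carrier E" "\<delta> v = \<zero>"
 shows "v \<in> adjoin C E {U 0, U 1}"
proof -
 interpret E: algebra C E by fact
 note dcl = derivation_zeroD[OF E \<delta>]
 have Ucl: "{U 0, U 1, U 2} \<subseteq> carrier E" using U(1) by (simp add: coordinate_system_def image_lessThan_3)
 obtain k \<sigma> \<Theta> where \<Theta>: "model C E k \<sigma> \<Theta> U" and W: "{v, \<delta> (U 2)} \<subseteq> \<Theta> ` space_over k"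
  using model_exists[OF C h0 E poly U(1), of "{}" "{v, \<delta> (U 2)}"] v dcl Ucl by auto
 note D = modelD[OF \<Theta>]
 note k = sub_fieldD(1)[OF D(1)]
 note S3 = polys_over_sub_ring[OF polys_over_sub_ring[OF polys_over_sub_ring[OF k]]]
 have \<Theta>0: "\<Theta> 0 = \<zero>" by (rule hom_on_zero[OF D(3) S3 E.ring_axioms])
 obtain b g where b: "b \<in> space_over k" "\<Theta> b = v" and g: "g \<in> space_over k" "\<Theta> g = \<delta> (U 2)" using W by auto
 have der: "\<delta> (\<Theta> b) = \<Theta> (plane_der 0 g b)"
  by (rule model_derivation[OF E \<delta> \<Theta> U(2) sub_ringD(1)[OF S3] _ g b(1)]) (simp only: \<Theta>0 U(3))
 hence "plane_der 0 g b = 0"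
  using D(4)[OF plane_der_polys_over[OF polys_over_sub_ring[OF k] sub_ringD(1)[OF S3] g(1) b(1)]] v(2) b(2) by simp
 moreover have "g \<noteq> 0" using g(2) U(4) \<Theta>0 by auto
 ultimately have "pderiv b = 0" by (simp add: plane_der_def)
 hence "degree b = 0" by (simp add: pderiv_eq_0_iff)
 then obtain p where p: "b = [:p:]" by (rule degree_eq_zeroE)
 have "subst3 xvar yvar zvar b = b"
  by (rule subst3_eqI[OF k b(1) rhom_subst3]) (simp_all add: rhom_def subst3_const subst3_vars)
 hence "subst3 xvar yvar 0 b = b" by (simp add: p subst3_def map_poly_const)
 moreover have "\<Theta> (subst3 xvar yvar 0 b) \<in> adjoin C E {U 0, U 1}"
 proof (rule model_subst_in_subring[OF E.ring_axioms \<Theta>])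
  show T: "subring (adjoin C E {U 0, U 1}) E" using Ucl by (intro adjoin_subring[OF E]) auto
  show "\<Theta> xvar \<in> adjoin C E {U 0, U 1}" "\<Theta> yvar \<in> adjoin C E {U 0, U 1}"
   unfolding D(6,7) using adjoin_incl(1)[of "{U 0, U 1}" C E] by auto
  show "\<Theta> 0 \<in> adjoin C E {U 0, U 1}" unfolding \<Theta>0 by (rule subringE(2)[OF T])
  show "scalar E (\<sigma> c) \<in> adjoin C E {U 0, U 1}" if "c \<in> k" for c
   using hom_onD(1)[OF D(2) that] by (rule adjoin_incl)
 qed (use vars_in_space[OF k] sub_ringD(1)[OF S3] b(1) in auto)
 ultimately show ?thesis using b(2) by simp
qed

text \<open>
 Over a suitable countable subfield the two systems and \<open>\<delta>\<close> become data on complex polynomials, to which lemma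
 \<open>two_first_coordinates\<close> applies. Its second alternative gives a coordinate system with two elements in the kernel.
\<close>

lemma kernel_one_coordinate:
 fixes E (structure)
 assumes C: "field C" and h0: "h0 \<in> ring_hom rat_ring C" and E: "algebra C E"
  and poly: "is_polynomial_algebra C E 3" and \<delta>: "\<delta> \<in> LNDs C E"
  and U: "coordinate_system C E 3 U" "\<delta> (U 0) = \<zero>" and V: "coordinate_system C E 3 V" "\<delta> (V 0) = \<zero>"
  and no_rank0: "\<And>U. coordinate_system C E 3 U ==> \<not> {U 0, U 1, U 2} \<subseteq> Ker E \<delta>"
  and no_rank1: "\<And>U. coordinate_system C E 3 U ==> \<not> {U 0, U 1} \<subseteq> Ker E \<delta>"
 shows "U 0 \<in> adjoin C E {V 0}"
proof -
 interpret E: algebra C E by fact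
 note Er = E.ring_axioms
 have \<delta>': "\<delta> \<in> derivations C E" and nil: "\<And>x. x \<in> carrier E ==> \<exists>m. (\<delta> ^^ m) x = \<zero>"
  using \<delta> by (auto simp: LNDs_def)
 note dcl = derivation_zeroD[OF E \<delta>']
 have Ucl: "{U 0, U 1, U 2} \<subseteq> carrier E" and Vcl: "{V 0, V 1, V 2} \<subseteq> carrier E"
  and genV: "carrier E = adjoin C E {V 0, V 1, V 2}"
  using U(1) V(1) by (simp_all add: coordinate_system_def image_lessThan_3)
 obtain H where H: "finite H" "H \<subseteq> carrier C"
  "\<And>T. subring T E ==> \<forall>c\<in>H. scalar E c \<in> T ==> {V 0, V 1, V 2} \<subseteq> T ==> {U 0, U 1, U 2} \<subseteq> T"
  using adjoin_finite[of "{U 0, U 1, U 2}" C E "{V 0, V 1, V 2}"] Ucl genV by auto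
 let ?W = "{\<delta> (U 1), \<delta> (U 2), V 0, V 1, V 2, \<delta> (V 1), \<delta> (V 2)}"
 have "?W \<subseteq> carrier E" using Ucl Vcl dcl(1) by auto
 then obtain k \<sigma> \<Theta> where \<Theta>: "model C E k \<sigma> \<Theta> U" and countable: "countable k"
   and Hk: "H \<subseteq> \<sigma> ` k" and W: "?W \<subseteq> \<Theta> ` space_over k"
  using model_exists[OF C h0 E poly U(1) H(1,2), of ?W] by blast
 let ?B = "space_over k"
 note D = modelD[OF \<Theta>]
 note k = sub_fieldD(1)[OF D(1)]
 note S1 = polys_over_sub_ring[OF k]
 note S3 = polys_over_sub_ring[OF polys_over_sub_ring[OF S1]]
 note vars = vars_in_space[OF k]
 have \<Theta>0: "\<Theta> 0 = \<zero>" by (rule hom_on_zero[OF D(3) S3 Er])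
 have pick: "\<exists>b. b \<in> ?B \<and> \<Theta> b = y" if "y \<in> ?W" for y
  using subsetD[OF W that] by (elim imageE) (intro exI conjI, simp_all)
 obtain f where f: "f \<in> ?B" "\<Theta> f = \<delta> (U 1)" using pick[of "\<delta> (U 1)"] by auto
 obtain g where g: "g \<in> ?B" "\<Theta> g = \<delta> (U 2)" using pick[of "\<delta> (U 2)"] by auto
 obtain v0 where v0: "v0 \<in> ?B" "\<Theta> v0 = V 0" using pick[of "V 0"] by auto
 obtain v1 where v1: "v1 \<in> ?B" "\<Theta> v1 = V 1" using pick[of "V 1"] by auto
 obtain v2 where v2: "v2 \<in> ?B" "\<Theta> v2 = V 2" using pick[of "V 2"] by auto
 obtain d1 where d1: "d1 \<in> ?B" "\<Theta> d1 = \<delta> (V 1)" using pick[of "\<delta> (V 1)"] by auto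
 obtain d2 where d2: "d2 \<in> ?B" "\<Theta> d2 = \<delta> (V 2)" using pick[of "\<delta> (V 2)"] by auto
 let ?\<phi> = "subst3 v0 v1 v2"
 have gen: "{U 0, U 1, U 2} \<subseteq> T"
  if "subring T E" "\<And>c. c \<in> k ==> \<sigma> c \<odot> \<one> \<in> T" "{V 0, V 1, V 2} \<subseteq> T" for T
  using H(3)[OF that(1) _ that(3)] that(2) Hk by blast
 note change = model_change[OF Er \<Theta> v0(1) v1(1) v2(1) v0(2) v1(2) v2(2) gen]
 have \<Theta>': "model C E k \<sigma> (\<lambda>F. \<Theta> (?\<phi> F)) V" and inj: "\<And>G. ?\<phi> G = 0 ==> G = 0" and surj: "?\<phi> ` ?B = ?B"
  using change by blast+
 obtain f' where f': "f' \<in> ?B" "d1 = ?\<phi> f'" using d1(1) surj by (metis imageE)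
 obtain g' where g': "g' \<in> ?B" "d2 = ?\<phi> g'" using d2(1) surj by (metis imageE)
 have der: "\<delta> (\<Theta> b) = \<Theta> (plane_der f g b)" if "b \<in> ?B" for b
  by (rule model_derivation[OF E \<delta>' \<Theta> U(2) f g that])
 have der': "\<delta> (\<Theta> (?\<phi> b)) = \<Theta> (?\<phi> (plane_der f' g' b))" if "b \<in> ?B" for b
  by (rule model_derivation[OF E \<delta>' \<Theta>' V(2) f'(1) _ g'(1) _ that]) (simp_all add: f'(2)[symmetric] g'(2)[symmetric] d1 d2)
 note DB = plane_der_polys_over[OF S1 f(1) g(1)] and DB' = plane_der_polys_over[OF S1 f'(1) g'(1)]
 have \<phi>B: "?\<phi> b \<in> ?B" if "b \<in> ?B" for b using surj that by blast
 have \<phi>_der: "?\<phi> (plane_der f' g' b) = plane_der f g (?\<phi> b)" if b: "b \<in> ?B" for b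
  using model_eqI[OF Er \<Theta> \<phi>B[OF DB'[OF b]] DB[OF \<phi>B[OF b]]] der[OF \<phi>B[OF b]] der'[OF b] by simp
 have nilp: "\<exists>n. (plane_der f g ^^ n) b = 0" if b: "b \<in> ?B" for b
 proof -
  obtain n where n: "(\<delta> ^^ n) (\<Theta> b) = \<zero>" using nil hom_onD(1)[OF D(3) b] by blast
  have "(\<delta> ^^ j) (\<Theta> b) = \<Theta> ((plane_der f g ^^ j) b)" for j
   by (induction j) (simp_all add: der plane_der_funpow_polys_over[OF S1 f(1) g(1) b])
  thus ?thesis using n D(4) plane_der_funpow_polys_over[OF S1 f(1) g(1) b] by metis
 qed
 have nilp': "\<exists>n. (plane_der f' g' ^^ n) b = 0" if b: "b \<in> ?B" for b
 proof -
  obtain n where n: "(plane_der f g ^^ n) (?\<phi> b) = 0" using nilp[OF \<phi>B[OF b]] by blast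
  have "?\<phi> ((plane_der f' g' ^^ j) b) = (plane_der f g ^^ j) (?\<phi> b)" for j
   by (induction j) (simp_all add: \<phi>_der plane_der_funpow_polys_over[OF S1 f'(1) g'(1) b])
  thus ?thesis using n inj by metis
 qed
 have fg: "f \<noteq> 0 \<or> g \<noteq> 0"
  using no_rank0[OF U(1)] f(2) g(2) U(2) Ucl \<Theta>0 by (auto simp: Ker_def)
 have fg': "f' \<noteq> 0 \<or> g' \<noteq> 0"
 proof (rule ccontr)
  assume "\<not> (f' \<noteq> 0 \<or> g' \<noteq> 0)"
  hence "d1 = 0" "d2 = 0" using f'(2) g'(2) rhomD(2)[OF rhom_subst3, of v0 v1 v2] by auto
  hence "\<delta> (V 1) = \<zero>" "\<delta> (V 2) = \<zero>" using d1(2) d2(2) \<Theta>0 by metis+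
  thus False using no_rank0[OF V(1)] V(2) Vcl by (auto simp: Ker_def)
 qed
 obtain \<tau> where \<tau>: "transcendental_over k \<tau>" using exists_transcendental[OF countable] by blast
 obtain n1 n2 where n: "(plane_der f g ^^ n1) yvar = 0" "(plane_der f g ^^ n2) zvar = 0" using nilp vars(2,3) by blast
 obtain m1 m2 where m: "(plane_der f' g' ^^ m1) yvar = 0" "(plane_der f' g' ^^ m2) zvar = 0" using nilp' vars(2,3) by blast
 have cT: "scalar E (\<sigma> c) \<in> adjoin C E S" if "c \<in> k" for c S
  using hom_onD(1)[OF D(2) that] by (rule adjoin_incl)
 consider (poly) p where "p \<in> polys_over k" "xvar = poly (map_poly const3 p) v0"
  | (slice) P s where "P \<in> ?B" "s \<in> ?B" "plane_der f g P = 0" "\<And>b. b \<in> ?B ==> \<exists>G\<in>?B. b = ins2 P s G"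
  using two_first_coordinates[OF D(1) \<tau> f(1) g(1) fg n f'(1) g'(1) fg' m rhom_subst3 inj surj subst3_const \<phi>_der]
  unfolding subst3_vars by blast
 thus ?thesis
 proof cases
  case poly
  have "subst3 v0 v0 v0 (cc p) = poly (map_poly const3 p) v0" by (simp add: cc_def subst3_def map_poly_const)
  hence "\<Theta> (subst3 v0 v0 v0 (cc p)) = U 0" using poly(2) D(6) by simp
  moreover have "\<Theta> (subst3 v0 v0 v0 (cc p)) \<in> adjoin C E {V 0}"
  proof (rule model_subst_in_subring[OF Er \<Theta> _ v0(1) v0(1) v0(1)])
   show "subring (adjoin C E {V 0}) E" using Vcl by (intro adjoin_subring[OF E]) auto
   show "\<Theta> v0 \<in> adjoin C E {V 0}" "\<Theta> v0 \<in> adjoin C E {V 0}" "\<Theta> v0 \<in> adjoin C E {V 0}"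
    using v0(2) adjoin_incl(1)[of "{V 0}" C E] by auto
   show "cc p \<in> ?B" using poly(1) by (simp add: cc_polys_over[OF S1])
  qed (rule cT)
  ultimately show ?thesis by simp
 next
  case slice
  define U' where "U' i = (if i = 0 then U 0 else if i = 1 then \<Theta> P else \<Theta> s)" for i :: nat
  have U': "U' 0 = U 0" "U' 1 = \<Theta> P" "U' 2 = \<Theta> s" by (simp_all add: U'_def)
  have U'cl: "{U' 0, U' 1, U' 2} \<subseteq> carrier E" unfolding U' using Ucl hom_onD(1)[OF D(3)] slice(1,2) by simp
  note T = adjoin_subring[OF E U'cl]
  have sub: "\<Theta> (subst3 xvar P s G) \<in> adjoin C E {U' 0, U' 1, U' 2}" if "G \<in> ?B" for G
  proof (rule model_subst_in_subring[OF Er \<Theta> T vars(1) slice(1,2) _ _ _ _ that])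
   show "\<Theta> xvar \<in> adjoin C E {U' 0, U' 1, U' 2}" "\<Theta> P \<in> adjoin C E {U' 0, U' 1, U' 2}"
    "\<Theta> s \<in> adjoin C E {U' 0, U' 1, U' 2}"
    using adjoin_incl(1)[of "{U' 0, U' 1, U' 2}" C E] unfolding D(6) U' by auto
  qed (rule cT)
  have "ins2 P s G = subst3 xvar P s G" if "G \<in> ?B" for G
  proof (rule subst3_eqI[OF k that rhom_ins2 rhom_subst3])
   show "ins2 P s (const3 c) = subst3 xvar P s (const3 c)" for c
    by (simp add: subst3_const) (simp only: cc_def ins2_const ins_const)
   show "ins2 P s xvar = subst3 xvar P s xvar"
    by (simp only: subst3_vars) (simp only: cc_def ins2_const ins_const)
   show "ins2 P s yvar = subst3 xvar P s yvar"
    by (simp only: subst3_vars ins2_const) (use ins_linear[of P 0] in \<open>simp add: rhomD[OF rhom_cc]\<close>)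
   show "ins2 P s zvar = subst3 xvar P s zvar"
    by (simp only: subst3_vars ins2_pCons rhomD(2)[OF rhom_ins] rhomD(2)[OF rhom_ins2])
     (simp add: one_pCons[symmetric] rhomD(1)[OF rhom_ins] rhomD(2)[OF rhom_ins2])
  qed
  hence all: "\<Theta> b \<in> adjoin C E {U' 0, U' 1, U' 2}" if "b \<in> ?B" for b using slice(4)[OF that] sub by metis
  have "{U 0, U 1, U 2} \<subseteq> adjoin C E {U' 0, U' 1, U' 2}"
   using all[OF vars(1)] all[OF vars(2)] all[OF vars(3)] D(6-8) by simp
  hence "adjoin C E {U 0, U 1, U 2} \<subseteq> adjoin C E {U' 0, U' 1, U' 2}"
   by (rule adjoin_least[OF E T _ adjoin_incl(2)])
  hence "coordinate_system C E 3 U'"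
   using U(1) U'cl by (intro coordinate_systemI[OF E]) (simp_all add: coordinate_system_def image_lessThan_3)
  moreover have "\<delta> (\<Theta> P) = \<zero>" using der[OF slice(1)] slice(3) \<Theta>0 by simp
  hence "{U' 0, U' 1} \<subseteq> Ker E \<delta>" using U'cl U(2) unfolding U' by (simp add: Ker_def)
  ultimately show ?thesis using no_rank1 by blast
 qed
qed

text \<open>
 In rank one the kernel is \<open>C[X, Y]\<close> for each system whose first two coordinates lie in it. In rank two the first coordinates of two systems
 are polynomials in each other.
\<close>

theorem rigid_three_variables:
 fixes E (structure)
 assumes C: "field C" and h0: "h0 \<in> ring_hom rat_ring C" and E: "algebra C E"
  and poly: "is_polynomial_algebra C E 3" and \<delta>: "\<delta> \<in> LNDs C E"
 shows "rigid C E 3 \<delta>"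
 unfolding rigid_def Let_def
proof (intro allI impI)
 fix U V
 define r where "r = LND_rank C E 3 \<delta>"
 assume "coordinate_system C E 3 U \<and> coordinate_system C E 3 V \<and>
  U ` {..<3 - LND_rank C E 3 \<delta>} \<subseteq> Ker E \<delta> \<and> V ` {..<3 - LND_rank C E 3 \<delta>} \<subseteq> Ker E \<delta>"
 hence U: "coordinate_system C E 3 U" "U ` {..<3 - r} \<subseteq> Ker E \<delta>"
  and V: "coordinate_system C E 3 V" "V ` {..<3 - r} \<subseteq> Ker E \<delta>" by (auto simp: r_def)
 interpret E: algebra C E by fact
 have \<delta>': "\<delta> \<in> derivations C E" using \<delta> by (simp add: LNDs_def)
 define Q where "Q r \<longleftrightarrow> r \<le> 3 \<and> (\<exists>U. coordinate_system C E 3 U \<and> U ` {..<3 - r} \<subseteq> Ker E \<delta>)" for r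
 have rL: "r = (LEAST r. Q r)" by (simp add: r_def LND_rank_def Q_def)
 have "Q 3" using U(1) by (auto simp: Q_def)
 hence "Q r" unfolding rL by (rule LeastI)
 hence r3: "r \<le> 3" by (simp add: Q_def)
 have less: "\<not> Q j" if "j < r" for j using not_less_Least that unfolding rL by blast
 have cl: "{W 0, W 1, W 2} \<subseteq> carrier E" if "coordinate_system C E 3 W" for W
  using that by (simp add: coordinate_system_def image_lessThan_3)
 have no0: "\<not> {W 0, W 1, W 2} \<subseteq> Ker E \<delta>" if "0 < r" "coordinate_system C E 3 W" for W
  using less[OF that(1)] that(2) by (auto simp: Q_def image_lessThan_3)
 have no1: "\<not> {W 0, W 1} \<subseteq> Ker E \<delta>" if "1 < r" "coordinate_system C E 3 W" for W
  using less[OF that(1)] that(2) by (auto simp: Q_def image_lessThan_2)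
 have sub: "adjoin C E S \<subseteq> adjoin C E S'" if "S' \<subseteq> carrier E" "S \<subseteq> adjoin C E S'" for S S'
  by (rule adjoin_least[OF E adjoin_subring[OF E that(1)] that(2) adjoin_incl(2)])
 consider "r = 0" | "r = 1" | "r = 2" | "r = 3" using r3 by linarith
 hence "adjoin C E (U ` {..<3 - r}) = adjoin C E (V ` {..<3 - r})"
 proof cases
  case 1
  thus ?thesis using U(1) V(1) by (simp add: coordinate_system_def)
 next
  case 2
  have *: "adjoin C E {W 0, W 1} \<subseteq> adjoin C E {W' 0, W' 1}"
   if W: "coordinate_system C E 3 W" "W ` {..<2} \<subseteq> Ker E \<delta>"
    and W': "coordinate_system C E 3 W'" "W' ` {..<2} \<subseteq> Ker E \<delta>" for W W'
  proof (rule sub)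
   show "{W' 0, W' 1} \<subseteq> carrier E" using cl[OF W'(1)] by simp
   have k: "\<delta> (W' 0) = \<zero>" "\<delta> (W' 1) = \<zero>" using W'(2) by (auto simp: image_lessThan_2 Ker_def)
   have "\<delta> (W' 2) \<noteq> \<zero>" using no0[OF _ W'(1)] 2 k cl[OF W'(1)] by (auto simp: Ker_def)
   thus "{W 0, W 1} \<subseteq> adjoin C E {W' 0, W' 1}"
    using kernel_two_coordinates[OF C h0 E poly \<delta>' W'(1) k] W(2) by (auto simp: image_lessThan_2 Ker_def)
  qed
  have e: "3 - r = 2" using 2 by simp
  show ?thesis
   unfolding e image_lessThan_2
   by (intro subset_antisym *[OF U(1) _ V(1)] *[OF V(1) _ U(1)] U(2)[unfolded e] V(2)[unfolded e])
 next
  case 3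
  have *: "adjoin C E {W 0} \<subseteq> adjoin C E {W' 0}"
   if W: "coordinate_system C E 3 W" "W ` {..<1} \<subseteq> Ker E \<delta>"
    and W': "coordinate_system C E 3 W'" "W' ` {..<1} \<subseteq> Ker E \<delta>" for W W'
  proof (rule sub)
   show "{W' 0} \<subseteq> carrier E" using cl[OF W'(1)] by simp
   have "W 0 \<in> adjoin C E {W' 0}"
   proof (rule kernel_one_coordinate[OF C h0 E poly \<delta> W(1) _ W'(1)])
    show "\<delta> (W 0) = \<zero>" "\<delta> (W' 0) = \<zero>" using W(2) W'(2) by (auto simp: image_lessThan_1 Ker_def)
   qed (use no0 no1 3 in auto)
   thus "{W 0} \<subseteq> adjoin C E {W' 0}" by simp
  qed
  have e: "3 - r = 1" using 3 by simp
  show ?thesis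
   unfolding e image_lessThan_1
   by (intro subset_antisym *[OF U(1) _ V(1)] *[OF V(1) _ U(1)] U(2)[unfolded e] V(2)[unfolded e])
 next
  case 4
  thus ?thesis by simp
 qed
 thus "adjoin C E (U ` {..<3 - LND_rank C E 3 \<delta>}) = adjoin C E (V ` {..<3 - LND_rank C E 3 \<delta>})"
  by (simp add: r_def)
qed

section \<open>Tensor products\<close>

locale two_modules = M: module R M + N: module R N
 for R :: "('r, 'x) ring_scheme" (structure) and M :: "('r, 'a, 'm) module_scheme" and N :: "('r, 'b, 'k) module_scheme"
begin

definition tkeys :: "('a \<times> 'b \<Rightarrow>\<^sub>0 int) \<Rightarrow> bool"
 where "tkeys x \<longleftrightarrow> Poly_Mapping.keys x \<subseteq> carrier M \<times> carrier N"

abbreviation K where "K \<equiv> tensor_kernel R M N"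

abbreviation tc where "tc \<equiv> tensor_class R M N"

lemma tkeys_simps [simp]:
 "tkeys 0" "tkeys (- x) \<longleftrightarrow> tkeys x" "tkeys (frag_of (a, l)) \<longleftrightarrow> a \<in> carrier M \<and> l \<in> carrier N"
 by (simp_all add: tkeys_def)

lemma tkeys_diff [intro]: "tkeys x ==> tkeys y ==> tkeys (x - y)"
 unfolding tkeys_def using keys_diff[of x y] by blast

lemma tkeys_add [intro]: "tkeys x ==> tkeys y ==> tkeys (x + y)"
 unfolding tkeys_def using keys_add[of x y] by blast

lemma tkeys_induct [consumes 1, case_names zero pure diff]:
 assumes "tkeys x" and "Q 0" and "\<And>a l. a \<in> carrier M ==> l \<in> carrier N ==> Q (frag_of (a, l))"
  and "\<And>x y. Q x ==> Q y ==> Q (x - y)"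
 shows "Q x"
 using assms(1)[unfolded tkeys_def] by (induction x rule: frag_induction) (use assms in auto)

lemma relator_cases [consumes 1, case_names left right balanced]:
 assumes "z \<in> tensor_relators R M N"
 obtains x x' y where "z = frag_of (x \<oplus>\<^bsub>M\<^esub> x', y) - frag_of (x, y) - frag_of (x', y)"
   "x \<in> carrier M" "x' \<in> carrier M" "y \<in> carrier N"
 | x y y' where "z = frag_of (x, y \<oplus>\<^bsub>N\<^esub> y') - frag_of (x, y) - frag_of (x, y')"
   "x \<in> carrier M" "y \<in> carrier N" "y' \<in> carrier N"
 | r x y where "z = frag_of (r \<odot>\<^bsub>M\<^esub> x, y) - frag_of (x, r \<odot>\<^bsub>N\<^esub> y)"
   "r \<in> carrier R" "x \<in> carrier M" "y \<in> carrier N"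
 using assms unfolding tensor_relators_def by blast

lemma relatorsI:
 "x \<in> carrier M ==> x' \<in> carrier M ==> y \<in> carrier N ==>
  frag_of (x \<oplus>\<^bsub>M\<^esub> x', y) - frag_of (x, y) - frag_of (x', y) \<in> tensor_relators R M N"
 "x \<in> carrier M ==> y \<in> carrier N ==> y' \<in> carrier N ==>
  frag_of (x, y \<oplus>\<^bsub>N\<^esub> y') - frag_of (x, y) - frag_of (x, y') \<in> tensor_relators R M N"
 "r \<in> carrier R ==> x \<in> carrier M ==> y \<in> carrier N ==>
  frag_of (r \<odot>\<^bsub>M\<^esub> x, y) - frag_of (x, r \<odot>\<^bsub>N\<^esub> y) \<in> tensor_relators R M N"
 unfolding tensor_relators_def by blast+

lemma relators_tkeys: "x \<in> tensor_relators R M N ==> tkeys x"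
 by (erule relator_cases) (auto intro!: tkeys_diff)

lemma relator_kernel: "x \<in> tensor_relators R M N ==> x \<in> K"
 unfolding tensor_kernel_def by (rule generate.incl)

lemma kernel_zero: "0 \<in> K"
 unfolding tensor_kernel_def tensor_free_def using generate.one by (metis one_free_Abelian_group)

lemma kernel_add: "x \<in> K ==> y \<in> K ==> x + y \<in> K"
 unfolding tensor_kernel_def tensor_free_def using generate.eng by (metis mult_free_Abelian_group)

lemma kernel_induct [consumes 1, case_names zero relator uminus add]:
 assumes x: "x \<in> K" and zero: "P 0" and relator: "\<And>r. r \<in> tensor_relators R M N ==> P r"
  and uminus: "\<And>r. r \<in> tensor_relators R M N ==> P r ==> P (- r)"
  and add: "\<And>x y. x \<in> K ==> y \<in> K ==> P x ==> P y ==> P (x + y)"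
 shows "P x"
 using x unfolding tensor_kernel_def tensor_free_def
proof (induction x rule: generate.induct)
 case one
 thus ?case by (simp add: zero)
next
 case (incl h)
 thus ?case by (rule relator)
next
 case (inv h)
 thus ?case using uminus[OF inv relator[OF inv]] relators_tkeys[OF inv] by (simp add: tkeys_def)
next
 case (eng x y)
 thus ?case using add[of x y] by (simp add: tensor_kernel_def tensor_free_def)
qed

lemma kernel_uminus: "x \<in> K ==> - x \<in> K"
proof (induction x rule: kernel_induct)
 case zero
 thus ?case by (simp add: kernel_zero)
next
 case (relator r)
 hence "inv\<^bsub>tensor_free M N\<^esub> r \<in> K" unfolding tensor_kernel_def by (rule generate.inv)
 thus ?case using relators_tkeys[OF relator] by (simp add: tensor_free_def tkeys_def)
next
 case (uminus r)
 thus ?case by (simp add: relator_kernel)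
next
 case (add x y)
 thus ?case using kernel_add[of "- x" "- y"] by simp
qed

lemma kernel_tkeys: "x \<in> K ==> tkeys x"
 by (induction x rule: kernel_induct) (auto simp: relators_tkeys)

lemma kernel_diff: "x \<in> K ==> y \<in> K ==> x - y \<in> K"
 using kernel_add[of x "- y"] kernel_uminus by simp

lemma mem_class_iff: "y \<in> tc x \<longleftrightarrow> y - x \<in> K"
proof
 show "y \<in> tc x ==> y - x \<in> K"
  by (auto simp: tensor_class_def r_coset_def tensor_free_def)
 assume "y - x \<in> K"
 hence "(y - x) + x \<in> tc x" unfolding tensor_class_def r_coset_def tensor_free_def by force
 thus "y \<in> tc x" by simp
qed

lemma class_eq_iff: "tc x = tc y \<longleftrightarrow> x - y \<in> K"
proof
 assume "tc x = tc y"
 thus "x - y \<in> K" using mem_class_iff[of x x] mem_class_iff[of x y] kernel_zero by simp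
next
 assume xy: "x - y \<in> K"
 have "z - x \<in> K \<longleftrightarrow> z - y \<in> K" for z
  using kernel_add[OF _ xy, of "z - x"] kernel_diff[OF _ xy, of "z - y"] by (auto simp: algebra_simps)
 thus "tc x = tc y" by (auto simp: mem_class_iff)
qed

lemma carrier_tensor_group: "carrier (tensor_group R M N) = tc ` {x. tkeys x}"
 by (auto simp: tensor_group_def carrier_FactGroup tensor_class_def tensor_free_def tkeys_def)

lemma one_tensor_group: "\<one>\<^bsub>tensor_group R M N\<^esub> = tc 0"
 by (auto simp: tensor_group_def mem_class_iff)

lemma mult_tensor_group: "tc x \<otimes>\<^bsub>tensor_group R M N\<^esub> tc y = tc (x + y)"
proof -
 have "(\<exists>a b. a - x \<in> K \<and> b - y \<in> K \<and> z = a + b) \<longleftrightarrow> z - (x + y) \<in> K" for z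
 proof
  assume "\<exists>a b. a - x \<in> K \<and> b - y \<in> K \<and> z = a + b"
  then obtain a b where "a - x \<in> K" "b - y \<in> K" "z = a + b" by blast
  thus "z - (x + y) \<in> K" using kernel_add[of "a - x" "b - y"] by (simp add: algebra_simps)
 next
  assume "z - (x + y) \<in> K"
  hence "(z - y) - x \<in> K" "y - y \<in> K" "z = (z - y) + y" by (simp_all add: kernel_zero algebra_simps)
  thus "\<exists>a b. a - x \<in> K \<and> b - y \<in> K \<and> z = a + b" by blast
 qed
 hence "{a + b | a b. a \<in> tc x \<and> b \<in> tc y} = tc (x + y)"
  unfolding set_eq_iff mem_Collect_eq mem_class_iff by blast
 moreover have "tc x \<otimes>\<^bsub>tensor_group R M N\<^esub> tc y = {a + b | a b. a \<in> tc x \<and> b \<in> tc y}"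
  unfolding tensor_group_def FactGroup_def set_mult_def tensor_free_def by auto
 ultimately show ?thesis by simp
qed

lemma class_add_left:
 assumes "a \<in> carrier M" "a' \<in> carrier M" "l \<in> carrier N"
 shows "tc (frag_of (a \<oplus>\<^bsub>M\<^esub> a', l)) = tc (frag_of (a, l) + frag_of (a', l))"
 using relator_kernel[OF relatorsI(1)] assms by (simp add: class_eq_iff algebra_simps)

lemma class_add_right:
 assumes "a \<in> carrier M" "l \<in> carrier N" "l' \<in> carrier N"
 shows "tc (frag_of (a, l \<oplus>\<^bsub>N\<^esub> l')) = tc (frag_of (a, l) + frag_of (a, l'))"
 using relator_kernel[OF relatorsI(2)] assms by (simp add: class_eq_iff algebra_simps)

lemma class_balanced:
 assumes "r \<in> carrier R" "a \<in> carrier M" "l \<in> carrier N"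
 shows "tc (frag_of (r \<odot>\<^bsub>M\<^esub> a, l)) = tc (frag_of (a, r \<odot>\<^bsub>N\<^esub> l))"
 using relator_kernel[OF relatorsI(3)] assms by (simp add: class_eq_iff)

lemma class_double_zero: "tc x = tc (x + x) ==> tc x = tc 0"
 using kernel_uminus[of "- x"] by (simp add: class_eq_iff)

lemma class_zero_left: "l \<in> carrier N ==> tc (frag_of (\<zero>\<^bsub>M\<^esub>, l)) = tc 0"
 using class_add_left[of "\<zero>\<^bsub>M\<^esub>" "\<zero>\<^bsub>M\<^esub>" l] by (intro class_double_zero) simp

lemma class_zero_right: "a \<in> carrier M ==> tc (frag_of (a, \<zero>\<^bsub>N\<^esub>)) = tc 0"
 using class_add_right[of a "\<zero>\<^bsub>N\<^esub>" "\<zero>\<^bsub>N\<^esub>"] by (intro class_double_zero) simp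

lemma class_cong_add: "tc x = tc x' ==> tc y = tc y' ==> tc (x + y) = tc (x' + y')"
 using kernel_add[of "x - x'" "y - y'"] by (simp add: class_eq_iff algebra_simps)

lemma class_uminus_left:
 assumes "a \<in> carrier M" "l \<in> carrier N"
 shows "tc (- frag_of (a, l)) = tc (frag_of (\<ominus>\<^bsub>M\<^esub> a, l))"
proof -
 have "tc (frag_of (a, l) + frag_of (\<ominus>\<^bsub>M\<^esub> a, l)) = tc 0"
  using class_add_left[of a "\<ominus>\<^bsub>M\<^esub> a" l] class_zero_left[of l] assms by (simp add: M.M.r_neg)
 hence "frag_of (a, l) + frag_of (\<ominus>\<^bsub>M\<^esub> a, l) \<in> K" by (simp add: class_eq_iff)
 thus ?thesis using kernel_uminus[of "frag_of (a, l) + frag_of (\<ominus>\<^bsub>M\<^esub> a, l)"] by (simp add: class_eq_iff)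
qed

text \<open>
 Negatives need no case of their own, since \<open>- (a \<otimes> l) = (- a) \<otimes> l\<close>.
\<close>

lemma tensor_induct [consumes 1, case_names tensor add]:
 assumes U: "U \<in> carrier (tensor_group R M N)"
  and tensor: "\<And>a l. a \<in> carrier M ==> l \<in> carrier N ==> P (tc (frag_of (a, l)))"
  and add: "\<And>x y. tkeys x ==> tkeys y ==> P (tc x) ==> P (tc y) ==> P (tc (x + y))"
 shows "P U"
proof -
 obtain x where x: "tkeys x" "U = tc x" using U by (auto simp: carrier_tensor_group)
 have "tkeys x \<and> P (tc x) \<and> P (tc (- x))"
  using x(1)
 proof (induction x rule: tkeys_induct)
  case zero
  thus ?case using tensor[of "\<zero>\<^bsub>M\<^esub>" "\<zero>\<^bsub>N\<^esub>"] class_zero_left[of "\<zero>\<^bsub>N\<^esub>"] by simp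
 next
  case (pure a l)
  thus ?case using tensor[of a l] tensor[of "\<ominus>\<^bsub>M\<^esub> a" l] class_uminus_left[of a l] by simp
 next
  case (diff x y)
  thus ?case using add[of x "- y"] add[of y "- x"] tkeys_diff by simp
 qed
 thus ?thesis using x(2) by simp
qed

end

lemma frag_extend_add_fun: "frag_extend (\<lambda>i. f i + g i) x = frag_extend f x + frag_extend g x"
 by (simp add: frag_extend_def frag_cmul_distrib2 sum.distrib)

lemma frag_extend_diff_fun: "frag_extend (\<lambda>i. f i - g i) x = frag_extend f x - frag_extend g x"
 using subset_UNIV[of "Poly_Mapping.keys x"]
 by (induction x rule: frag_induction) (simp_all add: frag_extend_diff)

definition frag_map2 :: "('c \<Rightarrow> 'a) \<Rightarrow> ('d \<Rightarrow> 'b) \<Rightarrow> ('c \<times> 'd \<Rightarrow>\<^sub>0 int) \<Rightarrow> ('a \<times> 'b \<Rightarrow>\<^sub>0 int)"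
 where "frag_map2 f g = frag_extend (\<lambda>(c, d). frag_of (f c, g d))"

lemma frag_map2_simps:
 "frag_map2 f g 0 = 0" "frag_map2 f g (frag_of (c, d)) = frag_of (f c, g d)"
 "frag_map2 f g (x + y) = frag_map2 f g x + frag_map2 f g y"
 "frag_map2 f g (x - y) = frag_map2 f g x - frag_map2 f g y"
 "frag_map2 f g (- x) = - frag_map2 f g x"
 by (simp_all add: frag_map2_def frag_extend_add frag_extend_diff frag_extend_minus)

lemma frag_map2_id: "frag_map2 (\<lambda>a. a) (\<lambda>b. b) x = x"
 using frag_expansion[of x] by (simp add: frag_map2_def case_prod_unfold)

lemma linear_mapsD:
 assumes "f \<in> linear_maps R M N"
 shows "x \<in> carrier M ==> f x \<in> carrier N"
  "x \<in> carrier M ==> y \<in> carrier M ==> f (x \<oplus>\<^bsub>M\<^esub> y) = f x \<oplus>\<^bsub>N\<^esub> f y"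
  "r \<in> carrier R ==> x \<in> carrier M ==> f (r \<odot>\<^bsub>M\<^esub> x) = r \<odot>\<^bsub>N\<^esub> f x"
 using assms by (auto simp: linear_maps_def)

lemma frag_map2_tkeys:
 assumes "two_modules R M N" "two_modules R M' N'"
  and f: "f \<in> linear_maps R M M'" and g: "g \<in> linear_maps R N N'" and x: "two_modules.tkeys M N x"
 shows "two_modules.tkeys M' N' (frag_map2 f g x)"
proof -
 interpret S: two_modules R M N by fact
 interpret T: two_modules R M' N' by fact
 show ?thesis
  using x by (induction x rule: S.tkeys_induct)
   (auto simp: frag_map2_simps linear_mapsD[OF f] linear_mapsD[OF g])
qed

lemma frag_map2_kernel:
 assumes "two_modules R M N" "two_modules R M' N'"
  and f: "f \<in> linear_maps R M M'" and g: "g \<in> linear_maps R N N'" and x: "x \<in> tensor_kernel R M N"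
 shows "frag_map2 f g x \<in> tensor_kernel R M' N'"
proof -
 interpret S: two_modules R M N by fact
 interpret T: two_modules R M' N' by fact
 note D = linear_mapsD[OF f] linear_mapsD[OF g]
 have rel: "frag_map2 f g r \<in> tensor_relators R M' N'" if "r \<in> tensor_relators R M N" for r
  using that
 proof (cases rule: S.relator_cases)
  case (left x x' y)
  thus ?thesis using T.relatorsI(1)[of "f x" "f x'" "g y"] by (simp add: frag_map2_simps D)
 next
  case (right x y y')
  thus ?thesis using T.relatorsI(2)[of "f x" "g y" "g y'"] by (simp add: frag_map2_simps D)
 next
  case (balanced r x y)
  thus ?thesis using T.relatorsI(3)[of r "f x" "g y"] by (simp add: frag_map2_simps D)
 qed
 show ?thesis
  using x
 proof (induction x rule: S.kernel_induct)
  case zero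
  show ?case by (simp add: frag_map2_simps T.kernel_zero)
 next
  case (relator r)
  thus ?case by (intro T.relator_kernel rel)
 next
  case (uminus r)
  thus ?case by (simp add: frag_map2_simps T.kernel_uminus)
 next
  case (add x y)
  thus ?case by (simp add: frag_map2_simps T.kernel_add)
 qed
qed

lemma tensor_map_class:
 assumes "two_modules R M N" "two_modules R M' N'"
  and "f \<in> linear_maps R M M'" "g \<in> linear_maps R N N'"
 shows "tensor_map R M' N' f g (tensor_class R M N x) = tensor_class R M' N' (frag_map2 f g x)"
proof -
 interpret S: two_modules R M N by fact
 interpret T: two_modules R M' N' by fact
 have "tensor_class R M' N' (frag_map2 f g y) = tensor_class R M' N' (frag_map2 f g x)"
  if "y \<in> tensor_class R M N x" for y
  using frag_map2_kernel[OF assms, of "y - x"] that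
  by (simp add: T.class_eq_iff S.mem_class_iff frag_map2_simps)
 moreover have "x \<in> tensor_class R M N x" by (simp add: S.mem_class_iff S.kernel_zero)
 ultimately show ?thesis unfolding tensor_map_def frag_map2_def[symmetric] by blast
qed

subsection \<open>The ring structure\<close>

definition frag_mult :: "('a, 'm) ring_scheme \<Rightarrow> ('b, 'k) ring_scheme
  \<Rightarrow> ('a \<times> 'b \<Rightarrow>\<^sub>0 int) \<Rightarrow> ('a \<times> 'b \<Rightarrow>\<^sub>0 int) \<Rightarrow> ('a \<times> 'b \<Rightarrow>\<^sub>0 int)"
 where "frag_mult A L x y =
  frag_extend (\<lambda>(a, l). frag_extend (\<lambda>(a', l'). frag_of (a \<otimes>\<^bsub>A\<^esub> a', l \<otimes>\<^bsub>L\<^esub> l')) y) x"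

lemma frag_mult_simps:
 "frag_mult A L 0 y = 0" "frag_mult A L x 0 = 0"
 "frag_mult A L (x + x') y = frag_mult A L x y + frag_mult A L x' y"
 "frag_mult A L (x - x') y = frag_mult A L x y - frag_mult A L x' y"
 "frag_mult A L (- x) y = - frag_mult A L x y"
 "frag_mult A L x (y + y') = frag_mult A L x y + frag_mult A L x y'"
 "frag_mult A L x (y - y') = frag_mult A L x y - frag_mult A L x y'"
 "frag_mult A L (frag_of (a, l)) (frag_of (a', l')) = frag_of (a \<otimes>\<^bsub>A\<^esub> a', l \<otimes>\<^bsub>L\<^esub> l')"
proof -
 show "frag_mult A L x 0 = 0" by (simp add: frag_mult_def frag_extend_eq_0)
 show "frag_mult A L x (y + y') = frag_mult A L x y + frag_mult A L x y'"
  by (simp add: frag_mult_def frag_extend_add case_prod_unfold frag_extend_add_fun)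
 show "frag_mult A L x (y - y') = frag_mult A L x y - frag_mult A L x y'"
  by (simp add: frag_mult_def frag_extend_diff case_prod_unfold frag_extend_diff_fun)
qed (simp_all add: frag_mult_def frag_extend_add frag_extend_diff frag_extend_minus)

locale two_algebras = A: algebra R A + L: algebra R L
 for R :: "('r, 'x) ring_scheme" (structure) and A :: "('r, 'a, 'm) module_scheme" and L :: "('r, 'b, 'k) module_scheme"
begin

sublocale two_modules R A L
 by unfold_locales

abbreviation fm where "fm \<equiv> frag_mult A L"

lemma fm_tkeys [intro]: "tkeys x ==> tkeys y ==> tkeys (fm x y)"
proof (induction x rule: tkeys_induct)
 case (pure a l)
 from pure(3) show ?case
  by (induction y rule: tkeys_induct) (use pure in \<open>auto simp: frag_mult_simps\<close>)
qed (auto simp: frag_mult_simps)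

lemma fm_comm: "tkeys x ==> tkeys y ==> fm x y = fm y x"
proof (induction x rule: tkeys_induct)
 case (pure a l)
 from pure(3) show ?case
  by (induction y rule: tkeys_induct) (use pure in \<open>auto simp: frag_mult_simps A.m_comm L.m_comm\<close>)
qed (auto simp: frag_mult_simps)

lemma fm_assoc: "tkeys x ==> tkeys y ==> tkeys z ==> fm (fm x y) z = fm x (fm y z)"
proof (induction x rule: tkeys_induct)
 case (pure a l)
 from pure(3) show ?case
 proof (induction y rule: tkeys_induct)
  case (pure a' l')
  note q = pure
  from \<open>tkeys z\<close> show ?case
   by (induction z rule: tkeys_induct)
    (use q \<open>a \<in> carrier A\<close> \<open>l \<in> carrier L\<close> in \<open>auto simp: frag_mult_simps A.m_assoc L.m_assoc\<close>)
 qed (auto simp: frag_mult_simps)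
qed (auto simp: frag_mult_simps)

lemma fm_one: "tkeys x ==> fm (frag_of (\<one>\<^bsub>A\<^esub>, \<one>\<^bsub>L\<^esub>)) x = x"
 by (induction x rule: tkeys_induct) (auto simp: frag_mult_simps)

lemma fm_kernel: "x \<in> K ==> tkeys y ==> fm x y \<in> K"
proof (induction x rule: kernel_induct)
 case (relator r)
 from relator(2) show ?case
 proof (induction y rule: tkeys_induct)
  case (pure a l)
  from relator(1) have "fm r (frag_of (a, l)) \<in> tensor_relators R A L"
  proof (cases rule: relator_cases)
   case (left x x' y)
   thus ?thesis using relatorsI(1)[of "x \<otimes>\<^bsub>A\<^esub> a" "x' \<otimes>\<^bsub>A\<^esub> a" "y \<otimes>\<^bsub>L\<^esub> l"] pure
    by (simp add: frag_mult_simps A.l_distr)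
  next
   case (right x y y')
   thus ?thesis using relatorsI(2)[of "x \<otimes>\<^bsub>A\<^esub> a" "y \<otimes>\<^bsub>L\<^esub> l" "y' \<otimes>\<^bsub>L\<^esub> l"] pure
    by (simp add: frag_mult_simps L.l_distr)
  next
   case (balanced s x y)
   thus ?thesis using relatorsI(3)[of s "x \<otimes>\<^bsub>A\<^esub> a" "y \<otimes>\<^bsub>L\<^esub> l"] pure
    by (simp add: frag_mult_simps A.smult_assoc2 L.smult_assoc2)
  qed
  thus ?case by (rule relator_kernel)
 qed (auto simp: frag_mult_simps kernel_zero intro: kernel_diff)
next
 case (uminus r)
 thus ?case by (simp add: frag_mult_simps kernel_uminus)
qed (auto simp: frag_mult_simps kernel_zero kernel_add)

lemma class_tkeys: "tkeys x ==> y \<in> tc x ==> tkeys y"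
 using kernel_tkeys[of "y - x"] tkeys_add[of "y - x" x] by (simp add: mem_class_iff)

abbreviation TR where "TR \<equiv> tensor_ring R A L"

lemma tensor_mult:
 assumes x: "tkeys x" and y: "tkeys y"
 shows "tc x \<otimes>\<^bsub>TR\<^esub> tc y = tc (fm x y)"
proof -
 have "tc (fm x' y') = tc (fm x y)" if "x' \<in> tc x" "y' \<in> tc y" for x' y'
 proof -
  have k: "tkeys x'" "tkeys y'" using that class_tkeys x y by auto
  have "fm (x' - x) y' \<in> K" using fm_kernel[OF _ k(2)] that(1) by (simp add: mem_class_iff)
  moreover have "fm (y' - y) x \<in> K" using fm_kernel[OF _ x] that(2) by (simp add: mem_class_iff)
  ultimately have "fm (x' - x) y' + fm (y' - y) x \<in> K" by (rule kernel_add)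
  moreover have "fm (x' - x) y' + fm (y' - y) x = fm x' y' - fm x y"
   using fm_comm[OF x k(2)] fm_comm[OF x y] by (simp add: frag_mult_simps)
  ultimately show ?thesis by (simp add: class_eq_iff)
 qed
 moreover have "x \<in> tc x" "y \<in> tc y" by (simp_all add: mem_class_iff kernel_zero)
 ultimately have "(\<Union>x'\<in>tc x. \<Union>y'\<in>tc y. tc (fm x' y')) = tc (fm x y)" by blast
 thus ?thesis by (simp add: tensor_ring_def frag_mult_def)
qed

lemma tensor_ring_simps:
 "carrier TR = tc ` {x. tkeys x}" "\<one>\<^bsub>TR\<^esub> = tc (frag_of (\<one>\<^bsub>A\<^esub>, \<one>\<^bsub>L\<^esub>))" "\<zero>\<^bsub>TR\<^esub> = tc 0"
 "tc x \<oplus>\<^bsub>TR\<^esub> tc y = tc (x + y)"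
 by (simp_all add: tensor_ring_def carrier_tensor_group one_tensor_group mult_tensor_group)

lemma pure_in_tensor: "a \<in> carrier A ==> l \<in> carrier L ==> tc (frag_of (a, l)) \<in> carrier TR"
 by (auto simp: tensor_ring_simps)

lemma pure_mult:
 "a \<in> carrier A ==> l \<in> carrier L ==> a' \<in> carrier A ==> l' \<in> carrier L ==>
  tc (frag_of (a, l)) \<otimes>\<^bsub>TR\<^esub> tc (frag_of (a', l')) = tc (frag_of (a \<otimes>\<^bsub>A\<^esub> a', l \<otimes>\<^bsub>L\<^esub> l'))"
 by (simp add: tensor_mult frag_mult_simps)

lemma tensor_cring: "cring TR"
proof (rule cringI)
 show "abelian_group TR"
 proof (rule abelian_groupI)
  fix U V assume "U \<in> carrier TR" "V \<in> carrier TR"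
  thus "U \<oplus>\<^bsub>TR\<^esub> V \<in> carrier TR" by (auto simp: tensor_ring_simps intro: tkeys_add)
 next
  show "\<zero>\<^bsub>TR\<^esub> \<in> carrier TR" by (auto simp: tensor_ring_simps)
 next
  fix U V W assume "U \<in> carrier TR" "V \<in> carrier TR" "W \<in> carrier TR"
  thus "U \<oplus>\<^bsub>TR\<^esub> V \<oplus>\<^bsub>TR\<^esub> W = U \<oplus>\<^bsub>TR\<^esub> (V \<oplus>\<^bsub>TR\<^esub> W)"
   by (auto simp: tensor_ring_simps add.assoc)
 next
  fix U V assume "U \<in> carrier TR" "V \<in> carrier TR"
  thus "U \<oplus>\<^bsub>TR\<^esub> V = V \<oplus>\<^bsub>TR\<^esub> U" by (auto simp: tensor_ring_simps add.commute)
 next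
  fix U assume "U \<in> carrier TR"
  then obtain x where x: "tkeys x" "U = tc x" by (auto simp: tensor_ring_simps)
  thus "\<zero>\<^bsub>TR\<^esub> \<oplus>\<^bsub>TR\<^esub> U = U" by (simp add: tensor_ring_simps)
  have "tc (- x) \<oplus>\<^bsub>TR\<^esub> U = \<zero>\<^bsub>TR\<^esub>" "tc (- x) \<in> carrier TR" using x by (auto simp: tensor_ring_simps)
  thus "\<exists>V\<in>carrier TR. V \<oplus>\<^bsub>TR\<^esub> U = \<zero>\<^bsub>TR\<^esub>" by blast
 qed
 show "comm_monoid TR"
 proof (rule comm_monoidI)
  fix U V assume "U \<in> carrier TR" "V \<in> carrier TR"
  thus "U \<otimes>\<^bsub>TR\<^esub> V \<in> carrier TR"
   by (auto simp: tensor_ring_simps(1) tensor_mult intro: fm_tkeys)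
 next
  show "\<one>\<^bsub>TR\<^esub> \<in> carrier TR" by (auto simp: tensor_ring_simps)
 next
  fix U V W assume "U \<in> carrier TR" "V \<in> carrier TR" "W \<in> carrier TR"
  thus "U \<otimes>\<^bsub>TR\<^esub> V \<otimes>\<^bsub>TR\<^esub> W = U \<otimes>\<^bsub>TR\<^esub> (V \<otimes>\<^bsub>TR\<^esub> W)"
   by (auto simp: tensor_ring_simps(1) tensor_mult fm_tkeys fm_assoc)
 next
  fix U assume "U \<in> carrier TR"
  thus "\<one>\<^bsub>TR\<^esub> \<otimes>\<^bsub>TR\<^esub> U = U" by (auto simp: tensor_ring_simps(1,2) tensor_mult fm_one)
 next
  fix U V assume "U \<in> carrier TR" "V \<in> carrier TR"
  thus "U \<otimes>\<^bsub>TR\<^esub> V = V \<otimes>\<^bsub>TR\<^esub> U" by (auto simp: tensor_ring_simps(1) tensor_mult fm_comm)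
 qed
 fix U V W assume "U \<in> carrier TR" "V \<in> carrier TR" "W \<in> carrier TR"
 thus "(U \<oplus>\<^bsub>TR\<^esub> V) \<otimes>\<^bsub>TR\<^esub> W = U \<otimes>\<^bsub>TR\<^esub> W \<oplus>\<^bsub>TR\<^esub> V \<otimes>\<^bsub>TR\<^esub> W"
  by (auto simp: tensor_ring_simps(1,4) tensor_mult tkeys_add frag_mult_simps)
qed

end

lemma algebra_of_hom_simps:
 "carrier (algebra_of_hom h E) = carrier E" "x \<otimes>\<^bsub>algebra_of_hom h E\<^esub> y = x \<otimes>\<^bsub>E\<^esub> y"
 "\<one>\<^bsub>algebra_of_hom h E\<^esub> = \<one>\<^bsub>E\<^esub>" "\<zero>\<^bsub>algebra_of_hom h E\<^esub> = \<zero>\<^bsub>E\<^esub>"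
 "x \<oplus>\<^bsub>algebra_of_hom h E\<^esub> y = x \<oplus>\<^bsub>E\<^esub> y" "c \<odot>\<^bsub>algebra_of_hom h E\<^esub> x = h c \<otimes>\<^bsub>E\<^esub> x"
 by (simp_all add: algebra_of_hom_def)

lemma cring_algebra_of_hom:
 assumes "cring E"
 shows "cring (algebra_of_hom h E)"
proof -
 interpret cring E by fact
 have "abelian_group (algebra_of_hom h E)"
  by (rule abelian_groupI) (use l_neg in \<open>auto simp: algebra_of_hom_simps a_ac\<close>)
 moreover have "comm_monoid (algebra_of_hom h E)"
  by (rule comm_monoidI) (simp_all add: algebra_of_hom_simps m_ac)
 ultimately show ?thesis by (rule cringI) (simp add: algebra_of_hom_simps l_distr)
qed

lemma algebra_algebra_of_hom:
 assumes E: "cring E" and C: "cring C" and h: "h \<in> ring_hom C E"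
 shows "algebra C (algebra_of_hom h E)"
proof -
 interpret cring E by fact
 note hD = ring_hom_memE[OF h]
 show ?thesis
  by (rule algebraI[OF C cring_algebra_of_hom[OF E]])
   (simp_all add: algebra_of_hom_simps hD l_distr r_distr m_assoc)
qed

lemma (in two_algebras) base_change_hom: "(\<lambda>l. tc (frag_of (\<one>\<^bsub>A\<^esub>, l))) \<in> ring_hom L TR"
proof (rule ring_hom_memI)
 fix l l' assume l: "l \<in> carrier L" "l' \<in> carrier L"
 show "tc (frag_of (\<one>\<^bsub>A\<^esub>, l \<otimes>\<^bsub>L\<^esub> l')) = tc (frag_of (\<one>\<^bsub>A\<^esub>, l)) \<otimes>\<^bsub>TR\<^esub> tc (frag_of (\<one>\<^bsub>A\<^esub>, l'))"
  using l by (simp add: pure_mult)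
 show "tc (frag_of (\<one>\<^bsub>A\<^esub>, l \<oplus>\<^bsub>L\<^esub> l')) = tc (frag_of (\<one>\<^bsub>A\<^esub>, l)) \<oplus>\<^bsub>TR\<^esub> tc (frag_of (\<one>\<^bsub>A\<^esub>, l'))"
  using l by (simp add: class_add_right tensor_ring_simps(4))
qed (auto simp: pure_in_tensor tensor_ring_simps(2))

lemma (in two_algebras) base_change_algebra: "algebra L (base_change R A L)"
 unfolding base_change_def by (rule algebra_algebra_of_hom[OF tensor_cring L.M_cring base_change_hom])

lemma (in two_algebras) base_change_simps:
 "carrier (base_change R A L) = tc ` {x. tkeys x}" "tkeys x ==> tkeys y ==> tc x \<otimes>\<^bsub>base_change R A L\<^esub> tc y = tc (fm x y)"
 "\<one>\<^bsub>base_change R A L\<^esub> = tc (frag_of (\<one>\<^bsub>A\<^esub>, \<one>\<^bsub>L\<^esub>))" "\<zero>\<^bsub>base_change R A L\<^esub> = tc 0"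
 "tc x \<oplus>\<^bsub>base_change R A L\<^esub> tc y = tc (x + y)"
 "l \<in> carrier L ==> tkeys x ==> l \<odot>\<^bsub>base_change R A L\<^esub> tc x = tc (fm (frag_of (\<one>\<^bsub>A\<^esub>, l)) x)"
 by (simp_all add: base_change_def algebra_of_hom_simps tensor_ring_simps tensor_mult)

section \<open>Fraction fields and residue fields\<close>

locale fractions = domain R for R :: "('r, 'x) ring_scheme" (structure) +
 fixes S :: "'r set"
 assumes S: "S \<subseteq> carrier R" "\<one> \<in> S" "\<And>s t. s \<in> S ==> t \<in> S ==> s \<otimes> t \<in> S" "\<zero> \<notin> S"
begin

abbreviation Q where "Q \<equiv> localization_ring R S"

lemma S_carrier [simp]: "s \<in> S ==> s \<in> carrier R"
 using S(1) by blast

lemma S_cancel: "u \<in> S ==> a \<in> carrier R ==> b \<in> carrier R ==> u \<otimes> a = u \<otimes> b \<longleftrightarrow> a = b"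
 using S(4) m_lcancel[of u a b] by auto

lemma fraction_rel_iff:
 "((a, s), (b, t)) \<in> fraction_rel R S \<longleftrightarrow>
  a \<in> carrier R \<and> s \<in> S \<and> b \<in> carrier R \<and> t \<in> S \<and> a \<otimes> t = b \<otimes> s"
 unfolding fraction_rel_def using S(2) by (auto simp: S_cancel)

lemma fraction_equiv: "equiv (carrier R \<times> S) (fraction_rel R S)"
proof (rule equivI)
 show "fraction_rel R S \<subseteq> (carrier R \<times> S) \<times> (carrier R \<times> S)"
  by (auto simp: fraction_rel_iff)
 show "refl_on (carrier R \<times> S) (fraction_rel R S)"
  by (auto simp: refl_on_def fraction_rel_iff)
 show "sym (fraction_rel R S)" by (auto simp: sym_def fraction_rel_iff)
 show "trans (fraction_rel R S)"
 proof (rule transI, clarify)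
  fix a s b t c v assume "((a, s), (b, t)) \<in> fraction_rel R S" "((b, t), (c, v)) \<in> fraction_rel R S"
  hence c: "a \<in> carrier R" "b \<in> carrier R" "c \<in> carrier R" "s \<in> S" "t \<in> S" "v \<in> S"
   and e: "a \<otimes> t = b \<otimes> s" "b \<otimes> v = c \<otimes> t" by (auto simp: fraction_rel_iff)
  have "t \<otimes> (a \<otimes> v) = (a \<otimes> t) \<otimes> v" using c by (simp add: m_ac)
  also have "\<dots> = (b \<otimes> v) \<otimes> s" unfolding e(1) using c by (simp add: m_ac)
  also have "\<dots> = t \<otimes> (c \<otimes> s)" unfolding e(2) using c by (simp add: m_ac)
  finally show "((a, s), (c, v)) \<in> fraction_rel R S" using c by (simp add: fraction_rel_iff S_cancel)
 qed
qed

lemma fraction_eq_iff: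
 "a \<in> carrier R ==> s \<in> S ==> b \<in> carrier R ==> t \<in> S ==> fraction R S a s = fraction R S b t \<longleftrightarrow> a \<otimes> t = b \<otimes> s"
 unfolding fraction_def by (simp add: eq_equiv_class_iff[OF fraction_equiv] fraction_rel_iff)

lemma fraction_memD: "(b, t) \<in> fraction R S a s ==> b \<in> carrier R \<and> t \<in> S \<and> a \<otimes> t = b \<otimes> s"
 unfolding fraction_def by (auto simp: fraction_rel_iff)

lemma fraction_self: "a \<in> carrier R ==> s \<in> S ==> (a, s) \<in> fraction R S a s"
 unfolding fraction_def by (auto simp: fraction_rel_iff)

lemma fraction_cases:
 assumes "U \<in> carrier Q"
 obtains a s where "U = fraction R S a s" "a \<in> carrier R" "s \<in> S"
 using assms by (auto simp: localization_ring_def quotient_def fraction_def)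

lemma fraction_closed: "a \<in> carrier R ==> s \<in> S ==> fraction R S a s \<in> carrier Q"
 by (auto simp: localization_ring_def quotient_def fraction_def)

lemma fraction_union:
 assumes U: "a \<in> carrier R" "s \<in> S" "b \<in> carrier R" "t \<in> S"
  and F: "\<And>x u y v. x \<in> carrier R ==> u \<in> S ==> y \<in> carrier R ==> v \<in> S ==>
   a \<otimes> u = x \<otimes> s ==> b \<otimes> v = y \<otimes> t ==> F x u y v = C"
 shows "(\<Union>(x, u)\<in>fraction R S a s. \<Union>(y, v)\<in>fraction R S b t. F x u y v) = C"
proof -
 have "F (fst p) (snd p) (fst q) (snd q) = C" if "p \<in> fraction R S a s" "q \<in> fraction R S b t" for p q
  using F[of "fst p" "snd p" "fst q" "snd q"] fraction_memD[of "fst p" "snd p" a s]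
   fraction_memD[of "fst q" "snd q" b t] that by simp
 hence "(\<Union>p\<in>fraction R S a s. \<Union>q\<in>fraction R S b t. F (fst p) (snd p) (fst q) (snd q)) = C"
  using fraction_self[OF U(1,2)] fraction_self[OF U(3,4)] by blast
 thus ?thesis by (simp add: case_prod_unfold)
qed

lemma fraction_mult:
 assumes "a \<in> carrier R" "s \<in> S" "b \<in> carrier R" "t \<in> S"
 shows "fraction R S a s \<otimes>\<^bsub>Q\<^esub> fraction R S b t = fraction R S (a \<otimes> b) (s \<otimes> t)"
 unfolding localization_ring_def
proof (simp, rule fraction_union[OF assms])
 fix x u y v assume c: "x \<in> carrier R" "u \<in> S" "y \<in> carrier R" "v \<in> S"
  and e: "a \<otimes> u = x \<otimes> s" "b \<otimes> v = y \<otimes> t"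
 have "(a \<otimes> b) \<otimes> (u \<otimes> v) = (a \<otimes> u) \<otimes> (b \<otimes> v)" using c assms by (simp add: m_ac)
 also have "\<dots> = (x \<otimes> y) \<otimes> (s \<otimes> t)" unfolding e using c assms by (simp add: m_ac)
 finally show "fraction R S (x \<otimes> y) (u \<otimes> v) = fraction R S (a \<otimes> b) (s \<otimes> t)"
  using c assms S(3) by (simp add: fraction_eq_iff)
qed

lemma fraction_add:
 assumes "a \<in> carrier R" "s \<in> S" "b \<in> carrier R" "t \<in> S"
 shows "fraction R S a s \<oplus>\<^bsub>Q\<^esub> fraction R S b t = fraction R S (a \<otimes> t \<oplus> b \<otimes> s) (s \<otimes> t)"
 unfolding localization_ring_def
proof (simp, rule fraction_union[OF assms])
 fix x u y v assume c: "x \<in> carrier R" "u \<in> S" "y \<in> carrier R" "v \<in> S"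
  and e: "a \<otimes> u = x \<otimes> s" "b \<otimes> v = y \<otimes> t"
 have "(a \<otimes> t \<oplus> b \<otimes> s) \<otimes> (u \<otimes> v) = (a \<otimes> u) \<otimes> (t \<otimes> v) \<oplus> (b \<otimes> v) \<otimes> (s \<otimes> u)"
  using c assms by (simp add: m_ac l_distr r_distr a_ac)
 also have "\<dots> = (x \<otimes> v \<oplus> y \<otimes> u) \<otimes> (s \<otimes> t)" unfolding e using c assms by (simp add: m_ac l_distr r_distr a_ac)
 finally show "fraction R S (x \<otimes> v \<oplus> y \<otimes> u) (u \<otimes> v) = fraction R S (a \<otimes> t \<oplus> b \<otimes> s) (s \<otimes> t)"
  using c assms S(3) by (simp add: fraction_eq_iff)
qed

lemma fraction_one: "\<one>\<^bsub>Q\<^esub> = fraction R S \<one> \<one>" and fraction_zero: "\<zero>\<^bsub>Q\<^esub> = fraction R S \<zero> \<one>"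
 by (simp_all add: localization_ring_def)

lemmas fraction_simps = fraction_mult fraction_add fraction_one fraction_zero fraction_eq_iff fraction_closed S(2,3)

lemma localization_cring: "cring Q"
proof (rule cringI)
 show "abelian_group Q"
 proof (rule abelian_groupI)
  fix U V W assume "U \<in> carrier Q" "V \<in> carrier Q" "W \<in> carrier Q"
  thus "U \<oplus>\<^bsub>Q\<^esub> V \<oplus>\<^bsub>Q\<^esub> W = U \<oplus>\<^bsub>Q\<^esub> (V \<oplus>\<^bsub>Q\<^esub> W)"
   by (elim fraction_cases) (simp add: fraction_simps m_ac l_distr r_distr a_ac)
 next
  fix U assume "U \<in> carrier Q"
  then obtain a s where U: "U = fraction R S a s" "a \<in> carrier R" "s \<in> S" by (rule fraction_cases)
  thus "\<zero>\<^bsub>Q\<^esub> \<oplus>\<^bsub>Q\<^esub> U = U" by (simp add: fraction_simps)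
  have "a \<otimes> s \<oplus> (\<ominus> a) \<otimes> s = \<zero>" using U by (simp add: l_minus r_neg)
  hence "fraction R S (\<ominus> a) s \<oplus>\<^bsub>Q\<^esub> U = \<zero>\<^bsub>Q\<^esub>" using U by (simp add: fraction_simps a_comm)
  thus "\<exists>V\<in>carrier Q. V \<oplus>\<^bsub>Q\<^esub> U = \<zero>\<^bsub>Q\<^esub>" using U fraction_closed[of "\<ominus> a" s] by blast
 next
  fix U V assume "U \<in> carrier Q" "V \<in> carrier Q"
  thus "U \<oplus>\<^bsub>Q\<^esub> V \<in> carrier Q" "U \<oplus>\<^bsub>Q\<^esub> V = V \<oplus>\<^bsub>Q\<^esub> U"
   by (elim fraction_cases; simp add: fraction_simps m_ac a_ac)+
 qed (simp add: fraction_simps)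
 show "comm_monoid Q"
 proof (rule comm_monoidI)
  fix U V W assume "U \<in> carrier Q" "V \<in> carrier Q" "W \<in> carrier Q"
  thus "U \<otimes>\<^bsub>Q\<^esub> V \<otimes>\<^bsub>Q\<^esub> W = U \<otimes>\<^bsub>Q\<^esub> (V \<otimes>\<^bsub>Q\<^esub> W)"
   by (elim fraction_cases) (simp add: fraction_simps m_ac)
 next
  fix U V assume "U \<in> carrier Q" "V \<in> carrier Q"
  thus "U \<otimes>\<^bsub>Q\<^esub> V \<in> carrier Q" "U \<otimes>\<^bsub>Q\<^esub> V = V \<otimes>\<^bsub>Q\<^esub> U"
   by (elim fraction_cases; simp add: fraction_simps m_ac)+
 next
  fix U assume "U \<in> carrier Q"
  thus "\<one>\<^bsub>Q\<^esub> \<otimes>\<^bsub>Q\<^esub> U = U" by (elim fraction_cases) (simp add: fraction_simps)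
 qed (simp add: fraction_simps)
 fix U V W assume "U \<in> carrier Q" "V \<in> carrier Q" "W \<in> carrier Q"
 thus "(U \<oplus>\<^bsub>Q\<^esub> V) \<otimes>\<^bsub>Q\<^esub> W = U \<otimes>\<^bsub>Q\<^esub> W \<oplus>\<^bsub>Q\<^esub> V \<otimes>\<^bsub>Q\<^esub> W"
  by (elim fraction_cases) (simp add: fraction_simps m_ac l_distr r_distr a_ac)
qed

lemma fraction_hom: "(\<lambda>a. fraction R S a \<one>) \<in> ring_hom R Q"
 by (rule ring_hom_memI) (simp_all add: fraction_simps)

end

text \<open>
 What the fraction field of \<open>R\<close> (for \<open>P = 0\<close>) and the residue field of \<open>R\<close> at \<open>P\<close> have in common:
 the image of \<open>R\<close> in \<open>L\<close> is \<open>R/P\<close>, and \<open>L\<close> is its field of fractions.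
\<close>

definition localizes ::
 "('r, 'x) ring_scheme \<Rightarrow> 'r set \<Rightarrow> ('r, 'l, 'k) module_scheme \<Rightarrow> bool"
 where "localizes R P L \<longleftrightarrow> algebra R L \<and> primeideal P R \<and>
  (\<forall>c\<in>carrier L. \<exists>s\<in>carrier R - P. \<exists>r\<in>carrier R. s \<odot>\<^bsub>L\<^esub> c = scalar L r) \<and>
  (\<forall>r\<in>carrier R. scalar L r = \<zero>\<^bsub>L\<^esub> \<longleftrightarrow> r \<in> P) \<and>
  (\<forall>s\<in>carrier R - P. \<exists>c\<in>carrier L. s \<odot>\<^bsub>L\<^esub> c = \<one>\<^bsub>L\<^esub>)"

lemma localizesD:
 fixes L (structure)
 assumes "localizes R P L"
 shows "algebra R L" "primeideal P R"
  "\<And>c. c \<in> carrier L ==> \<exists>s\<in>carrier R - P. \<exists>r\<in>carrier R. s \<odot> c = scalar L r"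
  "\<And>r. r \<in> carrier R ==> r \<odot> \<one> = \<zero> \<longleftrightarrow> r \<in> P"
  "\<And>s. s \<in> carrier R ==> s \<notin> P ==> \<exists>c\<in>carrier L. s \<odot> c = \<one>"
 using assms unfolding localizes_def by blast+

lemma (in domain) fractions_zero: "fractions R (carrier R - {\<zero>})"
 by unfold_locales (auto simp: integral_iff)

lemma (in domain) zero_prime: "primeideal {\<zero>} R"
 by (rule zeroprimeideal)

lemma (in domain) quotient_field_localizes: "localizes R {\<zero>} (quotient_field R)"
proof -
 interpret F: fractions R "carrier R - {\<zero>}" by (rule fractions_zero)
 have [simp]: "carrier (quotient_field R) = carrier F.Q" "\<one>\<^bsub>quotient_field R\<^esub> = \<one>\<^bsub>F.Q\<^esub>"
  "\<zero>\<^bsub>quotient_field R\<^esub> = \<zero>\<^bsub>F.Q\<^esub>"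
  "r \<odot>\<^bsub>quotient_field R\<^esub> c = fraction R (carrier R - {\<zero>}) r \<one> \<otimes>\<^bsub>F.Q\<^esub> c" for r c
  by (simp_all add: quotient_field_def localization_def algebra_of_hom_simps)
 show ?thesis
  unfolding localizes_def
 proof (intro conjI ballI)
  show "algebra R (quotient_field R)"
   unfolding quotient_field_def localization_def
   by (rule algebra_algebra_of_hom[OF F.localization_cring _ F.fraction_hom]) unfold_locales
  show "primeideal {\<zero>} R" by (rule zero_prime)
 next
  fix c assume "c \<in> carrier (quotient_field R)"
  then obtain a s where c: "c = fraction R (carrier R - {\<zero>}) a s" "a \<in> carrier R" "s \<in> carrier R - {\<zero>}"
   using F.fraction_cases[of c] by auto
  have "s \<odot>\<^bsub>quotient_field R\<^esub> c = a \<odot>\<^bsub>quotient_field R\<^esub> \<one>\<^bsub>quotient_field R\<^esub>"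
   using c by (simp add: F.fraction_simps m_ac)
  thus "\<exists>s\<in>carrier R - {\<zero>}. \<exists>r\<in>carrier R. s \<odot>\<^bsub>quotient_field R\<^esub> c = r \<odot>\<^bsub>quotient_field R\<^esub> \<one>\<^bsub>quotient_field R\<^esub>"
   using c by blast
 next
  fix r assume "r \<in> carrier R"
  thus "(r \<odot>\<^bsub>quotient_field R\<^esub> \<one>\<^bsub>quotient_field R\<^esub> = \<zero>\<^bsub>quotient_field R\<^esub>) = (r \<in> {\<zero>})"
   by (simp add: F.fraction_simps)
 next
  fix s assume s: "s \<in> carrier R - {\<zero>}"
  hence "s \<odot>\<^bsub>quotient_field R\<^esub> fraction R (carrier R - {\<zero>}) \<one> s = \<one>\<^bsub>quotient_field R\<^esub>"
   by (simp add: F.fraction_simps)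
  thus "\<exists>c\<in>carrier (quotient_field R). s \<odot>\<^bsub>quotient_field R\<^esub> c = \<one>\<^bsub>quotient_field R\<^esub>"
   using s F.fraction_closed[of \<one> s] by auto
 qed
qed

text \<open>
 \<open>P R\<^sub>P\<close> consists of the fractions with numerator in \<open>P\<close>.
\<close>

lemma (in domain) residue_ideal:
 assumes P: "primeideal P R"
 defines "S \<equiv> carrier R - P"
 defines "I \<equiv> Idl\<^bsub>localization_ring R S\<^esub> ((\<lambda>a. fraction R S a \<one>) ` P)"
 shows "fractions R S" "ideal I (localization_ring R S)"
  "a \<in> carrier R ==> s \<in> S ==> fraction R S a s \<in> I \<longleftrightarrow> a \<in> P"
proof -
 interpret P: primeideal P R by fact
 show F: "fractions R S"
 proof unfold_locales
  show "\<one> \<in> S" using P.I_notcarr P.one_imp_carrier unfolding S_def by blast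
  show "s \<otimes> t \<in> S" if "s \<in> S" "t \<in> S" for s t
   using that P.I_prime unfolding S_def by blast
 qed (auto simp: S_def P.zero_closed)
 interpret F: fractions R S by fact
 interpret Q: cring F.Q by (rule F.localization_cring)
 have sub: "(\<lambda>a. fraction R S a \<one>) ` P \<subseteq> carrier F.Q"
  using F.fraction_closed F.S(2) P.a_subset by blast
 show I: "ideal I F.Q" unfolding I_def by (rule Q.genideal_ideal[OF sub])
 interpret I: ideal I F.Q by fact
 define J where "J = {fraction R S a s | a s. a \<in> P \<and> s \<in> S}"
 have P_simps: "a \<in> carrier R" if "a \<in> P" for a using that by (rule P.Icarr)
 have "ideal J F.Q"
 proof (rule idealI)
  show "ring F.Q" by unfold_locales
  show "subgroup J (add_monoid F.Q)"
  proof (rule Q.add.subgroupI)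
   show "J \<subseteq> carrier F.Q" unfolding J_def using F.fraction_closed P_simps by blast
   show "J \<noteq> {}" unfolding J_def using F.S(2) P.zero_closed by blast
  next
   fix U assume "U \<in> J"
   then obtain a s where U: "U = fraction R S a s" "a \<in> P" "s \<in> S" unfolding J_def by blast
   have "fraction R S (\<ominus> a) s \<oplus>\<^bsub>F.Q\<^esub> U = \<zero>\<^bsub>F.Q\<^esub>"
    using U P_simps[of a] by (simp add: F.fraction_simps l_minus l_neg)
   hence "\<ominus>\<^bsub>F.Q\<^esub> U = fraction R S (\<ominus> a) s"
    using U P_simps[of a] F.fraction_closed Q.minus_equality by simp
   thus "\<ominus>\<^bsub>F.Q\<^esub> U \<in> J" unfolding J_def using U by auto
  next
   fix U V assume "U \<in> J" "V \<in> J"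
   then obtain a s b t where U: "U = fraction R S a s" "a \<in> P" "s \<in> S" "V = fraction R S b t" "b \<in> P" "t \<in> S"
    unfolding J_def by blast
   hence "U \<oplus>\<^bsub>F.Q\<^esub> V = fraction R S (a \<otimes> t \<oplus> b \<otimes> s) (s \<otimes> t)"
    using P_simps by (simp add: F.fraction_simps)
   thus "U \<oplus>\<^bsub>F.Q\<^esub> V \<in> J"
    unfolding J_def using U F.S(3)[of s t] P.a_closed[OF P.I_r_closed[of a t] P.I_r_closed[of b s]] by auto
  qed
 next
  fix U V assume "U \<in> J" "V \<in> carrier F.Q"
  then obtain a s b t where U: "U = fraction R S a s" "a \<in> P" "s \<in> S"
   "V = fraction R S b t" "b \<in> carrier R" "t \<in> S"
   unfolding J_def by (auto elim: F.fraction_cases)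
  hence "V \<otimes>\<^bsub>F.Q\<^esub> U = fraction R S (b \<otimes> a) (t \<otimes> s)" "U \<otimes>\<^bsub>F.Q\<^esub> V = fraction R S (a \<otimes> b) (s \<otimes> t)"
   using P_simps by (simp_all add: F.fraction_simps)
  thus "V \<otimes>\<^bsub>F.Q\<^esub> U \<in> J" "U \<otimes>\<^bsub>F.Q\<^esub> V \<in> J"
   unfolding J_def using U F.S(3) P.I_r_closed P.I_l_closed by blast+
 qed
 moreover have "(\<lambda>a. fraction R S a \<one>) ` P \<subseteq> J" unfolding J_def using F.S(2) by blast
 ultimately have IJ: "I \<subseteq> J" unfolding I_def by (rule Q.genideal_minimal)
 assume as: "a \<in> carrier R" "s \<in> S"
 show "fraction R S a s \<in> I \<longleftrightarrow> a \<in> P"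
 proof
  assume "fraction R S a s \<in> I"
  then obtain b t where b: "fraction R S a s = fraction R S b t" "b \<in> P" "t \<in> S"
   using IJ unfolding J_def by blast
  hence "a \<otimes> t = b \<otimes> s" using as P_simps by (simp add: F.fraction_simps)
  hence "a \<otimes> t \<in> P" using b as P.I_r_closed by simp
  thus "a \<in> P" using P.I_prime[of a t] as b(3) unfolding S_def by blast
 next
  assume a: "a \<in> P"
  have "fraction R S a \<one> \<in> I" unfolding I_def using Q.genideal_self[OF sub] a by blast
  hence "fraction R S a \<one> \<otimes>\<^bsub>F.Q\<^esub> fraction R S \<one> s \<in> I"
   using as by (intro I.I_r_closed F.fraction_closed) auto
  thus "fraction R S a s \<in> I" using as by (simp add: F.fraction_simps)
 qed
qed

lemma (in domain) residue_field_localizes: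
 assumes P: "primeideal P R"
 shows "localizes R P (residue_field R P)"
proof -
 interpret P: primeideal P R by fact
 define S where "S = carrier R - P"
 interpret F: fractions R S unfolding S_def by (rule residue_ideal(1)[OF P])
 interpret Q: cring F.Q by (rule F.localization_cring)
 define I where "I = Idl\<^bsub>F.Q\<^esub> ((\<lambda>a. fraction R S a \<one>) ` P)"
 interpret I: ideal I F.Q using residue_ideal(2)[OF P] unfolding I_def S_def .
 have mem: "fraction R S a s \<in> I \<longleftrightarrow> a \<in> P" if "a \<in> carrier R" "s \<in> S" for a s
  using residue_ideal(3)[OF P] that unfolding I_def S_def by blast
 define q where "q = (\<lambda>x. I +>\<^bsub>F.Q\<^esub> x)"
 have q: "q \<in> ring_hom F.Q (F.Q Quot I)" unfolding q_def by (rule I.rcos_ring_hom)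
 note qD = ring_hom_memE[OF q]
 interpret L: cring "F.Q Quot I" using I.quotient_is_cring Q.is_cring by blast
 have k: "residue_field R P = algebra_of_hom (\<lambda>a. q (fraction R S a \<one>)) (F.Q Quot I)"
  unfolding residue_field_def Let_def q_def I_def S_def ..
 have comp: "(\<lambda>a. q (fraction R S a \<one>)) \<in> ring_hom R (F.Q Quot I)"
  using ring_hom_trans[OF F.fraction_hom q] by (simp add: o_def)
 have [simp]: "carrier (residue_field R P) = carrier (F.Q Quot I)" "\<one>\<^bsub>residue_field R P\<^esub> = q \<one>\<^bsub>F.Q\<^esub>"
  "\<zero>\<^bsub>residue_field R P\<^esub> = q \<zero>\<^bsub>F.Q\<^esub>"
  "r \<odot>\<^bsub>residue_field R P\<^esub> c = q (fraction R S r \<one>) \<otimes>\<^bsub>F.Q Quot I\<^esub> c" for r c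
  using qD(4) ring_hom_zero[OF q] Q.ring_axioms L.ring_axioms
  by (simp_all add: k algebra_of_hom_simps)
 have q_cases: "\<exists>x\<in>carrier F.Q. c = q x" if "c \<in> carrier (F.Q Quot I)" for c
  using that by (auto simp: FactRing_def A_RCOSETS_def' q_def)
 have q_zero: "q x = q \<zero>\<^bsub>F.Q\<^esub> \<longleftrightarrow> x \<in> I" if "x \<in> carrier F.Q" for x
  using Q.quotient_eq_iff_same_a_r_cos[OF I.is_ideal, of x "\<zero>\<^bsub>F.Q\<^esub>"] that
  by (simp add: q_def a_minus_def)
 have qm: "q x \<otimes>\<^bsub>F.Q Quot I\<^esub> q y = q (x \<otimes>\<^bsub>F.Q\<^esub> y)" if "x \<in> carrier F.Q" "y \<in> carrier F.Q" for x y
  using qD(2) that by simp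
 show ?thesis
  unfolding localizes_def
 proof (intro conjI ballI P)
  show "algebra R (residue_field R P)"
   unfolding k by (rule algebra_algebra_of_hom[OF L.is_cring _ comp]) unfold_locales
 next
  fix c assume "c \<in> carrier (residue_field R P)"
  then obtain a s where c: "c = q (fraction R S a s)" "a \<in> carrier R" "s \<in> S"
   using q_cases[of c] by (auto elim: F.fraction_cases)
  have "s \<odot>\<^bsub>residue_field R P\<^esub> c = a \<odot>\<^bsub>residue_field R P\<^esub> \<one>\<^bsub>residue_field R P\<^esub>"
  proof -
   have "fraction R S s \<one> \<otimes>\<^bsub>F.Q\<^esub> fraction R S a s = fraction R S a \<one> \<otimes>\<^bsub>F.Q\<^esub> \<one>\<^bsub>F.Q\<^esub>"
    using c by (simp add: F.fraction_simps m_ac)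
   thus ?thesis using c by (simp add: qm F.fraction_closed F.S(2))
  qed
  thus "\<exists>s\<in>carrier R - P. \<exists>r\<in>carrier R. s \<odot>\<^bsub>residue_field R P\<^esub> c = r \<odot>\<^bsub>residue_field R P\<^esub> \<one>\<^bsub>residue_field R P\<^esub>"
   using c S_def by blast
 next
  fix r assume r: "r \<in> carrier R"
  have "q (fraction R S r \<one> \<otimes>\<^bsub>F.Q\<^esub> \<one>\<^bsub>F.Q\<^esub>) = q \<zero>\<^bsub>F.Q\<^esub> \<longleftrightarrow> r \<in> P"
   using q_zero[of "fraction R S r \<one>"] mem[of r \<one>] r by (simp add: F.fraction_simps)
  thus "(r \<odot>\<^bsub>residue_field R P\<^esub> \<one>\<^bsub>residue_field R P\<^esub> = \<zero>\<^bsub>residue_field R P\<^esub>) = (r \<in> P)"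
   using r by (simp add: qm F.fraction_closed F.S(2))
 next
  fix s assume "s \<in> carrier R - P"
  hence s: "s \<in> S" unfolding S_def .
  hence "fraction R S s \<one> \<otimes>\<^bsub>F.Q\<^esub> fraction R S \<one> s = \<one>\<^bsub>F.Q\<^esub>" by (simp add: F.fraction_simps)
  hence "s \<odot>\<^bsub>residue_field R P\<^esub> q (fraction R S \<one> s) = \<one>\<^bsub>residue_field R P\<^esub>"
   using s by (simp add: qm F.fraction_closed F.S(2))
  moreover have "q (fraction R S \<one> s) \<in> carrier (F.Q Quot I)"
   using s by (intro qD(1) F.fraction_closed) auto
  ultimately show "\<exists>c\<in>carrier (residue_field R P). s \<odot>\<^bsub>residue_field R P\<^esub> c = \<one>\<^bsub>residue_field R P\<^esub>"
   by auto
 qed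
qed

lemma localizes_field:
 fixes L (structure)
 assumes "localizes R P L"
 shows "field L"
proof -
 note D = localizesD[OF assms]
 interpret algebra R L by (rule D(1))
 interpret P: primeideal P R by (rule D(2))
 have nz: "\<one> \<noteq> \<zero>"
  using D(4)[of "\<one>\<^bsub>R\<^esub>"] P.one_imp_carrier P.I_notcarr by auto
 show ?thesis
 proof (rule cring.cring_fieldI2[OF M_cring nz[symmetric]])
  fix c assume c: "c \<in> carrier L" "c \<noteq> \<zero>"
  obtain s r where sr: "s \<in> carrier R" "s \<notin> P" "r \<in> carrier R" "s \<odot> c = scalar L r"
   using D(3)[OF c(1)] by blast
  obtain u where u: "u \<in> carrier L" "s \<odot> u = \<one>" using D(5)[OF sr(1,2)] by blast
  have e: "u \<otimes> (s \<odot> c) = c"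
   using u sr c smult_assoc2[of s u c] smult_assoc2[of s c u] by (simp add: m_comm[of u])
  have "r \<notin> P"
   using D(4)[OF sr(3)] e sr(4) c u(1) by auto
  then obtain v where v: "v \<in> carrier L" "r \<odot> v = \<one>" using D(5)[OF sr(3)] by blast
  have "c \<otimes> (s \<odot> v) = (s \<odot> c) \<otimes> v"
   using c sr v smult_assoc2[of s c v] smult_assoc2[of s v c] by (simp add: m_comm[of c])
  also have "\<dots> = \<one>" unfolding sr(4) using sr v smult_assoc2[of r "\<one>" v] by simp
  finally show "\<exists>b\<in>carrier L. c \<otimes> b = \<one>" using sr(1) v(1) by blast
 qed
qed

section \<open>Flatness, colon ideals and purity\<close>

text \<open>
 The submodule \<open>I M\<close>, with its elements as sums that are built up one term at a time.
\<close>

inductive_set ideal_span :: "'r set \<Rightarrow> ('r, 'a, 'm) module_scheme \<Rightarrow> 'a set"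
 for I :: "'r set" and M :: "('r, 'a, 'm) module_scheme" where
 zero: "\<zero>\<^bsub>M\<^esub> \<in> ideal_span I M"
| step: "i \<in> I ==> m \<in> carrier M ==> x \<in> ideal_span I M ==> (i \<odot>\<^bsub>M\<^esub> m) \<oplus>\<^bsub>M\<^esub> x \<in> ideal_span I M"

lemma ideal_span_mono:
 assumes "I \<subseteq> J" "B \<subseteq> carrier M" "x \<in> ideal_span I (M\<lparr>carrier := B\<rparr>)"
 shows "x \<in> ideal_span J M"
 using assms(3) by (induction rule: ideal_span.induct) (use assms(1,2) in \<open>auto intro: ideal_span.intros\<close>)

definition colon :: "('r, 'x) ring_scheme \<Rightarrow> 'r set \<Rightarrow> 'r \<Rightarrow> 'r set"
 where "colon R I a = {r \<in> carrier R. r \<otimes>\<^bsub>R\<^esub> a \<in> I}"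

lemma (in cring) colon_ideal:
 assumes "ideal I R" "a \<in> carrier R"
 shows "ideal (colon R I a) R"
proof -
 interpret I: ideal I R by fact
 show ?thesis
 proof (rule idealI)
  show "ring R" by unfold_locales
  show "subgroup (colon R I a) (add_monoid R)"
  proof (rule add.subgroupI)
   have "\<zero> \<in> colon R I a" unfolding colon_def using I.zero_closed assms(2) by simp
   thus "colon R I a \<noteq> {}" by blast
  qed (use assms(2) in \<open>auto simp: colon_def l_distr l_minus\<close>)
 next
  fix r x assume rx: "r \<in> colon R I a" "x \<in> carrier R"
  hence r: "r \<in> carrier R" "r \<otimes> a \<in> I" by (auto simp: colon_def)
  have e: "(x \<otimes> r) \<otimes> a = x \<otimes> (r \<otimes> a)" "(r \<otimes> x) \<otimes> a = x \<otimes> (r \<otimes> a)"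
   using r rx assms(2) by (simp_all add: m_ac)
  show "x \<otimes> r \<in> colon R I a" "r \<otimes> x \<in> colon R I a"
   unfolding colon_def mem_Collect_eq e using r rx I.I_l_closed by auto
 qed
qed

lemma (in cring) adjoin_element_ideal:
 assumes "ideal I R" "a \<in> carrier R"
 shows "ideal {i \<oplus> r \<otimes> a | i r. i \<in> I \<and> r \<in> carrier R} R"
proof -
 have "I <+>\<^bsub>R\<^esub> PIdl a = {i \<oplus> r \<otimes> a | i r. i \<in> I \<and> r \<in> carrier R}"
  unfolding set_add_defs cgenideal_def by auto
 thus ?thesis using add_ideals[OF assms(1) cgenideal_ideal[OF assms(2)]] by simp
qed

context module
begin

lemma ideal_span_closed:
 assumes "I \<subseteq> carrier R" "x \<in> ideal_span I M"
 shows "x \<in> carrier M"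
 using assms(2) by (induction rule: ideal_span.induct) (use assms(1) in auto)

lemma ideal_span_add:
 assumes "I \<subseteq> carrier R" "x \<in> ideal_span I M" "y \<in> ideal_span I M"
 shows "x \<oplus>\<^bsub>M\<^esub> y \<in> ideal_span I M"
 using assms(2)
proof (induction rule: ideal_span.induct)
 case zero
 thus ?case using assms ideal_span_closed by simp
next
 case (step i m x)
 have "(i \<odot>\<^bsub>M\<^esub> m) \<oplus>\<^bsub>M\<^esub> x \<oplus>\<^bsub>M\<^esub> y = (i \<odot>\<^bsub>M\<^esub> m) \<oplus>\<^bsub>M\<^esub> (x \<oplus>\<^bsub>M\<^esub> y)"
  using step assms(1,3) ideal_span_closed[OF assms(1)] by (auto simp: M.a_assoc)
 thus ?case using step by (auto intro: ideal_span.step)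
qed

lemma ideal_span_pure: "I \<subseteq> carrier R ==> i \<in> I ==> m \<in> carrier M ==> i \<odot>\<^bsub>M\<^esub> m \<in> ideal_span I M"
 using ideal_span.step[OF _ _ ideal_span.zero, of i I m M] by auto

lemma ideal_span_uminus:
 assumes "I \<subseteq> carrier R" "x \<in> ideal_span I M"
 shows "\<ominus>\<^bsub>M\<^esub> x \<in> ideal_span I M"
 using assms(2)
proof (induction rule: ideal_span.induct)
 case zero
 have "\<ominus>\<^bsub>M\<^esub> \<zero>\<^bsub>M\<^esub> = \<zero>\<^bsub>M\<^esub>" by (rule M.minus_equality) simp_all
 thus ?case by (simp only: ideal_span.zero)
next
 case (step i m x)
 have "\<ominus>\<^bsub>M\<^esub> ((i \<odot>\<^bsub>M\<^esub> m) \<oplus>\<^bsub>M\<^esub> x) = (i \<odot>\<^bsub>M\<^esub> (\<ominus>\<^bsub>M\<^esub> m)) \<oplus>\<^bsub>M\<^esub> (\<ominus>\<^bsub>M\<^esub> x)"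
  using step assms(1) ideal_span_closed[OF assms(1)] by (auto simp: M.minus_add smult_r_minus)
 thus ?case using step by (auto intro: ideal_span.step)
qed

lemma ideal_span_diff:
 "I \<subseteq> carrier R ==> x \<in> ideal_span I M ==> y \<in> ideal_span I M ==> x \<ominus>\<^bsub>M\<^esub> y \<in> ideal_span I M"
 unfolding a_minus_def by (intro ideal_span_add ideal_span_uminus)

lemma ideal_span_zero: "x \<in> ideal_span {\<zero>} M ==> x = \<zero>\<^bsub>M\<^esub>"
 by (induction rule: ideal_span.induct) auto

lemma ideal_span_adjoin_element:
 assumes I: "I \<subseteq> carrier R" and a: "a \<in> carrier R"
  and x: "x \<in> ideal_span {i \<oplus> r \<otimes> a | i r. i \<in> I \<and> r \<in> carrier R} M"
 shows "\<exists>y\<in>ideal_span I M. \<exists>z\<in>carrier M. x = y \<oplus>\<^bsub>M\<^esub> (a \<odot>\<^bsub>M\<^esub> z)"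
 using x
proof (induction rule: ideal_span.induct)
 case zero
 have "\<zero>\<^bsub>M\<^esub> = \<zero>\<^bsub>M\<^esub> \<oplus>\<^bsub>M\<^esub> (a \<odot>\<^bsub>M\<^esub> \<zero>\<^bsub>M\<^esub>)" using a by simp
 thus ?case using ideal_span.zero by blast
next
 case (step j m x)
 obtain i r where j: "j = i \<oplus> r \<otimes> a" "i \<in> I" "r \<in> carrier R" using step by blast
 obtain y z where y: "y \<in> ideal_span I M" "z \<in> carrier M" "x = y \<oplus>\<^bsub>M\<^esub> (a \<odot>\<^bsub>M\<^esub> z)" using step by blast
 note c = ideal_span_closed[OF I y(1)]
 have i: "i \<in> carrier R" using j I by blast
 have "(j \<odot>\<^bsub>M\<^esub> m) \<oplus>\<^bsub>M\<^esub> x = ((i \<odot>\<^bsub>M\<^esub> m) \<oplus>\<^bsub>M\<^esub> (a \<odot>\<^bsub>M\<^esub> (r \<odot>\<^bsub>M\<^esub> m))) \<oplus>\<^bsub>M\<^esub> (y \<oplus>\<^bsub>M\<^esub> (a \<odot>\<^bsub>M\<^esub> z))"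
  using j i a step(2) y by (simp add: smult_l_distr m_comm[of r] smult_assoc1)
 also have "\<dots> = ((i \<odot>\<^bsub>M\<^esub> m) \<oplus>\<^bsub>M\<^esub> y) \<oplus>\<^bsub>M\<^esub> (a \<odot>\<^bsub>M\<^esub> ((r \<odot>\<^bsub>M\<^esub> m) \<oplus>\<^bsub>M\<^esub> z))"
  using j i a step(2) y c by (simp add: smult_r_distr M.a_ac)
 finally show ?case
  using ideal_span.step[OF j(2) step(2) y(1)] j(3) step(2) y(2) by (blast intro: smult_closed M.a_closed)
qed

lemma smult_ideal_span_colon:
 assumes I: "ideal I R" and a: "a \<in> carrier R" and x: "x \<in> ideal_span (colon R I a) M"
 shows "a \<odot>\<^bsub>M\<^esub> x \<in> ideal_span I M"
proof -
 interpret I: ideal I R by fact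
 have sub: "colon R I a \<subseteq> carrier R" by (auto simp: colon_def)
 show ?thesis
  using x
 proof (induction rule: ideal_span.induct)
  case zero
  thus ?case using a ideal_span.zero by simp
 next
  case (step r m x)
  hence r: "r \<in> carrier R" "r \<otimes> a \<in> I" by (auto simp: colon_def)
  have "a \<odot>\<^bsub>M\<^esub> ((r \<odot>\<^bsub>M\<^esub> m) \<oplus>\<^bsub>M\<^esub> x) = ((r \<otimes> a) \<odot>\<^bsub>M\<^esub> m) \<oplus>\<^bsub>M\<^esub> (a \<odot>\<^bsub>M\<^esub> x)"
   using r step a ideal_span_closed[OF sub step(3)] by (simp add: smult_r_distr m_comm[of r] smult_assoc1)
  thus ?case using ideal_span.step[OF r(2) step(2,4)] by simp
 qed
qed

end

text \<open>
 Maps on a tensor product modulo a submodule are given by a function \<open>H\<close> on the free abelian group; its values on the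
 relators are controlled afterwards.
\<close>

lemma (in two_modules) additive_extension:
 assumes G: "abelian_group G" and f: "\<And>x y. x \<in> carrier M ==> y \<in> carrier N ==> f x y \<in> carrier G"
 obtains H where "\<And>x. tkeys x ==> H x \<in> carrier G" "H 0 = \<zero>\<^bsub>G\<^esub>"
  "\<And>x y. x \<in> carrier M ==> y \<in> carrier N ==> H (frag_of (x, y)) = f x y"
  "\<And>x y. tkeys x ==> tkeys y ==> H (x + y) = H x \<oplus>\<^bsub>G\<^esub> H y"
  "\<And>x. tkeys x ==> H (- x) = \<ominus>\<^bsub>G\<^esub> H x"
  "\<And>x y. tkeys x ==> tkeys y ==> H (x - y) = H x \<ominus>\<^bsub>G\<^esub> H y"
proof -
 interpret G: abelian_group G by fact
 let ?F = "free_Abelian_group (carrier M \<times> carrier N)"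
 have f': "(\<lambda>p. f (fst p) (snd p)) ` (carrier M \<times> carrier N) \<subseteq> carrier (add_monoid G)" using f by auto
 obtain H where H: "H \<in> hom ?F (add_monoid G)"
  "\<And>p. p \<in> carrier M \<times> carrier N ==> H (frag_of p) = f (fst p) (snd p)"
  by (rule comm_group.free_Abelian_group_universal[OF G.a_comm_group f']) blast
 have c: "H x \<in> carrier G" if "tkeys x" for x
  using H(1) that by (auto simp: hom_def tkeys_def)
 have add: "H (x + y) = H x \<oplus>\<^bsub>G\<^esub> H y" if "tkeys x" "tkeys y" for x y
  using H(1) that by (auto simp: hom_def tkeys_def)
 have zero: "H 0 = \<zero>\<^bsub>G\<^esub>" using add[of 0 0] c[of 0] G.add.r_cancel_one' by fastforce
 have minus: "H (- x) = \<ominus>\<^bsub>G\<^esub> H x" if "tkeys x" for x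
  using add[of "- x" x] zero that c[of x] c[of "- x"] G.minus_equality[of "H (- x)" "H x"] by simp
 have diff: "H (x - y) = H x \<ominus>\<^bsub>G\<^esub> H y" if "tkeys x" "tkeys y" for x y
  using add[of x "- y"] minus[of y] that by (simp add: a_minus_def)
 show thesis using that[of H] c zero H(2) add minus diff by auto
qed

text \<open>
 The equation \<open>a m = \<Sum> i\<^sub>k m\<^sub>k\<close> says that the element \<open>a \<otimes> m - \<Sum> i\<^sub>k \<otimes> m\<^sub>k\<close> of \<open>(I + aR) \<otimes> M\<close> becomes
 \<open>0\<close> in \<open>R \<otimes> M\<close>. By flatness it is \<open>0\<close>, and the additive map \<open>(i + x a) \<otimes> m \<mapsto> x m\<close>, which is well
 defined modulo \<open>(I : a) M\<close>, sends it to \<open>m\<close>.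
\<close>

theorem flat_colon:
 fixes R :: "('r, 'x) ring_scheme" (structure)
 assumes flat: "flat_module R M" and M: "module R M" and I: "ideal I R" and a: "a \<in> carrier R"
  and m: "m \<in> carrier M" and am: "a \<odot>\<^bsub>M\<^esub> m \<in> ideal_span I M"
 shows "m \<in> ideal_span (colon R I a) M"
proof -
 interpret module R M by fact
 interpret I: ideal I R by fact
 define J where "J = {i \<oplus> r \<otimes> a | i r. i \<in> I \<and> r \<in> carrier R}"
 have J: "ideal J R" unfolding J_def by (rule adjoin_element_ideal[OF I a])
 interpret J: ideal J R by fact
 define N where "N = algebra_of_hom (\<lambda>r. r) R"
 have N_simps: "carrier N = carrier R" "x \<oplus>\<^bsub>N\<^esub> y = x \<oplus> y" "\<zero>\<^bsub>N\<^esub> = \<zero>" "r \<odot>\<^bsub>N\<^esub> x = r \<otimes> x" for x y r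
  by (simp_all add: N_def algebra_of_hom_simps)
 have N: "module R N"
  unfolding N_def
  by (rule algebra.axioms(1)[OF algebra_algebra_of_hom]) (use is_cring in \<open>auto intro: ring_hom_memI\<close>)
 have Nm: "\<ominus>\<^bsub>N\<^esub> x = \<ominus> x" if "x \<in> carrier R" for x
  using that abelian_group.minus_equality[OF module.axioms(2)[OF N], of "\<ominus> x" x]
  by (simp add: N_simps R.l_neg)
 have "submodule J R N"
  by (rule module.submoduleI[OF N]) (use J.a_subset J.a_closed J.I_l_closed in \<open>auto simp: N_simps Nm\<close>)
 hence JN: "module R (N\<lparr>carrier := J\<rparr>)" by (rule submodule.submodule_is_module[OF _ N])
 have incl: "(\<lambda>x. x) \<in> linear_maps R (N\<lparr>carrier := J\<rparr>) N"
  using J.a_subset by (auto simp: linear_maps_def N_simps)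
 have idM: "(\<lambda>x. x) \<in> linear_maps R M M" by (auto simp: linear_maps_def)
 interpret T: two_modules R "N\<lparr>carrier := J\<rparr>" M
  by (intro two_modules.intro JN M)
 interpret T': two_modules R N M
  by (intro two_modules.intro N M)
 have inj: "inj_on (tensor_map R N M (\<lambda>x. x) (\<lambda>a. a)) (carrier (tensor_group R (N\<lparr>carrier := J\<rparr>) M))"
  using flat JN N incl unfolding flat_module_def by simp
 have kernel: "w \<in> T.K" if "T.tkeys w" "w \<in> T'.K" for w
 proof -
  have "tensor_map R N M (\<lambda>x. x) (\<lambda>a. a) (T.tc w) = tensor_map R N M (\<lambda>x. x) (\<lambda>a. a) (T.tc 0)"
   unfolding tensor_map_class[OF T.two_modules_axioms T'.two_modules_axioms incl idM] frag_map2_id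
   using that by (simp add: T'.class_eq_iff)
  hence "T.tc w = T.tc 0"
   using inj that(1) by (auto simp: T.carrier_tensor_group dest: inj_onD)
  thus ?thesis by (simp add: T.class_eq_iff)
 qed
 have "\<forall>j\<in>J. \<exists>r\<in>carrier R. j \<ominus> r \<otimes> a \<in> I"
 proof
  fix j assume "j \<in> J"
  then obtain i r where j: "j = i \<oplus> r \<otimes> a" "i \<in> I" "r \<in> carrier R" unfolding J_def by blast
  hence "j \<ominus> r \<otimes> a = i"
   using I.Icarr a by (simp add: a_minus_def R.a_assoc R.r_neg)
  thus "\<exists>r\<in>carrier R. j \<ominus> r \<otimes> a \<in> I"
   using j by (intro bexI[of _ r]) simp_all
 qed
 then obtain q where q: "\<And>j. j \<in> J ==> q j \<in> carrier R" "\<And>j. j \<in> J ==> j \<ominus> q j \<otimes> a \<in> I"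
  by metis
 let ?C = "colon R I a"
 have C: "?C \<subseteq> carrier R" by (auto simp: colon_def)
 obtain H where H: "\<And>x. T.tkeys x ==> H x \<in> carrier M" "H 0 = \<zero>\<^bsub>M\<^esub>"
  "\<And>x y. x \<in> J ==> y \<in> carrier M ==> H (frag_of (x, y)) = q x \<odot>\<^bsub>M\<^esub> y"
  "\<And>x y. T.tkeys x ==> T.tkeys y ==> H (x + y) = H x \<oplus>\<^bsub>M\<^esub> H y"
  "\<And>x. T.tkeys x ==> H (- x) = \<ominus>\<^bsub>M\<^esub> H x"
  "\<And>x y. T.tkeys x ==> T.tkeys y ==> H (x - y) = H x \<ominus>\<^bsub>M\<^esub> H y"
  using T.additive_extension[OF module.axioms(2)[OF M], of "\<lambda>x y. q x \<odot>\<^bsub>M\<^esub> y"] q(1) by auto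
 have HK: "H x \<in> ideal_span ?C M" if "x \<in> T.K" for x
  using that
 proof (induction x rule: T.kernel_induct)
  case zero
  thus ?case using H(2) ideal_span.zero by simp
 next
  case (relator z)
  thus ?case
  proof (cases rule: T.relator_cases)
   case (left x x' y)
   hence c: "x \<in> J" "x' \<in> J" "x \<oplus> x' \<in> J" "y \<in> carrier M" by (auto simp: N_simps)
   note cc = c J.Icarr[OF c(1)] J.Icarr[OF c(2)] q(1)[OF c(1)] q(1)[OF c(2)] q(1)[OF c(3)] a
   let ?u = "\<lambda>x. x \<ominus> q x \<otimes> a"
   define e where "e = q (x \<oplus> x') \<ominus> q x \<ominus> q x'"
   have "e \<otimes> a = ?u x \<oplus> ?u x' \<oplus> (\<ominus> ?u (x \<oplus> x'))"
    unfolding e_def using cc by algebra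
   hence "e \<in> ?C" using q(2)[OF c(1)] q(2)[OF c(2)] q(2)[OF c(3)] cc
    by (simp add: colon_def I.a_closed e_def)
   moreover have "H z = e \<odot>\<^bsub>M\<^esub> y"
    using left cc by (simp add: H N_simps T.tkeys_diff e_def a_minus_def smult_l_distr smult_l_minus)
   ultimately show ?thesis using ideal_span_pure[OF C] c by simp
  next
   case (right x y y')
   hence "H z = \<zero>\<^bsub>M\<^esub>"
    using q(1)[of x] by (simp add: H T.tkeys_diff a_minus_def smult_r_distr M.minus_add M.a_ac M.r_neg M.r_neg1 M.r_neg2)
   thus ?thesis using ideal_span.zero by simp
  next
   case (balanced r x y)
   hence c: "x \<in> J" "r \<otimes> x \<in> J" "y \<in> carrier M" "r \<in> carrier R" using J.I_l_closed by (auto simp: N_simps)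
   note cc = c J.Icarr[OF c(1)] q(1)[OF c(1)] q(1)[OF c(2)] a
   let ?u = "\<lambda>x. x \<ominus> q x \<otimes> a"
   define e where "e = q (r \<otimes> x) \<ominus> q x \<otimes> r"
   have "e \<otimes> a = r \<otimes> ?u x \<oplus> (\<ominus> ?u (r \<otimes> x))"
    unfolding e_def using cc by algebra
   hence "e \<in> ?C" using q(2)[OF c(1)] q(2)[OF c(2)] cc I.I_l_closed
    by (simp add: colon_def I.a_closed e_def)
   moreover have "H z = e \<odot>\<^bsub>M\<^esub> y"
    using balanced cc by (simp add: H N_simps T.tkeys_diff e_def a_minus_def smult_l_distr smult_l_minus smult_assoc1)
   ultimately show ?thesis using ideal_span_pure[OF C] c by simp
  qed
 next
  case (uminus r)
  thus ?case using ideal_span_uminus[OF C] T.relators_tkeys by (simp add: H)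
 next
  case (add x y)
  thus ?case using ideal_span_add[OF C] T.kernel_tkeys by (simp add: H)
 qed
 have IJ: "i \<in> J" if "i \<in> I" for i
 proof -
  have "i = i \<oplus> \<zero> \<otimes> a" using that I.Icarr a by simp
  thus ?thesis unfolding J_def using that by blast
 qed
 have aJ: "a \<in> J"
 proof -
  have "a = \<zero> \<oplus> \<one> \<otimes> a" using a by simp
  thus ?thesis unfolding J_def using I.zero_closed by blast
 qed
 have spanT: "\<exists>w. T.tkeys w \<and> T'.tc w = T'.tc (frag_of (\<one>, x)) \<and> H w \<in> ideal_span ?C M"
  if "x \<in> ideal_span I M" for x
  using that
 proof (induction rule: ideal_span.induct)
  case zero
  thus ?case
   using H(2) ideal_span.zero T'.class_zero_right[of "\<one>"] by (intro exI[of _ 0]) (auto simp: N_simps)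
 next
  case (step i m x)
  then obtain w where w: "T.tkeys w" "T'.tc w = T'.tc (frag_of (\<one>, x))" "H w \<in> ideal_span ?C M" by blast
  have i: "i \<in> carrier R" "i \<in> J" using step I.Icarr IJ by auto
  have x: "x \<in> carrier M" using ideal_span_closed[OF I.a_subset] step by blast
  have "T'.tc (frag_of (i, m)) = T'.tc (frag_of (\<one>, i \<odot>\<^bsub>M\<^esub> m))"
   using T'.class_balanced[of i "\<one>" m] i step by (simp add: N_simps)
  hence "T'.tc (frag_of (i, m) + w) = T'.tc (frag_of (\<one>, i \<odot>\<^bsub>M\<^esub> m) + frag_of (\<one>, x))"
   using w(2) by (rule T'.class_cong_add)
  also have "\<dots> = T'.tc (frag_of (\<one>, (i \<odot>\<^bsub>M\<^esub> m) \<oplus>\<^bsub>M\<^esub> x))"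
   using T'.class_add_right[of "\<one>" "i \<odot>\<^bsub>M\<^esub> m" x] i x step by (simp add: N_simps)
  finally have 1: "T'.tc (frag_of (i, m) + w) = T'.tc (frag_of (\<one>, (i \<odot>\<^bsub>M\<^esub> m) \<oplus>\<^bsub>M\<^esub> x))" .
  have "i \<ominus> (i \<ominus> q i \<otimes> a) = q i \<otimes> a" using i q(1) a by algebra
  moreover have "i \<ominus> (i \<ominus> q i \<otimes> a) \<in> I"
   unfolding a_minus_def[of _ i "i \<ominus> q i \<otimes> a"] using step q(2)[OF i(2)] by (simp add: I.a_closed)
  ultimately have "q i \<in> ?C" using q(1)[OF i(2)] by (simp add: colon_def)
  hence "H (frag_of (i, m) + w) \<in> ideal_span ?C M"
   using w i step ideal_span_add[OF C] ideal_span_pure[OF C] by (simp add: H)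
  moreover have "T.tkeys (frag_of (i, m) + w)" using w i step by auto
  ultimately show ?case using 1 by blast
 qed
 obtain w where w: "T.tkeys w" "T'.tc w = T'.tc (frag_of (\<one>, a \<odot>\<^bsub>M\<^esub> m))" "H w \<in> ideal_span ?C M"
  using spanT[OF am] by blast
 have "T'.tc (frag_of (a, m)) = T'.tc (frag_of (\<one>, a \<odot>\<^bsub>M\<^esub> m))"
  using T'.class_balanced[of a "\<one>" m] a m by (simp add: N_simps)
 hence "frag_of (a, m) - w \<in> T'.K" using w(2) by (simp add: T'.class_eq_iff[symmetric])
 moreover have k: "T.tkeys (frag_of (a, m))" using aJ m by simp
 ultimately have "frag_of (a, m) - w \<in> T.K" using kernel T.tkeys_diff[OF k w(1)] by blast
 hence "H (frag_of (a, m) - w) \<in> ideal_span ?C M" by (rule HK)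
 hence "(q a \<odot>\<^bsub>M\<^esub> m) \<ominus>\<^bsub>M\<^esub> H w \<in> ideal_span ?C M" using k w aJ m by (simp add: H)
 hence "((q a \<odot>\<^bsub>M\<^esub> m) \<ominus>\<^bsub>M\<^esub> H w) \<oplus>\<^bsub>M\<^esub> H w \<in> ideal_span ?C M" using w(3) by (rule ideal_span_add[OF C])
 hence 1: "q a \<odot>\<^bsub>M\<^esub> m \<in> ideal_span ?C M"
  using q(1)[OF aJ] m H(1)[OF w(1)] by (simp add: a_minus_def M.a_assoc M.l_neg)
 have "(\<one> \<ominus> q a) \<otimes> a = a \<ominus> q a \<otimes> a" using q(1)[OF aJ] a by algebra
 hence "\<one> \<ominus> q a \<in> ?C" using q[OF aJ] by (simp add: colon_def)
 hence "((\<one> \<ominus> q a) \<odot>\<^bsub>M\<^esub> m) \<oplus>\<^bsub>M\<^esub> (q a \<odot>\<^bsub>M\<^esub> m) \<in> ideal_span ?C M"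
  using 1 m by (intro ideal_span.step)
 moreover have "((\<one> \<ominus> q a) \<odot>\<^bsub>M\<^esub> m) \<oplus>\<^bsub>M\<^esub> (q a \<odot>\<^bsub>M\<^esub> m) = m"
 proof -
  have "((\<one> \<ominus> q a) \<odot>\<^bsub>M\<^esub> m) \<oplus>\<^bsub>M\<^esub> (q a \<odot>\<^bsub>M\<^esub> m) = ((\<one> \<ominus> q a) \<oplus> q a) \<odot>\<^bsub>M\<^esub> m"
   using q(1)[OF aJ] m by (simp add: smult_l_distr)
  also have "(\<one> \<ominus> q a) \<oplus> q a = \<one>" using q(1)[OF aJ] by algebra
  finally show ?thesis using m by simp
 qed
 ultimately show ?thesis by simp
qed

text \<open>
 An element of the tensor kernel is a finite sum of relators, so a common denominator \<open>s\<close> carries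
 everything to \<open>A\<close> modulo \<open>P A\<close>, by the maps \<open>a \<otimes> c \<mapsto> (s t c) a\<close> for \<open>t \<notin> P\<close>.
\<close>

lemma tensor_zero_localized:
 fixes R :: "('r, 'x) ring_scheme" (structure)
 assumes L: "localizes R P L" and A: "module R A" and a: "a \<in> carrier A"
  and z: "tensor_class R A L (frag_of (a, \<one>\<^bsub>L\<^esub>)) = tensor_class R A L 0"
 shows "\<exists>s\<in>carrier R - P. s \<odot>\<^bsub>A\<^esub> a \<in> ideal_span P A"
proof -
 note LD = localizesD[OF L]
 interpret A: module R A by fact
 interpret L: algebra R L by (rule LD(1))
 interpret P: primeideal P R by (rule LD(2))
 interpret T: two_modules R A L by unfold_locales
 define S where "S = carrier R - P"
 have S: "s \<in> carrier R" "s \<notin> P" if "s \<in> S" for s using that by (auto simp: S_def)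
 have SI: "s \<otimes> t \<in> S" if "s \<in> S" "t \<in> S" for s t
  using that P.I_prime unfolding S_def by blast
 have S1: "\<one> \<in> S" using P.one_imp_carrier P.I_notcarr unfolding S_def by blast
 define num where "num c = (if \<exists>r\<in>carrier R. scalar L r = c then SOME r. r \<in> carrier R \<and> r \<odot>\<^bsub>L\<^esub> \<one>\<^bsub>L\<^esub> = c else \<zero>)" for c
 have num: "num c \<in> carrier R \<and> num c \<odot>\<^bsub>L\<^esub> \<one>\<^bsub>L\<^esub> = c" if "r \<in> carrier R" "scalar L r = c" for r c
 proof -
  have e: "\<exists>r. r \<in> carrier R \<and> r \<odot>\<^bsub>L\<^esub> \<one>\<^bsub>L\<^esub> = c" using that by blast
  hence "num c = (SOME r. r \<in> carrier R \<and> r \<odot>\<^bsub>L\<^esub> \<one>\<^bsub>L\<^esub> = c)" unfolding num_def by auto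
  thus ?thesis using someI_ex[OF e] by simp
 qed
 have num_c: "num c \<in> carrier R" for c
 proof (cases "\<exists>r\<in>carrier R. scalar L r = c")
  case True
  thus ?thesis using num by blast
 qed (simp add: num_def)
 have PI: "d \<in> P" if "d \<in> carrier R" "scalar L d = \<zero>\<^bsub>L\<^esub>" for d using LD(4) that by simp
 define good where "good u H \<longleftrightarrow> (\<forall>x. T.tkeys x \<longrightarrow> H x \<in> carrier A) \<and> H 0 = \<zero>\<^bsub>A\<^esub> \<and>
  (\<forall>x\<in>carrier A. \<forall>y\<in>carrier L. H (frag_of (x, y)) = num (u \<odot>\<^bsub>L\<^esub> y) \<odot>\<^bsub>A\<^esub> x) \<and>
  (\<forall>x y. T.tkeys x \<longrightarrow> T.tkeys y \<longrightarrow> H (x + y) = H x \<oplus>\<^bsub>A\<^esub> H y) \<and>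
  (\<forall>x. T.tkeys x \<longrightarrow> H (- x) = \<ominus>\<^bsub>A\<^esub> H x) \<and>
  (\<forall>x y. T.tkeys x \<longrightarrow> T.tkeys y \<longrightarrow> H (x - y) = H x \<ominus>\<^bsub>A\<^esub> H y)" for u H
 have "\<exists>H. good u H" for u
 proof -
  have "num (u \<odot>\<^bsub>L\<^esub> y) \<odot>\<^bsub>A\<^esub> x \<in> carrier A" if "x \<in> carrier A" for x y using num_c that by simp
  then obtain H where "\<And>x. T.tkeys x ==> H x \<in> carrier A" "H 0 = \<zero>\<^bsub>A\<^esub>"
   "\<And>x y. x \<in> carrier A ==> y \<in> carrier L ==> H (frag_of (x, y)) = num (u \<odot>\<^bsub>L\<^esub> y) \<odot>\<^bsub>A\<^esub> x"
   "\<And>x y. T.tkeys x ==> T.tkeys y ==> H (x + y) = H x \<oplus>\<^bsub>A\<^esub> H y"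
   "\<And>x. T.tkeys x ==> H (- x) = \<ominus>\<^bsub>A\<^esub> H x"
   "\<And>x y. T.tkeys x ==> T.tkeys y ==> H (x - y) = H x \<ominus>\<^bsub>A\<^esub> H y"
   using T.additive_extension[OF A.abelian_group_axioms, of "\<lambda>x y. num (u \<odot>\<^bsub>L\<^esub> y) \<odot>\<^bsub>A\<^esub> x"] by blast
  hence "good u H" unfolding good_def by blast
  thus ?thesis by blast
 qed
 then obtain H where "\<And>u. good u (H u)" by metis
 hence H: "\<And>u x. T.tkeys x ==> H u x \<in> carrier A" "\<And>u. H u 0 = \<zero>\<^bsub>A\<^esub>"
  "\<And>u x y. x \<in> carrier A ==> y \<in> carrier L ==> H u (frag_of (x, y)) = num (u \<odot>\<^bsub>L\<^esub> y) \<odot>\<^bsub>A\<^esub> x"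
  "\<And>u x y. T.tkeys x ==> T.tkeys y ==> H u (x + y) = H u x \<oplus>\<^bsub>A\<^esub> H u y"
  "\<And>u x. T.tkeys x ==> H u (- x) = \<ominus>\<^bsub>A\<^esub> H u x"
  "\<And>u x y. T.tkeys x ==> T.tkeys y ==> H u (x - y) = H u x \<ominus>\<^bsub>A\<^esub> H u y"
  by (simp_all add: good_def)
 have Psub: "P \<subseteq> carrier R" by (rule P.a_subset)
 have key: "\<exists>s\<in>S. \<forall>t\<in>S. H (s \<otimes> t) x \<in> ideal_span P A" if "x \<in> T.K" for x
  using that
 proof (induction x rule: T.kernel_induct)
  case zero
  thus ?case using S1 H(2) by (intro bexI[of _ "\<one>"]) (simp_all add: ideal_span.zero)
 next
  case (relator z)
  thus ?case
  proof (cases rule: T.relator_cases)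
   case (left x x' y)
   hence "H u z = \<zero>\<^bsub>A\<^esub>" for u
    using num_c by (simp add: H T.tkeys_diff a_minus_def A.smult_r_distr A.M.minus_add A.M.a_ac A.M.r_neg A.M.r_neg1 A.M.r_neg2)
   thus ?thesis using S1 by (intro bexI[of _ "\<one>"]) (simp_all add: ideal_span.zero)
  next
   case (right x y y')
   obtain s r where s: "s \<in> S" "r \<in> carrier R" "s \<odot>\<^bsub>L\<^esub> y = scalar L r" using LD(3)[OF right(3)] S_def by blast
   obtain s' r' where s': "s' \<in> S" "r' \<in> carrier R" "s' \<odot>\<^bsub>L\<^esub> y' = scalar L r'" using LD(3)[OF right(4)] S_def by blast
   show ?thesis
   proof (intro bexI[of _ "s \<otimes> s'"] ballI SI s(1) s'(1))
    fix t assume t: "t \<in> S"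
    note c = S(1)[OF t] S(1)[OF s(1)] S(1)[OF s'(1)] s(2) s'(2) right(2-4)
    define u where "u = s \<otimes> s' \<otimes> t"
    have uc: "u \<in> carrier R" using c by (simp add: u_def)
    have "u \<odot>\<^bsub>L\<^esub> y = (s' \<otimes> t) \<odot>\<^bsub>L\<^esub> (s \<odot>\<^bsub>L\<^esub> y)" unfolding u_def using c
     by (simp add: L.smult_assoc1[symmetric] A.R.m_ac)
    hence 1: "scalar L (s' \<otimes> t \<otimes> r) = u \<odot>\<^bsub>L\<^esub> y" using c by (simp add: s(3) L.smult_assoc1)
    have "u \<odot>\<^bsub>L\<^esub> y' = (s \<otimes> t) \<odot>\<^bsub>L\<^esub> (s' \<odot>\<^bsub>L\<^esub> y')" unfolding u_def using c
     by (simp add: L.smult_assoc1[symmetric] A.R.m_ac)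
    hence 2: "scalar L (s \<otimes> t \<otimes> r') = u \<odot>\<^bsub>L\<^esub> y'" using c by (simp add: s'(3) L.smult_assoc1)
    have 3: "scalar L (s' \<otimes> t \<otimes> r \<oplus> s \<otimes> t \<otimes> r') = u \<odot>\<^bsub>L\<^esub> (y \<oplus>\<^bsub>L\<^esub> y')"
     using c uc 1 2 by (simp add: L.smult_l_distr L.smult_r_distr)
    note n = num[OF _ 1] num[OF _ 2] num[OF _ 3]
    define d where "d = num (u \<odot>\<^bsub>L\<^esub> (y \<oplus>\<^bsub>L\<^esub> y')) \<oplus> (\<ominus> num (u \<odot>\<^bsub>L\<^esub> y)) \<oplus> (\<ominus> num (u \<odot>\<^bsub>L\<^esub> y'))"
    have dc: "d \<in> carrier R" using num_c by (simp add: d_def)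
    have "scalar L d = u \<odot>\<^bsub>L\<^esub> (y \<oplus>\<^bsub>L\<^esub> y') \<oplus>\<^bsub>L\<^esub> (\<ominus>\<^bsub>L\<^esub> (u \<odot>\<^bsub>L\<^esub> y)) \<oplus>\<^bsub>L\<^esub> (\<ominus>\<^bsub>L\<^esub> (u \<odot>\<^bsub>L\<^esub> y'))"
     unfolding d_def using num_c n c by (simp add: L.smult_l_distr L.smult_l_minus)
    also have "\<dots> = \<zero>\<^bsub>L\<^esub>" using uc c
     by (simp add: L.smult_r_distr L.M.a_ac L.M.r_neg L.M.r_neg1 L.M.r_neg2)
    finally have "d \<in> P" using PI dc by blast
    moreover have "H u z = d \<odot>\<^bsub>A\<^esub> x"
     using right num_c by (simp add: H T.tkeys_diff a_minus_def d_def A.smult_l_distr A.smult_l_minus)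
    ultimately show "H (s \<otimes> s' \<otimes> t) z \<in> ideal_span P A"
     using A.ideal_span_pure[OF Psub] right(2) by (simp add: u_def)
   qed
  next
   case (balanced r x y)
   obtain s r0 where s: "s \<in> S" "r0 \<in> carrier R" "s \<odot>\<^bsub>L\<^esub> y = scalar L r0" using LD(3)[OF balanced(4)] S_def by blast
   show ?thesis
   proof (intro bexI[of _ s] ballI s(1))
    fix t assume t: "t \<in> S"
    note c = S(1)[OF t] S(1)[OF s(1)] s(2) balanced(2-4)
    define u where "u = s \<otimes> t"
    have uc: "u \<in> carrier R" using c by (simp add: u_def)
    have "u \<odot>\<^bsub>L\<^esub> y = t \<odot>\<^bsub>L\<^esub> (s \<odot>\<^bsub>L\<^esub> y)" unfolding u_def using c
     by (simp add: L.smult_assoc1[symmetric] A.R.m_ac)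
    hence 1: "scalar L (t \<otimes> r0) = u \<odot>\<^bsub>L\<^esub> y" using c by (simp add: s(3) L.smult_assoc1)
    have e: "r \<odot>\<^bsub>L\<^esub> (u \<odot>\<^bsub>L\<^esub> y) = u \<odot>\<^bsub>L\<^esub> (r \<odot>\<^bsub>L\<^esub> y)"
     using c uc by (simp add: L.smult_assoc1[symmetric] A.R.m_comm)
    have 2: "(r \<otimes> (t \<otimes> r0)) \<odot>\<^bsub>L\<^esub> \<one>\<^bsub>L\<^esub> = u \<odot>\<^bsub>L\<^esub> (r \<odot>\<^bsub>L\<^esub> y)"
     using c uc 1 e by (simp add: L.smult_assoc1)
    note n = num[OF _ 1] num[OF _ 2]
    define d where "d = r \<otimes> num (u \<odot>\<^bsub>L\<^esub> y) \<oplus> (\<ominus> num (u \<odot>\<^bsub>L\<^esub> (r \<odot>\<^bsub>L\<^esub> y)))"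
    have dc: "d \<in> carrier R" using num_c c by (simp add: d_def)
    have "scalar L d = r \<odot>\<^bsub>L\<^esub> (u \<odot>\<^bsub>L\<^esub> y) \<oplus>\<^bsub>L\<^esub> (\<ominus>\<^bsub>L\<^esub> (u \<odot>\<^bsub>L\<^esub> (r \<odot>\<^bsub>L\<^esub> y)))"
     unfolding d_def using num_c n c by (simp add: L.smult_l_distr L.smult_l_minus L.smult_assoc1)
    also have "\<dots> = \<zero>\<^bsub>L\<^esub>" unfolding e using uc c by (simp add: L.M.r_neg)
    finally have "d \<in> P" using PI dc by blast
    moreover have "H u z = d \<odot>\<^bsub>A\<^esub> x"
     using balanced num_c
     by (simp add: H T.tkeys_diff a_minus_def d_def A.smult_l_distr A.smult_l_minus A.smult_assoc1[symmetric] A.R.m_comm)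
    ultimately show "H (s \<otimes> t) z \<in> ideal_span P A"
     using A.ideal_span_pure[OF Psub] c by (simp add: u_def)
   qed
  qed
 next
  case (uminus r)
  thus ?case using A.ideal_span_uminus[OF Psub] T.relators_tkeys by (simp add: H) blast
 next
  case (add x y)
  then obtain s s' where s: "s \<in> S" "\<And>t. t \<in> S ==> H (s \<otimes> t) x \<in> ideal_span P A"
   "s' \<in> S" "\<And>t. t \<in> S ==> H (s' \<otimes> t) y \<in> ideal_span P A" by blast
  show ?case
  proof (intro bexI[of _ "s \<otimes> s'"] ballI SI s(1,3))
   fix t assume t: "t \<in> S"
   have "s \<otimes> s' \<otimes> t = s \<otimes> (s' \<otimes> t)" "s \<otimes> s' \<otimes> t = s' \<otimes> (s \<otimes> t)"
    using S(1)[OF t] S(1)[OF s(1)] S(1)[OF s(3)] by (simp_all add: A.R.m_ac)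
   hence "H (s \<otimes> s' \<otimes> t) x \<in> ideal_span P A" "H (s \<otimes> s' \<otimes> t) y \<in> ideal_span P A"
    using s SI t by metis+
   thus "H (s \<otimes> s' \<otimes> t) (x + y) \<in> ideal_span P A"
    using A.ideal_span_add[OF Psub] add T.kernel_tkeys by (simp add: H)
  qed
 qed
 have "frag_of (a, \<one>\<^bsub>L\<^esub>) \<in> T.K" using z by (simp add: T.class_eq_iff)
 then obtain s where s: "s \<in> S" "\<And>t. t \<in> S ==> H (s \<otimes> t) (frag_of (a, \<one>\<^bsub>L\<^esub>)) \<in> ideal_span P A"
  using key by blast
 have 1: "num (scalar L s) \<odot>\<^bsub>A\<^esub> a \<in> ideal_span P A"
  using s(2)[OF S1] S(1)[OF s(1)] a by (simp add: H)
 note n = num[OF S(1)[OF s(1)] refl]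
 have "(s \<oplus> (\<ominus> num (scalar L s))) \<odot>\<^bsub>L\<^esub> \<one>\<^bsub>L\<^esub> = \<zero>\<^bsub>L\<^esub>"
  using n S(1)[OF s(1)] by (simp add: L.smult_l_distr L.smult_l_minus L.M.r_neg)
 hence "s \<oplus> (\<ominus> num (scalar L s)) \<in> P" using PI n S(1)[OF s(1)] by simp
 hence "((s \<oplus> (\<ominus> num (scalar L s))) \<odot>\<^bsub>A\<^esub> a) \<oplus>\<^bsub>A\<^esub> (num (scalar L s) \<odot>\<^bsub>A\<^esub> a) \<in> ideal_span P A"
  using 1 a by (intro ideal_span.step)
 moreover have "((s \<oplus> (\<ominus> num (scalar L s))) \<odot>\<^bsub>A\<^esub> a) \<oplus>\<^bsub>A\<^esub> (num (scalar L s) \<odot>\<^bsub>A\<^esub> a) = s \<odot>\<^bsub>A\<^esub> a"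
  using n S(1)[OF s(1)] a by (simp add: A.smult_l_distr A.smult_l_minus A.M.a_assoc A.M.l_neg)
 ultimately show ?thesis using s(1) unfolding S_def by auto
qed

lemma flat_torsion_free:
 fixes R :: "('r, 'x) ring_scheme" (structure)
 assumes R: "domain R" and flat: "flat_module R M" and M: "module R M"
  and a: "a \<in> carrier R" "a \<noteq> \<zero>" and m: "m \<in> carrier M" "a \<odot>\<^bsub>M\<^esub> m = \<zero>\<^bsub>M\<^esub>"
 shows "m = \<zero>\<^bsub>M\<^esub>"
proof -
 interpret R: domain R by fact
 interpret module R M by fact
 have "m \<in> ideal_span (colon R {\<zero>} a) M"
  by (rule flat_colon[OF flat M R.zeroideal a(1) m(1)]) (simp add: m(2) ideal_span.zero)
 moreover have "colon R {\<zero>} a = {\<zero>}" using a by (auto simp: colon_def R.integral_iff)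
 ultimately show ?thesis using ideal_span_zero by simp
qed

text \<open>
 A largest ideal \<open>I\<close> with \<open>I A \<inter> B \<noteq> I B\<close> would be prime: if \<open>a b \<in> I\<close> with \<open>a, b \<notin> I\<close>, then
 \<open>I + a R\<close> and \<open>I : a\<close> are larger, so an element of \<open>I A \<inter> B\<close> is \<open>y + a z\<close> with \<open>y \<in> I B\<close>, \<open>z \<in> B\<close>,
 and \<open>a z \<in> I A\<close> gives \<open>z \<in> (I : a) A \<inter> B = (I : a) B\<close> by flatness.
\<close>

theorem purity:
 fixes R :: "('r, 'x) ring_scheme" (structure)
 assumes R: "noetherian_domain R" and A: "module R A" "flat_module R A" and B: "B \<subseteq> carrier A"
  and BA: "module R (A\<lparr>carrier := B\<rparr>)"
  and prime: "\<And>P x. primeideal P R ==> x \<in> B ==> x \<in> ideal_span P A ==> x \<in> ideal_span P (A\<lparr>carrier := B\<rparr>)"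
  and I: "ideal I R" and x: "x \<in> B" "x \<in> ideal_span I A"
 shows "x \<in> ideal_span I (A\<lparr>carrier := B\<rparr>)"
proof (rule ccontr)
 assume neg: "x \<notin> ideal_span I (A\<lparr>carrier := B\<rparr>)"
 interpret R: noetherian_domain R by fact
 interpret A: module R A by (rule A(1))
 define B' where "B' = A\<lparr>carrier := B\<rparr>"
 interpret B: module R B' unfolding B'_def by (rule BA)
 have B_simps: "carrier B' = B" "r \<odot>\<^bsub>B'\<^esub> y = r \<odot>\<^bsub>A\<^esub> y" "y \<oplus>\<^bsub>B'\<^esub> z = y \<oplus>\<^bsub>A\<^esub> z" for r y z
  by (simp_all add: B'_def)
 define bad where "bad = {I. ideal I R \<and> (\<exists>x\<in>B. x \<in> ideal_span I A \<and> x \<notin> ideal_span I B')}"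
 have "bad \<noteq> {}" using I x neg unfolding bad_def B'_def by blast
 moreover have "\<Union>C \<in> bad" if "C \<noteq> {}" "subset.chain bad C" for C
 proof -
  have "subset.chain {I. ideal I R} C" using that(2) unfolding subset.chain_def bad_def by blast
  thus ?thesis using R.ideal_chain_is_trivial[OF that(1)] that(2) unfolding subset.chain_def by blast
 qed
 ultimately obtain I where "I \<in> bad" and max: "\<And>J. J \<in> bad ==> I \<subseteq> J ==> J = I"
  using subset_Zorn_nonempty[of bad] by blast
 then obtain x where I: "ideal I R" and x: "x \<in> B" "x \<in> ideal_span I A" "x \<notin> ideal_span I B'"
  unfolding bad_def by blast
 interpret I: ideal I R by fact
 have good: "y \<in> ideal_span J B'" if "ideal J R" "I \<subseteq> J" "J \<noteq> I" "y \<in> B" "y \<in> ideal_span J A" for J y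
  using max[of J] that unfolding bad_def by blast
 have "\<not> primeideal I R" using prime[OF _ x(1,2)] x(3) unfolding B'_def by blast
 moreover have "carrier R \<noteq> I"
 proof
  assume "carrier R = I"
  hence "\<one> \<in> I" using R.one_closed by blast
  hence "\<one> \<odot>\<^bsub>B'\<^esub> x \<in> ideal_span I B'"
   by (intro B.ideal_span_pure I.a_subset) (use x(1) in \<open>auto simp: B_simps\<close>)
  moreover have "\<one> \<odot>\<^bsub>B'\<^esub> x = x" by (rule B.smult_one) (use x(1) in \<open>auto simp: B_simps\<close>)
  ultimately show False using x(3) by metis
 qed
 ultimately obtain a b where ab: "a \<in> carrier R" "b \<in> carrier R" "a \<otimes> b \<in> I" "a \<notin> I" "b \<notin> I"
  using primeidealI[OF I R.is_cring] by blast
 define J where "J = {i \<oplus> r \<otimes> a | i r. i \<in> I \<and> r \<in> carrier R}"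
 have J: "ideal J R" unfolding J_def by (rule R.adjoin_element_ideal[OF I ab(1)])
 have IJ: "I \<subseteq> J"
 proof
  fix i assume "i \<in> I"
  moreover from this have "i = i \<oplus> \<zero> \<otimes> a" using I.Icarr ab by simp
  ultimately show "i \<in> J" unfolding J_def by blast
 qed
 have "a = \<zero> \<oplus> \<one> \<otimes> a" using ab by simp
 hence "a \<in> J" unfolding J_def using I.zero_closed by blast
 hence "J \<noteq> I" using ab by blast
 moreover have "x \<in> ideal_span J A"
  using ideal_span_mono[OF IJ subset_refl, of x A] x(2) by simp
 ultimately have "x \<in> ideal_span J B'" using good[OF J IJ] x(1) by blast
 then obtain y z where y: "y \<in> ideal_span I B'" "z \<in> B" "x = y \<oplus>\<^bsub>A\<^esub> (a \<odot>\<^bsub>A\<^esub> z)"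
  using B.ideal_span_adjoin_element[OF I.a_subset ab(1), of x] unfolding J_def B_simps by blast
 have yA: "y \<in> ideal_span I A" using ideal_span_mono[OF subset_refl B] y(1) unfolding B'_def by blast
 have c: "x \<in> carrier A" "z \<in> carrier A" "y \<in> carrier A"
  using x(1) y(2) B A.ideal_span_closed[OF I.a_subset yA] by auto
 have "a \<odot>\<^bsub>A\<^esub> z = x \<ominus>\<^bsub>A\<^esub> y"
  using c ab(1) y(3) by (simp add: a_minus_def A.M.a_ac A.M.r_neg1 A.M.r_neg2)
 hence "a \<odot>\<^bsub>A\<^esub> z \<in> ideal_span I A" using A.ideal_span_diff[OF I.a_subset x(2) yA] by simp
 hence "z \<in> ideal_span (colon R I a) A" by (rule flat_colon[OF A(2,1) I ab(1) c(2)])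
 moreover have "I \<subseteq> colon R I a" unfolding colon_def using I.I_r_closed[OF _ ab(1)] I.a_subset by blast
 moreover have "b \<in> colon R I a" unfolding colon_def using ab by (simp add: R.m_comm)
 ultimately have "z \<in> ideal_span (colon R I a) B'"
  using good[OF R.colon_ideal[OF I ab(1)]] y(2) ab(5) by blast
 hence "a \<odot>\<^bsub>A\<^esub> z \<in> ideal_span I B'" using B.smult_ideal_span_colon[OF I ab(1)] by (simp add: B_simps)
 hence "x \<in> ideal_span I B'" using B.ideal_span_add[OF I.a_subset y(1)] y(3) by (simp add: B_simps)
 thus False using x(3) by blast
qed

lemma polynomial_algebra_structure_inj:
 fixes C :: "('a, 'b) ring_scheme"
 assumes C: "cring C" and E: "is_polynomial_algebra C E n"
  and cd: "c \<in> carrier C" "d \<in> carrier C" "scalar E c = scalar E d"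
 shows "c = d"
proof -
 interpret C: cring C by fact
 obtain h where h: "mpoly_iso C E n h" using E by (auto simp: is_polynomial_algebra_iff)
 note hD = mpoly_isoD[OF C h]
 have "ring.indexed_const C c = (ring.indexed_const C d :: nat multiset \<Rightarrow> 'a)"
  using inj_onD[OF hD(3), of "ring.indexed_const C c" "ring.indexed_const C d"]
   hD(6)[OF cd(1)] hD(6)[OF cd(2)] cd(3) C.const_in_mpoly[OF cd(1)] C.const_in_mpoly[OF cd(2)] by simp
 hence "ring.indexed_const C c ({#} :: nat multiset) = ring.indexed_const C d ({#} :: nat multiset)" by simp
 thus ?thesis by (simp add: C.indexed_const_def)
qed

section \<open>Maps between base changes\<close>

lemma linear_maps_id: "(\<lambda>x. x) \<in> linear_maps R M M"
 by (auto simp: linear_maps_def)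

lemma two_algebrasI: "algebra R A ==> algebra R L ==> two_algebras R A L"
 by (simp add: two_algebras_def)

lemma tensor_map_hom:
 assumes T: "two_algebras R A L" "two_algebras R A' L'"
  and f: "f \<in> linear_maps R A A'" "f \<in> ring_hom A A'" and g: "g \<in> linear_maps R L L'" "g \<in> ring_hom L L'"
 shows "tensor_map R A' L' f g \<in> ring_hom (tensor_ring R A L) (tensor_ring R A' L')"
proof -
 interpret S: two_algebras R A L by fact
 interpret T: two_algebras R A' L' by fact
 note cls = tensor_map_class[OF S.two_modules_axioms T.two_modules_axioms f(1) g(1)]
 note keys = frag_map2_tkeys[OF S.two_modules_axioms T.two_modules_axioms f(1) g(1)]
 note fD = ring_hom_memE[OF f(2)] and gD = ring_hom_memE[OF g(2)]
 have mult: "frag_map2 f g (S.fm x y) = T.fm (frag_map2 f g x) (frag_map2 f g y)"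
  if "S.tkeys x" "S.tkeys y" for x y
  using that
 proof (induction x rule: S.tkeys_induct)
  case (pure a l)
  from pure(3) show ?case
   by (induction y rule: S.tkeys_induct)
    (use pure in \<open>auto simp: frag_mult_simps frag_map2_simps fD gD\<close>)
 qed (auto simp: frag_mult_simps frag_map2_simps)
 show ?thesis
 proof (rule ring_hom_memI)
  fix U V assume "U \<in> carrier S.TR" "V \<in> carrier S.TR"
  then obtain x y where x: "S.tkeys x" "U = S.tc x" "S.tkeys y" "V = S.tc y"
   by (auto simp: S.tensor_ring_simps(1))
  thus "tensor_map R A' L' f g (U \<otimes>\<^bsub>S.TR\<^esub> V) = tensor_map R A' L' f g U \<otimes>\<^bsub>T.TR\<^esub> tensor_map R A' L' f g V"
   "tensor_map R A' L' f g (U \<oplus>\<^bsub>S.TR\<^esub> V) = tensor_map R A' L' f g U \<oplus>\<^bsub>T.TR\<^esub> tensor_map R A' L' f g V"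
   by (simp_all add: S.tensor_mult S.tensor_ring_simps(4) cls keys mult T.tensor_mult T.tensor_ring_simps(4)
     frag_map2_simps)
 next
  fix U assume "U \<in> carrier S.TR"
  thus "tensor_map R A' L' f g U \<in> carrier T.TR"
   by (auto simp: S.tensor_ring_simps(1) T.tensor_ring_simps(1) cls keys)
 qed (simp add: S.tensor_ring_simps(2) T.tensor_ring_simps(2) cls frag_map2_simps fD gD)
qed

lemma tensor_map_iso:
 fixes L (structure)
 assumes A: "algebra R A" "algebra R L" "algebra R L'" and g: "g \<in> ring_iso L L'" "g \<in> linear_maps R L L'"
 shows "tensor_map R A L' (\<lambda>a. a) g \<in> ring_iso (tensor_ring R A L) (tensor_ring R A L')"
proof -
 interpret S: two_algebras R A L by (rule two_algebrasI[OF A(1,2)])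
 interpret T: two_algebras R A L' by (rule two_algebrasI[OF A(1,3)])
 note ig = linear_maps_id g(2)
 note cls = tensor_map_class[OF S.two_modules_axioms T.two_modules_axioms ig]
 define g' where "g' = inv_into (carrier L) g"
 note gD = ring_iso_memE[OF g(1)]
 have bij: "inj_on g (carrier L)" "g ` carrier L = carrier L'" using gD(5) by (auto simp: bij_betw_def)
 have g': "g' (g c) = c" if "c \<in> carrier L" for c
  unfolding g'_def by (rule inv_into_f_f[OF bij(1) that])
 have gg: "g' d \<in> carrier L" "g (g' d) = d" if "d \<in> carrier L'" for d
  unfolding g'_def using inv_into_into[of d g "carrier L"] f_inv_into_f[of d g "carrier L"] that bij(2) by auto
 have lin: "g' \<in> linear_maps R L' L"
  unfolding linear_maps_def
 proof (intro CollectI conjI ballI Pi_I)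
  fix d e assume d: "d \<in> carrier L'" "e \<in> carrier L'"
  have "g (g' d \<oplus> g' e) = d \<oplus>\<^bsub>L'\<^esub> e" using d gg linear_mapsD(2)[OF g(2)] by simp
  thus "g' (d \<oplus>\<^bsub>L'\<^esub> e) = g' d \<oplus> g' e"
   using g'[of "g' d \<oplus> g' e"] gg(1) d S.L.a_closed by simp
 next
  fix r d assume d: "r \<in> carrier R" "d \<in> carrier L'"
  have "g (r \<odot> g' d) = r \<odot>\<^bsub>L'\<^esub> d" using d gg linear_mapsD(3)[OF g(2)] by simp
  thus "g' (r \<odot>\<^bsub>L'\<^esub> d) = r \<odot> g' d" using g'[of "r \<odot> g' d"] gg(1) d S.L.smult_closed by simp
 qed (use gg in auto)
 have id_left: "frag_map2 (\<lambda>a. a) g' (frag_map2 (\<lambda>a. a) g x) = x" if "S.tkeys x" for x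
  using that by (induction x rule: S.tkeys_induct) (auto simp: frag_map2_simps g')
 have id_right: "frag_map2 (\<lambda>a. a) g (frag_map2 (\<lambda>a. a) g' x) = x" if "T.tkeys x" for x
  using that by (induction x rule: T.tkeys_induct) (auto simp: frag_map2_simps gg)
 have hom: "tensor_map R A L' (\<lambda>a. a) g \<in> ring_hom S.TR T.TR"
  using gD by (intro tensor_map_hom S.two_algebras_axioms T.two_algebras_axioms ig) (auto intro: ring_hom_memI)
 have "inj_on (tensor_map R A L' (\<lambda>a. a) g) (carrier S.TR)"
 proof (rule inj_onI)
  fix U V assume "U \<in> carrier S.TR" "V \<in> carrier S.TR"
   and e: "tensor_map R A L' (\<lambda>a. a) g U = tensor_map R A L' (\<lambda>a. a) g V"
  then obtain x y where x: "S.tkeys x" "U = S.tc x" "S.tkeys y" "V = S.tc y"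
   by (auto simp: S.tensor_ring_simps(1))
  hence "frag_map2 (\<lambda>a. a) g (x - y) \<in> T.K"
   using e by (simp add: cls T.class_eq_iff frag_map2_simps)
  hence "frag_map2 (\<lambda>a. a) g' (frag_map2 (\<lambda>a. a) g (x - y)) \<in> S.K"
   by (rule frag_map2_kernel[OF T.two_modules_axioms S.two_modules_axioms linear_maps_id lin])
  thus "U = V" using x by (simp add: id_left S.tkeys_diff S.class_eq_iff)
 qed
 moreover have "U \<in> tensor_map R A L' (\<lambda>a. a) g ` carrier S.TR" if U: "U \<in> carrier T.TR" for U
 proof -
  obtain x where x: "T.tkeys x" "U = T.tc x" using U by (auto simp: T.tensor_ring_simps(1))
  have "S.tkeys (frag_map2 (\<lambda>a. a) g' x)"
   using frag_map2_tkeys[OF T.two_modules_axioms S.two_modules_axioms linear_maps_id lin x(1)] .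
  moreover have "U = tensor_map R A L' (\<lambda>a. a) g (S.tc (frag_map2 (\<lambda>a. a) g' x))"
   using x by (simp add: cls id_right)
  ultimately show ?thesis by (auto simp: S.tensor_ring_simps(1))
 qed
 ultimately show ?thesis
  using hom ring_hom_memE(1)[OF hom] unfolding ring_iso_def bij_betw_def by auto
qed

text \<open>
 Residual systems are formulated with \<open>k(0)\<close> and the rank of \<open>D\<^sub>K\<close> with \<open>K\<close>; as sets of cosets the two fields are
 different.
\<close>

lemma (in domain) residue_field_zero:
 "\<exists>\<rho>. \<rho> \<in> ring_iso (quotient_field R) (residue_field R {\<zero>\<^bsub>R\<^esub>}) \<and>
  \<rho> \<in> linear_maps R (quotient_field R) (residue_field R {\<zero>\<^bsub>R\<^esub>})"
proof -
 interpret F: fractions R "carrier R - {\<zero>}" by (rule fractions_zero)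
 interpret Q: cring F.Q by (rule F.localization_cring)
 define I where "I = Idl\<^bsub>F.Q\<^esub> ((\<lambda>a. fraction R (carrier R - {\<zero>}) a \<one>) ` {\<zero>})"
 interpret I: ideal I F.Q using residue_ideal(2)[OF zero_prime] unfolding I_def .
 define q where "q = (\<lambda>x. I +>\<^bsub>F.Q\<^esub> x)"
 have k: "residue_field R {\<zero>} = algebra_of_hom (\<lambda>a. q (fraction R (carrier R - {\<zero>}) a \<one>)) (F.Q Quot I)"
  unfolding residue_field_def Let_def q_def I_def ..
 have K: "quotient_field R = algebra_of_hom (\<lambda>a. fraction R (carrier R - {\<zero>}) a \<one>) F.Q"
  unfolding quotient_field_def localization_def ..
 have q: "q \<in> ring_hom F.Q (F.Q Quot I)" unfolding q_def by (rule I.rcos_ring_hom)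
 note qD = ring_hom_memE[OF q]
 have "inj_on q (carrier F.Q)"
 proof (rule inj_onI)
  fix x y assume x: "x \<in> carrier F.Q" "y \<in> carrier F.Q" "q x = q y"
  hence d: "x \<ominus>\<^bsub>F.Q\<^esub> y \<in> I"
   using Q.quotient_eq_iff_same_a_r_cos[OF I.is_ideal x(1,2)] by (simp add: q_def)
  have "x \<ominus>\<^bsub>F.Q\<^esub> y \<in> carrier F.Q" using x by simp
  then obtain a s where a: "x \<ominus>\<^bsub>F.Q\<^esub> y = fraction R (carrier R - {\<zero>}) a s" "a \<in> carrier R" "s \<in> carrier R - {\<zero>}"
   by (rule F.fraction_cases)
  have "a \<in> {\<zero>}" using residue_ideal(3)[OF zero_prime a(2,3)] d a(1) unfolding I_def by simp
  hence "x \<ominus>\<^bsub>F.Q\<^esub> y = \<zero>\<^bsub>F.Q\<^esub>" using a by (simp add: F.fraction_simps)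
  thus "x = y" using x by (simp add: Q.r_right_minus_eq)
 qed
 moreover have "q ` carrier F.Q = carrier (F.Q Quot I)"
  by (auto simp: FactRing_def A_RCOSETS_def' q_def)
 ultimately have "q \<in> ring_iso F.Q (F.Q Quot I)" using q unfolding ring_iso_def bij_betw_def by simp
 hence "q \<in> ring_iso (quotient_field R) (residue_field R {\<zero>})"
  unfolding k K ring_iso_def ring_hom_def by (simp add: algebra_of_hom_simps)
 moreover have "q \<in> linear_maps R (quotient_field R) (residue_field R {\<zero>})"
  unfolding k K linear_maps_def using qD F.fraction_closed[OF _ F.S(2)]
  by (auto simp: algebra_of_hom_simps)
 ultimately show ?thesis by blast
qed

lemma mpoly_map_coefficients:
 assumes C: "cring C" "cring C'" and \<rho>: "\<rho> \<in> ring_iso C' C"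
 shows "(\<lambda>p m. \<rho> (p m)) \<in> ring_iso (mpoly_algebra C' n) (mpoly_algebra C n)"
proof -
 interpret C: cring C by fact
 interpret C': cring C' by fact
 have hom: "\<rho> \<in> ring_hom C' C" and bij: "inj_on \<rho> (carrier C')" "\<rho> ` carrier C' = carrier C"
  using \<rho> by (auto simp: ring_iso_def bij_betw_def)
 interpret h: ring_hom_cring C' C \<rho> by unfold_locales (rule hom)
 let ?f = "\<lambda>p (m :: nat multiset). \<rho> (p m)"
 let ?M' = "mpoly_algebra C' n" and ?M = "mpoly_algebra C n"
 have const: "?f (ring.indexed_const C' c) = ring.indexed_const C (\<rho> c)" for c
  by (auto simp: C.indexed_const_def C'.indexed_const_def)
 have cl: "?f p \<in> carrier ?M" if "p \<in> carrier ?M'" for p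
  using that unfolding mpoly_algebra_simps(1)
 proof (induction p rule: C'.indexed_pset.induct)
  case (indexed_const c)
  thus ?case unfolding const by (intro C.indexed_pset.indexed_const) simp
 next
  case (indexed_padd p q)
  have "?f (C'.indexed_padd p q) = C.indexed_padd (?f p) (?f q)"
   using indexed_padd(1,2) C'.mpoly_coeff[of p n] C'.mpoly_coeff[of q n]
   by (auto simp: C.indexed_padd_def C'.indexed_padd_def mpoly_algebra_simps C'.carrier_coeff_def)
  thus ?case using indexed_padd by (simp add: C.indexed_pset.indexed_padd)
 next
  case (indexed_pmult p i)
  have "?f (C'.indexed_pmult p i) = C.indexed_pmult (?f p) i"
   by (auto simp: C.indexed_pmult_def C'.indexed_pmult_def)
  thus ?case using indexed_pmult by (simp add: C.indexed_pset.indexed_pmult)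
 qed
 have co: "p m \<in> carrier C'" if "p \<in> carrier ?M'" for p m
  using C'.mpoly_coeff[OF that] by (simp add: C'.carrier_coeff_def)
 have "?f \<in> ring_hom ?M' ?M"
 proof (rule ring_hom_memI)
  fix p q assume p: "p \<in> carrier ?M'" "q \<in> carrier ?M'"
  show "?f (p \<otimes>\<^bsub>?M'\<^esub> q) = ?f p \<otimes>\<^bsub>?M\<^esub> ?f q"
  proof
   fix m
   show "?f (p \<otimes>\<^bsub>?M'\<^esub> q) m = (?f p \<otimes>\<^bsub>?M\<^esub> ?f q) m"
    unfolding mpoly_algebra_mult using co p
    by (subst h.hom_finsum) (auto intro!: C.finsum_cong')
  qed
  show "?f (p \<oplus>\<^bsub>?M'\<^esub> q) = ?f p \<oplus>\<^bsub>?M\<^esub> ?f q"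
   using co p by (auto simp: mpoly_algebra_simps C.indexed_padd_def C'.indexed_padd_def)
 qed (use cl const in \<open>auto simp: mpoly_algebra_simps\<close>)
 moreover have "inj_on ?f (carrier ?M')"
 proof (rule inj_onI, rule ext)
  fix p q m assume "p \<in> carrier ?M'" "q \<in> carrier ?M'" "?f p = ?f q"
  thus "p m = q m" using inj_onD[OF bij(1), of "p m" "q m"] co by (metis)
 qed
 moreover have "p \<in> ?f ` carrier ?M'" if "p \<in> carrier ?M" for p
  using that unfolding mpoly_algebra_simps(1)
 proof (induction p rule: C.indexed_pset.induct)
  case (indexed_const c)
  then obtain d where "d \<in> carrier C'" "c = \<rho> d" using bij(2) by blast
  thus ?case using const[of d] C'.indexed_pset.indexed_const[of d] by (metis image_eqI)
 next
  case (indexed_padd p q)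
  then obtain p' q' where p: "p = ?f p'" "q = ?f q'" "p' \<in> carrier ?M'" "q' \<in> carrier ?M'"
   by (auto simp: mpoly_algebra_simps)
  have "C.indexed_padd p q = ?f (C'.indexed_padd p' q')"
   using co p by (auto simp: C.indexed_padd_def C'.indexed_padd_def)
  thus ?case using p(3,4) unfolding mpoly_algebra_simps(1) by (blast intro: C'.indexed_pset.indexed_padd)
 next
  case (indexed_pmult p i)
  then obtain p' where p: "p = ?f p'" "p' \<in> carrier ?M'"
   by (auto simp: mpoly_algebra_simps)
  have "C.indexed_pmult p i = ?f (C'.indexed_pmult p' i)"
   using p by (auto simp: C.indexed_pmult_def C'.indexed_pmult_def)
  thus ?case using p(2) indexed_pmult(2) unfolding mpoly_algebra_simps(1)
   by (blast intro: C'.indexed_pset.indexed_pmult)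
 qed
 ultimately show ?thesis using cl unfolding ring_iso_def bij_betw_def by auto
qed

lemma is_polynomial_algebra_transport:
 assumes C: "cring C" "cring C'" and \<rho>: "\<rho> \<in> ring_iso C' C" and \<Psi>: "\<Psi> \<in> ring_iso E E'"
  and semi: "\<And>c x. c \<in> carrier C' ==> x \<in> carrier E ==> \<Psi> (\<rho> c \<odot>\<^bsub>E\<^esub> x) = c \<odot>\<^bsub>E'\<^esub> \<Psi> x"
  and E: "is_polynomial_algebra C E n"
 shows "is_polynomial_algebra C' E' n"
proof -
 interpret C: cring C by fact
 interpret C': cring C' by fact
 obtain h where h: "h \<in> ring_iso (mpoly_algebra C n) E" "h \<in> linear_maps C (mpoly_algebra C n) E"
  using E unfolding is_polynomial_algebra_def by blast
 let ?f = "\<lambda>p (m :: nat multiset). \<rho> (p m)"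
 have f: "?f \<in> ring_iso (mpoly_algebra C' n) (mpoly_algebra C n)" by (rule mpoly_map_coefficients[OF C \<rho>])
 note fD = ring_iso_memE[OF f] and hD = ring_iso_memE[OF h(1)] and pD = ring_iso_memE[OF \<Psi>] and rD = ring_iso_memE[OF \<rho>]
 let ?h = "\<lambda>p. \<Psi> (h (?f p))"
 have iso: "?h \<in> ring_iso (mpoly_algebra C' n) E'"
  using ring_iso_set_trans[OF ring_iso_set_trans[OF f h(1)] \<Psi>] by (simp add: o_def)
 note iD = ring_iso_memE[OF iso]
 have "?h \<in> linear_maps C' (mpoly_algebra C' n) E'"
  unfolding linear_maps_def
 proof (intro CollectI conjI ballI Pi_I)
  fix c p assume c: "c \<in> carrier C'" and p: "p \<in> carrier (mpoly_algebra C' n)"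
  have co: "p m \<in> carrier C'" for m
   using C'.mpoly_coeff[OF p] by (simp add: C'.carrier_coeff_def)
  have "?f (c \<odot>\<^bsub>mpoly_algebra C' n\<^esub> p) = \<rho> c \<odot>\<^bsub>mpoly_algebra C n\<^esub> ?f p"
   using c co rD by (simp add: mpoly_algebra_simps)
  thus "?h (c \<odot>\<^bsub>mpoly_algebra C' n\<^esub> p) = c \<odot>\<^bsub>E'\<^esub> ?h p"
   using linear_mapsD(3)[OF h(2)] rD(1)[OF c] fD(1)[OF p] hD(1)[OF fD(1)[OF p]] semi[OF c] by simp
 qed (use iD in auto)
 thus ?thesis using iso unfolding is_polynomial_algebra_def by blast
qed

section \<open>Residual systems\<close>

text \<open>
 The inverse of a base change along \<open>\<rho>\<close> transports polynomial algebra structures from \<open>k(0)\<close> to \<open>K\<close>.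
\<close>

lemma base_change_iso_inverse:
 assumes M: "algebra R M" and K: "algebra R K" and k: "algebra R k"
  and \<rho>: "\<rho> \<in> ring_iso K k" "\<rho> \<in> linear_maps R K k"
 shows "\<exists>\<Psi>. \<Psi> \<in> ring_iso (base_change R M k) (base_change R M K) \<and>
  (\<forall>x\<in>carrier (base_change R M K). \<Psi> (tensor_map R M k (\<lambda>a. a) \<rho> x) = x) \<and>
  (\<forall>c\<in>carrier K. \<forall>x\<in>carrier (base_change R M k).
   \<Psi> (\<rho> c \<odot>\<^bsub>base_change R M k\<^esub> x) = c \<odot>\<^bsub>base_change R M K\<^esub> \<Psi> x)"
proof -
 interpret TK: two_algebras R M K by (rule two_algebrasI[OF M K])
 interpret Tk: two_algebras R M k by (rule two_algebrasI[OF M k])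
 interpret EK: algebra K "base_change R M K" by (rule TK.base_change_algebra)
 interpret Ek: algebra k "base_change R M k" by (rule Tk.base_change_algebra)
 let ?\<Phi> = "tensor_map R M k (\<lambda>a. a) \<rho>"
 have iso: "?\<Phi> \<in> ring_iso (base_change R M K) (base_change R M k)"
  using tensor_map_iso[OF M K k \<rho>]
  unfolding base_change_def ring_iso_def ring_hom_def by (simp add: algebra_of_hom_simps)
 note iD = ring_iso_memE[OF iso]
 have inj: "inj_on ?\<Phi> (carrier (base_change R M K))" using iD(5) by (simp add: bij_betw_def)
 have im: "?\<Phi> ` carrier (base_change R M K) = carrier (base_change R M k)" using iD(5) by (simp add: bij_betw_def)
 let ?\<Psi> = "inv_into (carrier (base_change R M K)) ?\<Phi>"
 have 1: "?\<Psi> \<in> ring_iso (base_change R M k) (base_change R M K)"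
  by (rule ring_iso_set_sym[OF EK.ring_axioms iso])
 have 2: "?\<Psi> (?\<Phi> x) = x" if "x \<in> carrier (base_change R M K)" for x
  by (rule inv_into_f_f[OF inj that])
 have "?\<Phi> (c \<odot>\<^bsub>base_change R M K\<^esub> x) = \<rho> c \<odot>\<^bsub>base_change R M k\<^esub> ?\<Phi> x"
  if c: "c \<in> carrier K" "x \<in> carrier (base_change R M K)" for c x
 proof -
  have "TK.tc (frag_of (\<one>\<^bsub>M\<^esub>, c)) \<in> carrier (base_change R M K)"
   using c(1) unfolding TK.base_change_simps(1) by (intro imageI) simp
  hence "?\<Phi> (TK.tc (frag_of (\<one>\<^bsub>M\<^esub>, c)) \<otimes>\<^bsub>base_change R M K\<^esub> x) =
    Tk.tc (frag_of (\<one>\<^bsub>M\<^esub>, \<rho> c)) \<otimes>\<^bsub>base_change R M k\<^esub> ?\<Phi> x"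
   using iD(2) c(2) tensor_map_class[OF TK.two_modules_axioms Tk.two_modules_axioms linear_maps_id \<rho>(2)]
   by (simp add: frag_map2_simps)
  thus ?thesis by (simp add: base_change_def algebra_of_hom_simps)
 qed
 hence "?\<Psi> (\<rho> c \<odot>\<^bsub>base_change R M k\<^esub> x) = c \<odot>\<^bsub>base_change R M K\<^esub> ?\<Psi> x"
  if c: "c \<in> carrier K" "x \<in> carrier (base_change R M k)" for c x
  using 2[of "c \<odot>\<^bsub>base_change R M K\<^esub> ?\<Psi> x"] c inv_into_into[of x ?\<Phi> "carrier (base_change R M K)"]
   f_inv_into_f[of x ?\<Phi> "carrier (base_change R M K)"] EK.smult_closed unfolding im by simp
 thus ?thesis using 1 2 by (intro exI[of _ ?\<Psi>]) blast
qed

lemma generic_fibre_polynomial: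
 assumes R: "domain R" and A: "affine_fibration R A n"
 shows "is_polynomial_algebra (quotient_field R) (base_change R A (quotient_field R)) n"
proof -
 interpret domain R by fact
 define K where "K = quotient_field R"
 define k where "k = residue_field R {\<zero>\<^bsub>R\<^esub>}"
 have loc: "localizes R {\<zero>\<^bsub>R\<^esub>} K" "localizes R {\<zero>\<^bsub>R\<^esub>} k"
  unfolding K_def k_def by (rule quotient_field_localizes residue_field_localizes zero_prime)+
 interpret K: algebra R K by (rule localizesD(1)[OF loc(1)])
 interpret k: algebra R k by (rule localizesD(1)[OF loc(2)])
 obtain \<rho> where \<rho>: "\<rho> \<in> ring_iso K k" "\<rho> \<in> linear_maps R K k"
  using residue_field_zero unfolding K_def k_def by blast
 have alg: "algebra R A" and poly: "is_polynomial_algebra k (base_change R A k) n"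
  using A zero_prime unfolding affine_fibration_def k_def by simp_all
 from base_change_iso_inverse[OF alg K.algebra_axioms k.algebra_axioms \<rho>]
 obtain \<Psi> where "\<Psi> \<in> ring_iso (base_change R A k) (base_change R A K) \<and>
  (\<forall>x\<in>carrier (base_change R A K). \<Psi> (tensor_map R A k (\<lambda>a. a) \<rho> x) = x) \<and>
  (\<forall>c\<in>carrier K. \<forall>x\<in>carrier (base_change R A k).
   \<Psi> (\<rho> c \<odot>\<^bsub>base_change R A k\<^esub> x) = c \<odot>\<^bsub>base_change R A K\<^esub> \<Psi> x)" ..
 thus ?thesis
  unfolding K_def[symmetric]
  by (intro is_polynomial_algebra_transport[OF k.M_cring K.M_cring \<rho>(1) _ _ poly]) auto
qed

locale residual_subalgebra = domain R for R :: "('r, 'x) ring_scheme" (structure) +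
 fixes A :: "('r, 'a, 'm) module_scheme" and B :: "'a set" and n r :: nat
 assumes residual: "residual_system R B A n r"
begin

abbreviation B' where "B' \<equiv> A\<lparr>carrier := B\<rparr>"

lemma A_fibration: "affine_fibration R A n" and B_fibration: "affine_fibration R B' (n - r)" and r_le: "r \<le> n"
 using residual by (simp_all add: residual_system_def)

lemma A_algebra: "algebra R A" and A_flat: "flat_module R A"
 and A_poly: "primeideal P R ==> is_polynomial_algebra (residue_field R P) (base_change R A (residue_field R P)) n"
 using A_fibration by (simp_all add: affine_fibration_def)

lemma B_algebra: "algebra R B'" and B_flat: "flat_module R B'"
 and B_poly: "primeideal P R ==> is_polynomial_algebra (residue_field R P) (base_change R B' (residue_field R P)) (n - r)"
 using B_fibration by (simp_all add: affine_fibration_def)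

lemma A_module: "module R A" and B_module: "module R B'"
 using A_algebra B_algebra by (simp_all add: algebra_def)

lemma B_sub: "B \<subseteq> carrier A"
 using residual subringE(1) by (auto simp: residual_system_def is_subalgebra_def)

abbreviation incl where "incl L \<equiv> tensor_map R A L (\<lambda>b. b) (\<lambda>c. c)"

lemma AB_poly:
 "primeideal P R ==> is_polynomial_algebra (base_change R B' (residue_field R P))
  (algebra_of_hom (incl (residue_field R P)) (base_change R A (residue_field R P))) r"
 using residual by (simp add: residual_system_def Let_def)

lemma incl_linear: "(\<lambda>b. b) \<in> linear_maps R B' A"
 using B_sub by (auto simp: linear_maps_def)

lemma incl_class:
 assumes "algebra R L"
 shows "incl L (tensor_class R B' L x) = tensor_class R A L x"
proof -
 interpret A: algebra R A by (rule A_algebra)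
 interpret B: algebra R B' by (rule B_algebra)
 interpret L: algebra R L by fact
 show ?thesis
  using tensor_map_class[of R B' L A L, OF _ _ incl_linear linear_maps_id]
  by (simp add: frag_map2_id two_modules_def A.module_axioms B.module_axioms L.module_axioms)
qed

lemma incl_hom:
 assumes "algebra R L"
 shows "incl L \<in> ring_hom (base_change R B' L) (base_change R A L)"
proof -
 have "(\<lambda>b. b) \<in> ring_hom B' A" using B_sub by (intro ring_hom_memI) auto
 moreover have "(\<lambda>c. c) \<in> ring_hom L L" by (intro ring_hom_memI) auto
 ultimately have "incl L \<in> ring_hom (tensor_ring R B' L) (tensor_ring R A L)"
  by (rule tensor_map_hom[OF two_algebrasI[OF B_algebra assms] two_algebrasI[OF A_algebra assms]
     incl_linear _ linear_maps_id])
 thus ?thesis by (simp add: base_change_def ring_hom_def algebra_of_hom_simps)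
qed

lemma base_change_algebras:
 assumes "algebra R L"
 shows "algebra L (base_change R A L)" "algebra L (base_change R B' L)"
 using two_algebras.base_change_algebra two_algebrasI[OF A_algebra assms] two_algebrasI[OF B_algebra assms]
 by blast+

lemma incl_linear_base_change:
 assumes L: "algebra R L"
 shows "incl L \<in> linear_maps L (base_change R B' L) (base_change R A L)"
proof -
 interpret TA: two_algebras R A L by (rule two_algebrasI[OF A_algebra L])
 interpret TB: two_algebras R B' L by (rule two_algebrasI[OF B_algebra L])
 note D = ring_hom_memE[OF incl_hom[OF L]]
 have "incl L (l \<odot>\<^bsub>base_change R B' L\<^esub> x) = l \<odot>\<^bsub>base_change R A L\<^esub> incl L x"
  if "l \<in> carrier L" "x \<in> carrier (base_change R B' L)" for l x
 proof -
  have "TB.tc (frag_of (\<one>\<^bsub>B'\<^esub>, l)) \<in> carrier (base_change R B' L)"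
   using that(1) TB.A.one_closed unfolding TB.base_change_simps(1) by (intro imageI) simp
  hence "incl L (TB.tc (frag_of (\<one>\<^bsub>B'\<^esub>, l)) \<otimes>\<^bsub>base_change R B' L\<^esub> x) =
    TA.tc (frag_of (\<one>\<^bsub>A\<^esub>, l)) \<otimes>\<^bsub>base_change R A L\<^esub> incl L x"
   using D(2) that(2) incl_class[OF L] by simp
  thus ?thesis by (simp add: base_change_def algebra_of_hom_simps)
 qed
 thus ?thesis using D unfolding linear_maps_def by auto
qed

lemma incl_inj:
 assumes P: "primeideal P R"
 defines "k \<equiv> residue_field R P"
 shows "inj_on (incl k) (carrier (base_change R B' k))"
proof (rule inj_onI)
 fix x y assume x: "x \<in> carrier (base_change R B' k)" "y \<in> carrier (base_change R B' k)" "incl k x = incl k y"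
 have k: "algebra R k" unfolding k_def by (rule localizesD(1)[OF residue_field_localizes[OF P]])
 interpret EA: algebra k "base_change R A k" by (rule base_change_algebras(1)[OF k])
 interpret EB: algebra k "base_change R B' k" by (rule base_change_algebras(2)[OF k])
 note D = ring_hom_memE[OF incl_hom[OF k]]
 show "x = y"
 proof (rule polynomial_algebra_structure_inj[OF EB.M_cring AB_poly[OF P, folded k_def] x(1,2)])
  show "x \<odot>\<^bsub>algebra_of_hom (incl k) (base_change R A k)\<^esub> \<one>\<^bsub>algebra_of_hom (incl k) (base_change R A k)\<^esub> =
   y \<odot>\<^bsub>algebra_of_hom (incl k) (base_change R A k)\<^esub> \<one>\<^bsub>algebra_of_hom (incl k) (base_change R A k)\<^esub>"
   using x(3) by (simp add: algebra_of_hom_simps)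
 qed
qed

text \<open>
 An element of \<open>PA \<inter> B\<close> vanishes in \<open>A \<otimes> k(P)\<close>, hence in \<open>B \<otimes> k(P)\<close>, since a polynomial ring contains its
 ring of coefficients. So a multiple \<open>s x\<close> with \<open>s \<notin> P\<close> lies in \<open>PB\<close>, and flatness of \<open>B\<close> allows to cancel \<open>s\<close>.
\<close>

lemma residual_purity_prime:
 assumes P: "primeideal P R" and x: "x \<in> B" "x \<in> ideal_span P A"
 shows "x \<in> ideal_span P B'"
proof -
 define k where "k = residue_field R P"
 note loc = residue_field_localizes[OF P, folded k_def]
 note kD = localizesD[OF loc]
 interpret P: primeideal P R by fact
 interpret A: module R A by (rule A_module)
 interpret B: module R B' by (rule B_module)
 interpret k: algebra R k by (rule kD(1))
 interpret TA: two_algebras R A k by (rule two_algebrasI[OF A_algebra kD(1)])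
 interpret TB: two_algebras R B' k by (rule two_algebrasI[OF B_algebra kD(1)])
 have "TA.tc (frag_of (x, \<one>\<^bsub>k\<^esub>)) = TA.tc 0"
  using x(2)
 proof (induction x rule: ideal_span.induct)
  case zero
  show ?case by (rule TA.class_zero_left) simp
 next
  case (step p m y)
  have p: "p \<in> carrier R" using step P.Icarr by blast
  have y: "y \<in> carrier A" using A.ideal_span_closed[OF P.a_subset step(3)] .
  have "TA.tc (frag_of (p \<odot>\<^bsub>A\<^esub> m, \<one>\<^bsub>k\<^esub>)) = TA.tc 0"
   using TA.class_balanced[of p m "\<one>\<^bsub>k\<^esub>"] TA.class_zero_right[of m] p step kD(4)[of p] by simp
  hence "TA.tc (frag_of (p \<odot>\<^bsub>A\<^esub> m, \<one>\<^bsub>k\<^esub>) + frag_of (y, \<one>\<^bsub>k\<^esub>)) = TA.tc (0 + 0)"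
   using step(4) by (rule TA.class_cong_add)
  thus ?case using TA.class_add_left[of "p \<odot>\<^bsub>A\<^esub> m" y "\<one>\<^bsub>k\<^esub>"] p y step by simp
 qed
 hence "incl k (TB.tc (frag_of (x, \<one>\<^bsub>k\<^esub>))) = incl k (TB.tc 0)"
  by (simp add: incl_class[OF kD(1)])
 moreover have "TB.tc (frag_of (x, \<one>\<^bsub>k\<^esub>)) \<in> carrier (base_change R B' k)" "TB.tc 0 \<in> carrier (base_change R B' k)"
  unfolding TB.base_change_simps(1) using x(1) by (auto intro!: imageI)
 ultimately have "TB.tc (frag_of (x, \<one>\<^bsub>k\<^esub>)) = TB.tc 0"
  using incl_inj[OF P] unfolding k_def[symmetric] by (auto dest: inj_onD)
 then obtain s where s: "s \<in> carrier R" "s \<notin> P" "s \<odot>\<^bsub>B'\<^esub> x \<in> ideal_span P B'"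
  using tensor_zero_localized[OF loc B_module, of x] x(1) by auto
 have "x \<in> ideal_span (colon R P s) B'"
  using flat_colon[OF B_flat B_module P.is_ideal s(1) _ s(3)] x(1) by simp
 moreover have "colon R P s \<subseteq> P" unfolding colon_def using P.I_prime[of _ s] s by blast
 ultimately show ?thesis using ideal_span_mono[of "colon R P s" P "carrier B'" B'] by simp
qed

lemma residual_purity:
 assumes "noetherian_domain R" "ideal I R" "x \<in> B" "x \<in> ideal_span I A"
 shows "x \<in> ideal_span I B'"
 by (rule purity[OF assms(1) A_module A_flat B_sub B_module residual_purity_prime assms(2-4)])

lemma generic_polynomial:
 defines "K \<equiv> quotient_field R"
 shows "is_polynomial_algebra K (base_change R B' K) (n - r)"
  "is_polynomial_algebra (base_change R B' K) (algebra_of_hom (incl K) (base_change R A K)) r"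
proof -
 define k where "k = residue_field R {\<zero>}"
 have loc: "localizes R {\<zero>} K" "localizes R {\<zero>} k"
  unfolding K_def k_def by (rule quotient_field_localizes residue_field_localizes zero_prime)+
 note K = localizesD(1)[OF loc(1)] and k = localizesD(1)[OF loc(2)]
 interpret K: algebra R K by (rule K)
 interpret k: algebra R k by (rule k)
 obtain \<rho> where \<rho>: "\<rho> \<in> ring_iso K k" "\<rho> \<in> linear_maps R K k"
  using residue_field_zero unfolding K_def k_def by blast
 from base_change_iso_inverse[OF A_algebra K k \<rho>] obtain \<Psi>A where "\<Psi>A \<in> ring_iso (base_change R A k) (base_change R A K) \<and>
   (\<forall>x\<in>carrier (base_change R A K). \<Psi>A (tensor_map R A k (\<lambda>a. a) \<rho> x) = x) \<and>
   (\<forall>c\<in>carrier K. \<forall>x\<in>carrier (base_change R A k).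
    \<Psi>A (\<rho> c \<odot>\<^bsub>base_change R A k\<^esub> x) = c \<odot>\<^bsub>base_change R A K\<^esub> \<Psi>A x)" ..
 hence A: "\<Psi>A \<in> ring_iso (base_change R A k) (base_change R A K)"
  "\<And>x. x \<in> carrier (base_change R A K) ==> \<Psi>A (tensor_map R A k (\<lambda>a. a) \<rho> x) = x"
  "\<And>c x. c \<in> carrier K ==> x \<in> carrier (base_change R A k) ==>
   \<Psi>A (\<rho> c \<odot>\<^bsub>base_change R A k\<^esub> x) = c \<odot>\<^bsub>base_change R A K\<^esub> \<Psi>A x"
  by simp_all
 show "is_polynomial_algebra K (base_change R B' K) (n - r)"
  unfolding K_def by (rule generic_fibre_polynomial[OF domain_axioms B_fibration])
 interpret EKA: algebra K "base_change R A K" by (rule base_change_algebras(1)[OF K])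
 interpret EkA: algebra k "base_change R A k" by (rule base_change_algebras(1)[OF k])
 interpret EKB: algebra K "base_change R B' K" by (rule base_change_algebras(2)[OF K])
 interpret EkB: algebra k "base_change R B' k" by (rule base_change_algebras(2)[OF k])
 interpret TK: two_algebras R B' K by (rule two_algebrasI[OF B_algebra K])
 interpret Tk: two_algebras R B' k by (rule two_algebrasI[OF B_algebra k])
 interpret TKA: two_algebras R A K by (rule two_algebrasI[OF A_algebra K])
 interpret TkA: two_algebras R A k by (rule two_algebrasI[OF A_algebra k])
 let ?\<Phi>B = "tensor_map R B' k (\<lambda>a. a) \<rho>" and ?\<Phi>A = "tensor_map R A k (\<lambda>a. a) \<rho>"
 have isoB: "?\<Phi>B \<in> ring_iso (base_change R B' K) (base_change R B' k)"
  using tensor_map_iso[OF B_algebra K k \<rho>]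
  unfolding base_change_def ring_iso_def ring_hom_def by (simp add: algebra_of_hom_simps)
 have square: "incl k (?\<Phi>B x) = ?\<Phi>A (incl K x)" if x: "x \<in> carrier (base_change R B' K)" for x
 proof -
  obtain w where w: "x = TK.tc w" using x unfolding TK.base_change_simps(1) by blast
  show ?thesis
   unfolding w incl_class[OF K] tensor_map_class[OF TK.two_modules_axioms Tk.two_modules_axioms linear_maps_id \<rho>(2)]
    incl_class[OF k] tensor_map_class[OF TKA.two_modules_axioms TkA.two_modules_axioms linear_maps_id \<rho>(2)] ..
 qed
 have isoA: "\<Psi>A \<in> ring_iso (algebra_of_hom (incl k) (base_change R A k)) (algebra_of_hom (incl K) (base_change R A K))"
  using A(1) unfolding ring_iso_def ring_hom_def by (simp add: algebra_of_hom_simps)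
 show "is_polynomial_algebra (base_change R B' K) (algebra_of_hom (incl K) (base_change R A K)) r"
 proof (rule is_polynomial_algebra_transport[OF EkB.M_cring EKB.M_cring isoB isoA _ AB_poly[OF zero_prime, folded k_def]])
  fix c x assume c: "c \<in> carrier (base_change R B' K)" and x: "x \<in> carrier (algebra_of_hom (incl k) (base_change R A k))"
  have ic: "incl K c \<in> carrier (base_change R A K)" by (rule ring_hom_memE(1)[OF incl_hom[OF K] c])
  have "?\<Phi>A (incl K c) \<in> carrier (base_change R A k)"
   using ring_hom_memE(1)[OF incl_hom[OF k] ring_iso_memE(1)[OF isoB c]] unfolding square[OF c] .
  hence "\<Psi>A (?\<Phi>A (incl K c) \<otimes>\<^bsub>base_change R A k\<^esub> x) = incl K c \<otimes>\<^bsub>base_change R A K\<^esub> \<Psi>A x"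
   using ring_iso_memE(2)[OF A(1)] A(2)[OF ic] x by (simp add: algebra_of_hom_simps)
  thus "\<Psi>A (?\<Phi>B c \<odot>\<^bsub>algebra_of_hom (incl k) (base_change R A k)\<^esub> x) =
    c \<odot>\<^bsub>algebra_of_hom (incl K) (base_change R A K)\<^esub> \<Psi>A x"
   by (simp add: algebra_of_hom_simps square[OF c])
 qed
qed

end

section \<open>The generic fibre of a residual system\<close>

lemma subring_algebra_of_hom:
 assumes E: "cring E" and T: "subring T E"
 shows "subring T (algebra_of_hom h E)"
proof -
 interpret E: cring E by fact
 interpret H: cring "algebra_of_hom h E" by (rule cring_algebra_of_hom[OF E])
 note TD = subringE[OF T]
 have minus: "\<ominus>\<^bsub>algebra_of_hom h E\<^esub> x = \<ominus>\<^bsub>E\<^esub> x" if "x \<in> carrier E" for x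
  by (rule H.minus_equality) (use that in \<open>simp_all add: algebra_of_hom_simps E.l_neg\<close>)
 show ?thesis
 proof (rule H.subringI)
  show "T \<subseteq> carrier (algebra_of_hom h E)" using TD(1) by (simp add: algebra_of_hom_simps)
  show "\<ominus>\<^bsub>algebra_of_hom h E\<^esub> x \<in> T" if "x \<in> T" for x
   using minus[of x] TD(1) TD(5)[OF that] that by auto
 qed (simp_all add: algebra_of_hom_simps TD)
qed

lemma adjoin_hom_image:
 assumes E: "algebra C E" and F: "algebra C F" and \<phi>: "\<phi> \<in> ring_hom E F" "\<phi> \<in> linear_maps C E F"
  and S: "S \<subseteq> carrier E" "adjoin C E S = carrier E"
 shows "adjoin C F (\<phi> ` S) = \<phi> ` carrier E"
proof
 interpret E: algebra C E by fact
 interpret F: algebra C F by fact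
 interpret \<phi>: ring_hom_ring E F \<phi> by unfold_locales (rule \<phi>(1))
 have scalars: "scalar F c = \<phi> (scalar E c)" if "c \<in> carrier C" for c
  using linear_mapsD(3)[OF \<phi>(2) that] by simp
 have sub: "\<phi> ` S \<subseteq> carrier F" using S(1) by auto
 show "adjoin C F (\<phi> ` S) \<subseteq> \<phi> ` carrier E"
  by (rule adjoin_least[OF F \<phi>.img_is_subring[OF E.carrier_is_subring]]) (use S(1) scalars in auto)
 note GD = subringE[OF adjoin_subring[OF F sub]]
 define T where "T = {x \<in> carrier E. \<phi> x \<in> adjoin C F (\<phi> ` S)}"
 have "subring T E"
  by (rule E.subringI) (auto simp: T_def GD)
 hence "adjoin C E S \<subseteq> T"
 proof (rule adjoin_least[OF E])
  show "S \<subseteq> T" using S(1) adjoin_incl(1)[of "\<phi> ` S" C F] unfolding T_def by blast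
  show "scalar E c \<in> T" if "c \<in> carrier C" for c
   using scalars[OF that] adjoin_incl(2)[OF that, of F "\<phi> ` S"] that unfolding T_def by simp
 qed
 thus "\<phi> ` carrier E \<subseteq> adjoin C F (\<phi> ` S)" unfolding S(2) T_def by blast
qed

text \<open>
 The image of \<open>E\<close> in \<open>F\<close> is generated by the first coordinates, so \<open>F\<close> is generated by all of them.
\<close>

lemma stacked_coordinates:
 assumes E: "algebra C E" and F: "algebra C F" and \<phi>: "\<phi> \<in> ring_hom E F" "\<phi> \<in> linear_maps C E F"
  and V: "coordinate_system C E m V" and W: "coordinate_system E (algebra_of_hom \<phi> F) r W"
 defines "U \<equiv> \<lambda>i. if i < m then \<phi> (V i) else W (i - m)"
 shows "coordinate_system C F (m + r) U" "adjoin C F (U ` {..<m}) = \<phi> ` carrier E" "U ` {..<m} \<subseteq> \<phi> ` carrier E"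
proof -
 interpret E: algebra C E by fact
 interpret F: algebra C F by fact
 interpret \<phi>: ring_hom_ring E F \<phi> by unfold_locales (rule \<phi>(1))
 have V': "V ` {..<m} \<subseteq> carrier E" "adjoin C E (V ` {..<m}) = carrier E"
  using V by (auto simp: coordinate_system_def)
 have W': "W ` {..<r} \<subseteq> carrier F" "adjoin E (algebra_of_hom \<phi> F) (W ` {..<r}) = carrier F"
  using W by (auto simp: coordinate_system_def algebra_of_hom_simps)
 have UV: "U ` {..<m} = \<phi> ` V ` {..<m}" by (auto simp: U_def)
 show 1: "adjoin C F (U ` {..<m}) = \<phi> ` carrier E"
  unfolding UV by (rule adjoin_hom_image[OF E F \<phi> V'])
 show "U ` {..<m} \<subseteq> \<phi> ` carrier E" unfolding UV using V'(1) by blast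
 have U: "U ` {..<m + r} \<subseteq> carrier F"
 proof
  fix y assume "y \<in> U ` {..<m + r}"
  then obtain i where i: "i < m + r" "y = U i" by blast
  show "y \<in> carrier F"
  proof (cases "i < m")
   case True
   hence "V i \<in> carrier E" using V'(1) by blast
   thus ?thesis using i True by (simp add: U_def)
  next
   case False
   hence "i - m \<in> {..<r}" using i by auto
   thus ?thesis using i False W'(1) by (auto simp: U_def)
  qed
 qed
 have W_sub: "W ` {..<r} \<subseteq> U ` {..<m + r}"
 proof
  fix y assume "y \<in> W ` {..<r}"
  then obtain j where "j < r" "y = U (m + j)" by (auto simp: U_def)
  thus "y \<in> U ` {..<m + r}" by auto
 qed
 let ?T = "adjoin C F (U ` {..<m + r})"
 interpret T: subring ?T F by (rule adjoin_subring[OF F U])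
 have "U ` {..<m} \<subseteq> ?T" using adjoin_incl(1)[of "U ` {..<m + r}" C F] by force
 hence "adjoin C F (U ` {..<m}) \<subseteq> ?T"
  by (rule adjoin_least[OF F T.subring_axioms]) (rule adjoin_incl(2))
 hence img: "\<phi> ` carrier E \<subseteq> ?T" unfolding 1 .
 have "adjoin E (algebra_of_hom \<phi> F) (W ` {..<r}) \<subseteq> ?T"
 proof (rule adjoin_least)
  show "algebra E (algebra_of_hom \<phi> F)" by (rule algebra_algebra_of_hom[OF F.M_cring E.M_cring \<phi>(1)])
  show "subring ?T (algebra_of_hom \<phi> F)" by (rule subring_algebra_of_hom[OF F.M_cring T.subring_axioms])
  show "W ` {..<r} \<subseteq> ?T" using W_sub adjoin_incl(1)[of "U ` {..<m + r}" C F] by (rule order_trans)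
  show "c \<odot>\<^bsub>algebra_of_hom \<phi> F\<^esub> \<one>\<^bsub>algebra_of_hom \<phi> F\<^esub> \<in> ?T" if "c \<in> carrier E" for c
  proof -
   have "\<phi> c \<otimes>\<^bsub>F\<^esub> \<one>\<^bsub>F\<^esub> = \<phi> c" using that by simp
   thus ?thesis using img that by (auto simp: algebra_of_hom_simps)
  qed
 qed
 thus "coordinate_system C F (m + r) U"
  using W'(2) by (intro coordinate_systemI F U) simp
qed

text \<open>
 All conditions are checked on pure tensors, where \<open>D \<otimes> 1\<close> acts by \<open>a \<otimes> l \<mapsto> D a \<otimes> l\<close>.
\<close>

lemma base_change_LND:
 fixes A (structure)
 assumes A: "algebra R A" and L: "algebra R L" and D: "D \<in> LNDs R A"
 shows "tensor_map R A L D (\<lambda>c. c) \<in> LNDs L (base_change R A L)"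
proof -
 interpret T: two_algebras R A L by (rule two_algebrasI[OF A L])
 interpret E: algebra L "base_change R A L" by (rule T.base_change_algebra)
 let ?E = "base_change R A L" and ?D = "tensor_map R A L D (\<lambda>c. c)"
 have lin: "D \<in> linear_maps R A A" using D by (simp add: LNDs_def derivations_def)
 note lD = linear_mapsD[OF lin]
 have leib: "D (x \<otimes> y) = (D x \<otimes> y) \<oplus> (x \<otimes> D y)" if "x \<in> carrier A" "y \<in> carrier A" for x y
  using D that by (simp add: LNDs_def derivations_def)
 have nil: "\<exists>m. (D ^^ m) x = \<zero>" if "x \<in> carrier A" for x
  using D that by (simp add: LNDs_def)
 note cls = tensor_map_class[OF T.two_modules_axioms T.two_modules_axioms lin linear_maps_id]
 note keys = frag_map2_tkeys[OF T.two_modules_axioms T.two_modules_axioms lin linear_maps_id]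
 have carrier: "carrier ?E = carrier (tensor_group R A L)"
  by (simp add: T.base_change_simps(1) T.carrier_tensor_group)
 have pure_cl: "T.tc (frag_of (a, l)) \<in> carrier ?E" if "a \<in> carrier A" "l \<in> carrier L" for a l
  unfolding T.base_change_simps(1) using that by (intro imageI) simp
 have tc_cl: "T.tc x \<in> carrier ?E" if "T.tkeys x" for x
  unfolding T.base_change_simps(1) using that by (intro imageI) simp
 have pure: "?D (T.tc (frag_of (a, l))) = T.tc (frag_of (D a, l))" for a l
  by (simp add: cls frag_map2_simps)
 have cl: "?D U \<in> carrier ?E" if "U \<in> carrier ?E" for U
  using that keys by (auto simp: T.base_change_simps(1) cls)
 have add: "?D (U \<oplus>\<^bsub>?E\<^esub> V) = ?D U \<oplus>\<^bsub>?E\<^esub> ?D V" if "U \<in> carrier ?E" "V \<in> carrier ?E" for U V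
  using that by (auto simp: T.base_change_simps(1,5) cls frag_map2_simps)
 have mult_pure: "T.tc (frag_of (a, l)) \<otimes>\<^bsub>?E\<^esub> T.tc (frag_of (a', l')) = T.tc (frag_of (a \<otimes> a', l \<otimes>\<^bsub>L\<^esub> l'))"
  if "a \<in> carrier A" "l \<in> carrier L" "a' \<in> carrier A" "l' \<in> carrier L" for a l a' l'
  using that by (simp add: T.base_change_simps(2) frag_mult_simps)
 have prod: "?D (U \<otimes>\<^bsub>?E\<^esub> V) = (?D U \<otimes>\<^bsub>?E\<^esub> V) \<oplus>\<^bsub>?E\<^esub> (U \<otimes>\<^bsub>?E\<^esub> ?D V)"
  if U: "U \<in> carrier ?E" and V: "V \<in> carrier ?E" for U V
  using U unfolding carrier
 proof (induction U rule: T.tensor_induct)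
  case (tensor a l)
  note al = tensor
  from V show ?case unfolding carrier
  proof (induction V rule: T.tensor_induct)
   case (tensor a' l')
   thus ?case
    using al lD by (simp add: mult_pure pure leib T.base_change_simps(5) T.class_add_left)
  next
   case (add x y)
   let ?p = "T.tc (frag_of (a, l))"
   have c: "?p \<in> carrier ?E" "?D ?p \<in> carrier ?E" "T.tc x \<in> carrier ?E" "T.tc y \<in> carrier ?E"
    "?D (T.tc x) \<in> carrier ?E" "?D (T.tc y) \<in> carrier ?E"
    using pure_cl[OF al] tc_cl add cl by auto
   show ?case
    unfolding T.base_change_simps(5)[symmetric] using c add
    by (simp add: \<open>\<And>U V. U \<in> carrier ?E ==> V \<in> carrier ?E ==> ?D (U \<oplus>\<^bsub>?E\<^esub> V) = ?D U \<oplus>\<^bsub>?E\<^esub> ?D V\<close> E.r_distr E.M.a_ac)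
  qed
 next
  case (add x y)
  have c: "V \<in> carrier ?E" "?D V \<in> carrier ?E" "T.tc x \<in> carrier ?E" "T.tc y \<in> carrier ?E"
   "?D (T.tc x) \<in> carrier ?E" "?D (T.tc y) \<in> carrier ?E"
   using V tc_cl add cl by auto
  show ?case
   unfolding T.base_change_simps(5)[symmetric] using c add
   by (simp add: \<open>\<And>U V. U \<in> carrier ?E ==> V \<in> carrier ?E ==> ?D (U \<oplus>\<^bsub>?E\<^esub> V) = ?D U \<oplus>\<^bsub>?E\<^esub> ?D V\<close> E.l_distr E.M.a_ac)
 qed
 have smult: "?D (l \<odot>\<^bsub>?E\<^esub> U) = l \<odot>\<^bsub>?E\<^esub> ?D U" if l: "l \<in> carrier L" and U: "U \<in> carrier ?E" for l U
 proof -
  have D1: "D \<one> = \<zero>"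
  proof -
   have d: "D \<one> \<in> carrier A" using lD(1) by simp
   have "D \<one> = D \<one> \<oplus> D \<one>" using leib[of "\<one>" "\<one>"] d by simp
   thus ?thesis using d T.A.add.l_cancel_one'[of "D \<one>" "D \<one>"] by simp
  qed
  let ?l = "T.tc (frag_of (\<one>, l))"
  have e: "l \<odot>\<^bsub>?E\<^esub> W = ?l \<otimes>\<^bsub>?E\<^esub> W" for W by (simp add: base_change_def algebra_of_hom_simps)
  have "?D ?l = \<zero>\<^bsub>?E\<^esub>" using l by (simp add: pure D1 T.class_zero_left T.base_change_simps(4))
  thus ?thesis
   unfolding e using prod[OF pure_cl[OF _ l] U, of "\<one>"] U cl[OF U] l pure_cl[of "\<one>" l] by simp
 qed
 have pow_cl: "(?D ^^ m) U \<in> carrier ?E" if "U \<in> carrier ?E" for U m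
  using that by (induction m) (auto simp: cl)
 have pow_add: "(?D ^^ m) (U \<oplus>\<^bsub>?E\<^esub> V) = (?D ^^ m) U \<oplus>\<^bsub>?E\<^esub> (?D ^^ m) V"
  if "U \<in> carrier ?E" "V \<in> carrier ?E" for U V m
  using that by (induction m) (auto simp: add pow_cl)
 have pow_zero: "(?D ^^ m) \<zero>\<^bsub>?E\<^esub> = \<zero>\<^bsub>?E\<^esub>" for m
  by (induction m) (auto simp: T.base_change_simps(4) cls frag_map2_simps)
 have nilp: "\<exists>m. (?D ^^ m) U = \<zero>\<^bsub>?E\<^esub>" if "U \<in> carrier ?E" for U
  using that unfolding carrier
 proof (induction U rule: T.tensor_induct)
  case (tensor a l)
  obtain m where m: "(D ^^ m) a = \<zero>" using nil[OF tensor(1)] by blast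
  have "(?D ^^ m) (T.tc (frag_of (a, l))) = T.tc (frag_of ((D ^^ m) a, l))" for m
   by (induction m) (auto simp: pure)
  hence "(?D ^^ m) (T.tc (frag_of (a, l))) = \<zero>\<^bsub>?E\<^esub>"
   using m tensor by (simp add: T.class_zero_left T.base_change_simps(4))
  thus ?case ..
 next
  case (add x y)
  then obtain p q where pq: "(?D ^^ p) (T.tc x) = \<zero>\<^bsub>?E\<^esub>" "(?D ^^ q) (T.tc y) = \<zero>\<^bsub>?E\<^esub>" by blast
  have "(?D ^^ (p + q)) (T.tc x) = \<zero>\<^bsub>?E\<^esub>" unfolding add.commute[of p q] funpow_add by (simp add: pq pow_zero)
  moreover have "(?D ^^ (p + q)) (T.tc y) = \<zero>\<^bsub>?E\<^esub>" unfolding funpow_add by (simp add: pq pow_zero)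
  ultimately have "(?D ^^ (p + q)) (T.tc (x + y)) = \<zero>\<^bsub>?E\<^esub>"
   unfolding T.base_change_simps(5)[symmetric] using pow_add tc_cl add(1,2) by simp
  thus ?case ..
 qed
 show ?thesis
  unfolding LNDs_def derivations_def linear_maps_def using cl add smult prod nilp by auto
qed

context residual_subalgebra
begin

abbreviation K where "K \<equiv> quotient_field R"
abbreviation AK where "AK \<equiv> base_change R A K"
abbreviation BK where "BK \<equiv> base_change R B' K"

lemma K_algebra: "algebra R K"
 by (rule localizesD(1)[OF quotient_field_localizes])

lemma residual_coordinates:
 obtains U where "coordinate_system K AK n U" "adjoin K AK (U ` {..<n - r}) = incl K ` carrier BK"
  "U ` {..<n - r} \<subseteq> incl K ` carrier BK"
proof -
 interpret EA: algebra K AK by (rule base_change_algebras(1)[OF K_algebra])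
 interpret EB: algebra K BK by (rule base_change_algebras(2)[OF K_algebra])
 have AB: "algebra BK (algebra_of_hom (incl K) AK)"
  by (rule algebra_algebra_of_hom[OF EA.M_cring EB.M_cring incl_hom[OF K_algebra]])
 obtain V where V: "coordinate_system K BK (n - r) V"
  using generic_polynomial(1) polynomial_algebra_generated[OF EB.algebra_axioms]
  unfolding is_polynomial_algebra_iff by blast
 obtain W where W: "coordinate_system BK (algebra_of_hom (incl K) AK) r W"
  using generic_polynomial(2) polynomial_algebra_generated[OF AB]
  unfolding is_polynomial_algebra_iff by blast
 note stacked = stacked_coordinates[OF EB.algebra_axioms EA.algebra_axioms incl_hom[OF K_algebra]
   incl_linear_base_change[OF K_algebra] V W]
 have "n - r + r = n" using r_le by simp
 with stacked(1) have "coordinate_system K AK n (\<lambda>i. if i < n - r then incl K (V i) else W (i - (n - r)))"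
  by simp
 thus thesis using stacked(2,3) by (rule that)
qed

lemma generic_kernel:
 assumes D: "D \<in> LNDs R A" and B: "B \<subseteq> Ker A D"
 shows "incl K ` carrier BK \<subseteq> Ker AK (generic_extension R A D)"
proof -
 interpret TA: two_algebras R A K by (rule two_algebrasI[OF A_algebra K_algebra])
 interpret TB: two_algebras R B' K by (rule two_algebrasI[OF B_algebra K_algebra])
 have lin: "D \<in> linear_maps R A A" using D by (simp add: LNDs_def derivations_def)
 note cls = tensor_map_class[OF TA.two_modules_axioms TA.two_modules_axioms lin linear_maps_id]
 have zero: "TA.tc (frag_map2 D (\<lambda>c. c) x) = TA.tc 0" if "TB.tkeys x" for x
  using that
 proof (induction x rule: TB.tkeys_induct)
  case zero
  show ?case by (simp add: frag_map2_simps)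
 next
  case (pure b l)
  hence "D b = \<zero>\<^bsub>A\<^esub>" using B by (auto simp: Ker_def)
  thus ?case using pure by (simp add: frag_map2_simps TA.class_zero_left)
 next
  case (diff x y)
  thus ?case using TA.kernel_diff by (simp add: frag_map2_simps TA.class_eq_iff)
 qed
 show ?thesis
 proof
  fix U assume "U \<in> incl K ` carrier BK"
  then obtain V where V: "V \<in> carrier BK" "U = incl K V" by blast
  then obtain x where x: "TB.tkeys x" "V = TB.tc x" unfolding TB.base_change_simps(1) by blast
  have "U \<in> carrier AK" unfolding V(2) by (rule ring_hom_memE(1)[OF incl_hom[OF K_algebra] V(1)])
  moreover have "generic_extension R A D U = \<zero>\<^bsub>AK\<^esub>"
   unfolding generic_extension_def V(2) x(2) incl_class[OF K_algebra] cls
   using zero[OF x(1)] by (simp add: TA.base_change_simps(4))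
  ultimately show "U \<in> Ker AK (generic_extension R A D)" unfolding Ker_def by simp
 qed
qed

text \<open>
 On a pure tensor \<open>b \<otimes> l\<close> a denominator of \<open>l\<close> will do, on sums a product of denominators.
\<close>

lemma generic_denominator:
 assumes "U \<in> carrier BK"
 shows "\<exists>s\<in>carrier R - {\<zero>}. \<exists>b\<in>B.
  (scalar K s) \<odot>\<^bsub>AK\<^esub> incl K U = tensor_class R A K (frag_of (b, \<one>\<^bsub>K\<^esub>))"
proof -
 interpret A: algebra R A by (rule A_algebra)
 interpret B: algebra R B' by (rule B_algebra)
 interpret K: algebra R K by (rule K_algebra)
 interpret TA: two_algebras R A K by (rule two_algebrasI[OF A_algebra K_algebra])
 interpret TB: two_algebras R B' K by (rule two_algebrasI[OF B_algebra K_algebra])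
 interpret EA: algebra K AK by (rule TA.base_change_algebra)
 note LD = localizesD[OF quotient_field_localizes]
 have act: "(scalar K s) \<odot>\<^bsub>AK\<^esub> TA.tc (frag_of (a, l)) = TA.tc (frag_of (a, s \<odot>\<^bsub>K\<^esub> l))"
  if "s \<in> carrier R" "a \<in> carrier A" "l \<in> carrier K" for s a l
  using that K.smult_assoc2[of s "\<one>\<^bsub>K\<^esub>" l] by (simp add: TA.base_change_simps(6) frag_mult_simps)
 have bal: "TA.tc (frag_of (b, s \<odot>\<^bsub>K\<^esub> \<one>\<^bsub>K\<^esub>)) = TA.tc (frag_of (s \<odot>\<^bsub>A\<^esub> b, \<one>\<^bsub>K\<^esub>))"
  if "s \<in> carrier R" "b \<in> carrier A" for s b
  using TA.class_balanced[of s b "\<one>\<^bsub>K\<^esub>"] that by simp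
 have sB: "s \<odot>\<^bsub>A\<^esub> b \<in> B" if "s \<in> carrier R" "b \<in> B" for s b
  using B.smult_closed[of s b] that by simp
 have U: "U \<in> carrier (tensor_group R B' K)"
  using assms by (simp add: TB.base_change_simps(1) TB.carrier_tensor_group)
 thus ?thesis
 proof (induction U rule: TB.tensor_induct)
  case (tensor b l)
  obtain s t where s: "s \<in> carrier R - {\<zero>}" "t \<in> carrier R" "s \<odot>\<^bsub>K\<^esub> l = scalar K t"
   using LD(3)[OF tensor(2)] by blast
  have b: "b \<in> B" "b \<in> carrier A" using tensor B_sub by auto
  have "(scalar K s) \<odot>\<^bsub>AK\<^esub> incl K (TB.tc (frag_of (b, l))) = TA.tc (frag_of (t \<odot>\<^bsub>A\<^esub> b, \<one>\<^bsub>K\<^esub>))"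
   using s b tensor by (simp add: incl_class[OF K_algebra] act bal)
  thus ?case using s(1) sB[OF s(2) b(1)] by blast
 next
  case (add x y)
  then obtain s b s' b' where s: "s \<in> carrier R - {\<zero>}" "b \<in> B" "s' \<in> carrier R - {\<zero>}" "b' \<in> B"
   and e: "(scalar K s) \<odot>\<^bsub>AK\<^esub> TA.tc x = TA.tc (frag_of (b, \<one>\<^bsub>K\<^esub>))"
    "(scalar K s') \<odot>\<^bsub>AK\<^esub> TA.tc y = TA.tc (frag_of (b', \<one>\<^bsub>K\<^esub>))"
   unfolding incl_class[OF K_algebra] by blast
  have c: "s \<in> carrier R" "s' \<in> carrier R" "b \<in> carrier A" "b' \<in> carrier A" using s B_sub by auto
  have keys: "TA.tkeys x" "TA.tkeys y"
   using add(1,2) B_sub by (auto simp: TA.tkeys_def TB.tkeys_def)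
  have xy: "TA.tc x \<in> carrier AK" "TA.tc y \<in> carrier AK"
   unfolding TA.base_change_simps(1) using keys by blast+
  define u v where "u = scalar K s" and "v = scalar K s'"
  have uv: "u \<in> carrier K" "v \<in> carrier K" using c by (simp_all add: u_def v_def)
  have w: "scalar K (s \<otimes> s') = v \<otimes>\<^bsub>K\<^esub> u" "v \<otimes>\<^bsub>K\<^esub> u = u \<otimes>\<^bsub>K\<^esub> v"
   using c uv K.smult_assoc2[of s "\<one>\<^bsub>K\<^esub>" v] K.m_comm[of u v] by (simp_all add: K.smult_assoc1 u_def v_def)
  have "(scalar K (s \<otimes> s')) \<odot>\<^bsub>AK\<^esub> TA.tc (x + y) =
    (v \<odot>\<^bsub>AK\<^esub> (u \<odot>\<^bsub>AK\<^esub> TA.tc x)) \<oplus>\<^bsub>AK\<^esub> (u \<odot>\<^bsub>AK\<^esub> (v \<odot>\<^bsub>AK\<^esub> TA.tc y))"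
   unfolding TA.base_change_simps(5)[symmetric] w(1) using xy uv w(2)
   by (simp add: EA.smult_r_distr EA.smult_assoc1[symmetric])
  also have "\<dots> = TA.tc (frag_of (s' \<odot>\<^bsub>A\<^esub> b, \<one>\<^bsub>K\<^esub>)) \<oplus>\<^bsub>AK\<^esub> TA.tc (frag_of (s \<odot>\<^bsub>A\<^esub> b', \<one>\<^bsub>K\<^esub>))"
   using e c by (simp add: u_def v_def act bal)
  also have "\<dots> = TA.tc (frag_of ((s' \<odot>\<^bsub>A\<^esub> b) \<oplus>\<^bsub>A\<^esub> (s \<odot>\<^bsub>A\<^esub> b'), \<one>\<^bsub>K\<^esub>))"
   using c by (simp add: TA.base_change_simps(5) TA.class_add_left)
  finally have "(scalar K (s \<otimes> s')) \<odot>\<^bsub>AK\<^esub> incl K (TB.tc (x + y)) =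
    TA.tc (frag_of ((s' \<odot>\<^bsub>A\<^esub> b) \<oplus>\<^bsub>A\<^esub> (s \<odot>\<^bsub>A\<^esub> b'), \<one>\<^bsub>K\<^esub>))"
   unfolding incl_class[OF K_algebra] .
  moreover have "s \<otimes> s' \<in> carrier R - {\<zero>}" using s c by (auto simp: integral_iff)
  moreover have "(s' \<odot>\<^bsub>A\<^esub> b) \<oplus>\<^bsub>A\<^esub> (s \<odot>\<^bsub>A\<^esub> b') \<in> B"
   using B.M.a_closed[of "s' \<odot>\<^bsub>A\<^esub> b" "s \<odot>\<^bsub>A\<^esub> b'"] sB c s by simp
  ultimately show ?case by blast
 qed
qed

text \<open>
 Contracting from the generic fibre loses nothing: \<open>(B \<otimes> K) \<inter> A = B\<close>. An element \<open>b\<close> of the left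
 side has \<open>s b \<in> B\<close> for some \<open>s \<noteq> 0\<close>, hence \<open>s b \<in> s A \<inter> B = s B\<close> by purity.
\<close>

lemma generic_contraction:
 assumes R: "noetherian_domain R" and b: "b \<in> carrier A"
  and mem: "tensor_class R A K (frag_of (b, \<one>\<^bsub>K\<^esub>)) \<in> incl K ` carrier BK"
 shows "b \<in> B"
proof -
 interpret A: algebra R A by (rule A_algebra)
 interpret B: algebra R B' by (rule B_algebra)
 interpret K: algebra R K by (rule K_algebra)
 interpret TA: two_algebras R A K by (rule two_algebrasI[OF A_algebra K_algebra])
 obtain V where V: "V \<in> carrier BK" "TA.tc (frag_of (b, \<one>\<^bsub>K\<^esub>)) = incl K V" using mem by blast
 obtain s c where s: "s \<in> carrier R" "s \<noteq> \<zero>" "c \<in> B"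
  and e: "(scalar K s) \<odot>\<^bsub>AK\<^esub> TA.tc (frag_of (b, \<one>\<^bsub>K\<^esub>)) = TA.tc (frag_of (c, \<one>\<^bsub>K\<^esub>))"
  using generic_denominator[OF V(1)] unfolding V(2) by blast
 have c: "c \<in> carrier A" using s B_sub by blast
 have "TA.tc (frag_of (b, s \<odot>\<^bsub>K\<^esub> \<one>\<^bsub>K\<^esub>)) = TA.tc (frag_of (c, \<one>\<^bsub>K\<^esub>))"
  using e s b by (simp add: TA.base_change_simps(6) frag_mult_simps)
 hence 1: "TA.tc (frag_of (s \<odot>\<^bsub>A\<^esub> b, \<one>\<^bsub>K\<^esub>)) = TA.tc (frag_of (c, \<one>\<^bsub>K\<^esub>))"
  using TA.class_balanced[of s b "\<one>\<^bsub>K\<^esub>"] s b by simp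
 define d where "d = (s \<odot>\<^bsub>A\<^esub> b) \<oplus>\<^bsub>A\<^esub> (\<ominus>\<^bsub>A\<^esub> c)"
 have dc: "d \<in> carrier A" using s b c by (simp add: d_def)
 have "TA.tc (frag_of (d, \<one>\<^bsub>K\<^esub>)) = TA.tc (frag_of (s \<odot>\<^bsub>A\<^esub> b, \<one>\<^bsub>K\<^esub>) + frag_of (\<ominus>\<^bsub>A\<^esub> c, \<one>\<^bsub>K\<^esub>))"
  unfolding d_def using s b c by (simp add: TA.class_add_left)
 also have "\<dots> = TA.tc (frag_of (c, \<one>\<^bsub>K\<^esub>) + frag_of (\<ominus>\<^bsub>A\<^esub> c, \<one>\<^bsub>K\<^esub>))"
  using 1 by (intro TA.class_cong_add refl)
 also have "\<dots> = TA.tc 0"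
  using c TA.class_add_left[of c "\<ominus>\<^bsub>A\<^esub> c" "\<one>\<^bsub>K\<^esub>"] by (simp add: A.r_neg TA.class_zero_left)
 finally obtain u where u: "u \<in> carrier R" "u \<noteq> \<zero>" "u \<odot>\<^bsub>A\<^esub> d \<in> ideal_span {\<zero>} A"
  using tensor_zero_localized[OF quotient_field_localizes A_module dc] by auto
 have "d = \<zero>\<^bsub>A\<^esub>"
  by (rule flat_torsion_free[OF domain_axioms A_flat A_module u(1,2) dc A.ideal_span_zero[OF u(3)]])
 hence sb: "s \<odot>\<^bsub>A\<^esub> b = c"
  using s b c A.minus_equality[of "s \<odot>\<^bsub>A\<^esub> b" "\<ominus>\<^bsub>A\<^esub> c"] by (simp add: d_def)
 define J where "J = {i \<oplus> t \<otimes> s | i t. i \<in> {\<zero>} \<and> t \<in> carrier R}"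
 have J: "ideal J R" unfolding J_def by (rule adjoin_element_ideal[OF zeroideal s(1)])
 have "\<zero> \<oplus> \<one> \<otimes> s \<in> J" unfolding J_def by blast
 hence "s \<in> J" using s(1) by simp
 hence "c \<in> ideal_span J A"
  using A.ideal_span_pure[of J s b] ideal.Icarr[OF J] b sb by blast
 hence "c \<in> ideal_span J B'" by (rule residual_purity[OF R J s(3)])
 hence "\<exists>y\<in>ideal_span {\<zero>} B'. \<exists>z\<in>carrier B'. c = y \<oplus>\<^bsub>B'\<^esub> (s \<odot>\<^bsub>B'\<^esub> z)"
  unfolding J_def by (intro B.ideal_span_adjoin_element s(1)) simp_all
 then obtain y z where y: "y \<in> ideal_span {\<zero>} B'" "z \<in> carrier B'" "c = y \<oplus>\<^bsub>B'\<^esub> (s \<odot>\<^bsub>B'\<^esub> z)"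
  by blast
 have "y = \<zero>\<^bsub>A\<^esub>" using B.ideal_span_zero[OF y(1)] by simp
 moreover have z: "z \<in> B" "z \<in> carrier A" using y(2) B_sub by auto
 ultimately have c': "c = s \<odot>\<^bsub>A\<^esub> z" using y(3) s by simp
 have "s \<odot>\<^bsub>A\<^esub> (b \<oplus>\<^bsub>A\<^esub> (\<ominus>\<^bsub>A\<^esub> z)) = \<zero>\<^bsub>A\<^esub>"
  using sb c' s b z by (simp add: A.smult_r_distr A.smult_r_minus A.r_neg)
 moreover have bz: "b \<oplus>\<^bsub>A\<^esub> (\<ominus>\<^bsub>A\<^esub> z) \<in> carrier A" using b z by simp
 ultimately have "b \<oplus>\<^bsub>A\<^esub> (\<ominus>\<^bsub>A\<^esub> z) = \<zero>\<^bsub>A\<^esub>"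
  by (intro flat_torsion_free[OF domain_axioms A_flat A_module s(1,2) bz])
 hence "b = z" using b z A.minus_equality[of b "\<ominus>\<^bsub>A\<^esub> z"] by simp
 thus ?thesis using z by simp
qed

lemma element_in_generic:
 assumes "b \<in> B"
 shows "tensor_class R A K (frag_of (b, \<one>\<^bsub>K\<^esub>)) \<in> incl K ` carrier BK"
proof -
 interpret K: algebra R K by (rule K_algebra)
 interpret TB: two_algebras R B' K by (rule two_algebrasI[OF B_algebra K_algebra])
 have "TB.tc (frag_of (b, \<one>\<^bsub>K\<^esub>)) \<in> carrier BK"
  unfolding TB.base_change_simps(1) using assms by (intro imageI) simp
 thus ?thesis using incl_class[OF K_algebra, of "frag_of (b, \<one>\<^bsub>K\<^esub>)"] by (metis imageI)
qed

end

text \<open>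
 Rigidity identifies \<open>B\<^sub>1 \<otimes> K\<close> with \<open>B\<^sub>2 \<otimes> K\<close> in \<open>A\<^sub>K\<close>, and the intersection with \<open>A\<close> recovers \<open>B\<^sub>1\<close> and
 \<open>B\<^sub>2\<close>.
\<close>

theorem residually_rigid_if_rigid:
 assumes R: "noetherian_domain R" and A: "affine_fibration R A n" and D: "D \<in> LNDs R A"
  and rank: "residual_rank R A n D = LND_rank (quotient_field R) (generic_fibre R A) n (generic_extension R A D)"
  and rig: "rigid (quotient_field R) (generic_fibre R A) n (generic_extension R A D)"
 shows "residually_rigid R A n D"
proof -
 interpret noetherian_domain R by fact
 define r where "r = residual_rank R A n D"
 have sub: "B\<^sub>1 \<subseteq> B\<^sub>2" if B1: "residual_system R B\<^sub>1 A n r" "B\<^sub>1 \<subseteq> Ker A D"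
   and B2: "residual_system R B\<^sub>2 A n r" "B\<^sub>2 \<subseteq> Ker A D" for B\<^sub>1 B\<^sub>2
 proof
  interpret B1: residual_subalgebra R A B\<^sub>1 n r by unfold_locales (rule B1(1))
  interpret B2: residual_subalgebra R A B\<^sub>2 n r by unfold_locales (rule B2(1))
  obtain U where U: "coordinate_system B1.K B1.AK n U"
   "adjoin B1.K B1.AK (U ` {..<n - r}) = B1.incl B1.K ` carrier B1.BK"
   "U ` {..<n - r} \<subseteq> B1.incl B1.K ` carrier B1.BK" by (rule B1.residual_coordinates)
  obtain V where V: "coordinate_system B1.K B1.AK n V"
   "adjoin B1.K B1.AK (V ` {..<n - r}) = B1.incl B1.K ` carrier B2.BK"
   "V ` {..<n - r} \<subseteq> B1.incl B1.K ` carrier B2.BK" by (rule B2.residual_coordinates)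
  have rk: "LND_rank B1.K B1.AK n (generic_extension R A D) = r"
   using rank unfolding generic_fibre_def r_def by simp
  from rig have rig': "\<forall>U V. coordinate_system B1.K B1.AK n U \<and> coordinate_system B1.K B1.AK n V \<and>
    U ` {..<n - r} \<subseteq> Ker B1.AK (generic_extension R A D) \<and> V ` {..<n - r} \<subseteq> Ker B1.AK (generic_extension R A D) \<longrightarrow>
    adjoin B1.K B1.AK (U ` {..<n - r}) = adjoin B1.K B1.AK (V ` {..<n - r})"
   unfolding rigid_def Let_def generic_fibre_def rk .
  have "adjoin B1.K B1.AK (U ` {..<n - r}) = adjoin B1.K B1.AK (V ` {..<n - r})"
   by (rule rig'[rule_format], intro conjI U(1) V(1) order_trans[OF U(3)] order_trans[OF V(3)]
     B1.generic_kernel[OF D B1(2)] B2.generic_kernel[OF D B2(2)])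
  hence eq: "B1.incl B1.K ` carrier B1.BK = B1.incl B1.K ` carrier B2.BK" unfolding U(2) V(2) .
  fix b assume b: "b \<in> B\<^sub>1"
  have "tensor_class R A B1.K (frag_of (b, \<one>\<^bsub>B1.K\<^esub>)) \<in> B1.incl B1.K ` carrier B2.BK"
   using B1.element_in_generic[OF b] unfolding eq .
  moreover have "b \<in> carrier A" using B1.B_sub b by blast
  ultimately show "b \<in> B\<^sub>2" using B2.generic_contraction[OF R] by simp
 qed
 show ?thesis
  unfolding residually_rigid_def Let_def r_def[symmetric] using sub by blast
qed

theorem theoremC:
  fixes R :: "('r, 'x) ring_scheme"
    and A :: "('r, 'a, 'm) module_scheme"
    and n :: nat
    and D :: "'a \<Rightarrow> 'a"
  assumes "noetherian_domain R"
    and "contains_rationals R"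
    and "affine_fibration R A n"
    and "D \<in> LNDs R A"
  defines "K \<equiv> quotient_field R"
    and "A\<^sub>K \<equiv> generic_fibre R A"
    and "D\<^sub>K \<equiv> generic_extension R A D"
  shows "(residual_rank R A n D = LND_rank K A\<^sub>K n D\<^sub>K \<and> rigid K A\<^sub>K n D\<^sub>K
            \<longrightarrow> residually_rigid R A n D) \<and>
         (n = 3 \<and> residual_rank R A n D = LND_rank K A\<^sub>K n D\<^sub>K
            \<longrightarrow> residually_rigid R A n D)"
proof -
  interpret noetherian_domain R by fact
  have alg: "algebra R A" using assms(3) by (simp add: affine_fibration_def)
  have loc: "localizes R {\<zero>\<^bsub>R\<^esub>} K" unfolding K_def by (rule quotient_field_localizes)
  interpret K: algebra R K by (rule localizesD(1)[OF loc])
  have field: "field K" by (rule localizes_field[OF loc])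
  obtain h where h: "h \<in> ring_hom rat_ring R" using assms(2) unfolding contains_rationals_def by blast
  have "(\<lambda>r. scalar K r) \<in> ring_hom R K"
  proof (rule ring_hom_memI)
    fix r s assume "r \<in> carrier R" "s \<in> carrier R"
    then show "scalar K (r \<otimes>\<^bsub>R\<^esub> s) = (scalar K r) \<otimes>\<^bsub>K\<^esub> (scalar K s)"
      using K.smult_assoc2[of r "\<one>\<^bsub>K\<^esub>" "scalar K s"] by (simp add: K.smult_assoc1)
  qed (auto simp: K.smult_l_distr)
  then have h0: "(\<lambda>r. scalar K r) \<circ> h \<in> ring_hom rat_ring K" using ring_hom_trans[OF h] by blast
  interpret E: two_algebras R A K by (rule two_algebrasI[OF alg K.algebra_axioms])
  have AK: "A\<^sub>K = base_change R A K" "algebra K A\<^sub>K"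
    unfolding A\<^sub>K_def K_def generic_fibre_def using E.base_change_algebra unfolding K_def by simp_all
  have LND: "D\<^sub>K \<in> LNDs K A\<^sub>K"
    unfolding AK(1) D\<^sub>K_def generic_extension_def K_def[symmetric]
    by (rule base_change_LND[OF alg K.algebra_axioms assms(4)])
  have poly: "is_polynomial_algebra K A\<^sub>K n" unfolding AK(1) K_def
    by (rule generic_fibre_polynomial[OF domain_axioms assms(3)])
  have "rigid K A\<^sub>K n D\<^sub>K" if "n = 3"
    using rigid_three_variables[OF field h0 AK(2) _ LND] poly that by simp
  then show ?thesis
    using residually_rigid_if_rigid[OF assms(1,3,4)] unfolding K_def A\<^sub>K_def D\<^sub>K_def by blast
qed

end
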